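(* Let $D \subset \mathbb{R}^d$ be any non-empty open bounded set. We have $$\mathbb{P}\left(\limsup_{|B| \to 0} \sqrt{\log \frac{1}{|B|}}\; M(B) > 0\right) = 1,$$ where the lim sup is taken over all cubes $B$ inside $D$ and $|B|$ denotes the Lebesgue measure of $B$.
   Context: Let $d\ge 1$ and $\gamma_c := \sqrt{2d}$. Let $\rho:\mathbb{R}^d\to[0,\infty)$ be a positive definite, rotationally symmetric function with $\rho(0)=1$, $\rho\in C_c^\infty(\mathbb{R}^d)$ and $\mathrm{supp}(\rho)\subset B(0,R/2)$ for some $R>0$. Let $X$ be the associated $\star$-scale invariant field, i.e. the centred Gaussian field on $\mathbb{R}^d$ with covariance $\int_0^\infty \rho(e^u(x-y))\,du$, and let $(X_t)_{t\ge 0}$ be its martingale decomposition: a jointly Gaussian family of centred continuous random fields on $\mathbb{R}^d$ with $\mathbb{E}[X_s(x)X_t(y)] = \int_0^{\min(s,t)}\rho(e^u(x-y))\,du$ (so that $X_t-X_s$ is independent of $\sigma(X_u(x): u\le s, x\in\mathbb{R}^d)$ for $s<t$). The critical Gaussian multiplicative chaos $M$ is the random measure $$M(dx) := \lim_{t\to\infty} \sqrt{t}\, e^{\gamma_c X_t(x) - dt}\,dx,$$ where the limit holds in probability with respect to the weak$^*$ topology. *)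

theory Defs
  imports "HOL-Probability.Probability"
begin

text \<open>Meant for real-valued even functions, for which real coefficients suffice.\<close>

definition positive_definite_fun :: "('a::real_vector \<Rightarrow> real) \<Rightarrow> bool" where
  "positive_definite_fun rho \<longleftrightarrow>
     (\<forall>S c. finite S \<longrightarrow> 0 \<le> (\<Sum>x\<in>S. \<Sum>y\<in>S. c x * c y * rho (x - y)))"

definition rotationally_symmetric :: "('a::real_inner \<Rightarrow> real) \<Rightarrow> bool" where
  "rotationally_symmetric rho \<longleftrightarrow>
     (\<forall>T. orthogonal_transformation T \<longrightarrow> (\<forall>x. rho (T x) = rho x))"

primrec k_times_cont_diff :: "nat \<Rightarrow> ('a::euclidean_space \<Rightarrow> real) \<Rightarrow> bool" where
  "k_times_cont_diff 0 f \<longleftrightarrow> continuous_on UNIV f"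
| "k_times_cont_diff (Suc k) f \<longleftrightarrow>
     f differentiable_on UNIV \<and>
     (\<forall>b\<in>Basis. k_times_cont_diff k (\<lambda>x. frechet_derivative f (at x) b))"

definition smooth_fun :: "('a::euclidean_space \<Rightarrow> real) \<Rightarrow> bool" where
  "smooth_fun f \<longleftrightarrow> (\<forall>k. k_times_cont_diff k f)"

definition closed_support :: "('a::topological_space \<Rightarrow> real) \<Rightarrow> 'a set" where
  "closed_support f = closure {x. f x \<noteq> 0}"

text \<open>Compactness of the support is implied by its containment in a ball.\<close>

definition seed_covariance :: "real \<Rightarrow> ('a::euclidean_space \<Rightarrow> real) \<Rightarrow> bool" where
  "seed_covariance R rho \<longleftrightarrow>
     (\<forall>x. 0 \<le> rho x) \<and> positive_definite_fun rho \<and> rotationally_symmetric rho \<and>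
     rho 0 = 1 \<and> smooth_fun rho \<and> closed_support rho \<subseteq> ball 0 (R / 2)"

text \<open>Gaussian variables are allowed to be degenerate (almost surely constant); indeed the field
  at time 0 vanishes almost surely.\<close>

definition gaussian_rv :: "'w measure \<Rightarrow> ('w \<Rightarrow> real) \<Rightarrow> bool" where
  "gaussian_rv P Y \<longleftrightarrow> Y \<in> borel_measurable P \<and>
     ((\<exists>\<mu>. AE \<omega> in P. Y \<omega> = \<mu>) \<or>
      (\<exists>\<mu> \<sigma>. 0 < \<sigma> \<and> distributed P lborel Y (normal_density \<mu> \<sigma>)))"

definition jointly_gaussian :: "'w measure \<Rightarrow> 'i set \<Rightarrow> ('i \<Rightarrow> 'w \<Rightarrow> real) \<Rightarrow> bool" where
  "jointly_gaussian P I Y \<longleftrightarrow>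
     (\<forall>S c. finite S \<and> S \<subseteq> I \<longrightarrow> gaussian_rv P (\<lambda>\<omega>. \<Sum>i\<in>S. c i * Y i \<omega>))"

text \<open>The star-scale invariant field itself is a generalised field that exists only as the limit
  of \<open>X t\<close> as \<open>t \<rightarrow> \<infinity>\<close>; all that is needed of it is the following approximating family,
  where \<open>X t x \<omega>\<close> is the value at the point \<open>x\<close> of the field at time \<open>t \<ge> 0\<close>.\<close>

definition star_scale_martingale ::
    "'w measure \<Rightarrow> ('a::euclidean_space \<Rightarrow> real) \<Rightarrow> (real \<Rightarrow> 'a \<Rightarrow> 'w \<Rightarrow> real) \<Rightarrow> bool" where
  "star_scale_martingale P rho X \<longleftrightarrow>
     jointly_gaussian P ({0..} \<times> UNIV) (\<lambda>(t, x). X t x) \<and>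
     (\<forall>t\<ge>0. \<forall>\<omega>\<in>space P. continuous_on UNIV (\<lambda>x. X t x \<omega>)) \<and>
     (\<forall>t\<ge>0. \<forall>x. (\<integral>\<omega>. X t x \<omega> \<partial>P) = 0) \<and>
     (\<forall>s\<ge>0. \<forall>t\<ge>0. \<forall>x y. (\<integral>\<omega>. X s x \<omega> * X t y \<omega> \<partial>P) =
        integral {0..min s t} (\<lambda>u. rho (exp u *\<^sub>R (x - y))))"

definition random_radon_measure ::
    "'w measure \<Rightarrow> ('w \<Rightarrow> 'a::euclidean_space measure) \<Rightarrow> bool" where
  "random_radon_measure P M \<longleftrightarrow>
     (\<forall>\<omega>\<in>space P. sets (M \<omega>) = sets borel \<and> (\<forall>K. compact K \<longrightarrow> emeasure (M \<omega>) K < \<infinity>)) \<and>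
     (\<forall>A\<in>sets borel. (\<lambda>\<omega>. emeasure (M \<omega>) A) \<in> borel_measurable P)"

definition test_functions :: "('a::euclidean_space \<Rightarrow> real) set" where
  "test_functions = {f. continuous_on UNIV f \<and> compact (closed_support f)}"

text \<open>Convergence in probability for the weak-star topology on Radon measures, viewed inside the
  dual of the space of test functions. A base of neighbourhoods of 0 there is given by the
  conditions \<open>\<bar>\<langle>\<mu>, f\<rangle>\<bar> < \<epsilon>\<close> for all \<open>f\<close> in a finite set \<open>F\<close>; the probability that the
  difference leaves any such neighbourhood has to tend to 0.\<close>

definition converges_in_prob_weak_star ::
    "'w measure \<Rightarrow> ('t \<Rightarrow> 'w \<Rightarrow> 'a::euclidean_space measure) \<Rightarrow> ('w \<Rightarrow> 'a measure) \<Rightarrow> 't filter \<Rightarrow> bool"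
  where
  "converges_in_prob_weak_star P N M T \<longleftrightarrow>
     (\<forall>F \<epsilon>. finite F \<and> F \<subseteq> test_functions \<and> 0 < \<epsilon> \<longrightarrow>
        ((\<lambda>t. measure P {\<omega>\<in>space P. \<exists>f\<in>F. \<epsilon> \<le> \<bar>(\<integral>x. f x \<partial>N t \<omega>) - (\<integral>x. f x \<partial>M \<omega>)\<bar>})
           \<longlongrightarrow> 0) T)"

definition critical_gamma :: "'a::euclidean_space itself \<Rightarrow> real" where
  "critical_gamma _ = sqrt (2 * real DIM('a))"

definition critical_approx ::
    "(real \<Rightarrow> 'a::euclidean_space \<Rightarrow> 'w \<Rightarrow> real) \<Rightarrow> real \<Rightarrow> 'w \<Rightarrow> 'a measure" where
  "critical_approx X t \<omega> = density lborel
     (\<lambda>x. ennreal (sqrt t * exp (critical_gamma TYPE('a) * X t x \<omega> - real DIM('a) * t)))"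

definition critical_gmc ::
    "'w measure \<Rightarrow> (real \<Rightarrow> 'a::euclidean_space \<Rightarrow> 'w \<Rightarrow> real) \<Rightarrow> ('w \<Rightarrow> 'a measure) \<Rightarrow> bool" where
  "critical_gmc P X M \<longleftrightarrow> random_radon_measure P M \<and>
     converges_in_prob_weak_star P (critical_approx X) M at_top"

text \<open>Closed, non-degenerate, with sides parallel to the coordinate axes.\<close>

definition cubes_inside :: "'a::euclidean_space set \<Rightarrow> 'a set set" where
  "cubes_inside D = {B. B \<subseteq> D \<and> (\<exists>a r. 0 < r \<and> B = cbox a (a + r *\<^sub>R One))}"

definition small_cubes :: "'a::euclidean_space set \<Rightarrow> 'a set filter" where
  "small_cubes D =
     inf (filtercomap (measure lborel) (at_right 0)) (principal (cubes_inside D))"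

end

theory Submission
  imports Defs
begin

text \<open>Put \<open>E n x = X (n + 1) x - X n x\<close>. These fields are independent over \<open>n\<close>, have variance 1, and
  are uncorrelated beyond a distance of order \<open>exp (- n)\<close>. Restart the field at a time \<open>\<tau>\<close> and put
  \<open>R\<^sub>j = 1 + \<gamma> j - (\<Sum>i<j. E (\<tau> + i) x)\<close>; since \<open>\<gamma>\<^sup>2 = 2 d\<close>, the critical density after \<open>j\<close> steps is
  \<open>exp (\<gamma> - \<gamma> R\<^sub>j + d j)\<close>. Under the measure tilted by this density \<open>R\<close> is a random walk, and weighting each step by the
  probability that a Brownian bridge stays positive turns it into Brownian motion killed at 0, whose transition
  kernel is explicit. A point is hit at scale \<open>\<tau> + j\<close>, with \<open>n < j \<le> 33 n\<close>, when the killed path lies within distance 1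
  above \<open>ln n / (2 \<gamma>)\<close>: there the density is of order \<open>exp (d j) / sqrt n\<close>, so that a cell of side
  \<open>exp (- (\<tau> + j))\<close> around a hit carries mass of order \<open>1 / sqrt n\<close>, provided the later increments put
  a normal amount of mass on it. The expected volume of good hits and its second moment are comparable uniformly in \<open>n\<close>, so
  good hits exist in a given region with probability at least \<open>prob_const\<close>, which does not depend on the region or on \<open>\<tau>\<close>.
  For large \<open>\<tau>\<close> the regions can be taken to be \<open>J\<close> separated cubes inside \<open>D\<close>; the corresponding events are pairwise
  independent, and Chebyshev's inequality gives probability at least \<open>1 - 1 / (prob_const * J)\<close> for their union.
  The bound passes to \<open>M\<close> by testing against finitely many bump functions, the limit superior over \<open>n\<close> preserves it,
  and finally \<open>J \<rightarrow> \<infinity>\<close>.\<close>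

section \<open>Independence in Gaussian spaces\<close>

text \<open>The unrestricted critical density has too large a second moment: for two points at
  distance \<open>exp (- i)\<close> the square costs \<open>exp (2 * d * i)\<close>, while the
  partners of a point fill only volume \<open>exp (- d * i)\<close>. Positivity of the walk repairs
  this: one of the two factors is at most \<open>exp (\<gamma> + d * i - \<gamma> * R)\<close>,
  which balances the volume, and the remaining expectation of \<open>exp (- \<gamma> * R)\<close> is
  summable because a killed path from 1 is near 0 at time i with probability of order
  \<open>i powr (- 3 / 2)\<close>. Killing at integer times only would leave no closed kernel; the
  bridge factor makes reflection exact, and being at most 1 it never raises the density, so lower
  bounds carry over. One scale contributes only order 1 / n to the expected volume of hits, hence a
  window of scales of length proportional to n; paths that survive to time n have height of order
  \<open>sqrt n\<close> and return within 32 n further steps. Convergence to \<open>M\<close> holds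
  in probability and for finitely many test functions at a time. So n is fixed before the
  approximation time N tends to infinity, and hits are recorded in a finite grid that does not
  depend on N.\<close>

definition centred_gaussian_space :: "'w measure \<Rightarrow> ('w \<Rightarrow> real) set \<Rightarrow> bool" where
  "centred_gaussian_space P H \<longleftrightarrow>
     (\<forall>f\<in>H. gaussian_rv P f \<and> (\<integral>\<omega>. f \<omega> \<partial>P) = 0) \<and> (\<lambda>_. 0) \<in> H \<and>
     (\<forall>f\<in>H. \<forall>g\<in>H. (\<lambda>\<omega>. f \<omega> + g \<omega>) \<in> H) \<and> (\<forall>f\<in>H. \<forall>c. (\<lambda>\<omega>. c * f \<omega>) \<in> H)"

text \<open>Only the sigma-algebra of this measure matters; its \<open>emeasure\<close> is never
  evaluated. Packaging it as a measure lets measurability be phrased with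
  \<open>borel_measurable\<close>.\<close>

definition generated_sigma :: "'w measure \<Rightarrow> ('w \<Rightarrow> real) set \<Rightarrow> 'w measure" where
  "generated_sigma P A = sigma (space P) {f -` S \<inter> space P | f S. f \<in> A \<and> S \<in> sets borel}"

definition uncorrelated :: "'w measure \<Rightarrow> ('w \<Rightarrow> real) set \<Rightarrow> ('w \<Rightarrow> real) set \<Rightarrow> bool" where
  "uncorrelated P A B \<longleftrightarrow> (\<forall>f\<in>A. \<forall>g\<in>B. (\<integral>\<omega>. f \<omega> * g \<omega> \<partial>P) = 0)"

lemma space_generated_sigma [simp]: "space (generated_sigma P A) = space P"
  by (simp add: generated_sigma_def space_measure_of_conv)

lemma sets_generated_sigma:
  "sets (generated_sigma P A) =
     sigma_sets (space P) {f -` S \<inter> space P | f S. f \<in> A \<and> S \<in> sets borel}"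
  unfolding generated_sigma_def by (rule sets_measure_of) auto

lemma measurable_generated_sigma: "f \<in> A \<Longrightarrow> f \<in> borel_measurable (generated_sigma P A)"
  by (rule measurableI) (auto simp: sets_generated_sigma intro!: sigma_sets.Basic)

lemma sets_generated_sigma_mono: "A \<subseteq> B \<Longrightarrow> sets (generated_sigma P A) \<subseteq> sets (generated_sigma P B)"
  unfolding sets_generated_sigma by (rule sigma_sets_mono') auto

lemma measurable_generated_sigma_mono:
  "A \<subseteq> B \<Longrightarrow> f \<in> measurable (generated_sigma P A) N \<Longrightarrow> f \<in> measurable (generated_sigma P B) N"
  using sets_generated_sigma_mono[of A B P] by (auto simp: measurable_def)

lemma sets_generated_sigma_subset:
  "A \<subseteq> borel_measurable P \<Longrightarrow> sets (generated_sigma P A) \<subseteq> sets P"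
  unfolding sets_generated_sigma by (rule sets.sigma_sets_subset) (auto intro: measurable_sets)

lemma measurable_from_generated_sigma:
  "A \<subseteq> borel_measurable P \<Longrightarrow> f \<in> measurable (generated_sigma P A) N \<Longrightarrow> f \<in> measurable P N"
  using sets_generated_sigma_subset[of A P] by (auto simp: measurable_def)

lemma centred_gaussian_spaceD:
  assumes "centred_gaussian_space P H"
  shows "f \<in> H \<Longrightarrow> gaussian_rv P f" "f \<in> H \<Longrightarrow> (\<integral>\<omega>. f \<omega> \<partial>P) = 0" "f \<in> H \<Longrightarrow> f \<in> borel_measurable P"
    and "f \<in> H \<Longrightarrow> g \<in> H \<Longrightarrow> (\<lambda>\<omega>. f \<omega> + g \<omega>) \<in> H" "f \<in> H \<Longrightarrow> (\<lambda>\<omega>. c * f \<omega>) \<in> H" "(\<lambda>_. 0) \<in> H"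
  using assms unfolding centred_gaussian_space_def gaussian_rv_def by blast+

lemma centred_gaussian_space_diff:
  assumes "centred_gaussian_space P H" "f \<in> H" "g \<in> H"
  shows "(\<lambda>\<omega>. f \<omega> - g \<omega>) \<in> H"
proof -
  have "(\<lambda>\<omega>. f \<omega> + (-1) * g \<omega>) \<in> H"
    using assms centred_gaussian_spaceD(4,5)[OF assms(1)] by blast
  then show ?thesis by simp
qed

lemma centred_gaussian_space_sum:
  assumes "centred_gaussian_space P H" "finite F" "F \<subseteq> H"
  shows "(\<lambda>\<omega>. \<Sum>f\<in>F. c f * f \<omega>) \<in> H"
  using assms(2,3)
proof (induction F)
  case empty
  then show ?case using centred_gaussian_spaceD(6)[OF assms(1)] by simp
next
  case (insert x F)
  then show ?case
    using centred_gaussian_spaceD(4,5)[OF assms(1)] by simp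
qed

context prob_space
begin

section \<open>Centred Gaussian variables and their characteristic functions\<close>

lemma gaussian_rv_cases:
  assumes "gaussian_rv M f" "(\<integral>\<omega>. f \<omega> \<partial>M) = 0"
  obtains "AE \<omega> in M. f \<omega> = 0"
  | \<sigma> where "0 < \<sigma>" "distributed M lborel f (normal_density 0 \<sigma>)"
proof -
  have m: "f \<in> borel_measurable M" using assms(1) by (simp add: gaussian_rv_def)
  consider (a) \<mu> where "AE \<omega> in M. f \<omega> = \<mu>" | (b) \<mu> \<sigma> where "0 < \<sigma>" "distributed M lborel f (normal_density \<mu> \<sigma>)"
    using assms(1) unfolding gaussian_rv_def by blast
  then show ?thesis
  proof cases
    case a
    have "(\<integral>\<omega>. f \<omega> \<partial>M) = (\<integral>\<omega>. \<mu> \<partial>M)"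
      by (rule integral_cong_AE) (use a m in auto)
    then have "\<mu> = 0" using assms(2) by (simp add: prob_space)
    then show ?thesis using a that(1) by simp
  next
    case b
    then have "\<mu> = 0" using normal_distributed_expectation[OF b] assms(2) by simp
    then show ?thesis using b that(2) by simp
  qed
qed

lemma gaussian_square_integrable:
  assumes "gaussian_rv M f" "(\<integral>\<omega>. f \<omega> \<partial>M) = 0"
  shows "integrable M (\<lambda>\<omega>. (f \<omega>)\<^sup>2)"
  using assms
proof (rule gaussian_rv_cases)
  assume *: "AE \<omega> in M. f \<omega> = 0"
  have "f \<in> borel_measurable M" using assms(1) by (simp add: gaussian_rv_def)
  then show ?thesis
    using integrable_cong_AE[of "\<lambda>\<omega>. (f \<omega>)\<^sup>2" M "\<lambda>_. 0"] * by auto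
next
  fix \<sigma> :: real assume *: "0 < \<sigma>" "distributed M lborel f (normal_density 0 \<sigma>)"
  show ?thesis
    using integrable_normal_moment[OF *(1), of 0 2] distributed_integrable[OF *(2), of "\<lambda>x. x\<^sup>2"]
    by simp
qed

text \<open>An almost surely zero variable is the case of variance 0, so a formula in terms of the
  second moment covers both cases and applies to arbitrary linear combinations.\<close>

lemma gaussian_char:
  assumes "gaussian_rv M f" "(\<integral>\<omega>. f \<omega> \<partial>M) = 0"
  shows "(CLINT \<omega>|M. iexp (f \<omega>)) = of_real (exp (- (\<integral>\<omega>. (f \<omega>)\<^sup>2 \<partial>M) / 2))"
  using assms
proof (rule gaussian_rv_cases)
  assume *: "AE \<omega> in M. f \<omega> = 0"
  have m[measurable]: "f \<in> borel_measurable M" using assms(1) by (simp add: gaussian_rv_def)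
  have "(CLINT \<omega>|M. iexp (f \<omega>)) = (CLINT \<omega>|M. 1)"
    by (rule integral_cong_AE) (use * in auto)
  moreover have "(\<integral>\<omega>. (f \<omega>)\<^sup>2 \<partial>M) = (\<integral>\<omega>. 0 \<partial>M)"
    by (rule integral_cong_AE) (use * in auto)
  ultimately show ?thesis by (simp add: prob_space)
next
  fix \<sigma> :: real assume *: "0 < \<sigma>" "distributed M lborel f (normal_density 0 \<sigma>)"
  have "(\<integral>\<omega>. (f \<omega>)\<^sup>2 \<partial>M) = \<sigma>\<^sup>2"
    using normal_distributed_variance[OF *] normal_distributed_expectation[OF *] by simp
  have m[measurable]: "f \<in> borel_measurable M" using assms(1) by (simp add: gaussian_rv_def)
  have "distributed M lborel (\<lambda>x. f x / \<sigma>) std_normal_density"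
    using normal_standard_normal_convert[OF *(1), of f 0] *(2) by simp
  then have d: "distr M lborel (\<lambda>x. f x / \<sigma>) = std_normal_distribution"
    by (simp add: distributed_distr_eq_density)
  have "(CLINT \<omega>|M. iexp (f \<omega>)) = (CLINT \<omega>|M. iexp (\<sigma> * (f \<omega> / \<sigma>)))"
    using *(1) by simp
  also have "\<dots> = (CLINT x|distr M lborel (\<lambda>x. f x / \<sigma>). iexp (\<sigma> * x))"
    by (subst integral_distr) auto
  also have "\<dots> = char std_normal_distribution \<sigma>"
    by (simp add: d char_def)
  also have "\<dots> = of_real (exp (- \<sigma>\<^sup>2 / 2))"
    by (simp add: char_std_normal_distribution)
  finally show ?thesis using \<open>(\<integral>\<omega>. (f \<omega>)\<^sup>2 \<partial>M) = \<sigma>\<^sup>2\<close> by simp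
qed

text \<open>Adding a constant to u turns it into a probability density up to scaling. The hypothesis
  then says that \<open>Y\<close> has the same characteristic function under the reweighted measure
  as under \<open>M\<close>; Levy uniqueness equates the two laws, and their difference isolates
  u.\<close>

lemma weighted_char_eq_0_real:
  fixes u Y :: "'a \<Rightarrow> real"
  assumes u[measurable]: "u \<in> borel_measurable M" and Y[measurable]: "Y \<in> borel_measurable M"
    and bd: "\<And>\<omega>. \<bar>u \<omega>\<bar> \<le> C"
    and ch: "\<And>s. (CLINT \<omega>|M. of_real (u \<omega>) * iexp (s * Y \<omega>)) = 0"
    and S[measurable]: "S \<in> sets borel"
  shows "(\<integral>\<omega>. u \<omega> * indicator S (Y \<omega>) \<partial>M) = 0"
proof -
  \<comment> \<open>The summand 1 keeps the constant positive when u vanishes and C is 0.\<close>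
  define C' where "C' = C + 1"
  have C': "C' > 0" using bd[of undefined] by (simp add: C'_def)
  have pos: "u \<omega> + C' > 0" for \<omega> using bd[of \<omega>] by (simp add: C'_def)
  define v where "v \<omega> = (u \<omega> + C') / C'" for \<omega>
  have [measurable]: "v \<in> borel_measurable M" unfolding v_def by simp
  have vpos: "0 \<le> v \<omega>" for \<omega> using pos[of \<omega>] C' by (simp add: v_def)
  have ui: "integrable M u"
    by (rule integrable_const_bound[of _ C]) (use bd in auto)
  have vi: "integrable M v" unfolding v_def using ui by auto
  have "(CLINT \<omega>|M. of_real (u \<omega>)) = 0" using ch[of 0] by simp
  then have "of_real (\<integral>\<omega>. u \<omega> \<partial>M) = (0::complex)" by simp
  then have u0: "(\<integral>\<omega>. u \<omega> \<partial>M) = 0" by (simp only: of_real_eq_0_iff)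
  have "(\<integral>\<omega>. v \<omega> \<partial>M) = 1"
    unfolding v_def using ui u0 C' by (simp add: prob_space)
  define N where "N = density M (\<lambda>\<omega>. ennreal (v \<omega>))"
  have emN: "emeasure N (space M) = 1"
    unfolding N_def using \<open>(\<integral>\<omega>. v \<omega> \<partial>M) = 1\<close> vi vpos
    by (simp add: emeasure_density nn_integral_eq_integral)
  interpret N: prob_space N
    by (rule prob_spaceI) (use emN in \<open>simp add: N_def\<close>)
  have YN[measurable]: "Y \<in> borel_measurable N" by (simp add: N_def)
  interpret D1: real_distribution "distr N borel Y"
    by (rule N.real_distribution_distr) simp
  interpret D2: real_distribution "distr M borel Y"
    by (rule real_distribution_distr) simp
  have "char (distr N borel Y) = char (distr M borel Y)"
  proof
    fix t
    have i1: "complex_integrable M (\<lambda>\<omega>. of_real (u \<omega>) * iexp (t * Y \<omega>))"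
      by (rule integrable_const_bound[of _ C]) (use bd in \<open>auto simp: norm_mult\<close>)
    have i2: "complex_integrable M (\<lambda>\<omega>. iexp (t * Y \<omega>))"
      by (rule integrable_const_bound[of _ 1]) auto
    have "char (distr N borel Y) t = (CLINT \<omega>|N. iexp (t * Y \<omega>))"
      unfolding char_def by (subst integral_distr) auto
    also have "\<dots> = (CLINT \<omega>|M. v \<omega> *\<^sub>R iexp (t * Y \<omega>))"
      unfolding N_def by (subst integral_density) (use vpos in auto)
    also have "\<dots> = (CLINT \<omega>|M. of_real (1 / C') * (of_real (u \<omega>) * iexp (t * Y \<omega>)) + iexp (t * Y \<omega>))"
      by (rule Bochner_Integration.integral_cong)
        (use C' in \<open>auto simp: v_def scaleR_conv_of_real field_simps\<close>)
    also have "\<dots> = of_real (1 / C') * (CLINT \<omega>|M. of_real (u \<omega>) * iexp (t * Y \<omega>)) + (CLINT \<omega>|M. iexp (t * Y \<omega>))"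
      using i1 i2 by (subst Bochner_Integration.integral_add) auto
    also have "\<dots> = (CLINT \<omega>|M. iexp (t * Y \<omega>))" using ch[of t] by simp
    also have "\<dots> = char (distr M borel Y) t"
      unfolding char_def by (subst integral_distr) auto
    finally show "char (distr N borel Y) t = char (distr M borel Y) t" .
  qed
  then have eq: "distr N borel Y = distr M borel Y"
    by (intro Levy_uniqueness) (unfold_locales)
  have "(\<integral>\<omega>. v \<omega> * indicator S (Y \<omega>) \<partial>M) = (\<integral>\<omega>. indicator S (Y \<omega>) \<partial>N)"
    unfolding N_def by (subst integral_density) (use vpos in auto)
  also have "\<dots> = (\<integral>x. indicator S x \<partial>distr N borel Y)" by (subst integral_distr) auto
  also have "\<dots> = (\<integral>x. indicator S x \<partial>distr M borel Y)" by (simp only: eq)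
  also have "\<dots> = (\<integral>\<omega>. indicator S (Y \<omega>) \<partial>M)" by (subst integral_distr) auto
  finally have e: "(\<integral>\<omega>. v \<omega> * indicator S (Y \<omega>) \<partial>M) = (\<integral>\<omega>. indicator S (Y \<omega>) \<partial>M)" .
  have iu: "integrable M (\<lambda>\<omega>. u \<omega> * indicator S (Y \<omega>))"
    by (rule integrable_const_bound[of _ "\<bar>C\<bar>"])
      (use order_trans[OF bd abs_ge_self] in \<open>auto simp: indicator_def\<close>)
  have iS: "integrable M (\<lambda>\<omega>. indicator S (Y \<omega>) :: real)"
    by (rule integrable_const_bound[of _ 1]) (auto simp: indicator_def)
  have "(\<integral>\<omega>. v \<omega> * indicator S (Y \<omega>) \<partial>M) = (\<integral>\<omega>. (1 / C') * (u \<omega> * indicator S (Y \<omega>)) + indicator S (Y \<omega>) \<partial>M)"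
    by (rule Bochner_Integration.integral_cong) (use C' in \<open>auto simp: v_def field_simps\<close>)
  also have "\<dots> = (1 / C') * (\<integral>\<omega>. u \<omega> * indicator S (Y \<omega>) \<partial>M) + (\<integral>\<omega>. indicator S (Y \<omega>) \<partial>M)"
    using iu iS by (subst Bochner_Integration.integral_add) auto
  finally show ?thesis using e C' by simp
qed

text \<open>Conjugating the hypothesis at \<open>- s\<close> gives it for the conjugate weight, so
  it holds separately for the real and the imaginary part.\<close>

lemma weighted_char_eq_0:
  fixes h :: "'a \<Rightarrow> complex" and Y :: "'a \<Rightarrow> real"
  assumes h[measurable]: "h \<in> borel_measurable M" and Y[measurable]: "Y \<in> borel_measurable M"
    and bd: "\<And>\<omega>. norm (h \<omega>) \<le> C"
    and ch: "\<And>s. (CLINT \<omega>|M. h \<omega> * iexp (s * Y \<omega>)) = 0"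
    and S[measurable]: "S \<in> sets borel"
  shows "(CLINT \<omega>|M. h \<omega> * indicator S (Y \<omega>)) = 0"
proof -
  have ih: "complex_integrable M (\<lambda>\<omega>. h \<omega> * iexp (s * Y \<omega>))" for s
    by (rule integrable_const_bound[of _ C]) (use bd in \<open>auto simp: norm_mult\<close>)
  have cn: "(CLINT \<omega>|M. cnj (h \<omega>) * iexp (s * Y \<omega>)) = 0" for s
  proof -
    have "(CLINT \<omega>|M. cnj (h \<omega>) * iexp (s * Y \<omega>)) = (CLINT \<omega>|M. cnj (h \<omega> * iexp (- s * Y \<omega>)))"
      by (rule Bochner_Integration.integral_cong) (auto simp: exp_cnj)
    also have "\<dots> = cnj (CLINT \<omega>|M. h \<omega> * iexp (- s * Y \<omega>))"
      by (simp only: Bochner_Integration.integral_cnj)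
    finally show ?thesis using ch[of "-s"] by simp
  qed
  have icn: "complex_integrable M (\<lambda>\<omega>. cnj (h \<omega>) * iexp (s * Y \<omega>))" for s
  proof -
    have "complex_integrable M (\<lambda>\<omega>. cnj (h \<omega> * iexp (- s * Y \<omega>)))"
      using ih[of "- s"] by (rule integrable_cnj)
    then show ?thesis by (simp add: exp_cnj)
  qed
  have re: "(CLINT \<omega>|M. of_real (Re (h \<omega>)) * iexp (s * Y \<omega>)) = 0" for s
  proof -
    have "(CLINT \<omega>|M. of_real (Re (h \<omega>)) * iexp (s * Y \<omega>)) =
      (CLINT \<omega>|M. (1/2) * (h \<omega> * iexp (s * Y \<omega>)) + (1/2) * (cnj (h \<omega>) * iexp (s * Y \<omega>)))"
    proof (rule Bochner_Integration.integral_cong[OF refl])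
      fix \<omega>
      have "complex_of_real (Re (h \<omega>)) = (h \<omega> + cnj (h \<omega>)) / 2" by (simp add: complex_add_cnj)
      then show "of_real (Re (h \<omega>)) * iexp (s * Y \<omega>) =
        (1/2) * (h \<omega> * iexp (s * Y \<omega>)) + (1/2) * (cnj (h \<omega>) * iexp (s * Y \<omega>))"
        by (simp add: add_divide_distrib distrib_right)
    qed
    also have "\<dots> = 0" using ih icn ch cn by (subst Bochner_Integration.integral_add) auto
    finally show ?thesis .
  qed
  have im: "(CLINT \<omega>|M. of_real (Im (h \<omega>)) * iexp (s * Y \<omega>)) = 0" for s
  proof -
    have "(CLINT \<omega>|M. of_real (Im (h \<omega>)) * iexp (s * Y \<omega>)) =
      (CLINT \<omega>|M. (- \<i>/2) * (h \<omega> * iexp (s * Y \<omega>)) + (\<i>/2) * (cnj (h \<omega>) * iexp (s * Y \<omega>)))"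
    proof (rule Bochner_Integration.integral_cong[OF refl])
      fix \<omega>
      have "complex_of_real (Im (h \<omega>)) = (- \<i>/2) * h \<omega> + (\<i>/2) * cnj (h \<omega>)"
        by (simp add: complex_eq_iff)
      then show "of_real (Im (h \<omega>)) * iexp (s * Y \<omega>) =
        (- \<i>/2) * (h \<omega> * iexp (s * Y \<omega>)) + (\<i>/2) * (cnj (h \<omega>) * iexp (s * Y \<omega>))"
        by (simp only: distrib_right mult.assoc)
    qed
    also have "\<dots> = 0" using ih icn ch cn by (subst Bochner_Integration.integral_add) auto
    finally show ?thesis .
  qed
  have r: "(\<integral>\<omega>. Re (h \<omega>) * indicator S (Y \<omega>) \<partial>M) = 0"
    by (rule weighted_char_eq_0_real[of _ _ C])
      (use re in \<open>auto intro: order_trans[OF abs_Re_le_cmod bd]\<close>)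
  have i: "(\<integral>\<omega>. Im (h \<omega>) * indicator S (Y \<omega>) \<partial>M) = 0"
    by (rule weighted_char_eq_0_real[of _ _ C])
      (use im in \<open>auto intro: order_trans[OF abs_Im_le_cmod bd]\<close>)
  have int: "complex_integrable M (\<lambda>\<omega>. h \<omega> * indicator S (Y \<omega>))"
    by (rule integrable_const_bound[of _ C])
      (use bd order_trans[OF norm_ge_zero bd] in \<open>auto simp: norm_mult indicator_def\<close>)
  show ?thesis
  proof (rule complex_eqI)
    have "Re (h \<omega> * indicator S (Y \<omega>)) = Re (h \<omega>) * indicator S (Y \<omega>)" for \<omega>
      by (simp add: indicator_def)
    then show "Re (CLINT \<omega>|M. h \<omega> * indicator S (Y \<omega>)) = Re 0"
      using r integral_Re[OF int] by (simp only: zero_complex.simps)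
    have "Im (h \<omega> * indicator S (Y \<omega>)) = Im (h \<omega>) * indicator S (Y \<omega>)" for \<omega>
      by (simp add: indicator_def)
    then show "Im (CLINT \<omega>|M. h \<omega> * indicator S (Y \<omega>)) = Im 0"
      using i integral_Im[OF int] by (simp only: zero_complex.simps)
  qed
qed

text \<open>Indicators enter one function at a time: the hypothesis with an extra frequency on
  \<open>f0\<close> is exactly what \<open>weighted_char_eq_0\<close> asks for, and its conclusion
  trades that exponential for the indicator of a Borel set. The exponential over F stays arbitrary
  so that the induction hypothesis can supply the extra frequency.\<close>

lemma char_to_indicator:
  fixes V :: "'a \<Rightarrow> complex"
  assumes A: "A \<subseteq> borel_measurable M" and V[measurable]: "V \<in> borel_measurable M"
    and bd: "\<And>\<omega>. norm (V \<omega>) \<le> C"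
    and base: "\<And>F c. finite F \<Longrightarrow> F \<subseteq> A \<Longrightarrow> (CLINT \<omega>|M. iexp (\<Sum>f\<in>F. c f * f \<omega>) * V \<omega>) = 0"
    and G: "finite G" "G \<subseteq> A" and S: "\<And>f. S f \<in> sets borel" and F: "finite F" "F \<subseteq> A"
  shows "(CLINT \<omega>|M. iexp (\<Sum>f\<in>F. c f * f \<omega>) * ((\<Prod>f\<in>G. indicator (S f) (f \<omega>)) * V \<omega>)) = 0"
  using G F
proof (induction G arbitrary: F c)
  case empty
  then show ?case using base by simp
next
  case (insert f0 G)
  have m[measurable]: "f \<in> borel_measurable M" if "f \<in> A" for f using that A by auto
  have f0: "f0 \<in> A" using insert by auto
  note S[measurable]
  have mF: "(\<lambda>\<omega>. \<Sum>f\<in>F. c f * f \<omega>) \<in> borel_measurable M"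
    using insert.prems by (intro borel_measurable_sum borel_measurable_times) auto
  have mG: "(\<lambda>\<omega>. \<Prod>f\<in>G. indicator (S f) (f \<omega>) :: complex) \<in> borel_measurable M"
  proof (rule borel_measurable_prod)
    fix f assume "f \<in> G"
    then have [measurable]: "f \<in> borel_measurable M" using insert.prems A by auto
    show "(\<lambda>\<omega>. indicator (S f) (f \<omega>) :: complex) \<in> borel_measurable M" by measurable
  qed
  have "(CLINT \<omega>|M. (iexp (\<Sum>f\<in>F. c f * f \<omega>) * ((\<Prod>f\<in>G. indicator (S f) (f \<omega>)) * V \<omega>)) * indicator (S f0) (f0 \<omega>)) = 0"
  proof (rule weighted_char_eq_0[where C = C])
    show "(\<lambda>\<omega>. iexp (\<Sum>f\<in>F. c f * f \<omega>) * ((\<Prod>f\<in>G. indicator (S f) (f \<omega>)) * V \<omega>)) \<in> borel_measurable M"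
      using mF mG by measurable
    show "f0 \<in> borel_measurable M" using f0 by (rule m)
    show "S f0 \<in> sets borel" by (rule S)
    fix \<omega>
    have "norm (\<Prod>f\<in>G. indicator (S f) (f \<omega>) :: complex) \<le> 1"
      by (simp add: prod_norm[symmetric]) (rule prod_le_1, auto simp: indicator_def)
    then show "norm (iexp (\<Sum>f\<in>F. c f * f \<omega>) * ((\<Prod>f\<in>G. indicator (S f) (f \<omega>)) * V \<omega>)) \<le> C"
      using bd[of \<omega>] mult_mono[of "norm (\<Prod>f\<in>G. indicator (S f) (f \<omega>) :: complex)" 1 "norm (V \<omega>)" C]
      by (simp add: norm_mult del: of_real_sum)
  next
    fix s
    \<comment> \<open>\<open>f0\<close> may already occur in F, so the new frequency is added to its
      coefficient.\<close>
    define c' where "c' f = (if f \<in> F then c f else 0) + (if f = f0 then s else 0)" for f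
    have sum: "(\<Sum>f\<in>insert f0 F. c' f * f \<omega>) = (\<Sum>f\<in>F. c f * f \<omega>) + s * f0 \<omega>" for \<omega>
    proof -
      have "(\<Sum>f\<in>insert f0 F. c' f * f \<omega>) =
         (\<Sum>f\<in>insert f0 F. (if f \<in> F then c f else 0) * f \<omega>) + (\<Sum>f\<in>insert f0 F. (if f = f0 then s else 0) * f \<omega>)"
        by (simp add: c'_def algebra_simps sum.distrib)
      also have "(\<Sum>f\<in>insert f0 F. (if f \<in> F then c f else 0) * f \<omega>) = (\<Sum>f\<in>F. c f * f \<omega>)"
        using insert.prems by (intro sum.mono_neutral_cong_right) auto
      also have "(\<Sum>f\<in>insert f0 F. (if f = f0 then s else 0) * f \<omega>) = (\<Sum>f\<in>{f0}. s * f \<omega>)"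
        using insert.prems by (intro sum.mono_neutral_cong_right) auto
      finally show ?thesis by simp
    qed
    have "(CLINT \<omega>|M. iexp (\<Sum>f\<in>insert f0 F. c' f * f \<omega>) * ((\<Prod>f\<in>G. indicator (S f) (f \<omega>)) * V \<omega>)) = 0"
      using insert.prems f0 by (intro insert.IH) auto
    moreover have "iexp (\<Sum>f\<in>insert f0 F. c' f * f \<omega>) * ((\<Prod>f\<in>G. indicator (S f) (f \<omega>)) * V \<omega>) =
       iexp (\<Sum>f\<in>F. c f * f \<omega>) * ((\<Prod>f\<in>G. indicator (S f) (f \<omega>)) * V \<omega>) * iexp (s * f0 \<omega>)" for \<omega>
      unfolding sum of_real_add distrib_left exp_add by (simp only: mult_ac)
    ultimately show "(CLINT \<omega>|M. iexp (\<Sum>f\<in>F. c f * f \<omega>) * ((\<Prod>f\<in>G. indicator (S f) (f \<omega>)) * V \<omega>) * iexp (s * f0 \<omega>)) = 0"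
      by (simp only:)
  qed
  then show ?case using insert.hyps by (simp add: algebra_simps)
qed

lemma uncorrelated_span:
  assumes "centred_gaussian_space M H" "A \<subseteq> H" "B \<subseteq> H" "uncorrelated M A B"
    "finite F" "F \<subseteq> A" "finite G" "G \<subseteq> B"
  shows "(\<integral>\<omega>. (\<Sum>f\<in>F. c f * f \<omega>) * (\<Sum>g\<in>G. k g * g \<omega>) \<partial>M) = 0"
proof -
  have int: "integrable M (\<lambda>\<omega>. f \<omega> * g \<omega>)" if "f \<in> H" "g \<in> H" for f g
  proof (rule Bochner_Integration.integrable_bound)
    have "integrable M (\<lambda>\<omega>. (f \<omega>)\<^sup>2)" "integrable M (\<lambda>\<omega>. (g \<omega>)\<^sup>2)"
      using that centred_gaussian_spaceD(1,2)[OF assms(1)] gaussian_square_integrable by blast+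
    then show "integrable M (\<lambda>\<omega>. (f \<omega>)\<^sup>2 + (g \<omega>)\<^sup>2)" by simp
    show "(\<lambda>\<omega>. f \<omega> * g \<omega>) \<in> borel_measurable M"
      using that centred_gaussian_spaceD(3)[OF assms(1)] by simp
    have "\<bar>x * y\<bar> \<le> x\<^sup>2 + y\<^sup>2" for x y :: real
    proof -
      have "0 \<le> (\<bar>x\<bar> - \<bar>y\<bar>)\<^sup>2" by simp
      then have "2 * (\<bar>x\<bar> * \<bar>y\<bar>) \<le> x\<^sup>2 + y\<^sup>2" by (simp add: power2_diff)
      moreover have "0 \<le> \<bar>x\<bar> * \<bar>y\<bar>" by simp
      ultimately have "\<bar>x\<bar> * \<bar>y\<bar> \<le> x\<^sup>2 + y\<^sup>2" by linarith
      then show ?thesis by (simp only: abs_mult)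
    qed
    then show "AE \<omega> in M. norm (f \<omega> * g \<omega>) \<le> norm ((f \<omega>)\<^sup>2 + (g \<omega>)\<^sup>2)" by simp
  qed
  have "(\<integral>\<omega>. (\<Sum>f\<in>F. c f * f \<omega>) * (\<Sum>g\<in>G. k g * g \<omega>) \<partial>M) = (\<integral>\<omega>. (\<Sum>f\<in>F. \<Sum>g\<in>G. c f * k g * (f \<omega> * g \<omega>)) \<partial>M)"
    by (simp add: sum_product mult_ac)
  also have "\<dots> = (\<Sum>f\<in>F. \<Sum>g\<in>G. c f * k g * (\<integral>\<omega>. f \<omega> * g \<omega> \<partial>M))"
  proof -
    have i: "integrable M (\<lambda>\<omega>. c f * k g * (f \<omega> * g \<omega>))" if "f \<in> F" "g \<in> G" for f g
      using int[of f g] that assms by (intro integrable_mult_right) auto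
    have "(\<integral>\<omega>. (\<Sum>f\<in>F. \<Sum>g\<in>G. c f * k g * (f \<omega> * g \<omega>)) \<partial>M) =
        (\<Sum>f\<in>F. \<integral>\<omega>. (\<Sum>g\<in>G. c f * k g * (f \<omega> * g \<omega>)) \<partial>M)"
      by (rule Bochner_Integration.integral_sum) (rule Bochner_Integration.integrable_sum, rule i)
    also have "\<dots> = (\<Sum>f\<in>F. \<Sum>g\<in>G. \<integral>\<omega>. c f * k g * (f \<omega> * g \<omega>) \<partial>M)"
      by (rule sum.cong[OF refl], rule Bochner_Integration.integral_sum) (rule i)
    finally show ?thesis by (simp only: integral_mult_right_zero)
  qed
  also have "\<dots> = 0"
    using assms unfolding uncorrelated_def by (intro sum.neutral ballI) (auto dest!: subsetD)
  finally show ?thesis .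
qed

lemma cylinder_event:
  assumes "finite G" "G \<subseteq> borel_measurable M" "\<And>f. S f \<in> sets (borel :: real measure)"
  shows "space M \<inter> (\<Inter>f\<in>G. f -` S f) \<in> events"
  using assms(1,2)
proof (induction G)
  case (insert f G)
  have "space M \<inter> (\<Inter>f\<in>insert f G. f -` S f) = (f -` S f \<inter> space M) \<inter> (space M \<inter> (\<Inter>f\<in>G. f -` S f))"
    by auto
  moreover have "f -` S f \<inter> space M \<in> events"
    using insert.prems assms(3) by (auto intro: measurable_sets)
  ultimately show ?case using insert by auto
qed simp

text \<open>For linear combinations over A and over B the cross term in the variance vanishes, so
  the joint characteristic function factorises. \<open>char_to_indicator\<close> is then used twice:
  on A with the centred exponential over B as weight, and afterwards on B with the centred cylinder
  indicator over A as weight. Cylinders form pi-systems that generate the two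
  sigma-algebras.\<close>

lemma indep_generated_sigma:
  assumes H: "centred_gaussian_space M H" and A: "A \<subseteq> H" and B: "B \<subseteq> H" and AB: "uncorrelated M A B"
  shows "indep_set (sets (generated_sigma M A)) (sets (generated_sigma M B))"
proof -
  note HD = centred_gaussian_spaceD[OF H]
  define cyl where "cyl A = {space M \<inter> (\<Inter>f\<in>G. f -` S f) | G S. finite G \<and> G \<subseteq> A \<and> (\<forall>f. S f \<in> sets (borel::real measure))}"
    for A :: "('a \<Rightarrow> real) set"
  have mH: "A \<subseteq> borel_measurable M" "B \<subseteq> borel_measurable M" using A B HD(3) by auto
  have ind: "prob ((space M \<inter> (\<Inter>f\<in>G. f -` S f)) \<inter> (space M \<inter> (\<Inter>f\<in>G'. f -` S' f))) =
      prob (space M \<inter> (\<Inter>f\<in>G. f -` S f)) * prob (space M \<inter> (\<Inter>f\<in>G'. f -` S' f))"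
    if G: "finite G" "G \<subseteq> A" and S: "\<And>f. S f \<in> sets (borel::real measure)"
      and G': "finite G'" "G' \<subseteq> B" and S': "\<And>f. S' f \<in> sets (borel::real measure)" for G S G' S'
  proof -
    define V where "V \<omega> = (\<Prod>f\<in>G. indicator (S f) (f \<omega>) :: complex)" for \<omega>
    define V' where "V' \<omega> = (\<Prod>f\<in>G'. indicator (S' f) (f \<omega>) :: complex)" for \<omega>
    have Vm[measurable]: "V \<in> borel_measurable M" unfolding V_def
    proof (rule borel_measurable_prod)
      fix f assume "f \<in> G"
      then have [measurable]: "f \<in> borel_measurable M" using G mH by auto
      note S[measurable]
      show "(\<lambda>\<omega>. indicator (S f) (f \<omega>) :: complex) \<in> borel_measurable M" by measurable
    qed
    have Vm'[measurable]: "V' \<in> borel_measurable M" unfolding V'_def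
    proof (rule borel_measurable_prod)
      fix f assume "f \<in> G'"
      then have [measurable]: "f \<in> borel_measurable M" using G' mH by auto
      note S'[measurable]
      show "(\<lambda>\<omega>. indicator (S' f) (f \<omega>) :: complex) \<in> borel_measurable M" by measurable
    qed
    have Vb: "norm (V \<omega>) \<le> 1" for \<omega> unfolding V_def
      by (simp add: prod_norm[symmetric]) (rule prod_le_1, auto simp: indicator_def)
    have Vb': "norm (V' \<omega>) \<le> 1" for \<omega> unfolding V'_def
      by (simp add: prod_norm[symmetric]) (rule prod_le_1, auto simp: indicator_def)
    have step1: "(CLINT \<omega>|M. V \<omega> * (iexp (\<Sum>f\<in>F. c f * f \<omega>) - (CLINT \<omega>|M. iexp (\<Sum>f\<in>F. c f * f \<omega>)))) = 0"
      if F: "finite F" "F \<subseteq> B" for F c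
    proof -
      define g where "g \<omega> = (\<Sum>f\<in>F. c f * f \<omega>)" for \<omega>
      have gH: "g \<in> H" unfolding g_def using centred_gaussian_space_sum[OF H, of F c] F B by auto
      have gm[measurable]: "g \<in> borel_measurable M" using HD(3) gH by auto
      define e where "e = (CLINT \<omega>|M. iexp (g \<omega>))"
      have ig: "complex_integrable M (\<lambda>\<omega>. iexp (g \<omega>))"
        by (rule integrable_const_bound[of _ 1]) auto
      have "norm e \<le> 1"
      proof -
        have "norm e \<le> (\<integral>\<omega>. norm (iexp (g \<omega>)) \<partial>M)" unfolding e_def
          by (rule integral_norm_bound)
        then show ?thesis by (simp add: prob_space)
      qed
      have "(CLINT \<omega>|M. iexp (\<Sum>f\<in>{}. (\<lambda>_. 0) f * f \<omega>) * ((\<Prod>f\<in>G. indicator (S f) (f \<omega>)) * (iexp (g \<omega>) - e))) = 0"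
      proof (rule char_to_indicator[OF mH(1), where C = 2])
        show "norm (iexp (g \<omega>) - e) \<le> 2" for \<omega>
          using norm_triangle_ineq4[of "iexp (g \<omega>)" e] \<open>norm e \<le> 1\<close> by simp
        fix K k assume K: "finite K" "K \<subseteq> A"
        define f where "f \<omega> = (\<Sum>f\<in>K. k f * f \<omega>)" for \<omega>
        have fH: "f \<in> H" unfolding f_def using centred_gaussian_space_sum[OF H, of K k] K A by auto
        have fm[measurable]: "f \<in> borel_measurable M" using HD(3) fH by auto
        have fgH: "(\<lambda>\<omega>. f \<omega> + g \<omega>) \<in> H" using fH gH HD(4) by auto
        have if2: "integrable M (\<lambda>\<omega>. (f \<omega>)\<^sup>2)" "integrable M (\<lambda>\<omega>. (g \<omega>)\<^sup>2)" "integrable M (\<lambda>\<omega>. (f \<omega> + g \<omega>)\<^sup>2)"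
          using gaussian_square_integrable HD(1,2) fH gH fgH by blast+
        have "integrable M (\<lambda>\<omega>. ((f \<omega> + g \<omega>)\<^sup>2 - (f \<omega>)\<^sup>2 - (g \<omega>)\<^sup>2) / 2)"
          using if2 by auto
        then have ifg: "integrable M (\<lambda>\<omega>. f \<omega> * g \<omega>)"
          by (simp add: power2_sum field_simps)
        have 0: "(\<integral>\<omega>. f \<omega> * g \<omega> \<partial>M) = 0"
          unfolding f_def g_def by (rule uncorrelated_span[OF H A B AB K F])
        have "(\<integral>\<omega>. (f \<omega> + g \<omega>)\<^sup>2 \<partial>M) = (\<integral>\<omega>. (f \<omega>)\<^sup>2 + (g \<omega>)\<^sup>2 + 2 * (f \<omega> * g \<omega>) \<partial>M)"
          by (simp add: power2_sum mult_ac)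
        also have "\<dots> = (\<integral>\<omega>. (f \<omega>)\<^sup>2 \<partial>M) + (\<integral>\<omega>. (g \<omega>)\<^sup>2 \<partial>M)"
          using if2 ifg 0 by simp
        finally have var: "(\<integral>\<omega>. (f \<omega> + g \<omega>)\<^sup>2 \<partial>M) = (\<integral>\<omega>. (f \<omega>)\<^sup>2 \<partial>M) + (\<integral>\<omega>. (g \<omega>)\<^sup>2 \<partial>M)" .
        have "(CLINT \<omega>|M. iexp (f \<omega> + g \<omega>)) = (CLINT \<omega>|M. iexp (f \<omega>)) * e"
          unfolding e_def using gaussian_char[OF HD(1,2)[OF fgH] ] gaussian_char[OF HD(1,2)[OF fH]]
            gaussian_char[OF HD(1,2)[OF gH]] HD(2)[OF fgH]
          by (simp add: var HD fH gH fgH add_divide_distrib exp_add[symmetric] flip: of_real_mult)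
        moreover have "complex_integrable M (\<lambda>\<omega>. iexp (f \<omega>))" "complex_integrable M (\<lambda>\<omega>. iexp (f \<omega> + g \<omega>))"
          by (rule integrable_const_bound[of _ 1]; auto)+
        moreover have "(CLINT \<omega>|M. iexp (f \<omega>) * (iexp (g \<omega>) - e)) = (CLINT \<omega>|M. iexp (f \<omega> + g \<omega>) - iexp (f \<omega>) * e)"
          by (simp add: exp_add algebra_simps)
        ultimately have "(CLINT \<omega>|M. iexp (f \<omega>) * (iexp (g \<omega>) - e)) = 0" by simp
        then show "(CLINT \<omega>|M. iexp (\<Sum>f\<in>K. k f * f \<omega>) * (iexp (g \<omega>) - e)) = 0"
          by (simp add: f_def)
      qed (use G S in auto)
      then show ?thesis by (simp add: V_def g_def e_def)
    qed
    define e where "e = (CLINT \<omega>|M. V \<omega>)"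
    have iV: "complex_integrable M V" "complex_integrable M V'"
      by (rule integrable_const_bound[of _ 1]; use Vb Vb' in auto)+
    have "norm e \<le> 1"
    proof -
      have "norm e \<le> (\<integral>\<omega>. norm (V \<omega>) \<partial>M)" unfolding e_def by (rule integral_norm_bound)
      also have "\<dots> \<le> (\<integral>\<omega>. 1 \<partial>M)" by (rule integral_mono) (use iV Vb in auto)
      finally show ?thesis by (simp add: prob_space)
    qed
    have "(CLINT \<omega>|M. iexp (\<Sum>f\<in>{}. (\<lambda>_. 0) f * f \<omega>) * ((\<Prod>f\<in>G'. indicator (S' f) (f \<omega>)) * (V \<omega> - e))) = 0"
    proof (rule char_to_indicator[OF mH(2), where C = 2])
      show "norm (V \<omega> - e) \<le> 2" for \<omega>
        using norm_triangle_ineq4[of "V \<omega>" e] \<open>norm e \<le> 1\<close> Vb[of \<omega>] by simp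
      fix K k assume K: "finite K" "K \<subseteq> B"
      define g where "g \<omega> = (\<Sum>f\<in>K. k f * f \<omega>)" for \<omega>
      have gH: "g \<in> H" unfolding g_def using centred_gaussian_space_sum[OF H, of K k] K B by auto
      have gm[measurable]: "g \<in> borel_measurable M" using HD(3) gH by auto
      have ig: "complex_integrable M (\<lambda>\<omega>. iexp (g \<omega>))"
        by (rule integrable_const_bound[of _ 1]) auto
      have ig2: "complex_integrable M (\<lambda>\<omega>. V \<omega> * iexp (g \<omega>))"
        by (rule integrable_const_bound[of _ 1]) (use Vb in \<open>auto simp: norm_mult\<close>)
      have "(CLINT \<omega>|M. V \<omega> * iexp (g \<omega>) - V \<omega> * (CLINT \<omega>|M. iexp (g \<omega>))) = 0"
        using step1[OF K, of k] by (simp add: g_def algebra_simps)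
      then have "(CLINT \<omega>|M. V \<omega> * iexp (g \<omega>)) = e * (CLINT \<omega>|M. iexp (g \<omega>))"
        using ig2 iV by (simp add: e_def)
      then have "(CLINT \<omega>|M. V \<omega> * iexp (g \<omega>) - e * iexp (g \<omega>)) = 0"
        using ig ig2 by simp
      then show "(CLINT \<omega>|M. iexp (\<Sum>f\<in>K. k f * f \<omega>) * (V \<omega> - e)) = 0"
        by (simp add: g_def algebra_simps)
    qed (use G' S' in auto)
    then have 1: "(CLINT \<omega>|M. V' \<omega> * V \<omega> - V' \<omega> * e) = 0" by (simp add: V'_def algebra_simps)
    have iVV: "complex_integrable M (\<lambda>\<omega>. V' \<omega> * V \<omega>)"
      by (rule integrable_const_bound[of _ 1]) (use Vb Vb' in \<open>auto simp: norm_mult mult_le_one\<close>)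
    have 2: "(CLINT \<omega>|M. V' \<omega> * V \<omega>) = (CLINT \<omega>|M. V' \<omega>) * (CLINT \<omega>|M. V \<omega>)"
      using 1 iVV iV by (simp add: e_def)
    define E1 where "E1 = space M \<inter> (\<Inter>f\<in>G. f -` S f)"
    define E2 where "E2 = space M \<inter> (\<Inter>f\<in>G'. f -` S' f)"
    have V1: "V \<omega> = indicator E1 \<omega>" if "\<omega> \<in> space M" for \<omega>
      using that G by (auto simp: V_def E1_def indicator_def)
    have V2: "V' \<omega> = indicator E2 \<omega>" if "\<omega> \<in> space M" for \<omega>
      using that G' by (auto simp: V'_def E2_def indicator_def)
    have E: "E1 \<in> events" "E2 \<in> events"
    unfolding E1_def E2_def
      using G G' S S' mH by (auto intro!: cylinder_event)
    have ci: "(CLINT \<omega>|M. indicator E \<omega>) = of_real (prob E)" if "E \<in> events" for E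
    proof -
      have "(CLINT \<omega>|M. indicator E \<omega>) = (CLINT \<omega>|M. of_real (indicator E \<omega>))"
        by (rule Bochner_Integration.integral_cong) (auto simp: indicator_def)
      then show ?thesis using that by (simp add: Int_absorb1 sets.sets_into_space)
    qed
    have "(CLINT \<omega>|M. V' \<omega> * V \<omega>) = (CLINT \<omega>|M. indicator (E1 \<inter> E2) \<omega>)"
      by (rule Bochner_Integration.integral_cong) (auto simp: V1 V2 indicator_def)
    moreover have "(CLINT \<omega>|M. V \<omega>) = (CLINT \<omega>|M. indicator E1 \<omega>)"
      by (rule Bochner_Integration.integral_cong) (auto simp: V1)
    moreover have "(CLINT \<omega>|M. V' \<omega>) = (CLINT \<omega>|M. indicator E2 \<omega>)"
      by (rule Bochner_Integration.integral_cong) (auto simp: V2)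
    ultimately have "complex_of_real (prob (E1 \<inter> E2)) = of_real (prob E1 * prob E2)"
      using 2 E by (simp add: ci mult.commute)
    then show ?thesis unfolding of_real_eq_iff E1_def E2_def .
  qed
  have stab: "Int_stable (cyl A)" for A
  proof (rule Int_stableI)
    fix a b assume "a \<in> cyl A" "b \<in> cyl A"
    then obtain G S G' S' where a: "a = space M \<inter> (\<Inter>f\<in>G. f -` S f)" "finite G" "G \<subseteq> A" "\<forall>f. S f \<in> sets borel"
      and b: "b = space M \<inter> (\<Inter>f\<in>G'. f -` S' f)" "finite G'" "G' \<subseteq> A" "\<forall>f. S' f \<in> sets borel"
      unfolding cyl_def by blast
    define T where "T f = (if f \<in> G then S f else UNIV) \<inter> (if f \<in> G' then S' f else UNIV)" for f
    have "a \<inter> b = space M \<inter> (\<Inter>f\<in>G \<union> G'. f -` T f)"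
      unfolding a b T_def by (auto split: if_splits)
    moreover have "\<forall>f. T f \<in> sets borel" using a b by (auto simp: T_def)
    ultimately show "a \<inter> b \<in> cyl A" unfolding cyl_def using a b
      by (intro CollectI exI[of _ "G \<union> G'"] exI[of _ T]) auto
  qed
  have cylev: "cyl A \<subseteq> events" if "A \<subseteq> borel_measurable M" for A
  proof
    fix a assume "a \<in> cyl A"
    then obtain G S where a: "a = space M \<inter> (\<Inter>f\<in>G. f -` S f)" "finite G" "G \<subseteq> A" "\<forall>f. S f \<in> sets borel"
      unfolding cyl_def by blast
    then show "a \<in> events" using that unfolding a(1) by (intro cylinder_event) auto
  qed
  have "indep_set (cyl A) (cyl B)"
    unfolding indep_sets2_eq
  proof (intro conjI ballI)
    fix a b assume "a \<in> cyl A" "b \<in> cyl B"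
    then show "prob (a \<inter> b) = prob a * prob b" unfolding cyl_def using ind by blast
  qed (use cylev mH in auto)
  then have *: "indep_set (sigma_sets (space M) (cyl A)) (sigma_sets (space M) (cyl B))"
    by (rule indep_set_sigma_sets) (rule stab)+
  have sub: "sets (generated_sigma M A) \<subseteq> sigma_sets (space M) (cyl A)" for A
    unfolding sets_generated_sigma
  proof (rule sigma_sets_mono', safe)
    fix f S assume "f \<in> A" "S \<in> sets (borel::real measure)"
    then show "f -` S \<inter> space M \<in> cyl A" unfolding cyl_def
      by (intro CollectI exI[of _ "{f}"] exI[of _ "\<lambda>_. S"]) auto
  qed
  show ?thesis using * sub unfolding indep_sets2_eq by blast
qed

text \<open>The identity map, read into the two sigma-algebras, is a pair of independent random
  elements, so the law of the diagonal is a product law. This covers integrands that mix both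
  sources, where a formula for products would not suffice.\<close>

lemma indep_product_distr:
  assumes H: "centred_gaussian_space M H" and A: "A \<subseteq> H" and B: "B \<subseteq> H" and AB: "uncorrelated M A B"
    and f: "f \<in> borel_measurable (generated_sigma M A \<Otimes>\<^sub>M generated_sigma M B)"
  shows "(\<integral>\<^sup>+\<omega>. f (\<omega>, \<omega>) \<partial>M) = (\<integral>\<^sup>+\<omega>. \<integral>\<^sup>+\<omega>'. f (\<omega>, \<omega>') \<partial>M \<partial>M)"
proof -
  let ?A = "generated_sigma M A" and ?B = "generated_sigma M B"
  have mH: "A \<subseteq> borel_measurable M" "B \<subseteq> borel_measurable M"
    using A B centred_gaussian_spaceD(3)[OF H] by auto
  have idm[measurable]: "(\<lambda>\<omega>. \<omega>) \<in> measurable M ?A" "(\<lambda>\<omega>. \<omega>) \<in> measurable M ?B"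
    using mH[THEN sets_generated_sigma_subset] by (auto simp: measurable_def)
  have sig: "sigma_sets (space M) {S \<inter> space M | S. S \<in> sets N} = sets N"
    if "space N = space M" for N :: "'a measure"
  proof -
    have "S \<inter> space M = S" if "S \<in> sets N" for S
      using sets.sets_into_space[OF that] \<open>space N = space M\<close> by auto
    then have "{S \<inter> space M | S. S \<in> sets N} = sets N"
      by auto
    then show ?thesis using sets.sigma_sets_eq[of N] that by simp
  qed
  have "indep_var ?A (\<lambda>\<omega>. \<omega>) ?B (\<lambda>\<omega>. \<omega>)"
    unfolding indep_var_eq using indep_generated_sigma[OF H A B AB] by (simp add: sig vimage_ident)
  then have eq: "distr M ?A (\<lambda>\<omega>. \<omega>) \<Otimes>\<^sub>M distr M ?B (\<lambda>\<omega>. \<omega>) = distr M (?A \<Otimes>\<^sub>M ?B) (\<lambda>\<omega>. (\<omega>, \<omega>))"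
    using indep_var_distribution_eq[of ?A "\<lambda>\<omega>. \<omega>" ?B "\<lambda>\<omega>. \<omega>"] by simp
  interpret B: prob_space "distr M ?B (\<lambda>\<omega>. \<omega>)" by (rule prob_space_distr) simp
  have "(\<integral>\<^sup>+\<omega>. f (\<omega>, \<omega>) \<partial>M) = (\<integral>\<^sup>+z. f z \<partial>distr M (?A \<Otimes>\<^sub>M ?B) (\<lambda>\<omega>. (\<omega>, \<omega>)))"
    by (subst nn_integral_distr) (use f in auto)
  also have "\<dots> = (\<integral>\<^sup>+z. f z \<partial>(distr M ?A (\<lambda>\<omega>. \<omega>) \<Otimes>\<^sub>M distr M ?B (\<lambda>\<omega>. \<omega>)))" by (simp add: eq)
  also have "\<dots> = (\<integral>\<^sup>+\<omega>. \<integral>\<^sup>+\<omega>'. f (\<omega>, \<omega>') \<partial>distr M ?B (\<lambda>\<omega>. \<omega>) \<partial>distr M ?A (\<lambda>\<omega>. \<omega>))"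
    by (rule B.nn_integral_fst[symmetric]) (use f in \<open>simp cong: measurable_cong_sets\<close>)
  also have "\<dots> = (\<integral>\<^sup>+\<omega>. \<integral>\<^sup>+\<omega>'. f (\<omega>, \<omega>') \<partial>distr M ?B (\<lambda>\<omega>. \<omega>) \<partial>M)"
    by (subst nn_integral_distr)
      (use f in \<open>auto intro!: B.borel_measurable_nn_integral_fst simp: cong: measurable_cong_sets\<close>)
  also have "\<dots> = (\<integral>\<^sup>+\<omega>. \<integral>\<^sup>+\<omega>'. f (\<omega>, \<omega>') \<partial>M \<partial>M)"
  proof (rule nn_integral_cong)
    fix \<omega> assume "\<omega> \<in> space M"
    then have "(\<lambda>\<omega>'. f (\<omega>, \<omega>')) \<in> borel_measurable ?B"
      using measurable_compose[OF measurable_Pair1' f, of \<omega>] by simp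
    then show "(\<integral>\<^sup>+\<omega>'. f (\<omega>, \<omega>') \<partial>distr M ?B (\<lambda>\<omega>. \<omega>)) = (\<integral>\<^sup>+\<omega>'. f (\<omega>, \<omega>') \<partial>M)"
      by (subst nn_integral_distr) auto
  qed
  finally show ?thesis .
qed

lemma indep_nn_integral_mult:
  assumes H: "centred_gaussian_space M H" and A: "A \<subseteq> H" and B: "B \<subseteq> H" and AB: "uncorrelated M A B"
    and f[measurable]: "f \<in> borel_measurable (generated_sigma M A)"
    and g[measurable]: "g \<in> borel_measurable (generated_sigma M B)"
  shows "(\<integral>\<^sup>+\<omega>. f \<omega> * g \<omega> \<partial>M) = (\<integral>\<^sup>+\<omega>. f \<omega> \<partial>M) * (\<integral>\<^sup>+\<omega>. g \<omega> \<partial>M)"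
proof -
  have mH: "A \<subseteq> borel_measurable M" "B \<subseteq> borel_measurable M"
    using A B centred_gaussian_spaceD(3)[OF H] by auto
  have fg: "f \<in> borel_measurable M" "g \<in> borel_measurable M"
    using measurable_from_generated_sigma mH f g by blast+
  have "(\<integral>\<^sup>+\<omega>. f \<omega> * g \<omega> \<partial>M) = (\<integral>\<^sup>+\<omega>. \<integral>\<^sup>+\<omega>'. f \<omega> * g \<omega>' \<partial>M \<partial>M)"
    using indep_product_distr[OF H A B AB, of "\<lambda>(x, y). f x * g y"] by simp
  also have "\<dots> = (\<integral>\<^sup>+\<omega>. f \<omega> \<partial>M) * (\<integral>\<^sup>+\<omega>. g \<omega> \<partial>M)"
    using fg by (simp add: nn_integral_cmult nn_integral_multc)
  finally show ?thesis .
qed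

text \<open>Takes the place of conditional expectations: D is integrated out under its density while
  everything determined by A is held fixed. All computations of path weights, one step at a time,
  rest on this.\<close>

lemma indep_freeze:
  assumes H: "centred_gaussian_space M H" and A: "A \<subseteq> H" and D: "D \<in> H" and AD: "uncorrelated M A {D}"
    and dist: "distributed M lborel D std_normal_density"
    and f[measurable]: "f \<in> borel_measurable (generated_sigma M A \<Otimes>\<^sub>M borel)"
  shows "(\<integral>\<^sup>+\<omega>. f (\<omega>, D \<omega>) \<partial>M) = (\<integral>\<^sup>+\<omega>. \<integral>\<^sup>+u. ennreal (std_normal_density u) * f (\<omega>, u) \<partial>lborel \<partial>M)"
proof -
  have Dm[measurable]: "D \<in> borel_measurable (generated_sigma M {D})"
    by (rule measurable_generated_sigma) simp
  have "(\<integral>\<^sup>+\<omega>. f (\<omega>, D \<omega>) \<partial>M) = (\<integral>\<^sup>+\<omega>. \<integral>\<^sup>+\<omega>'. f (\<omega>, D \<omega>') \<partial>M \<partial>M)"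
    using indep_product_distr[OF H A _ AD, of "\<lambda>(x, y). f (x, D y)"] D by simp
  also have "\<dots> = (\<integral>\<^sup>+\<omega>. \<integral>\<^sup>+u. ennreal (std_normal_density u) * f (\<omega>, u) \<partial>lborel \<partial>M)"
  proof (rule nn_integral_cong)
    fix \<omega> assume "\<omega> \<in> space M"
    then have "(\<lambda>u. f (\<omega>, u)) \<in> borel_measurable borel"
      using measurable_compose[OF measurable_Pair1' f, of \<omega>] by simp
    then show "(\<integral>\<^sup>+\<omega>'. f (\<omega>, D \<omega>') \<partial>M) = (\<integral>\<^sup>+u. ennreal (std_normal_density u) * f (\<omega>, u) \<partial>lborel)"
      using distributed_nn_integral[OF dist, of "\<lambda>u. f (\<omega>, u)"] by simp
  qed
  finally show ?thesis .
qed

end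

section \<open>Brownian motion killed at the origin\<close>

text \<open>\<open>bridge_weight r z\<close> is the probability that a Brownian bridge of unit length from \<open>r\<close> to \<open>z\<close> stays
  positive. By the reflection principle the iterates of \<open>killed_step\<close> have the kernel \<open>killed_density\<close>.\<close>

definition bridge_weight :: "real \<Rightarrow> real \<Rightarrow> real" where
  "bridge_weight r z = (if 0 < r \<and> 0 < z then 1 - exp (- (2 * r * z)) else 0)"

definition killed_step :: "(real \<Rightarrow> ennreal) \<Rightarrow> real \<Rightarrow> ennreal" where
  "killed_step F r = (\<integral>\<^sup>+z. ennreal (std_normal_density (z - r) * bridge_weight r z) * F z \<partial>lborel)"

definition killed_density :: "nat \<Rightarrow> real \<Rightarrow> real \<Rightarrow> real" where
  "killed_density k r z = (if 0 < r \<and> 0 < z then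
     normal_density 0 (sqrt k) (z - r) - normal_density 0 (sqrt k) (z + r) else 0)"

section \<open>Bounds and semigroup property of the killed kernel\<close>

lemma bridge_weight_nonneg: "0 \<le> bridge_weight r z"
  by (simp add: bridge_weight_def)

lemma bridge_weight_le_1: "bridge_weight r z \<le> 1"
  by (simp add: bridge_weight_def)

lemma bridge_weight_mono: "r \<le> r' \<Longrightarrow> z \<le> z' \<Longrightarrow> bridge_weight r z \<le> bridge_weight r' z'"
  by (auto simp: bridge_weight_def intro: mult_mono)

lemma measurable_bridge_weight [measurable]:
  assumes [measurable]: "f \<in> borel_measurable N" "g \<in> borel_measurable N"
  shows "(\<lambda>x. bridge_weight (f x) (g x)) \<in> borel_measurable N"
  unfolding bridge_weight_def by measurable

lemma measurable_killed_density [measurable]: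
  assumes [measurable]: "f \<in> borel_measurable N" "g \<in> borel_measurable N"
  shows "(\<lambda>x. killed_density k (f x) (g x)) \<in> borel_measurable N"
  unfolding killed_density_def by measurable

text \<open>Since \<open>(z + r)\<^sup>2 = (z - r)\<^sup>2 + 4 * r * z\<close>, the free kernel
  factors out of both images. For k = 1 the second factor is the bridge weight.\<close>

lemma killed_density_eq:
  assumes "1 \<le> k"
  shows "killed_density k r z = normal_density 0 (sqrt k) (z - r) * (if 0 < r \<and> 0 < z then 1 - exp (- (2 * r * z / k)) else 0)"
proof -
  have "- (z + r)\<^sup>2 / (2 * real k) = - (z - r)\<^sup>2 / (2 * k) + - (2 * r * z / k)"
    using assms by (simp add: power2_eq_square field_simps)
  then have "exp (- (z + r)\<^sup>2 / (2 * real k)) = exp (- (z - r)\<^sup>2 / (2 * k)) * exp (- (2 * r * z / k))"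
    by (simp only: exp_add)
  then show ?thesis
    by (simp add: killed_density_def normal_density_def right_diff_distrib diff_divide_distrib)
qed

lemma killed_density_1: "killed_density 1 r z = std_normal_density (z - r) * bridge_weight r z"
  by (subst killed_density_eq) (auto simp: bridge_weight_def)

lemma killed_density_sym: "killed_density k r z = killed_density k z r"
  by (auto simp: killed_density_def normal_density_def power2_commute add.commute)

lemma killed_density_nonneg: "1 \<le> k \<Longrightarrow> 0 \<le> killed_density k r z"
  by (subst killed_density_eq) (auto simp: normal_density_nonneg intro!: mult_nonneg_nonneg)

lemma sqrt_2_pi_ge: "2 \<le> sqrt (2 * pi)"
proof -
  have "sqrt 4 \<le> sqrt (2 * pi)" using pi_ge_two by (intro real_sqrt_le_mono) simp
  then show ?thesis by simp
qed

lemma normal_density_le: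
  assumes "1 \<le> k"
  shows "normal_density 0 (sqrt (real k)) x \<le> 1 / (2 * sqrt k) * exp (- x\<^sup>2 / (2 * k))"
    "normal_density 0 (sqrt (real k)) x \<le> 1 / (2 * sqrt k)"
proof -
  have "sqrt (2 * pi * real k) \<ge> 2 * sqrt k"
    using mult_right_mono[OF sqrt_2_pi_ge, of "sqrt k"] by (simp add: real_sqrt_mult)
  then have "1 / sqrt (2 * pi * real k) \<le> 1 / (2 * sqrt k)"
    using assms by (intro divide_left_mono) auto
  then show *: "normal_density 0 (sqrt (real k)) x \<le> 1 / (2 * sqrt k) * exp (- x\<^sup>2 / (2 * k))"
    unfolding normal_density_def using mult_right_mono[of "1 / sqrt (2 * pi * real k)" "1 / (2 * sqrt k)" "exp (- x\<^sup>2 / (2 * k))"] by simp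
  also have "\<dots> \<le> 1 / (2 * sqrt k)"
    using mult_left_mono[of "exp (- x\<^sup>2 / (2 * k))" 1 "1 / (2 * sqrt k)"] by simp
  finally show "normal_density 0 (sqrt (real k)) x \<le> 1 / (2 * sqrt k)" .
qed

lemma killed_density_le_normal:
  "1 \<le> k \<Longrightarrow> killed_density k r z \<le> normal_density 0 (sqrt k) (z - r)"
  by (subst killed_density_eq)
    (auto simp: normal_density_nonneg mult_left_le)

lemma killed_density_le_gauss:
  assumes "1 \<le> k" "0 < r" "0 < z"
  shows "killed_density k r z \<le> r * z / (k * sqrt k) * exp (- (z - r)\<^sup>2 / (2 * k))"
proof -
  have "1 - exp (- (2 * r * z / k)) \<le> 2 * r * z / k"
    using exp_ge_add_one_self[of "- (2 * r * z / k)"] by simp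
  then have "killed_density k r z \<le> (1 / (2 * sqrt k) * exp (- (z - r)\<^sup>2 / (2 * k))) * (2 * r * z / k)"
    using assms mult_mono[OF normal_density_le(1)[OF assms(1), of "z - r"], of "1 - exp (- (2 * r * z / k))" "2 * r * z / k"]
    by (subst killed_density_eq) (auto simp: normal_density_nonneg)
  then show ?thesis using assms by (simp add: field_simps)
qed

lemma killed_density_le:
  assumes "1 \<le> k" "0 < r" "0 < z"
  shows "killed_density k r z \<le> r * z / (k * sqrt k)"
proof -
  have "r * z / (k * sqrt k) * exp (- (z - r)\<^sup>2 / (2 * k)) \<le> r * z / (k * sqrt k) * 1"
    using assms by (intro mult_left_mono) auto
  with killed_density_le_gauss[OF assms] show ?thesis by simp
qed

text \<open>With \<open>u = 2 * r * z / k\<close> in [0, 1], \<open>exp u \<ge> 1 + u\<close> yields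
  \<open>1 - exp (- u) \<ge> u / 2\<close>, and the Gaussian factor is at least
  \<open>exp (- 2) / sqrt (2 * pi * k)\<close>. The 20 bounds \<open>exp 2 * sqrt (2 * pi)\<close>,
  which is at most 7.5 * 2.6.\<close>

lemma killed_density_ge:
  assumes k: "1 \<le> k" and rz: "0 < r" "0 < z" and a: "(z - r)\<^sup>2 \<le> 4 * k" and b: "2 * r * z \<le> k"
  shows "r * z / (20 * (k * sqrt k)) \<le> killed_density k r z"
proof -
  let ?u = "2 * r * z / k"
  have u: "0 \<le> ?u" "?u \<le> 1" using k rz b by (auto simp: field_simps)
  have "exp (- ?u) \<le> 1 - ?u / 2"
  proof -
    have "exp (- ?u) \<le> 1 / (1 + ?u)"
      using exp_ge_add_one_self[of ?u] u by (simp add: exp_minus field_simps)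
    also have "\<dots> \<le> 1 - ?u / 2"
    proof -
      have "0 \<le> ?u * (1 - ?u)" using u by (intro mult_nonneg_nonneg) auto
      moreover have "0 \<le> v * (1 - v) \<Longrightarrow> 1 \<le> (1 - v / 2) * (1 + v)" for v :: real
        by (simp add: field_simps)
      ultimately have "1 \<le> (1 - ?u / 2) * (1 + ?u)" by (simp only:)
      then show ?thesis using u by (simp add: divide_le_eq)
    qed
    finally show ?thesis .
  qed
  then have 1: "r * z / k \<le> 1 - exp (- ?u)" by simp
  have e2: "exp (2::real) \<le> 7.5"
  proof -
    have "exp (2::real) = exp 1 * exp 1" by (simp add: exp_add[symmetric])
    also have "\<dots> \<le> 2.72 * 2.72"
      using e_less_272 by (intro mult_mono) auto
    finally show ?thesis by simp
  qed
  have pi: "sqrt (2 * pi) \<le> 2.6"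
    by (rule real_le_lsqrt) (use pi_less_4 pi_approx in \<open>auto simp: power2_eq_square\<close>)
  have "exp (2::real) * sqrt (2 * pi) \<le> 7.5 * 2.6" by (rule mult_mono[OF e2 pi]) auto
  then have "1 / 20 \<le> 1 / (exp 2 * sqrt (2 * pi))" by (intro divide_left_mono) auto
  then have "1 / (20 * sqrt k) \<le> 1 / (exp 2 * sqrt (2 * pi)) / sqrt k"
    using k by (simp add: field_simps)
  also have "\<dots> = 1 / sqrt (2 * pi * k) * exp (-2)"
    using k by (simp add: exp_minus real_sqrt_mult field_simps)
  also have "\<dots> \<le> normal_density 0 (sqrt k) (z - r)"
    unfolding normal_density_def using k a
    by (auto intro!: divide_right_mono mult_left_mono simp: divide_simps)
  finally have 2: "1 / (20 * sqrt k) \<le> normal_density 0 (sqrt k) (z - r)" .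
  have "r * z / (20 * (k * sqrt k)) = 1 / (20 * sqrt k) * (r * z / k)" by simp
  also have "\<dots> \<le> normal_density 0 (sqrt k) (z - r) * (1 - exp (- ?u))"
    using 1 2 rz k by (intro mult_mono) auto
  also have "\<dots> = killed_density k r z" using rz k by (subst killed_density_eq) auto
  finally show ?thesis .
qed

lemma normal_convolution:
  assumes "1 \<le> j" "1 \<le> k"
  shows "has_bochner_integral lborel (\<lambda>z. normal_density 0 (sqrt (real j)) (z - a) * normal_density 0 (sqrt (real k)) (z - b))
    (normal_density 0 (sqrt (real (j + k))) (a - b))"
proof (rule has_bochner_integral_nn_integral)
  have "(\<integral>\<^sup>+z. ennreal (normal_density 0 (sqrt (real j)) (z - a) * normal_density 0 (sqrt (real k)) (z - b)) \<partial>lborel)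
    = (\<integral>\<^sup>+y. ennreal (normal_density 0 (sqrt (real j)) (b + 1 * y - a) * normal_density 0 (sqrt (real k)) (b + 1 * y - b)) \<partial>lborel)"
    by (subst nn_integral_real_affine[where c=1 and t=b]) auto
  also have "\<dots> = (\<integral>\<^sup>+y. ennreal (normal_density 0 (sqrt (real j)) ((a - b) - y) * normal_density 0 (sqrt (real k)) y) \<partial>lborel)"
    by (intro nn_integral_cong arg_cong[where f=ennreal])
      (auto simp: normal_density_def power2_commute algebra_simps)
  also have "\<dots> = ennreal (normal_density 0 (sqrt ((sqrt (real j))\<^sup>2 + (sqrt (real k))\<^sup>2)) (a - b))"
    using conv_normal_density_zero_mean[of "sqrt j" "sqrt k"] assms by (auto dest!: fun_cong)
  also have "\<dots> = ennreal (normal_density 0 (sqrt (real (j + k))) (a - b))" by simp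
  finally show "(\<integral>\<^sup>+z. ennreal (normal_density 0 (sqrt (real j)) (z - a) * normal_density 0 (sqrt (real k)) (z - b)) \<partial>lborel)
    = ennreal (normal_density 0 (sqrt (real (j + k))) (a - b))" .
qed (auto simp: normal_density_nonneg)

lemma nn_integral_even:
  fixes f :: "real \<Rightarrow> ennreal"
  assumes [measurable]: "f \<in> borel_measurable borel" and even: "\<And>z. f (- z) = f z"
  shows "(\<integral>\<^sup>+z. f z \<partial>lborel) = 2 * (\<integral>\<^sup>+z. f z * indicator {0<..} z \<partial>lborel)"
proof -
  have ae: "AE z in lborel. z \<noteq> (0::real)" by (rule AE_lborel_singleton)
  have "(\<integral>\<^sup>+z. f z \<partial>lborel) = (\<integral>\<^sup>+z. f z * indicator {0<..} z + f z * indicator {..<0} z \<partial>lborel)"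
    by (rule nn_integral_cong_AE, rule AE_mp[OF ae]) (auto simp: indicator_def)
  also have "\<dots> = (\<integral>\<^sup>+z. f z * indicator {0<..} z \<partial>lborel) + (\<integral>\<^sup>+z. f z * indicator {..<0} z \<partial>lborel)"
    by (rule nn_integral_add) auto
  also have "(\<integral>\<^sup>+z. f z * indicator {..<0} z \<partial>lborel) = (\<integral>\<^sup>+z. f (0 + (-1) * z) * indicator {..<0} (0 + (-1) * z) \<partial>lborel)"
    by (subst nn_integral_real_affine[where c="-1" and t=0]) auto
  also have "\<dots> = (\<integral>\<^sup>+z. f z * indicator {0<..} z \<partial>lborel)"
    by (intro nn_integral_cong) (auto simp: even indicator_def)
  finally show ?thesis by (simp add: mult_2)
qed

text \<open>Method of images: both kernels extend to odd functions of the intermediate point z.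
  Their product is even, so the integral over the half-line is half of one over the whole line, and
  the latter is a combination of four Gaussian convolutions.\<close>

lemma killed_density_Chapman_Kolmogorov:
  assumes jk: "1 \<le> j" "1 \<le> k"
  shows "(\<integral>\<^sup>+z. ennreal (killed_density j r z) * ennreal (killed_density k z w) \<partial>lborel) = ennreal (killed_density (j + k) r w)"
proof (cases "0 < r \<and> 0 < w")
  case False
  then show ?thesis by (auto simp: killed_density_def intro!: nn_integral_zero')
next
  case True
  let ?n = "\<lambda>k. normal_density 0 (sqrt (real k))"
  define f where "f z = (?n j (z - r) - ?n j (z + r)) * (?n k (z - w) - ?n k (z + w))" for z
  have [measurable]: "f \<in> borel_measurable borel" unfolding f_def by measurable
  have sym: "?n k (- x) = ?n k x" for k x by (simp add: normal_density_def)
  have even: "f (- z) = f z" for z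
    using sym[of j "z + r"] sym[of j "z - r"] sym[of k "z + w"] sym[of k "z - w"]
    sym[of j "z - r"] sym[of j "- z - r"] sym[of k "- z - w"]
    unfolding f_def by (simp add: algebra_simps)
  have fpos: "f z = killed_density j r z * killed_density k z w" if "0 < z" for z
    using that True sym[of k "z - w"] by (simp add: f_def killed_density_def add.commute)
  have fnn: "0 \<le> f z" for z
  proof -
    consider "0 < z" | "z = 0" | "0 < - z" by linarith
    then show ?thesis
    proof cases
      case 2 then show ?thesis using sym[of j r] by (simp add: f_def)
    next
      case 3 then show ?thesis using even[of z] fpos[of "-z"] killed_density_nonneg[OF jk(1), of r "-z"] killed_density_nonneg[OF jk(2), of "-z" w]
          by (metis mult_nonneg_nonneg)
    qed (use fpos killed_density_nonneg jk in auto)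
  qed
  have "has_bochner_integral lborel (\<lambda>z. ?n j (z - r) * ?n k (z - w) - ?n j (z - r) * ?n k (z - (- w))
      - ?n j (z - (- r)) * ?n k (z - w) + ?n j (z - (- r)) * ?n k (z - (- w)))
      (?n (j + k) (r - w) - ?n (j + k) (r - (- w)) - ?n (j + k) (- r - w) + ?n (j + k) (- r - (- w)))"
    by (intro has_bochner_integral_add has_bochner_integral_diff normal_convolution jk)
  moreover have "(\<lambda>z. ?n j (z - r) * ?n k (z - w) - ?n j (z - r) * ?n k (z - (- w))
      - ?n j (z - (- r)) * ?n k (z - w) + ?n j (z - (- r)) * ?n k (z - (- w))) = f"
    by (auto simp: f_def algebra_simps)
  moreover have "?n (j + k) (r - w) - ?n (j + k) (r - (- w)) - ?n (j + k) (- r - w) + ?n (j + k) (- r - (- w))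
     = 2 * killed_density (j + k) r w"
    using True sym[of "j + k" "r + w"] sym[of "j + k" "r - w"]
    by (simp add: killed_density_def add.commute)
  ultimately have f: "has_bochner_integral lborel f (2 * killed_density (j + k) r w)" by simp
  have "2 * (\<integral>\<^sup>+z. ennreal (f z) * indicator {0<..} z \<partial>lborel) = (\<integral>\<^sup>+z. ennreal (f z) \<partial>lborel)"
    by (rule nn_integral_even[symmetric]) (auto simp: even)
  also have "\<dots> = ennreal (\<integral>z. f z \<partial>lborel)"
    by (rule nn_integral_eq_integral) (use f fnn in \<open>auto dest: integrable.intros\<close>)
  also have "\<dots> = 2 * ennreal (killed_density (j + k) r w)"
    using f by (simp add: has_bochner_integral_integral_eq ennreal_mult')
  finally have "(\<integral>\<^sup>+z. ennreal (f z) * indicator {0<..} z \<partial>lborel) = ennreal (killed_density (j + k) r w)"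
    by (simp add: ennreal_mult_cancel_left)
  moreover have "ennreal (killed_density j r z) * ennreal (killed_density k z w) = ennreal (f z) * indicator {0<..} z" for z
    using fpos[of z] killed_density_nonneg jk
    by (auto simp: indicator_def ennreal_mult) (auto simp: killed_density_def)
  ultimately show ?thesis by simp
qed

lemma measurable_killed_step [measurable]:
  assumes [measurable]: "F \<in> borel_measurable borel"
  shows "killed_step F \<in> borel_measurable borel"
  unfolding killed_step_def by measurable

lemma measurable_killed_step_iter [measurable]:
  assumes "F \<in> borel_measurable borel"
  shows "(killed_step ^^ k) F \<in> borel_measurable borel"
  by (induction k) (use assms measurable_killed_step in \<open>auto\<close>)

lemma killed_step_iter:
  assumes F[measurable]: "F \<in> borel_measurable borel" and "1 \<le> k"
  shows "(killed_step ^^ k) F r = (\<integral>\<^sup>+z. ennreal (killed_density k r z) * F z \<partial>lborel)"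
  using \<open>1 \<le> k\<close>
proof (induction k arbitrary: r rule: dec_induct)
  case base
  then show ?case by (simp add: killed_step_def killed_density_1[unfolded One_nat_def])
next
  case (step k)
  have "(killed_step ^^ Suc k) F r = (\<integral>\<^sup>+y. ennreal (killed_density 1 r y) * (killed_step ^^ k) F y \<partial>lborel)"
    by (simp add: killed_step_def killed_density_1[unfolded One_nat_def])
  also have "\<dots> = (\<integral>\<^sup>+y. \<integral>\<^sup>+z. ennreal (killed_density 1 r y) * ennreal (killed_density k y z) * F z \<partial>lborel \<partial>lborel)"
    by (simp add: step.IH nn_integral_cmult[symmetric] mult.assoc)
  also have "\<dots> = (\<integral>\<^sup>+z. \<integral>\<^sup>+y. ennreal (killed_density 1 r y) * ennreal (killed_density k y z) * F z \<partial>lborel \<partial>lborel)"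
    by (rule lborel_pair.Fubini') measurable
  also have "\<dots> = (\<integral>\<^sup>+z. ennreal (killed_density (1 + k) r z) * F z \<partial>lborel)"
    using step.hyps by (intro nn_integral_cong, subst killed_density_Chapman_Kolmogorov[symmetric])
      (auto simp: nn_integral_multc)
  finally show ?case by simp
qed

lemma killed_step_mono:
  assumes "\<And>z. 0 < z \<Longrightarrow> F z \<le> G z"
  shows "killed_step F r \<le> killed_step G r"
  unfolding killed_step_def
proof (rule nn_integral_mono)
  fix z
  show "ennreal (std_normal_density (z - r) * bridge_weight r z) * F z
     \<le> ennreal (std_normal_density (z - r) * bridge_weight r z) * G z"
    using assms[of z] by (cases "0 < z") (auto simp: bridge_weight_def intro: mult_left_mono)
qed

lemma killed_step_nonpos: "r \<le> 0 \<Longrightarrow> killed_step F r = 0"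
  by (simp add: killed_step_def bridge_weight_def)

lemma killed_step_iter_mono:
  assumes "\<And>z. 0 < z \<Longrightarrow> F z \<le> G z" and "0 < r \<or> 0 < k"
  shows "(killed_step ^^ k) F r \<le> (killed_step ^^ k) G r"
  using assms(2)
proof (induction k arbitrary: r)
  case 0
  then show ?case using assms(1) by simp
next
  case (Suc k)
  show ?case using Suc.IH by (auto intro!: killed_step_mono)
qed

lemma killed_step_cmult:
  assumes [measurable]: "F \<in> borel_measurable borel"
  shows "killed_step (\<lambda>z. c * F z) r = c * killed_step F r"
  unfolding killed_step_def
  by (simp add: nn_integral_cmult[symmetric] mult.left_commute)

lemma killed_step_iter_cmult:
  assumes [measurable]: "F \<in> borel_measurable borel"
  shows "(killed_step ^^ k) (\<lambda>z. c * F z) r = c * (killed_step ^^ k) F r"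
proof (induction k arbitrary: r)
  case (Suc k)
  have "(killed_step ^^ k) (\<lambda>z. c * F z) = (\<lambda>r. c * (killed_step ^^ k) F r)" using Suc by auto
  then show ?case by (simp add: killed_step_cmult)
qed simp

lemma killed_step_sum:
  assumes [measurable]: "\<And>i. i \<in> I \<Longrightarrow> F i \<in> borel_measurable borel"
  shows "killed_step (\<lambda>z. \<Sum>i\<in>I. F i z) r = (\<Sum>i\<in>I. killed_step (F i) r)"
  unfolding killed_step_def
  by (simp add: sum_distrib_left nn_integral_sum)

lemma killed_step_iter_sum:
  assumes [measurable]: "\<And>i. i \<in> I \<Longrightarrow> F i \<in> borel_measurable borel"
  shows "(killed_step ^^ k) (\<lambda>z. \<Sum>i\<in>I. F i z) r = (\<Sum>i\<in>I. (killed_step ^^ k) (F i) r)"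
proof (induction k arbitrary: r)
  case (Suc k)
  have "(killed_step ^^ k) (\<lambda>z. \<Sum>i\<in>I. F i z) = (\<lambda>r. \<Sum>i\<in>I. (killed_step ^^ k) (F i) r)" using Suc by auto
  then show ?case by (simp add: killed_step_sum)
qed simp

text \<open>By reflection the survival probability is the mass that a centred normal law of variance
  k gives to an interval of length \<open>2 * r\<close>, where its density is at most
  \<open>1 / (2 * sqrt k)\<close>.\<close>

lemma killed_survival_le:
  assumes k: "1 \<le> k" and r: "0 < r"
  shows "(killed_step ^^ k) (\<lambda>_. 1) r \<le> ennreal (r / sqrt k)"
proof -
  let ?n = "normal_density 0 (sqrt (real k))"
  have [measurable]: "?n \<in> borel_measurable borel" by simp
  let ?I = "\<lambda>f. \<integral>\<^sup>+z. ennreal (f z) \<partial>lborel"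
  have shift: "(\<integral>\<^sup>+z. ennreal (?n (z + a)) * indicator {0<..} z \<partial>lborel) = (\<integral>\<^sup>+u. ennreal (?n u) * indicator {a<..} u \<partial>lborel)" for a
  proof -
    have "(\<integral>\<^sup>+u. ennreal (?n u) * indicator {a<..} u \<partial>lborel)
      = (\<integral>\<^sup>+z. ennreal (?n (a + 1 * z)) * indicator {a<..} (a + 1 * z) \<partial>lborel)"
      by (subst nn_integral_real_affine[where c=1 and t=a]) auto
    also have "\<dots> = (\<integral>\<^sup>+z. ennreal (?n (z + a)) * indicator {0<..} z \<partial>lborel)"
      by (intro nn_integral_cong) (auto simp: indicator_def add.commute)
    finally show ?thesis by simp
  qed
  let ?J = "\<integral>\<^sup>+u. ennreal (?n u) * indicator {r<..} u \<partial>lborel"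
  \<comment> \<open>The tail beyond r is added to both sides and cancelled at the end, which needs
    it to be finite.\<close>
  have fin: "?J \<noteq> \<top>"
  proof -
    have "?J \<le> (\<integral>\<^sup>+u. ennreal (?n u) \<partial>lborel)"
      by (intro nn_integral_mono) (auto simp: indicator_def)
    also have "\<dots> = 1" using k by (subst nn_integral_eq_integral) auto
    finally show ?thesis by (auto simp: top_unique)
  qed
  have kd: "0 \<le> ?n (z - r) - ?n (z + r)" if "0 < z" for z
    using killed_density_nonneg[OF k, of r z] r that by (simp add: killed_density_def)
  have "(\<integral>\<^sup>+z. ennreal (killed_density k r z) \<partial>lborel) + ?J
      = (\<integral>\<^sup>+z. ennreal (killed_density k r z) + ennreal (?n (z + r)) * indicator {0<..} z \<partial>lborel)"
    by (subst nn_integral_add) (auto simp: shift)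
  also have "\<dots> = (\<integral>\<^sup>+z. ennreal (?n (z + (- r))) * indicator {0<..} z \<partial>lborel)"
  proof (rule nn_integral_cong)
    fix z
    show "ennreal (killed_density k r z) + ennreal (?n (z + r)) * indicator {0<..} z = ennreal (?n (z + - r)) * indicator {0<..} z"
    proof (cases "0 < z")
      case True
      have "ennreal (killed_density k r z) + ennreal (?n (z + r)) = ennreal (killed_density k r z + ?n (z + r))"
        by (rule ennreal_plus[symmetric]) (rule killed_density_nonneg[OF k], rule normal_density_nonneg)
      also have "killed_density k r z + ?n (z + r) = ?n (z + - r)"
        using True r unfolding killed_density_def by simp
      finally show ?thesis using True by simp
    qed (simp add: killed_density_def)
  qed
  also have "\<dots> = (\<integral>\<^sup>+u. ennreal (?n u) * indicator {- r<..} u \<partial>lborel)" by (rule shift)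
  also have "\<dots> = (\<integral>\<^sup>+u. ennreal (?n u) * indicator {- r<..r} u + ennreal (?n u) * indicator {r<..} u \<partial>lborel)"
    using r by (intro nn_integral_cong) (auto simp: indicator_def)
  also have "\<dots> = (\<integral>\<^sup>+u. ennreal (?n u) * indicator {- r<..r} u \<partial>lborel) + ?J"
    by (rule nn_integral_add) auto
  finally have "(\<integral>\<^sup>+z. ennreal (killed_density k r z) \<partial>lborel) = (\<integral>\<^sup>+u. ennreal (?n u) * indicator {- r<..r} u \<partial>lborel)"
    using fin ennreal_add_left_cancel[of ?J] by (auto simp: add.commute)
  also have "\<dots> \<le> (\<integral>\<^sup>+u. ennreal (1 / (2 * sqrt k)) * indicator {- r<..r} u \<partial>lborel)"
    by (intro nn_integral_mono mult_right_mono ennreal_leI normal_density_le k) auto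
  also have "\<dots> = ennreal (1 / (2 * sqrt k)) * ennreal (2 * r)"
    using r by (subst nn_integral_cmult_indicator) auto
  also have "\<dots> = ennreal (r / sqrt k)" using r k by (simp flip: ennreal_mult)
  finally show ?thesis using k by (subst killed_step_iter) auto
qed

text \<open>The summand is the derivative of \<open>2 * z * arctan (sqrt t / z)\<close> at t = k.
  This derivative decreases in t, so every summand is at most an increment of that function, whose
  total increase is below \<open>pi * z\<close>.\<close>

lemma sum_arctan_bound:
  fixes z :: real assumes z: "0 < z"
  shows "(\<Sum>k=1..L. z\<^sup>2 / (sqrt (real k) * (z\<^sup>2 + real k))) \<le> pi * z"
proof -
  define \<theta> where "\<theta> t = 2 * z * arctan (sqrt t / z)" for t
  have step: "z\<^sup>2 / (sqrt (Suc k) * (z\<^sup>2 + Suc k)) \<le> \<theta> (Suc k) - \<theta> k" for k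
  proof -
    have cont: "continuous_on {real k..real (Suc k)} \<theta>" unfolding \<theta>_def
      using z by (intro continuous_intros) auto
    have der: "(\<theta> has_real_derivative (z\<^sup>2 / (sqrt x * (z\<^sup>2 + x)))) (at x)" if "0 < x" for x
    proof -
      have D: "1 + (sqrt x / z)\<^sup>2 = (z\<^sup>2 + x) / z\<^sup>2"
        using that z by (simp add: power_divide add_divide_distrib)
      have "2 * z * (inverse s / 2 / z / E) = 1 / (s * E)" for s E :: real
        using z by (simp add: field_simps)
      then have "2 * z * (inverse (sqrt x) / 2 / z / (1 + (sqrt x / z)\<^sup>2)) = 1 / (sqrt x * ((z\<^sup>2 + x) / z\<^sup>2))"
        unfolding D .
      also have "\<dots> = z\<^sup>2 / (sqrt x * (z\<^sup>2 + x))" using z by simp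
      finally have "2 * z * (inverse (sqrt x) / 2 / z / (1 + (sqrt x / z)\<^sup>2)) = z\<^sup>2 / (sqrt x * (z\<^sup>2 + x))" .
      moreover have "(\<theta> has_real_derivative 2 * z * (inverse (sqrt x) / 2 / z / (1 + (sqrt x / z)\<^sup>2))) (at x)"
      proof -
        have "((\<lambda>t. sqrt t / z) has_real_derivative inverse (sqrt x) / 2 / z) (at x)"
          by (rule DERIV_cdivide) (rule DERIV_real_sqrt, rule that)
        note d = DERIV_cmult[OF DERIV_chain2[OF DERIV_arctan this], of "2 * z"]
        have "inverse A * B = B / A" for A B :: real by (simp add: divide_inverse)
        then show ?thesis using d unfolding \<theta>_def by (simp only:)
      qed
      ultimately show ?thesis by simp
    qed
    have "\<theta> differentiable (at x)" if "real k < x" for x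
      unfolding real_differentiable_def using der[of x] that by (intro exI) auto
    then have "\<exists>l x. real k < x \<and> x < real (Suc k) \<and> DERIV \<theta> x :> l \<and> \<theta> (real (Suc k)) - \<theta> (real k) = (real (Suc k) - real k) * l"
      by (intro MVT cont) auto
    then obtain l x where x0: "real k < x" "x < real (Suc k)" "DERIV \<theta> x :> l"
        "\<theta> (real (Suc k)) - \<theta> (real k) = (real (Suc k) - real k) * l" by blast
    moreover have "l = z\<^sup>2 / (sqrt x * (z\<^sup>2 + x))"
      using der[of x] DERIV_unique[OF x0(3)] x0(1) by simp
    ultimately have x: "real k < x" "x < real (Suc k)" "\<theta> (Suc k) - \<theta> k = z\<^sup>2 / (sqrt x * (z\<^sup>2 + x))" by auto
    have x0: "0 < x" using x(1) by (smt (verit) of_nat_0_le_iff)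
    have "sqrt x * (z\<^sup>2 + x) \<le> sqrt (Suc k) * (z\<^sup>2 + Suc k)"
      using x x0 by (intro mult_mono) auto
    moreover have "0 < sqrt x * (z\<^sup>2 + x)" using x0 by (simp add: add_nonneg_pos)
    ultimately have "z\<^sup>2 / (sqrt (Suc k) * (z\<^sup>2 + Suc k)) \<le> z\<^sup>2 / (sqrt x * (z\<^sup>2 + x))"
      by (intro frac_le) auto
    then show ?thesis using x by simp
  qed
  have "(\<Sum>k=1..L. z\<^sup>2 / (sqrt (real k) * (z\<^sup>2 + real k))) \<le> \<theta> L - \<theta> 0"
  proof (induction L)
    case (Suc L)
    then show ?case using step[of L] by simp
  qed simp
  also have "\<dots> \<le> pi * z"
    using arctan_ubound[of "sqrt L / z"] z by (simp add: \<theta>_def)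
  finally show ?thesis .
qed

text \<open>Up to the constant this is the Green function \<open>2 * min r z\<close> of the killed
  motion. For \<open>r \<le> 2 * z\<close> the free density serves up to time
  \<open>z\<^sup>2\<close> and the cubic-root-type decay \<open>r * z / (k * sqrt k)\<close>
  afterwards. For larger r the Gaussian factor suppresses times well below \<open>r\<^sup>2\<close>.
  Both cases reduce to \<open>sum_arctan_bound\<close>; 26 is an upper bound for
  \<open>8 * pi\<close>.\<close>

lemma killed_green_le:
  assumes r: "0 < r" and z: "0 < z"
  shows "(\<Sum>k=1..L. killed_density k r z) \<le> 26 * z"
proof (cases "r \<le> 2 * z")
  case True
  have "killed_density k r z \<le> 4 * (z\<^sup>2 / (sqrt k * (z\<^sup>2 + k)))" if k: "k \<in> {1..L}" for k
  proof (cases "real k \<le> z\<^sup>2")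
    case True
    have "killed_density k r z \<le> 1 / (2 * sqrt k)"
      using k killed_density_le_normal[of k r z] normal_density_le(2)[of k "z - r"] by simp
    also have "\<dots> \<le> 4 * (z\<^sup>2 / (sqrt k * (z\<^sup>2 + k)))"
      using k z True by (simp add: field_simps add_pos_pos)
    finally show ?thesis .
  next
    case False
    have "killed_density k r z \<le> r * z / (k * sqrt k)" using k r z by (intro killed_density_le) auto
    also have "\<dots> \<le> (2 * z) * z / (k * sqrt k)"
      using True k z by (intro divide_right_mono mult_right_mono) auto
    also have "\<dots> \<le> 4 * (z\<^sup>2 / (sqrt k * (z\<^sup>2 + k)))"
    proof -
      have "z\<^sup>2 * (z\<^sup>2 + k) \<le> z\<^sup>2 * (2 * k)" using False by (intro mult_left_mono) auto
      then show ?thesis using k z by (simp add: field_simps power2_eq_square add_pos_pos)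
    qed
    finally show ?thesis .
  qed
  then have "(\<Sum>k=1..L. killed_density k r z) \<le> (\<Sum>k=1..L. 4 * (z\<^sup>2 / (sqrt k * (z\<^sup>2 + k))))"
    by (rule sum_mono)
  also have "\<dots> = 4 * (\<Sum>k=1..L. z\<^sup>2 / (sqrt k * (z\<^sup>2 + k)))" by (simp add: sum_distrib_left)
  also have "\<dots> \<le> 4 * (pi * z)" using sum_arctan_bound[OF z] by (intro mult_left_mono) auto
  also have "\<dots> \<le> 26 * z" using pi_less_4 z by simp
  finally show ?thesis .
next
  case False
  have "killed_density k r z \<le> 8 * z / r * (r\<^sup>2 / (sqrt k * (r\<^sup>2 + k)))" if k: "k \<in> {1..L}" for k
  proof -
    have k0: "0 < real k" using k by simp
    have "(r / 2)\<^sup>2 \<le> (r - z)\<^sup>2" using False r z by (intro power_mono) auto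
    then have sq: "r\<^sup>2 / 4 \<le> (z - r)\<^sup>2" by (simp add: power_divide power2_commute)
    have e: "exp (- (z - r)\<^sup>2 / (2 * real k)) \<le> 8 * real k / (r\<^sup>2 + real k)"
    proof -
      have "exp (- (z - r)\<^sup>2 / (2 * real k)) \<le> exp (- (r\<^sup>2 / (8 * real k)))"
        using sq k0 by (auto simp: field_simps)
      also have "\<dots> \<le> 1 / (1 + r\<^sup>2 / (8 * real k))"
        using exp_ge_add_one_self[of "r\<^sup>2 / (8 * real k)"] k0
        by (simp add: exp_minus inverse_eq_divide) (intro divide_left_mono; simp add: add_pos_nonneg)
      also have "\<dots> = 8 * real k / (8 * real k + r\<^sup>2)" using k0 by (simp add: field_simps)
      also have "\<dots> \<le> 8 * real k / (r\<^sup>2 + real k)" using k0 r by (intro divide_left_mono) (auto intro!: mult_pos_pos add_pos_nonneg add_nonneg_pos)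
      finally show ?thesis .
    qed
    have "killed_density k r z \<le> r * z / (k * sqrt k) * exp (- (z - r)\<^sup>2 / (2 * real k))"
      using k r z by (intro killed_density_le_gauss) auto
    also have "\<dots> \<le> r * z / (k * sqrt k) * (8 * real k / (r\<^sup>2 + real k))"
      using e r z k by (intro mult_left_mono) auto
    also have "\<dots> = 8 * z / r * (r\<^sup>2 / (sqrt k * (r\<^sup>2 + real k)))"
      using r k0 by (simp add: field_simps power2_eq_square)
    finally show ?thesis .
  qed
  then have "(\<Sum>k=1..L. killed_density k r z) \<le> (\<Sum>k=1..L. 8 * z / r * (r\<^sup>2 / (sqrt k * (r\<^sup>2 + k))))"
    by (rule sum_mono)
  also have "\<dots> = 8 * z / r * (\<Sum>k=1..L. r\<^sup>2 / (sqrt k * (r\<^sup>2 + k)))" by (simp add: sum_distrib_left)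
  also have "\<dots> \<le> 8 * z / r * (pi * r)" using sum_arctan_bound[OF r] r z by (intro mult_left_mono) auto
  also have "\<dots> = 8 * pi * z" using r by simp
  also have "\<dots> \<le> 26 * z" using pi_approx z by simp
  finally show ?thesis .
qed

text \<open>Symmetry of the kernel improves the bound by z to one by \<open>min r z\<close>.\<close>

lemma killed_green_iter_le:
  assumes [measurable]: "F \<in> borel_measurable borel"
  shows "(\<Sum>k=1..L. (killed_step ^^ k) F r) \<le> (\<integral>\<^sup>+z. ennreal (26 * min r z) * indicator {0<..} z * F z \<partial>lborel)"
proof -
  have "(\<Sum>k=1..L. (killed_step ^^ k) F r) = (\<integral>\<^sup>+z. (\<Sum>k=1..L. ennreal (killed_density k r z) * F z) \<partial>lborel)"
    by (subst nn_integral_sum) (auto intro!: sum.cong simp: killed_step_iter)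
  also have "\<dots> \<le> (\<integral>\<^sup>+z. ennreal (26 * min r z) * indicator {0<..} z * F z \<partial>lborel)"
  proof (rule nn_integral_mono)
    fix z
    have "(\<Sum>k=1..L. ennreal (killed_density k r z)) \<le> ennreal (26 * min r z) * indicator {0<..} z"
    proof (cases "0 < r \<and> 0 < z")
      case True
      have "(\<Sum>k=1..L. killed_density k r z) \<le> 26 * min r z"
        using killed_green_le[of r z L] killed_green_le[of z r L] True
        by (auto simp: min_def killed_density_sym[of _ z r])
      moreover have "(\<Sum>k=1..L. ennreal (killed_density k r z)) = ennreal (\<Sum>k=1..L. killed_density k r z)"
        by (rule sum_ennreal) (auto intro: killed_density_nonneg)
      ultimately show ?thesis using True by (auto intro: ennreal_leI)
    next
      case False
      then have "killed_density k r z = 0" for k by (auto simp: killed_density_def)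
      then show ?thesis by simp
    qed
    then show "(\<Sum>k=1..L. ennreal (killed_density k r z) * F z) \<le> ennreal (26 * min r z) * indicator {0<..} z * F z"
      by (simp add: sum_distrib_right[symmetric] mult_right_mono)
  qed
  finally show ?thesis .
qed

text \<open>The factor z makes the score vanish linearly at the barrier. Thus the term for zero
  steps obeys the same bound by \<open>min 1 r\<close> as the Green sum, and a downward shift of the
  argument can be absorbed into a multiple of \<open>z * exp (- z)\<close>.\<close>

definition target :: "real \<Rightarrow> ennreal" where
  "target z = ennreal z * indicator {0<..1} z"

lemma measurable_target [measurable]: "target \<in> borel_measurable borel"
  unfolding target_def by measurable

lemma killed_green_target_le:
  "(\<Sum>k=0..L. (killed_step ^^ k) target r) \<le> ennreal (27 * min 1 (max 0 r))"
proof (cases "0 < r")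
  case False
  then have "(killed_step ^^ k) target r = 0" for k
    by (cases k) (auto simp: killed_step_nonpos target_def)
  then show ?thesis by simp
next
  case True
  have "(\<Sum>k=1..L. (killed_step ^^ k) target r) \<le> (\<integral>\<^sup>+z. ennreal (26 * min r z) * indicator {0<..} z * target z \<partial>lborel)"
    by (rule killed_green_iter_le) simp
  also have "\<dots> \<le> (\<integral>\<^sup>+z. ennreal (26 * min 1 r) * indicator {0<..(1::real)} z \<partial>lborel)"
  proof (rule nn_integral_mono)
    fix z :: real
    show "ennreal (26 * min r z) * indicator {0<..} z * target z \<le> ennreal (26 * min 1 r) * indicator {0<..1} z"
    proof (cases "0 < z \<and> z \<le> 1")
      case 1: True
      have "min r z * z \<le> min 1 r"
      proof -
        have m: "min r z \<le> 1" using 1 by auto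
        have "min r z * z \<le> r * 1" "min r z * z \<le> 1 * 1"
          using 1 True m by (intro mult_mono; simp)+
        then show ?thesis by simp
      qed
      then show ?thesis using 1 True by (simp add: target_def flip: ennreal_mult)
    qed (auto simp: target_def indicator_def)
  qed
  also have "\<dots> = ennreal (26 * min 1 r)" by (subst nn_integral_cmult_indicator) auto
  finally have "(\<Sum>k=1..L. (killed_step ^^ k) target r) \<le> ennreal (26 * min 1 r)" .
  moreover have "target r \<le> ennreal (min 1 r)" using True by (auto simp: target_def indicator_def)
  ultimately have "target r + (\<Sum>k=1..L. (killed_step ^^ k) target r) \<le> ennreal (min 1 r) + ennreal (26 * min 1 r)"
    by (rule add_mono[rotated])
  also have "\<dots> = ennreal (27 * min 1 (max 0 r))" using True by (simp flip: ennreal_plus)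
  also have "target r + (\<Sum>k=1..L. (killed_step ^^ k) target r) = (\<Sum>k=0..L. (killed_step ^^ k) target r)"
    by (simp add: sum.atLeast_Suc_atMost)
  finally show ?thesis .
qed

lemma nn_integral_power_exp: "(\<integral>\<^sup>+z. ennreal (z ^ k * exp (- z)) * indicator {0<..} z \<partial>lborel) \<le> ennreal (fact k)"
proof -
  have "(\<integral>\<^sup>+z. ennreal (z ^ k * exp (- z)) * indicator {0<..} z \<partial>lborel)
    \<le> (\<integral>\<^sup>+z. ennreal (z ^ k * exp (- z)) * indicator {0..} z \<partial>lborel)"
    by (intro nn_integral_mono) (auto simp: indicator_def)
  then show ?thesis by (simp add: nn_intergal_power_times_exp_Ici)
qed

lemma killed_green_exp_le:
  "(\<Sum>k=1..L. (killed_step ^^ k) (\<lambda>z. ennreal (max 0 z * exp (- z))) r) \<le> 52"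
proof -
  have "(\<Sum>k=1..L. (killed_step ^^ k) (\<lambda>z. ennreal (max 0 z * exp (- z))) r)
    \<le> (\<integral>\<^sup>+z. ennreal (26 * min r z) * indicator {0<..} z * ennreal (max 0 z * exp (- z)) \<partial>lborel)"
    by (rule killed_green_iter_le) simp
  also have "\<dots> \<le> (\<integral>\<^sup>+z. ennreal 26 * (ennreal (z ^ 2 * exp (- z)) * indicator {0<..} z) \<partial>lborel)"
  proof (rule nn_integral_mono)
    fix z :: real
    show "ennreal (26 * min r z) * indicator {0<..} z * ennreal (max 0 z * exp (- z))
       \<le> ennreal 26 * (ennreal (z ^ 2 * exp (- z)) * indicator {0<..} z)"
    proof (cases "0 < z")
      case True
      have "ennreal (26 * min r z) * ennreal (z * exp (- z)) \<le> ennreal (26 * z) * ennreal (z * exp (- z))"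
        by (intro mult_right_mono ennreal_leI) auto
      also have "\<dots> = ennreal 26 * ennreal (z ^ 2 * exp (- z))"
        using True by (subst (1 2) ennreal_mult[symmetric]) (auto simp: power2_eq_square mult_ac)
      finally show ?thesis using True by simp
    qed simp
  qed
  also have "\<dots> \<le> ennreal 26 * ennreal (fact 2)"
    by (subst nn_integral_cmult, measurable) (rule mult_left_mono[OF nn_integral_power_exp], simp)
  also have "\<dots> = 52" by (simp add: fact_numeral flip: ennreal_mult)
  finally show ?thesis .
qed

text \<open>From height r the killed motion contributes order \<open>1 / r\<^sup>2\<close> at each
  single time between \<open>4 * r\<^sup>2\<close> and \<open>8 * r\<^sup>2\<close>, and this window
  contains at least \<open>3 * r\<^sup>2\<close> integers. Hence a bound that does not depend on
  r.\<close>

lemma killed_green_target_ge: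
  assumes r: "1 \<le> r" and L: "8 * r\<^sup>2 \<le> real L"
  shows "ennreal (1 / 1300) \<le> (\<Sum>k=1..L. (killed_step ^^ k) target r)"
proof -
  define A where "A = {nat \<lceil>4 * r\<^sup>2\<rceil>..nat \<lfloor>8 * r\<^sup>2\<rfloor>}"
  have r2: "1 \<le> r\<^sup>2" using r by (simp add: one_le_power)
  have A1: "A \<subseteq> {1..L}"
  proof -
    have "1 \<le> nat \<lceil>4 * r\<^sup>2\<rceil>" using r2 by linarith
    moreover have "nat \<lfloor>8 * r\<^sup>2\<rfloor> \<le> L" using L by linarith
    ultimately show ?thesis unfolding A_def by auto
  qed
  have cardA: "3 * r\<^sup>2 \<le> real (card A)"
    unfolding A_def using r2 by (simp add: of_nat_diff) linarith
  \<comment> \<open>On the window \<open>k * sqrt k \<le> 24 * r ^ 3\<close>, which turns the 20 of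
    \<open>killed_density_ge\<close> into 480. Restricting to z in [1/2, 1] gives
    \<open>z * z \<ge> 1 / 4\<close>, hence 1/1950 as a bound for 1/1920, and the length 1/2 of the
    interval doubles 1950.\<close>
  have trm: "ennreal (1 / (3900 * r\<^sup>2)) \<le> (killed_step ^^ k) target r" if "k \<in> A" for k
  proof -
    have k: "4 * r\<^sup>2 \<le> k" "k \<le> 8 * r\<^sup>2" "1 \<le> k"
      using that A1 r2 unfolding A_def by (auto simp: le_nat_floor) linarith+
    have lower: "1 / (1950 * r\<^sup>2) \<le> killed_density k r z * z" if z: "1/2 \<le> z" "z \<le> 1" for z
    proof -
      have "(z - r)\<^sup>2 \<le> r\<^sup>2" using z r by (intro abs_le_square_iff[THEN iffD1]) auto
      moreover have "2 * r * z \<le> 2 * r\<^sup>2" using z r by (simp add: power2_eq_square mult_mono)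
      ultimately have kd: "r * z / (20 * (k * sqrt k)) \<le> killed_density k r z"
        using k z r r2 by (intro killed_density_ge[OF k(3)]) auto
      have "sqrt k \<le> sqrt (8 * r\<^sup>2)" using k by simp
      also have "\<dots> \<le> 3 * r" by (rule real_le_lsqrt) (use r in \<open>auto simp: power_mult_distrib\<close>)
      finally have "k * sqrt k \<le> (8 * r\<^sup>2) * (3 * r)" using k r by (intro mult_mono) auto
      then have "r * z / (20 * ((8 * r\<^sup>2) * (3 * r))) \<le> r * z / (20 * (k * sqrt k))"
        using k r z by (intro divide_left_mono) (auto simp: mult_ac)
      moreover have "r * z / (20 * ((8 * r\<^sup>2) * (3 * r))) = z / (480 * r\<^sup>2)"
        using r by (simp add: field_simps)
      ultimately have "z / (480 * r\<^sup>2) \<le> killed_density k r z" using kd by linarith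
      then have "z / (480 * r\<^sup>2) * z \<le> killed_density k r z * z" using z by (intro mult_right_mono) auto
      moreover have "1 / (1950 * r\<^sup>2) \<le> z / (480 * r\<^sup>2) * z"
      proof -
        have "(1/2) * (1/2) \<le> z * z" using z by (intro mult_mono) auto
        then show ?thesis using r by (simp add: field_simps)
      qed
      ultimately show ?thesis by linarith
    qed
    have "ennreal (1 / (3900 * r\<^sup>2)) = ennreal (1 / (1950 * r\<^sup>2)) * ennreal (1 / 2)"
      using r by (subst ennreal_mult[symmetric]) auto
    also have "\<dots> = (\<integral>\<^sup>+z. ennreal (1 / (1950 * r\<^sup>2)) * indicator {1/2..1::real} z \<partial>lborel)"
      by (subst nn_integral_cmult_indicator) auto
    also have "\<dots> \<le> (\<integral>\<^sup>+z. ennreal (killed_density k r z) * target z \<partial>lborel)"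
    proof (rule nn_integral_mono)
      fix z :: real
      show "ennreal (1 / (1950 * r\<^sup>2)) * indicator {1/2..1::real} z \<le> ennreal (killed_density k r z) * target z"
        using lower[of z] killed_density_nonneg[OF k(3), of r z]
        by (auto simp: target_def indicator_def ennreal_leI simp flip: ennreal_mult)
    qed
    also have "\<dots> = (killed_step ^^ k) target r" by (rule killed_step_iter[symmetric]) (use k in auto)
    finally show ?thesis .
  qed
  have "ennreal (1 / 1300) \<le> ennreal (real (card A) * (1 / (3900 * r\<^sup>2)))"
    using cardA r by (intro ennreal_leI) (simp add: field_simps)
  also have "\<dots> = (\<Sum>k\<in>A. ennreal (1 / (3900 * r\<^sup>2)))" by (subst ennreal_mult) (auto simp: ennreal_of_nat_eq_real_of_nat)
  also have "\<dots> \<le> (\<Sum>k\<in>A. (killed_step ^^ k) target r)" by (intro sum_mono trm)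
  also have "\<dots> \<le> (\<Sum>k=1..L. (killed_step ^^ k) target r)" by (intro sum_mono2 A1) auto
  finally show ?thesis .
qed

text \<open>After n steps from 1 the killed motion lies in \<open>[sqrt n, 2 * sqrt n]\<close> with
  weight of order \<open>1 / sqrt n\<close>: the kernel there is at least
  \<open>1 / (20 * n)\<close> and the interval has length \<open>sqrt n\<close>.
  \<open>16 \<le> n\<close> ensures \<open>4 * sqrt n \<le> n\<close>, so that
  \<open>killed_density_ge\<close> applies.\<close>

lemma killed_iter_lower:
  assumes n: "16 \<le> n" and [measurable]: "G \<in> borel_measurable borel"
    and G: "\<And>z. sqrt n \<le> z \<Longrightarrow> z \<le> 2 * sqrt n \<Longrightarrow> c \<le> G z"
  shows "ennreal (1 / 20) * c \<le> ennreal (sqrt n) * (killed_step ^^ n) G 1"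
proof -
  have n0: "0 < real n" using n by simp
  have s4: "4 \<le> sqrt n" using n by (intro real_le_rsqrt) auto
  have lower: "1 / (20 * n) \<le> killed_density n 1 z" if z: "sqrt n \<le> z" "z \<le> 2 * sqrt n" for z
  proof -
    have "(z - 1)\<^sup>2 \<le> (2 * sqrt n)\<^sup>2" using z s4 by (intro power_mono) auto
    moreover have "4 * sqrt n \<le> sqrt n * sqrt n" using s4 by (intro mult_right_mono) auto
    ultimately have "1 * z / (20 * (n * sqrt n)) \<le> killed_density n 1 z"
      using z n s4 by (intro killed_density_ge) (auto simp: power_mult_distrib)
    moreover have "1 / (20 * n) \<le> 1 * z / (20 * (n * sqrt n))" using z n0 by (simp add: field_simps)
    ultimately show ?thesis by linarith
  qed
  have "ennreal (1 / 20) * c = ennreal (sqrt n) * (ennreal (1 / (20 * n)) * c * ennreal (sqrt n))"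
  proof -
    have "ennreal (sqrt n) * (ennreal (1 / (20 * n)) * c * ennreal (sqrt n)) = ennreal (sqrt n) * ennreal (1 / (20 * n)) * ennreal (sqrt n) * c"
      by (simp add: mult_ac)
    also have "ennreal (sqrt n) * ennreal (1 / (20 * n)) * ennreal (sqrt n) = ennreal (1 / 20)"
      using n0 by (simp flip: ennreal_mult)
    finally show ?thesis by simp
  qed
  also have "ennreal (1 / (20 * n)) * c * ennreal (sqrt n) = (\<integral>\<^sup>+z. (ennreal (1 / (20 * n)) * c) * indicator {sqrt n..2 * sqrt n} z \<partial>lborel)"
    by (subst nn_integral_cmult_indicator) auto
  also have "\<dots> \<le> (\<integral>\<^sup>+z. ennreal (killed_density n 1 z) * G z \<partial>lborel)"
    using lower G by (intro nn_integral_mono) (auto simp: indicator_def intro!: mult_mono ennreal_leI)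
  also have "\<dots> = (killed_step ^^ n) G 1" by (rule killed_step_iter[symmetric]) (use n in auto)
  finally show ?thesis by (simp add: mult_left_mono)
qed

lemma sum_inverse_3_2: "(\<Sum>i=1..n. 1 / (real i * sqrt i)) \<le> 3"
proof -
  \<comment> \<open>The subtracted term \<open>2 / sqrt (Suc m)\<close> is what telescopes; at m = 0
    both sides equal 1.\<close>
  have "(\<Sum>i=1..Suc m. 1 / (real i * sqrt i)) \<le> 3 - 2 / sqrt (Suc m)" for m
  proof (induction m)
    case (Suc m)
    define a b where "a = sqrt (Suc m)" and "b = sqrt (Suc (Suc m))"
    have ab: "0 < a" "a \<le> b" "b * b = a * a + 1" by (auto simp: a_def b_def)
    have "1 / (b * b * b) \<le> 2 / a - 2 / b"
    proof -
      have "(b - a) * (b + a) = 1" using ab by (simp add: algebra_simps)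
      moreover have "(b - a) * (b + a) \<le> (b - a) * (2 * b)" using ab by (intro mult_left_mono) auto
      ultimately have 1: "1 \<le> 2 * b * (b - a)" by (simp add: mult_ac)
      have "1 / (b * b * b) \<le> (2 * b * (b - a)) / (a * b * b)"
        using ab 1 by (intro frac_le mult_right_mono mult_pos_pos) auto
      also have "\<dots> = 2 / a - 2 / b" using ab(1,2) by (simp add: field_simps)
      finally show ?thesis .
    qed
    moreover have "1 / (real (Suc (Suc m)) * sqrt (real (Suc (Suc m)))) = 1 / (b * b * b)"
      unfolding b_def by simp
    moreover have "(\<Sum>i=1..Suc (Suc m). 1 / (real i * sqrt i)) =
        (\<Sum>i=1..Suc m. 1 / (real i * sqrt i)) + 1 / (real (Suc (Suc m)) * sqrt (real (Suc (Suc m))))"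
      by simp
    ultimately show ?case using Suc unfolding a_def[symmetric] b_def[symmetric] by linarith
  qed simp
  then show ?thesis
  proof (cases n)
    case (Suc m)
    then show ?thesis using \<open>\<And>m. (\<Sum>i=1..Suc m. 1 / (real i * sqrt i)) \<le> 3 - 2 / sqrt (Suc m)\<close>[of m]
      by (smt (verit) divide_nonneg_nonneg real_sqrt_ge_zero of_nat_0_le_iff)
  qed simp
qed

text \<open>With \<open>m = n - i + 1\<close> one has \<open>n \<le> i + m\<close>, which splits
  each term in two. The mixed part \<open>1 / (sqrt i * m)\<close> is at most the power 3/2 term of
  the smaller index. Three sums bounded by 3 remain.\<close>

lemma sum_phase1: "(\<Sum>i=1..n. n / (real i * sqrt i * (real (n - i) + 1))) \<le> 9"
proof -
  let ?g = "\<lambda>i. 1 / (real i * sqrt i)"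
  have "n / (real i * sqrt i * (real (n - i) + 1)) \<le> 2 * ?g i + ?g (n + 1 - i)" if i: "i \<in> {1..n}" for i
  proof -
    define m where "m = n + 1 - i"
    have m: "1 \<le> m" "real (n - i) + 1 = m" "real n + 1 = i + m" "1 \<le> i"
      using i by (auto simp: m_def of_nat_diff)
    have "n / (real i * sqrt i * (real (n - i) + 1)) \<le> (real i + m) / (real i * sqrt i * m)"
      unfolding m(2) using m by (intro divide_right_mono) auto
    also have "\<dots> = ?g i + 1 / (sqrt i * m)"
      using m by (simp add: field_simps)
    also have "1 / (sqrt i * m) \<le> ?g i + ?g m"
    proof (cases "i \<le> m")
      case True
      then have "1 / (sqrt i * m) \<le> ?g i" using m by (simp add: frac_le)
      moreover have "0 \<le> ?g m" by simp
      ultimately show ?thesis by linarith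
    next
      case False
      then have "1 / (sqrt i * m) \<le> ?g m" using m by (simp add: frac_le)
      moreover have "0 \<le> ?g i" by simp
      ultimately show ?thesis by linarith
    qed
    finally show ?thesis by (simp add: m_def)
  qed
  then have "(\<Sum>i=1..n. n / (real i * sqrt i * (real (n - i) + 1))) \<le> (\<Sum>i=1..n. 2 * ?g i + ?g (n + 1 - i))"
    by (rule sum_mono)
  also have "\<dots> = 2 * (\<Sum>i=1..n. ?g i) + (\<Sum>i=1..n. ?g (n + 1 - i))"
    by (simp add: sum.distrib sum_distrib_left)
  also have "(\<Sum>i=1..n. ?g (n + 1 - i)) = (\<Sum>i=1..n. ?g i)"
    by (rule sum.reindex_bij_witness[of _ "\<lambda>i. n + 1 - i" "\<lambda>i. n + 1 - i"]) auto
  also have "2 * (\<Sum>i=1..n. ?g i) + (\<Sum>i=1..n. ?g i) \<le> 9" using sum_inverse_3_2[of n] by simp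
  finally show ?thesis .
qed

text \<open>The factor \<open>exp (- (\<gamma> * z))\<close> forces the path to a height of order 1
  at the branching time i, which costs \<open>z / (i * sqrt i)\<close>. From there two copies
  survive the remaining steps, at cost about \<open>z\<^sup>2 / (n - i)\<close> against the factor
  n. Integrating \<open>(z + z ^ 3) * exp (- z)\<close> gives 1! + 3! = 7, hence 14 = 2 * 7 and 126
  = 14 * 9.\<close>

lemma phase1_second_moment:
  assumes \<gamma>: "1 \<le> \<gamma>"
  shows "(\<Sum>i=1..n. (killed_step ^^ i) (\<lambda>z. ennreal (exp (- (\<gamma> * z))) *
     (ennreal (sqrt n) * (killed_step ^^ (n - i)) (\<lambda>_. 1) z)\<^sup>2) 1) \<le> 126"
proof -
  have trm: "(killed_step ^^ i) (\<lambda>z. ennreal (exp (- (\<gamma> * z))) * (ennreal (sqrt n) * (killed_step ^^ (n - i)) (\<lambda>_. 1) z)\<^sup>2) 1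
      \<le> ennreal (14 * (n / (real i * sqrt i * (real (n - i) + 1))))" if i: "i \<in> {1..n}" for i
  proof -
    define m where "m = n - i"
    \<comment> \<open>The forms \<open>m + 1\<close> and \<open>1 + z\<^sup>2\<close> let one bound
      include m = 0, where nothing has to survive and \<open>killed_survival_le\<close> does not
      apply.\<close>
    have sq: "(ennreal (sqrt n) * (killed_step ^^ m) (\<lambda>_. 1) z)\<^sup>2 \<le> ennreal (2 * n * (1 + z\<^sup>2) / (real m + 1))" if z: "0 < z" for z :: real
    proof (cases "m = 0")
      case True
      have "real n * 1 \<le> real n * (2 * (1 + z\<^sup>2))" by (intro mult_left_mono) auto
      then show ?thesis using True
        by (auto simp: power2_eq_square mult_ac intro!: ennreal_leI simp flip: ennreal_mult)
    next
      case False
      have "(ennreal (sqrt n) * (killed_step ^^ m) (\<lambda>_. 1) z)\<^sup>2 \<le> (ennreal (sqrt n) * ennreal (z / sqrt m))\<^sup>2"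
        using False z by (intro power_mono mult_left_mono killed_survival_le) auto
      also have "\<dots> = ennreal ((sqrt n * (z / sqrt m))\<^sup>2)"
        using z by (simp add: ennreal_power flip: ennreal_mult)
      also have "(sqrt n * (z / sqrt m))\<^sup>2 = n * z\<^sup>2 / m" by (simp add: power_mult_distrib power_divide)
      also have "ennreal (n * z\<^sup>2 / m) \<le> ennreal (2 * n * (1 + z\<^sup>2) / (real m + 1))"
      proof (rule ennreal_leI)
        have m1: "1 \<le> real m" using False by simp
        have "n * z\<^sup>2 / m \<le> n * (1 + z\<^sup>2) / m" by (intro divide_right_mono mult_left_mono) auto
        also have "\<dots> = 2 * n * (1 + z\<^sup>2) / (2 * m)" by simp
        also have "\<dots> \<le> 2 * n * (1 + z\<^sup>2) / (real m + 1)"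
          using m1 by (intro divide_left_mono mult_nonneg_nonneg mult_pos_pos) auto
        finally show "n * z\<^sup>2 / m \<le> 2 * n * (1 + z\<^sup>2) / (real m + 1)" .
      qed
      finally show ?thesis .
    qed
    let ?c = "2 * n / (real i * sqrt i * (real m + 1))"
    have "(killed_step ^^ i) (\<lambda>z. ennreal (exp (- (\<gamma> * z))) * (ennreal (sqrt n) * (killed_step ^^ m) (\<lambda>_. 1) z)\<^sup>2) 1
      = (\<integral>\<^sup>+z. ennreal (killed_density i 1 z) * (ennreal (exp (- (\<gamma> * z))) * (ennreal (sqrt n) * (killed_step ^^ m) (\<lambda>_. 1) z)\<^sup>2) \<partial>lborel)"
      by (rule killed_step_iter) (use i in auto)
    also have "\<dots> \<le> (\<integral>\<^sup>+z. ennreal ?c * (ennreal (z ^ 1 * exp (- z)) * indicator {0<..} z + ennreal (z ^ 3 * exp (- z)) * indicator {0<..} z) \<partial>lborel)"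
    proof (rule nn_integral_mono)
      fix z :: real
      show "ennreal (killed_density i 1 z) * (ennreal (exp (- (\<gamma> * z))) * (ennreal (sqrt n) * (killed_step ^^ m) (\<lambda>_. 1) z)\<^sup>2)
        \<le> ennreal ?c * (ennreal (z ^ 1 * exp (- z)) * indicator {0<..} z + ennreal (z ^ 3 * exp (- z)) * indicator {0<..} z)"
      proof (cases "0 < z")
        case True
        have "ennreal (killed_density i 1 z) * (ennreal (exp (- (\<gamma> * z))) * (ennreal (sqrt n) * (killed_step ^^ m) (\<lambda>_. 1) z)\<^sup>2)
          \<le> ennreal (z / (i * sqrt i)) * (ennreal (exp (- z)) * ennreal (2 * n * (1 + z\<^sup>2) / (real m + 1)))"
          using True i \<gamma> killed_density_le[of i 1 z] by (intro mult_mono sq ennreal_leI) auto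
        also have "\<dots> = ennreal (z / (i * sqrt i) * (exp (- z) * (2 * n * (1 + z\<^sup>2) / (real m + 1))))"
          using True by (simp flip: ennreal_mult)
        also have "z / (i * sqrt i) * (exp (- z) * (2 * n * (1 + z\<^sup>2) / (real m + 1))) = ?c * (z ^ 1 * exp (- z) + z ^ 3 * exp (- z))"
          by (simp add: power3_eq_cube power2_eq_square algebra_simps add_divide_distrib)
        also have "ennreal (?c * (z ^ 1 * exp (- z) + z ^ 3 * exp (- z))) = ennreal ?c * (ennreal (z ^ 1 * exp (- z)) * indicator {0<..} z + ennreal (z ^ 3 * exp (- z)) * indicator {0<..} z)"
          using True by (simp flip: ennreal_mult ennreal_plus)
        finally show ?thesis .
      qed (simp add: killed_density_def)
    qed
    also have "\<dots> = ennreal ?c * ((\<integral>\<^sup>+z. ennreal (z ^ 1 * exp (- z)) * indicator {0<..} z \<partial>lborel) + (\<integral>\<^sup>+z. ennreal (z ^ 3 * exp (- z)) * indicator {0<..} z \<partial>lborel))"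
      by (subst nn_integral_cmult, simp, subst nn_integral_add) auto
    also have "\<dots> \<le> ennreal ?c * (ennreal (fact 1) + ennreal (fact 3))"
      by (intro mult_left_mono add_mono nn_integral_power_exp) auto
    also have "\<dots> = ennreal (14 * (n / (real i * sqrt i * (real (n - i) + 1))))"
      proof -
      have "ennreal (fact 1) + ennreal (fact 3) = ennreal (fact 1 + fact 3)" by (rule ennreal_plus[symmetric]) auto
      also have "fact 1 + fact 3 = (7 :: real)" by (simp add: fact_numeral)
      finally show ?thesis by (simp only: m_def) (subst ennreal_mult[symmetric]; simp)
    qed
    finally show ?thesis by (simp add: m_def)
  qed
  have "(\<Sum>i=1..n. (killed_step ^^ i) (\<lambda>z. ennreal (exp (- (\<gamma> * z))) * (ennreal (sqrt n) * (killed_step ^^ (n - i)) (\<lambda>_. 1) z)\<^sup>2) 1)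
    \<le> (\<Sum>i=1..n. ennreal (14 * (n / (real i * sqrt i * (real (n - i) + 1)))))" by (rule sum_mono) (rule trm)
  also have "\<dots> = ennreal (14 * (\<Sum>i=1..n. n / (real i * sqrt i * (real (n - i) + 1))))"
    by (subst sum_ennreal) (auto simp: sum_distrib_left)
  also have "\<dots> \<le> ennreal (14 * 9)" using sum_phase1[of n] by (intro ennreal_leI) auto
  finally show ?thesis by simp
qed

section \<open>Weighted paths of the field\<close>

text \<open>\<open>weight\<close> is the normalised exponential of the walk times the conditional probability that the Brownian
  interpolation of \<open>path\<close> stays above the barrier \<open>b\<close>.\<close>

primrec path :: "real \<Rightarrow> (nat \<Rightarrow> real) \<Rightarrow> nat \<Rightarrow> real" where
  "path g e 0 = 1"
| "path g e (Suc j) = path g e j + g - e j"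

primrec weight :: "real \<Rightarrow> (nat \<Rightarrow> real) \<Rightarrow> (nat \<Rightarrow> real) \<Rightarrow> nat \<Rightarrow> real" where
  "weight g b e 0 = 1"
| "weight g b e (Suc j) = weight g b e j *
     (exp (g * e j - g\<^sup>2 / 2) * bridge_weight (path g e j - b j) (path g e (Suc j) - b j))"

definition barrier_step :: "real \<Rightarrow> (real \<Rightarrow> ennreal) \<Rightarrow> real \<Rightarrow> ennreal" where
  "barrier_step b F r = killed_step (\<lambda>z. F (z + b)) (r - b)"

text \<open>The recursion peels off the last step first: F is a function of the position at time i +
  m, the result one of the position at time i, and the step leaving time i + k uses the barrier
  value at i + k.\<close>

primrec barrier_iter :: "(nat \<Rightarrow> real) \<Rightarrow> nat \<Rightarrow> nat \<Rightarrow> (real \<Rightarrow> ennreal) \<Rightarrow> real \<Rightarrow> ennreal" where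
  "barrier_iter b i 0 F = F"
| "barrier_iter b i (Suc m) F = barrier_iter b i m (barrier_step (b (i + m)) F)"

lemma path_eq: "path g e j = 1 + g * real j - (\<Sum>i<j. e i)"
  by (induction j) (auto simp: algebra_simps)

lemma weight_nonneg: "0 \<le> weight g b e j"
  by (induction j) (auto simp: bridge_weight_nonneg)

lemma weight_le: "weight g b e j \<le> exp (g * (\<Sum>i<j. e i) - real j * g\<^sup>2 / 2)"
proof (induction j)
  case (Suc j)
  have "weight g b e (Suc j) \<le> exp (g * (\<Sum>i<j. e i) - real j * g\<^sup>2 / 2) * (exp (g * e j - g\<^sup>2 / 2) * 1)"
    unfolding weight.simps
    by (intro mult_mono Suc bridge_weight_le_1) (auto simp: bridge_weight_nonneg)
  then show ?case by (simp add: exp_add[symmetric] algebra_simps add_divide_distrib)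
qed simp

lemma measurable_path:
  assumes "\<And>i. i < j \<Longrightarrow> (\<lambda>\<omega>. e \<omega> i) \<in> borel_measurable N"
  shows "(\<lambda>\<omega>. path g (e \<omega>) j) \<in> borel_measurable N"
  using assms by (induction j) auto

lemma measurable_weight:
  assumes "\<And>i. i < j \<Longrightarrow> (\<lambda>\<omega>. e \<omega> i) \<in> borel_measurable N"
  shows "(\<lambda>\<omega>. weight g b (e \<omega>) j) \<in> borel_measurable N"
  using assms
proof (induction j)
  case (Suc j)
  have [measurable]: "(\<lambda>\<omega>. path g (e \<omega>) j) \<in> borel_measurable N" "(\<lambda>\<omega>. e \<omega> j) \<in> borel_measurable N"
    using Suc.prems by (auto intro!: measurable_path)
  have [measurable]: "(\<lambda>\<omega>. weight g b (e \<omega>) j) \<in> borel_measurable N" using Suc by auto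
  show ?case by simp
qed simp

lemma measurable_barrier_step [measurable]:
  assumes [measurable]: "F \<in> borel_measurable borel"
  shows "barrier_step b F \<in> borel_measurable borel"
  unfolding barrier_step_def by measurable

lemma measurable_barrier_iter [measurable]:
  "F \<in> borel_measurable borel \<Longrightarrow> barrier_iter b i m F \<in> borel_measurable borel"
  by (induction m arbitrary: F) auto

lemma barrier_step_mono: "(\<And>z. F z \<le> G z) \<Longrightarrow> barrier_step b F r \<le> barrier_step b G r"
  unfolding barrier_step_def by (rule killed_step_mono) auto

lemma barrier_iter_mono: "(\<And>z. F z \<le> G z) \<Longrightarrow> barrier_iter b i m F r \<le> barrier_iter b i m G r"
proof (induction m arbitrary: F G)
  case (Suc m)
  show ?case unfolding barrier_iter.simps by (rule Suc.IH) (rule barrier_step_mono, rule Suc.prems)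
qed simp

lemma barrier_iter_const: "barrier_iter (\<lambda>_. 0) i m F = (killed_step ^^ m) F"
proof (induction m arbitrary: F)
  case (Suc m)
  have "barrier_step 0 F = killed_step F" by (auto simp: barrier_step_def)
  then show ?case using Suc by (simp add: funpow_swap1)
qed simp

lemma barrier_iter_shift:
  assumes "\<And>k. k < m \<Longrightarrow> b (i + k) = \<beta>"
  shows "barrier_iter b i m F r = (killed_step ^^ m) (\<lambda>z. F (z + \<beta>)) (r - \<beta>)"
  using assms
proof (induction m arbitrary: F)
  case (Suc m)
  have "barrier_iter b i (Suc m) F r = (killed_step ^^ m) (\<lambda>z. barrier_step \<beta> F (z + \<beta>)) (r - \<beta>)"
    using Suc by simp
  also have "(\<lambda>z. barrier_step \<beta> F (z + \<beta>)) = killed_step (\<lambda>z. F (z + \<beta>))"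
    by (auto simp: barrier_step_def)
  finally show ?case by (simp add: funpow_swap1)
qed simp

lemma barrier_iter_add: "barrier_iter b i (m + k) F = barrier_iter b i m (barrier_iter b (i + m) k F)"
  by (induction k arbitrary: F) (auto simp: add.assoc)

lemma ennreal_two_mult_le: "2 * (a * b) \<le> a\<^sup>2 + (b::ennreal)\<^sup>2"
proof (cases a; cases b)
  fix x y assume *: "a = ennreal x" "0 \<le> x" "b = ennreal y" "0 \<le> y"
  have "2 * (x * y) \<le> x\<^sup>2 + y\<^sup>2" using sum_squares_bound[of x y] by (simp add: mult_ac)
  then have "ennreal (2 * (x * y)) \<le> ennreal (x\<^sup>2 + y\<^sup>2)" by (rule ennreal_leI)
  then show ?thesis using * by (simp add: ennreal_mult' ennreal_power)
qed (auto simp: power2_eq_square)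

text \<open>Evaluating the field at the dyadic floor of x is, at each level, a countable case
  distinction and hence jointly measurable; continuity of the paths gives pointwise convergence. N
  is arbitrary because generated sigma-algebras are needed as well as that of the probability
  space.\<close>

lemma measurable_continuous_field:
  fixes f :: "'a::euclidean_space \<Rightarrow> 'w \<Rightarrow> real"
  assumes m: "\<And>x. f x \<in> borel_measurable N"
    and c: "\<And>\<omega>. \<omega> \<in> space N \<Longrightarrow> continuous_on UNIV (\<lambda>x. f x \<omega>)"
  shows "(\<lambda>(\<omega>, x). f x \<omega>) \<in> borel_measurable (N \<Otimes>\<^sub>M borel)"
proof -
  define K where "K = (Basis :: 'a set) \<rightarrow>\<^sub>E (UNIV :: int set)"
  define fl :: "nat \<Rightarrow> 'a \<Rightarrow> 'a \<Rightarrow> int" where "fl n x = restrict (\<lambda>b. \<lfloor>2 ^ n * (x \<bullet> b)\<rfloor>) Basis" for n x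
  define h :: "nat \<Rightarrow> ('a \<Rightarrow> int) \<Rightarrow> 'a" where "h n k = (\<Sum>b\<in>Basis. (of_int (k b) / 2 ^ n) *\<^sub>R b)" for n k
  have cK: "countable K" unfolding K_def by (rule countable_PiE) auto
  have flm: "fl n \<in> measurable borel (count_space K)" for n
  proof (rule measurableI)
    show "fl n x \<in> space (count_space K)" for x by (auto simp: fl_def K_def)
    fix A assume "A \<in> sets (count_space K)"
    then have A: "A \<subseteq> K" by simp
    have "fl n -` {k} \<in> sets borel" if "k \<in> K" for k
    proof -
      have "fl n -` {k} = {x. \<forall>b\<in>Basis. \<lfloor>2 ^ n * (x \<bullet> b)\<rfloor> = k b}"
        using that by (auto simp: fl_def K_def PiE_def extensional_def fun_eq_iff)
      also have "\<dots> \<in> sets borel" by measurable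
      finally show ?thesis .
    qed
    then have "(\<Union>k\<in>A. fl n -` {k}) \<in> sets borel"
      using A cK by (intro sets.countable_UN'') (auto intro: countable_subset)
    moreover have "fl n -` A \<inter> space borel = (\<Union>k\<in>A. fl n -` {k})" by auto
    ultimately show "fl n -` A \<inter> space borel \<in> sets borel" by simp
  qed
  have lim: "(\<lambda>n. h n (fl n x)) \<longlonglongrightarrow> x" for x :: 'a
  proof -
    have "(\<lambda>n. (\<Sum>b\<in>Basis. (of_int (fl n x b) / 2 ^ n) *\<^sub>R b)) \<longlonglongrightarrow> (\<Sum>b\<in>Basis. (x \<bullet> b) *\<^sub>R b)"
    proof (intro tendsto_sum tendsto_scaleR tendsto_const)
      fix b :: 'a assume b: "b \<in> Basis"
      show "(\<lambda>n. of_int (fl n x b) / 2 ^ n) \<longlonglongrightarrow> x \<bullet> b"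
      proof (rule real_tendsto_sandwich)
        show "\<forall>\<^sub>F n in sequentially. x \<bullet> b - (1 / 2) ^ n \<le> of_int (fl n x b) / 2 ^ n"
        proof (rule always_eventually, rule allI)
          fix n
          have "2 ^ n * (x \<bullet> b) - 1 \<le> of_int (fl n x b)" using b unfolding fl_def by simp
          then have "(2 ^ n * (x \<bullet> b) - 1) / 2 ^ n \<le> of_int (fl n x b) / 2 ^ n" by (rule divide_right_mono) simp
          then show "x \<bullet> b - (1 / 2) ^ n \<le> of_int (fl n x b) / 2 ^ n"
            by (simp add: diff_divide_distrib power_one_over)
        qed
        show "\<forall>\<^sub>F n in sequentially. of_int (fl n x b) / 2 ^ n \<le> x \<bullet> b"
          using b by (auto simp: fl_def divide_le_eq mult.commute intro!: always_eventually)
        have "(\<lambda>n. x \<bullet> b - (1 / 2) ^ n) \<longlonglongrightarrow> x \<bullet> b - 0"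
          by (intro tendsto_diff tendsto_const LIMSEQ_realpow_zero) auto
        then show "(\<lambda>n. x \<bullet> b - (1 / 2) ^ n) \<longlonglongrightarrow> x \<bullet> b" by simp
      qed simp
    qed
    then show ?thesis by (simp add: h_def euclidean_representation)
  qed
  show ?thesis
  proof (rule borel_measurable_LIMSEQ_real)
    fix n
    have "(\<lambda>z. f (h n (fl n (snd z))) (fst z)) \<in> borel_measurable (N \<Otimes>\<^sub>M borel)"
    proof (rule measurable_compose_countable'[OF _ _ cK])
      show "(\<lambda>z. f (h n k) (fst z)) \<in> borel_measurable (N \<Otimes>\<^sub>M borel)" for k
        using m by (intro measurable_compose[OF measurable_fst]) auto
      show "(\<lambda>z. fl n (snd z)) \<in> measurable (N \<Otimes>\<^sub>M borel) (count_space K)"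
        by (rule measurable_compose[OF measurable_snd flm])
    qed
    then show "(\<lambda>z. f (h n (fl n (snd z))) (fst z)) \<in> borel_measurable (N \<Otimes>\<^sub>M borel)" .
  next
    fix z assume "z \<in> space (N \<Otimes>\<^sub>M (borel :: 'a measure))"
    then have "fst z \<in> space N" by (auto simp: space_pair_measure)
    from c[OF this] have "isCont (\<lambda>x. f x (fst z)) (snd z)" by (simp add: continuous_on_eq_continuous_at)
    then have "(\<lambda>n. f (h n (fl n (snd z))) (fst z)) \<longlonglongrightarrow> f (snd z) (fst z)"
      using lim by (rule isCont_tendsto_compose)
    then show "(\<lambda>n. f (h n (fl n (snd z))) (fst z)) \<longlonglongrightarrow> (case z of (\<omega>, x) \<Rightarrow> f x \<omega>)"
      by (simp add: case_prod_beta)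
  qed
qed

section \<open>Exponential tilting\<close>

lemma (in prob_space) gaussian_exp_moment:
  assumes "gaussian_rv M f" "(\<integral>\<omega>. f \<omega> \<partial>M) = 0"
  shows "(\<integral>\<^sup>+\<omega>. ennreal (exp (f \<omega>)) \<partial>M) = ennreal (exp ((\<integral>\<omega>. (f \<omega>)\<^sup>2 \<partial>M) / 2))"
  using assms
proof (rule gaussian_rv_cases)
  assume *: "AE \<omega> in M. f \<omega> = 0"
  have [measurable]: "f \<in> borel_measurable M" using assms(1) by (simp add: gaussian_rv_def)
  have "(\<integral>\<^sup>+\<omega>. ennreal (exp (f \<omega>)) \<partial>M) = (\<integral>\<^sup>+\<omega>. 1 \<partial>M)"
    by (rule nn_integral_cong_AE) (use * in auto)
  moreover have "(\<integral>\<omega>. (f \<omega>)\<^sup>2 \<partial>M) = (\<integral>\<omega>. 0 \<partial>M)"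
    by (rule integral_cong_AE) (use * in auto)
  ultimately show ?thesis by (simp add: emeasure_space_1)
next
  fix \<sigma> :: real assume *: "0 < \<sigma>" "distributed M lborel f (normal_density 0 \<sigma>)"
  have var: "(\<integral>\<omega>. (f \<omega>)\<^sup>2 \<partial>M) = \<sigma>\<^sup>2"
    using normal_distributed_variance[OF *] normal_distributed_expectation[OF *] by simp
  have "(\<integral>\<^sup>+\<omega>. ennreal (exp (f \<omega>)) \<partial>M) = (\<integral>\<^sup>+u. ennreal (normal_density 0 \<sigma> u) * ennreal (exp u) \<partial>lborel)"
    using distributed_nn_integral[OF *(2), of "\<lambda>u. ennreal (exp u)"] by simp
  also have "\<dots> = (\<integral>\<^sup>+u. ennreal (exp (\<sigma>\<^sup>2 / 2)) * ennreal (normal_density (\<sigma>\<^sup>2) \<sigma> u) \<partial>lborel)"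
  proof (intro nn_integral_cong)
    fix u
    have "- u\<^sup>2 / (2 * \<sigma>\<^sup>2) + u = \<sigma>\<^sup>2 / 2 + - (u - \<sigma>\<^sup>2)\<^sup>2 / (2 * \<sigma>\<^sup>2)"
      using *(1) by (simp add: field_simps power2_eq_square)
    then have "exp (- u\<^sup>2 / (2 * \<sigma>\<^sup>2)) * exp u = exp (\<sigma>\<^sup>2 / 2) * exp (- (u - \<sigma>\<^sup>2)\<^sup>2 / (2 * \<sigma>\<^sup>2))"
      by (simp only: exp_add[symmetric])
    then have "normal_density 0 \<sigma> u * exp u = exp (\<sigma>\<^sup>2 / 2) * normal_density (\<sigma>\<^sup>2) \<sigma> u"
      by (simp add: normal_density_def mult_ac)
    then show "ennreal (normal_density 0 \<sigma> u) * ennreal (exp u) = ennreal (exp (\<sigma>\<^sup>2 / 2)) * ennreal (normal_density (\<sigma>\<^sup>2) \<sigma> u)"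
      by (simp add: ennreal_mult[symmetric] normal_density_nonneg)
  qed
  also have "\<dots> = ennreal (exp (\<sigma>\<^sup>2 / 2)) * 1"
    using *(1) by (subst nn_integral_cmult) (auto simp: nn_integral_eq_integral normal_density_nonneg)
  finally show ?thesis by (simp add: var)
qed

lemma std_normal_tilt:
  "std_normal_density u * exp (g * u - g\<^sup>2 / 2) = std_normal_density (u - g)"
proof -
  have "- u\<^sup>2 / 2 + (g * u - g\<^sup>2 / 2) = - (u - g)\<^sup>2 / 2" by (simp add: power2_eq_square field_simps)
  then have "exp (- u\<^sup>2 / 2) * exp (g * u - g\<^sup>2 / 2) = exp (- (u - g)\<^sup>2 / 2)" by (simp only: exp_add[symmetric])
  then show ?thesis by (simp add: std_normal_density_def)
qed

text \<open>What the path estimates need of the field: independent layers of unit variance, with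
  correlation length \<open>r0 * exp (- n)\<close> and with correlations that are Lipschitz at the
  diagonal on that scale. Independence of layers is expressed as vanishing covariance within a
  Gaussian space.\<close>

locale gaussian_noise = prob_space P for P :: "'w measure" +
  fixes H :: "('w \<Rightarrow> real) set" and E :: "nat \<Rightarrow> 'a::euclidean_space \<Rightarrow> 'w \<Rightarrow> real"
    and c :: "nat \<Rightarrow> 'a \<Rightarrow> 'a \<Rightarrow> real" and r0 C0 \<gamma> dimn :: real
  assumes gaussian: "centred_gaussian_space P H"
    and E_in: "E n x \<in> H"
    and cov: "(\<integral>\<omega>. E n x \<omega> * E m y \<omega> \<partial>P) = (if n = m then c n x y else 0)"
    and c_self: "c n x x = 1" and c_nonneg: "0 \<le> c n x y" and c_le_1: "c n x y \<le> 1"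
    and c_far: "r0 \<le> exp (real n) * dist x y \<Longrightarrow> c n x y = 0"
    and c_near: "1 - c n x y \<le> C0 * exp (real n) * dist x y"
    and E_cont: "\<omega> \<in> space P \<Longrightarrow> continuous_on UNIV (\<lambda>x. E n x \<omega>)"
    and gamma_eq: "\<gamma> = critical_gamma TYPE('a)" and dimn_eq: "dimn = real DIM('a)"
    and r0_pos: "0 < r0" and C0_nonneg: "0 \<le> C0"
begin

lemma gamma_sq: "\<gamma>\<^sup>2 = 2 * dimn" by (simp add: gamma_eq dimn_eq critical_gamma_def)

lemma gamma_ge_1: "1 \<le> \<gamma>"
proof -
  have "1 \<le> dimn" using DIM_positive[where 'a='a] unfolding dimn_eq by linarith
  then have "1 \<le> 2 * dimn" by linarith
  then show ?thesis unfolding gamma_eq critical_gamma_def dimn_eq by (rule real_sqrt_ge_one)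
qed

lemma measurable_E [measurable]: "E n x \<in> borel_measurable P"
  using centred_gaussian_spaceD(3)[OF gaussian] E_in by auto

definition R :: "nat \<Rightarrow> nat \<Rightarrow> 'a \<Rightarrow> 'w \<Rightarrow> real" where
  "R \<tau> j x \<omega> = path \<gamma> (\<lambda>i. E (\<tau> + i) x \<omega>) j"

definition W :: "(nat \<Rightarrow> real) \<Rightarrow> nat \<Rightarrow> nat \<Rightarrow> 'a \<Rightarrow> 'w \<Rightarrow> real" where
  "W b \<tau> j x \<omega> = weight \<gamma> b (\<lambda>i. E (\<tau> + i) x \<omega>) j"

definition past :: "nat \<Rightarrow> ('w \<Rightarrow> real) set" where
  "past n = {E q z | q z. q < n}"

text \<open>Restricted in space, unlike \<open>past\<close>, so that regions far apart give
  uncorrelated families.\<close>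

definition future :: "nat \<Rightarrow> 'a set \<Rightarrow> ('w \<Rightarrow> real) set" where
  "future n D = {E q z | q z. n \<le> q \<and> z \<in> D}"

lemma past_in: "past n \<subseteq> H" and future_in: "future n D \<subseteq> H"
  using E_in by (auto simp: past_def future_def)

lemma measurable_R_sigma:
  "(\<And>i. i < j \<Longrightarrow> E (\<tau> + i) x \<in> A) \<Longrightarrow> R \<tau> j x \<in> borel_measurable (generated_sigma P A)"
  unfolding R_def[abs_def] by (rule measurable_path) (rule measurable_generated_sigma)

lemma measurable_W_sigma:
  "(\<And>i. i < j \<Longrightarrow> E (\<tau> + i) x \<in> A) \<Longrightarrow> W b \<tau> j x \<in> borel_measurable (generated_sigma P A)"
  unfolding W_def[abs_def] by (rule measurable_weight) (rule measurable_generated_sigma)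

lemma measurable_R [measurable]: "R \<tau> j x \<in> borel_measurable P"
  unfolding R_def[abs_def] by (rule measurable_path) simp

lemma measurable_W [measurable]: "W b \<tau> j x \<in> borel_measurable P"
  unfolding W_def[abs_def] by (rule measurable_weight) simp

lemma W_nonneg: "0 \<le> W b \<tau> j x \<omega>" unfolding W_def by (rule weight_nonneg)

lemma W_0 [simp]: "W b \<tau> 0 x \<omega> = 1" and R_0 [simp]: "R \<tau> 0 x \<omega> = 1"
  by (simp_all add: W_def R_def)

lemma R_Suc: "R \<tau> (Suc j) x \<omega> = R \<tau> j x \<omega> + \<gamma> - E (\<tau> + j) x \<omega>"
  by (simp add: R_def)

lemma W_Suc: "W b \<tau> (Suc j) x \<omega> = W b \<tau> j x \<omega> * (exp (\<gamma> * E (\<tau> + j) x \<omega> - \<gamma>\<^sup>2 / 2) *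
    bridge_weight (R \<tau> j x \<omega> - b j) (R \<tau> j x \<omega> + \<gamma> - E (\<tau> + j) x \<omega> - b j))"
  by (simp add: W_def R_def)

text \<open>Dropping the bridge factors leaves the normalised exponential, and
  \<open>\<gamma>\<^sup>2 = 2 * dimn\<close> rewrites its exponent in terms of the current position.
  The summand \<open>\<gamma>\<close> stems from the start of the path at 1.\<close>

lemma W_le: "W b \<tau> j x \<omega> \<le> exp (\<gamma> + dimn * j - \<gamma> * R \<tau> j x \<omega>)"
proof -
  have "W b \<tau> j x \<omega> \<le> exp (\<gamma> * (\<Sum>i<j. E (\<tau> + i) x \<omega>) - real j * \<gamma>\<^sup>2 / 2)"
    unfolding W_def by (rule weight_le)
  also have "\<gamma> * (\<Sum>i<j. E (\<tau> + i) x \<omega>) - real j * \<gamma>\<^sup>2 / 2 = \<gamma> + dimn * j - \<gamma> * R \<tau> j x \<omega>"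
    unfolding R_def path_eq using gamma_sq by (simp add: algebra_simps power2_eq_square)
  finally show ?thesis .
qed

lemma E_std_normal: "distributed P lborel (E n x) std_normal_density"
proof -
  have g: "gaussian_rv P (E n x)" "(\<integral>\<omega>. E n x \<omega> \<partial>P) = 0"
    using centred_gaussian_spaceD(1,2)[OF gaussian E_in] by auto
  have v: "(\<integral>\<omega>. (E n x \<omega>)\<^sup>2 \<partial>P) = 1" using cov[of n x n x] c_self by (simp add: power2_eq_square)
  from g show ?thesis
  proof (rule gaussian_rv_cases)
    assume "AE \<omega> in P. E n x \<omega> = 0"
    then have "(\<integral>\<omega>. (E n x \<omega>)\<^sup>2 \<partial>P) = (\<integral>\<omega>. 0 \<partial>P)" by (intro integral_cong_AE) auto
    then show ?thesis using v by simp
  next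
    fix \<sigma> :: real assume *: "0 < \<sigma>" "distributed P lborel (E n x) (normal_density 0 \<sigma>)"
    have "(\<integral>\<omega>. (E n x \<omega>)\<^sup>2 \<partial>P) = \<sigma>\<^sup>2"
      using normal_distributed_variance[OF *] normal_distributed_expectation[OF *] by simp
    then have "\<sigma> = 1" using v *(1) by (simp add: power2_eq_1_iff)
    then show ?thesis using * by simp
  qed
qed

lemma uncorrelated_past: "n \<le> q \<Longrightarrow> uncorrelated P (past n) {E q y}"
  by (auto simp: uncorrelated_def past_def cov)

lemma uncorrelated_past_future: "uncorrelated P (past n) (future n D)"
  by (auto simp: uncorrelated_def past_def future_def cov)

lemma uncorrelated_Un: "uncorrelated P A C \<Longrightarrow> uncorrelated P B C \<Longrightarrow> uncorrelated P (A \<union> B) C"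
  by (auto simp: uncorrelated_def)

text \<open>Tilting by \<open>exp (\<gamma> * u - \<gamma>\<^sup>2 / 2)\<close> moves the mean of
  the increment to \<open>\<gamma>\<close>, which cancels the drift of the path. The next position
  is then a centred unit Gaussian step away, and with the bridge weight this is one step of the
  motion killed at b.\<close>

lemma step_expectation:
  assumes A: "A \<subseteq> H" and u: "uncorrelated P A {E q y}"
    and [measurable]: "G \<in> borel_measurable (generated_sigma P A)" "S \<in> borel_measurable (generated_sigma P A)"
      "F \<in> borel_measurable borel"
  shows "(\<integral>\<^sup>+\<omega>. G \<omega> * (ennreal (exp (\<gamma> * E q y \<omega> - \<gamma>\<^sup>2 / 2) * bridge_weight (S \<omega> - b) (S \<omega> + \<gamma> - E q y \<omega> - b))
      * F (S \<omega> + \<gamma> - E q y \<omega>)) \<partial>P) = (\<integral>\<^sup>+\<omega>. G \<omega> * barrier_step b F (S \<omega>) \<partial>P)"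
proof -
  have "(\<integral>\<^sup>+\<omega>. G \<omega> * (ennreal (exp (\<gamma> * E q y \<omega> - \<gamma>\<^sup>2 / 2) * bridge_weight (S \<omega> - b) (S \<omega> + \<gamma> - E q y \<omega> - b))
      * F (S \<omega> + \<gamma> - E q y \<omega>)) \<partial>P) =
    (\<integral>\<^sup>+\<omega>. \<integral>\<^sup>+u. ennreal (std_normal_density u) *
       (G \<omega> * (ennreal (exp (\<gamma> * u - \<gamma>\<^sup>2 / 2) * bridge_weight (S \<omega> - b) (S \<omega> + \<gamma> - u - b)) * F (S \<omega> + \<gamma> - u))) \<partial>lborel \<partial>P)"
    using indep_freeze[OF gaussian A E_in u E_std_normal,
        of "\<lambda>(\<omega>, u). G \<omega> * (ennreal (exp (\<gamma> * u - \<gamma>\<^sup>2 / 2) * bridge_weight (S \<omega> - b) (S \<omega> + \<gamma> - u - b)) * F (S \<omega> + \<gamma> - u))"]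
    by simp
  also have "\<dots> = (\<integral>\<^sup>+\<omega>. G \<omega> * barrier_step b F (S \<omega>) \<partial>P)"
  proof (rule nn_integral_cong)
    fix \<omega>
    let ?r = "S \<omega>"
    let ?f = "\<lambda>u. ennreal (std_normal_density (u - \<gamma>) * bridge_weight (?r - b) (?r + \<gamma> - u - b)) * F (?r + \<gamma> - u)"
    have "(\<integral>\<^sup>+u. ennreal (std_normal_density u) *
       (G \<omega> * (ennreal (exp (\<gamma> * u - \<gamma>\<^sup>2 / 2) * bridge_weight (?r - b) (?r + \<gamma> - u - b)) * F (?r + \<gamma> - u))) \<partial>lborel)
      = (\<integral>\<^sup>+u. G \<omega> * ?f u \<partial>lborel)"
    proof (rule nn_integral_cong)
      fix u
      have "ennreal (std_normal_density u) * ennreal (exp (\<gamma> * u - \<gamma>\<^sup>2 / 2) * bridge_weight (?r - b) (?r + \<gamma> - u - b))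
        = ennreal (std_normal_density (u - \<gamma>) * bridge_weight (?r - b) (?r + \<gamma> - u - b))"
        by (subst ennreal_mult[symmetric]) (auto simp: bridge_weight_nonneg mult.assoc[symmetric] std_normal_tilt)
      moreover have "a1 * (g1 * (b1 * f1)) = g1 * ((a1 * b1) * f1)" for a1 g1 b1 f1 :: ennreal
        by (simp only: mult_ac)
      ultimately show "ennreal (std_normal_density u) *
       (G \<omega> * (ennreal (exp (\<gamma> * u - \<gamma>\<^sup>2 / 2) * bridge_weight (?r - b) (?r + \<gamma> - u - b)) * F (?r + \<gamma> - u))) = G \<omega> * ?f u"
        by (simp only:)
    qed
    also have "\<dots> = G \<omega> * (\<integral>\<^sup>+u. ?f u \<partial>lborel)" by (rule nn_integral_cmult) measurable
    also have "(\<integral>\<^sup>+u. ?f u \<partial>lborel) = (\<integral>\<^sup>+z. ?f ((?r + \<gamma> - b) + (-1) * z) \<partial>lborel)"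
      by (subst nn_integral_real_affine[where c="-1" and t="?r + \<gamma> - b"]) auto
    also have "\<dots> = barrier_step b F ?r"
    proof -
      have e: "?r + \<gamma> - (?r + \<gamma> - b + - 1 * z) = z + b" for z by simp
      have n: "std_normal_density (?r + \<gamma> - b + - 1 * z - \<gamma>) = std_normal_density (z - (?r - b))" for z
      proof -
        have "(?r + \<gamma> - b + - 1 * z - \<gamma>)\<^sup>2 = (z - (?r - b))\<^sup>2"
          by (simp add: power2_eq_square algebra_simps)
        then show ?thesis by (simp only: std_normal_density_def)
      qed
      show ?thesis unfolding e n barrier_step_def killed_step_def by simp
    qed
    finally show "(\<integral>\<^sup>+u. ennreal (std_normal_density u) *
       (G \<omega> * (ennreal (exp (\<gamma> * u - \<gamma>\<^sup>2 / 2) * bridge_weight (?r - b) (?r + \<gamma> - u - b)) * F (?r + \<gamma> - u))) \<partial>lborel)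
      = G \<omega> * barrier_step b F ?r" .
  qed
  finally show ?thesis .
qed

text \<open>The steps at y are integrated out from the last one down to time i. The family A may
  contain anything uncorrelated with these steps, in particular a whole path at another
  point.\<close>

lemma path_expectation:
  assumes A: "A \<subseteq> H" and u: "\<And>q. \<tau> + i \<le> q \<Longrightarrow> uncorrelated P A {E q y}"
    and Ain: "\<And>q. \<tau> \<le> q \<Longrightarrow> q < \<tau> + i \<Longrightarrow> E q y \<in> A"
    and g: "g \<in> borel_measurable (generated_sigma P A)"
    and F: "F \<in> borel_measurable borel"
  shows "(\<integral>\<^sup>+\<omega>. g \<omega> * (ennreal (W b \<tau> (i + m) y \<omega>) * F (R \<tau> (i + m) y \<omega>)) \<partial>P) =
    (\<integral>\<^sup>+\<omega>. g \<omega> * (ennreal (W b \<tau> i y \<omega>) * barrier_iter b i m F (R \<tau> i y \<omega>)) \<partial>P)"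
  using F
proof (induction m arbitrary: F)
  case (Suc m)
  note [measurable] = Suc.prems
  define A' where "A' = A \<union> {E q y | q. \<tau> + i \<le> q \<and> q < \<tau> + i + m}"
  have A': "A' \<subseteq> H" using A E_in by (auto simp: A'_def)
  have u': "uncorrelated P A' {E (\<tau> + i + m) y}"
    unfolding A'_def using u[of "\<tau> + i + m"] by (intro uncorrelated_Un) (auto simp: uncorrelated_def cov)
  have in': "E (\<tau> + k) y \<in> A'" if "k < i + m" for k
    using that Ain[of "\<tau> + k"] by (cases "k < i") (auto simp: A'_def)
  have [measurable]: "g \<in> borel_measurable (generated_sigma P A')"
    by (rule measurable_generated_sigma_mono[OF _ g]) (auto simp: A'_def)
  have [measurable]: "R \<tau> (i + m) y \<in> borel_measurable (generated_sigma P A')"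
    by (rule measurable_R_sigma) (rule in')
  have [measurable]: "W b \<tau> (i + m) y \<in> borel_measurable (generated_sigma P A')"
    by (rule measurable_W_sigma) (rule in')
  have "(\<integral>\<^sup>+\<omega>. g \<omega> * (ennreal (W b \<tau> (i + Suc m) y \<omega>) * F (R \<tau> (i + Suc m) y \<omega>)) \<partial>P) =
    (\<integral>\<^sup>+\<omega>. (g \<omega> * ennreal (W b \<tau> (i + m) y \<omega>)) *
      (ennreal (exp (\<gamma> * E (\<tau> + i + m) y \<omega> - \<gamma>\<^sup>2 / 2) *
        bridge_weight (R \<tau> (i + m) y \<omega> - b (i + m)) (R \<tau> (i + m) y \<omega> + \<gamma> - E (\<tau> + i + m) y \<omega> - b (i + m)))
      * F (R \<tau> (i + m) y \<omega> + \<gamma> - E (\<tau> + i + m) y \<omega>)) \<partial>P)"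
    by (intro nn_integral_cong)
      (simp add: W_Suc R_Suc ennreal_mult W_nonneg bridge_weight_nonneg add.assoc mult.assoc)
  also have "\<dots> = (\<integral>\<^sup>+\<omega>. (g \<omega> * ennreal (W b \<tau> (i + m) y \<omega>)) * barrier_step (b (i + m)) F (R \<tau> (i + m) y \<omega>) \<partial>P)"
    by (rule step_expectation[OF A' u']) measurable
  also have "\<dots> = (\<integral>\<^sup>+\<omega>. g \<omega> * (ennreal (W b \<tau> (i + m) y \<omega>) * barrier_step (b (i + m)) F (R \<tau> (i + m) y \<omega>)) \<partial>P)"
    by (simp add: mult.assoc)
  also have "\<dots> = (\<integral>\<^sup>+\<omega>. g \<omega> * (ennreal (W b \<tau> i y \<omega>) * barrier_iter b i m (barrier_step (b (i + m)) F) (R \<tau> i y \<omega>)) \<partial>P)"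
    by (rule Suc.IH) measurable
  finally show ?case by simp
qed simp

lemma weight_expectation:
  assumes [measurable]: "F \<in> borel_measurable borel"
  shows "(\<integral>\<^sup>+\<omega>. ennreal (W b \<tau> m y \<omega>) * F (R \<tau> m y \<omega>) \<partial>P) = barrier_iter b 0 m F 1"
proof -
  have "(\<integral>\<^sup>+\<omega>. 1 * (ennreal (W b \<tau> (0 + m) y \<omega>) * F (R \<tau> (0 + m) y \<omega>)) \<partial>P) =
    (\<integral>\<^sup>+\<omega>. 1 * (ennreal (W b \<tau> 0 y \<omega>) * barrier_iter b 0 m F (R \<tau> 0 y \<omega>)) \<partial>P)"
    by (rule path_expectation[where A="{}"]) (auto simp: uncorrelated_def)
  then show ?thesis by (simp add: emeasure_space_1)
qed

text \<open>From time i on the increments at x and y are uncorrelated. So y is integrated out with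
  the entire path at x frozen, and then x with only the layers before i frozen.\<close>

lemma two_point_expectation:
  assumes sep: "r0 \<le> exp (real (\<tau> + i)) * dist x y" and j: "i \<le> j" "i \<le> j'"
    and [measurable]: "F \<in> borel_measurable borel" "F' \<in> borel_measurable borel"
  shows "(\<integral>\<^sup>+\<omega>. (ennreal (W b \<tau> j x \<omega>) * F (R \<tau> j x \<omega>)) * (ennreal (W b \<tau> j' y \<omega>) * F' (R \<tau> j' y \<omega>)) \<partial>P) =
    (\<integral>\<^sup>+\<omega>. (ennreal (W b \<tau> i x \<omega>) * barrier_iter b i (j - i) F (R \<tau> i x \<omega>)) *
       (ennreal (W b \<tau> i y \<omega>) * barrier_iter b i (j' - i) F' (R \<tau> i y \<omega>)) \<partial>P)"
proof -
  have c0: "c q x y = 0" "c q y x = 0" if "\<tau> + i \<le> q" for q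
  proof -
    have "exp (real (\<tau> + i)) * dist x y \<le> exp (real q) * dist x y"
      using that by (intro mult_right_mono) auto
    then show "c q x y = 0" "c q y x = 0" using sep c_far[of q x y] c_far[of q y x] by (auto simp: dist_commute)
  qed
  define A where "A = past (\<tau> + i) \<union> {E q x | q. \<tau> + i \<le> q}"
  have A: "A \<subseteq> H" using past_in E_in by (auto simp: A_def)
  have inA: "E (\<tau> + k) x \<in> A" for k
    by (cases "k < i") (auto simp: A_def past_def)
  have [measurable]: "R \<tau> j x \<in> borel_measurable (generated_sigma P A)" "W b \<tau> j x \<in> borel_measurable (generated_sigma P A)"
    using inA by (auto intro!: measurable_R_sigma measurable_W_sigma)
  have inp: "E (\<tau> + k) z \<in> past (\<tau> + i)" if "k < i" for k z using that by (auto simp: past_def)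
  have [measurable]: "R \<tau> i z \<in> borel_measurable (generated_sigma P (past (\<tau> + i)))"
      "W b \<tau> i z \<in> borel_measurable (generated_sigma P (past (\<tau> + i)))" for z
    using inp by (auto intro!: measurable_R_sigma measurable_W_sigma)
  have "(\<integral>\<^sup>+\<omega>. (ennreal (W b \<tau> j x \<omega>) * F (R \<tau> j x \<omega>)) * (ennreal (W b \<tau> (i + (j' - i)) y \<omega>) * F' (R \<tau> (i + (j' - i)) y \<omega>)) \<partial>P) =
    (\<integral>\<^sup>+\<omega>. (ennreal (W b \<tau> j x \<omega>) * F (R \<tau> j x \<omega>)) * (ennreal (W b \<tau> i y \<omega>) * barrier_iter b i (j' - i) F' (R \<tau> i y \<omega>)) \<partial>P)"
  proof (rule path_expectation[OF A])
    fix q assume "\<tau> + i \<le> q"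
    then show "uncorrelated P A {E q y}"
      unfolding A_def using uncorrelated_past[of "\<tau> + i" q y] c0
      by (intro uncorrelated_Un) (auto simp: uncorrelated_def cov)
  next
    fix q assume "\<tau> \<le> q" "q < \<tau> + i"
    then show "E q y \<in> A" by (auto simp: A_def past_def)
  qed measurable
  also have "\<dots> = (\<integral>\<^sup>+\<omega>. (ennreal (W b \<tau> i y \<omega>) * barrier_iter b i (j' - i) F' (R \<tau> i y \<omega>)) *
      (ennreal (W b \<tau> (i + (j - i)) x \<omega>) * F (R \<tau> (i + (j - i)) x \<omega>)) \<partial>P)"
    using j by (simp add: mult.commute)
  also have "\<dots> = (\<integral>\<^sup>+\<omega>. (ennreal (W b \<tau> i y \<omega>) * barrier_iter b i (j' - i) F' (R \<tau> i y \<omega>)) *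
      (ennreal (W b \<tau> i x \<omega>) * barrier_iter b i (j - i) F (R \<tau> i x \<omega>)) \<partial>P)"
  proof (rule path_expectation[OF past_in])
    fix q assume "\<tau> + i \<le> q" then show "uncorrelated P (past (\<tau> + i)) {E q x}" by (rule uncorrelated_past)
  next
    fix q assume "\<tau> \<le> q" "q < \<tau> + i"
    then show "E q x \<in> past (\<tau> + i)" by (auto simp: past_def)
  qed measurable
  finally show ?thesis using j by (simp add: mult.commute)
qed

section \<open>Two-point bounds by branching scale\<close>

definition score :: "(nat \<Rightarrow> real) \<Rightarrow> (nat \<Rightarrow> real \<Rightarrow> ennreal) \<Rightarrow> nat \<Rightarrow> nat \<Rightarrow> 'a \<Rightarrow> 'w \<Rightarrow> ennreal" where
  "score b F \<tau> j x \<omega> = ennreal (W b \<tau> j x \<omega>) * F j (R \<tau> j x \<omega>)"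

text \<open>The expected total score from time i on, as a function of the position at time
  i.\<close>

definition remaining :: "(nat \<Rightarrow> real) \<Rightarrow> (nat \<Rightarrow> real \<Rightarrow> ennreal) \<Rightarrow> nat \<Rightarrow> nat \<Rightarrow> real \<Rightarrow> ennreal" where
  "remaining b F J i r = (\<Sum>j=i..J. barrier_iter b i (j - i) (F j) r)"

text \<open>An upper bound for the mean square of the weight at scale i times the expected later
  score: one of the two weights is replaced by \<open>W_le\<close>, the other acts as change of
  measure. It is the cost of two paths that branch at scale i.\<close>

definition branch_energy :: "(nat \<Rightarrow> real) \<Rightarrow> (nat \<Rightarrow> real \<Rightarrow> ennreal) \<Rightarrow> nat \<Rightarrow> nat \<Rightarrow> ennreal" where
  "branch_energy b F J i = ennreal (exp (\<gamma> + dimn * i)) *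
     barrier_iter b 0 i (\<lambda>z. ennreal (exp (- (\<gamma> * z))) * (remaining b F J i z)\<^sup>2) 1"

context
  fixes b :: "nat \<Rightarrow> real" and F :: "nat \<Rightarrow> real \<Rightarrow> ennreal" and J :: nat
  assumes F[measurable]: "\<And>j. F j \<in> borel_measurable borel"
begin

lemma measurable_remaining [measurable]: "remaining b F J i \<in> borel_measurable borel"
  unfolding remaining_def by measurable

lemma measurable_score [measurable]: "score b F \<tau> j x \<in> borel_measurable P"
  unfolding score_def by measurable

lemma diagonal_bound:
  "(\<integral>\<^sup>+\<omega>. (ennreal (W b \<tau> i x \<omega>) * remaining b F J i (R \<tau> i x \<omega>))\<^sup>2 \<partial>P) \<le> branch_energy b F J i"
proof -
  have "(ennreal (W b \<tau> i x \<omega>) * remaining b F J i (R \<tau> i x \<omega>))\<^sup>2 \<le>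
     ennreal (exp (\<gamma> + dimn * i)) * (ennreal (W b \<tau> i x \<omega>) *
       (ennreal (exp (- (\<gamma> * R \<tau> i x \<omega>))) * (remaining b F J i (R \<tau> i x \<omega>))\<^sup>2))" for \<omega>
  proof -
    have "ennreal (W b \<tau> i x \<omega>) * ennreal (W b \<tau> i x \<omega>) \<le> ennreal (W b \<tau> i x \<omega>) * ennreal (exp (\<gamma> + dimn * i - \<gamma> * R \<tau> i x \<omega>))"
      by (intro mult_left_mono ennreal_leI W_le) auto
    also have "ennreal (exp (\<gamma> + dimn * i - \<gamma> * R \<tau> i x \<omega>)) = ennreal (exp (\<gamma> + dimn * i)) * ennreal (exp (- (\<gamma> * R \<tau> i x \<omega>)))"
      by (subst ennreal_mult[symmetric]) (auto simp: exp_add[symmetric])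
    finally have "ennreal (W b \<tau> i x \<omega>) * ennreal (W b \<tau> i x \<omega>) * (remaining b F J i (R \<tau> i x \<omega>))\<^sup>2 \<le>
      ennreal (W b \<tau> i x \<omega>) * (ennreal (exp (\<gamma> + dimn * i)) * ennreal (exp (- (\<gamma> * R \<tau> i x \<omega>)))) * (remaining b F J i (R \<tau> i x \<omega>))\<^sup>2"
      by (rule mult_right_mono) simp
    then show ?thesis by (simp add: power2_eq_square mult_ac)
  qed
  then have "(\<integral>\<^sup>+\<omega>. (ennreal (W b \<tau> i x \<omega>) * remaining b F J i (R \<tau> i x \<omega>))\<^sup>2 \<partial>P) \<le>
    (\<integral>\<^sup>+\<omega>. ennreal (exp (\<gamma> + dimn * i)) * (ennreal (W b \<tau> i x \<omega>) *
       (ennreal (exp (- (\<gamma> * R \<tau> i x \<omega>))) * (remaining b F J i (R \<tau> i x \<omega>))\<^sup>2)) \<partial>P)"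
    by (rule nn_integral_mono)
  also have "\<dots> = ennreal (exp (\<gamma> + dimn * i)) * (\<integral>\<^sup>+\<omega>. ennreal (W b \<tau> i x \<omega>) *
       (ennreal (exp (- (\<gamma> * R \<tau> i x \<omega>))) * (remaining b F J i (R \<tau> i x \<omega>))\<^sup>2) \<partial>P)"
    by (rule nn_integral_cmult) measurable
  also have "\<dots> = branch_energy b F J i"
    unfolding branch_energy_def
    by (subst weight_expectation[of "\<lambda>z. ennreal (exp (- (\<gamma> * z))) * (remaining b F J i z)\<^sup>2", symmetric]) auto
  finally show ?thesis .
qed

text \<open>\<open>2 * (a * b) \<le> a\<^sup>2 + b\<^sup>2\<close> removes the correlation between
  the two points: both squares are diagonal terms.\<close>

lemma pair_bound_step:
  assumes i: "i \<le> J" and f: "f = (\<lambda>\<omega>. score b F \<tau> i x \<omega>) \<or> f = (\<lambda>\<omega>. ennreal (W b \<tau> i x \<omega>) * remaining b F J i (R \<tau> i x \<omega>))"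
  shows "(\<integral>\<^sup>+\<omega>. f \<omega> * (ennreal (W b \<tau> i y \<omega>) * remaining b F J i (R \<tau> i y \<omega>)) \<partial>P) \<le> branch_energy b F J i"
proof -
  let ?X = "\<lambda>x \<omega>. ennreal (W b \<tau> i x \<omega>) * remaining b F J i (R \<tau> i x \<omega>)"
  have [measurable]: "f \<in> borel_measurable P" using f by auto
  have "F i r \<le> remaining b F J i r" for r
    unfolding remaining_def using member_le_sum[of i "{i..J}" "\<lambda>j. barrier_iter b i (j - i) (F j) r"] i by simp
  then have fle: "f \<omega> \<le> ?X x \<omega>" for \<omega>
    using f by (auto simp: score_def intro: mult_left_mono)
  have "2 * (\<integral>\<^sup>+\<omega>. f \<omega> * ?X y \<omega> \<partial>P) = (\<integral>\<^sup>+\<omega>. 2 * (f \<omega> * ?X y \<omega>) \<partial>P)"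
    by (rule nn_integral_cmult[symmetric]) measurable
  also have "\<dots> \<le> (\<integral>\<^sup>+\<omega>. (?X x \<omega>)\<^sup>2 + (?X y \<omega>)\<^sup>2 \<partial>P)"
  proof (rule nn_integral_mono)
    fix \<omega>
    have "2 * (f \<omega> * ?X y \<omega>) \<le> 2 * (?X x \<omega> * ?X y \<omega>)" using fle[of \<omega>] by (intro mult_left_mono mult_right_mono) auto
    also have "\<dots> \<le> (?X x \<omega>)\<^sup>2 + (?X y \<omega>)\<^sup>2" by (rule ennreal_two_mult_le)
    finally show "2 * (f \<omega> * ?X y \<omega>) \<le> (?X x \<omega>)\<^sup>2 + (?X y \<omega>)\<^sup>2" .
  qed
  also have "\<dots> = (\<integral>\<^sup>+\<omega>. (?X x \<omega>)\<^sup>2 \<partial>P) + (\<integral>\<^sup>+\<omega>. (?X y \<omega>)\<^sup>2 \<partial>P)" by (rule nn_integral_add) measurable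
  also have "\<dots> \<le> branch_energy b F J i + branch_energy b F J i" by (intro add_mono diagonal_bound)
  finally show ?thesis by (simp add: mult_2[symmetric] ennreal_mult_le_mult_iff)
qed

lemma score_remaining:
  assumes g: "g \<in> borel_measurable (generated_sigma P (past (\<tau> + i)))"
  shows "(\<integral>\<^sup>+\<omega>. g \<omega> * (\<Sum>j=i..J. score b F \<tau> j y \<omega>) \<partial>P) =
     (\<integral>\<^sup>+\<omega>. g \<omega> * (ennreal (W b \<tau> i y \<omega>) * remaining b F J i (R \<tau> i y \<omega>)) \<partial>P)"
proof -
  have gm[measurable]: "g \<in> borel_measurable P"
    by (rule measurable_from_generated_sigma[OF _ g]) (use past_in centred_gaussian_spaceD(3)[OF gaussian] in auto)
  have "(\<integral>\<^sup>+\<omega>. g \<omega> * (\<Sum>j=i..J. score b F \<tau> j y \<omega>) \<partial>P) = (\<Sum>j=i..J. \<integral>\<^sup>+\<omega>. g \<omega> * score b F \<tau> j y \<omega> \<partial>P)"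
    by (simp add: sum_distrib_left nn_integral_sum)
  also have "\<dots> = (\<Sum>j=i..J. \<integral>\<^sup>+\<omega>. g \<omega> * (ennreal (W b \<tau> i y \<omega>) * barrier_iter b i (j - i) (F j) (R \<tau> i y \<omega>)) \<partial>P)"
  proof (rule sum.cong[OF refl])
    fix j assume j: "j \<in> {i..J}"
    have "(\<integral>\<^sup>+\<omega>. g \<omega> * (ennreal (W b \<tau> (i + (j - i)) y \<omega>) * F j (R \<tau> (i + (j - i)) y \<omega>)) \<partial>P) =
      (\<integral>\<^sup>+\<omega>. g \<omega> * (ennreal (W b \<tau> i y \<omega>) * barrier_iter b i (j - i) (F j) (R \<tau> i y \<omega>)) \<partial>P)"
    proof (rule path_expectation[OF past_in])
      fix q assume "\<tau> + i \<le> q" then show "uncorrelated P (past (\<tau> + i)) {E q y}" by (rule uncorrelated_past)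
    next
      fix q assume "\<tau> \<le> q" "q < \<tau> + i"
      then show "E q y \<in> past (\<tau> + i)" by (auto simp: past_def)
    qed (use g in measurable)
    then show "(\<integral>\<^sup>+\<omega>. g \<omega> * score b F \<tau> j y \<omega> \<partial>P) =
      (\<integral>\<^sup>+\<omega>. g \<omega> * (ennreal (W b \<tau> i y \<omega>) * barrier_iter b i (j - i) (F j) (R \<tau> i y \<omega>)) \<partial>P)"
      using j by (simp add: score_def)
  qed
  also have "\<dots> = (\<integral>\<^sup>+\<omega>. (\<Sum>j=i..J. g \<omega> * (ennreal (W b \<tau> i y \<omega>) * barrier_iter b i (j - i) (F j) (R \<tau> i y \<omega>))) \<partial>P)"
    by (subst nn_integral_sum) auto
  also have "\<dots> = (\<integral>\<^sup>+\<omega>. g \<omega> * (ennreal (W b \<tau> i y \<omega>) * remaining b F J i (R \<tau> i y \<omega>)) \<partial>P)"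
    by (simp add: remaining_def sum_distrib_left)
  finally show ?thesis .
qed

lemma score_measurable_past: "score b F \<tau> i x \<in> borel_measurable (generated_sigma P (past (\<tau> + i)))"
proof -
  have inp: "E (\<tau> + k) z \<in> past (\<tau> + i)" if "k < i" for k z using that by (auto simp: past_def)
  have [measurable]: "R \<tau> i x \<in> borel_measurable (generated_sigma P (past (\<tau> + i)))"
      "W b \<tau> i x \<in> borel_measurable (generated_sigma P (past (\<tau> + i)))"
    using inp by (auto intro!: measurable_R_sigma measurable_W_sigma)
  show ?thesis unfolding score_def by measurable
qed

text \<open>Induction from late to early starting scales. If x and y are decorrelated from i on,
  both futures integrate out and only the energy at i remains. Otherwise the score at i is split off
  at either point; each of the two cross terms costs one energy at i, whence the factor 2, and what
  is left starts at i + 1. So scale k is charged only if it is the starting scale or the points are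
  still correlated at k - 1.\<close>

lemma pair_bound:
  "i \<le> Suc J \<Longrightarrow> (\<integral>\<^sup>+\<omega>. (\<Sum>j=i..J. score b F \<tau> j x \<omega>) * (\<Sum>j=i..J. score b F \<tau> j y \<omega>) \<partial>P) \<le>
     2 * (\<Sum>k=i..J. branch_energy b F J k * (if k = i \<or> exp (real (\<tau> + k - 1)) * dist x y < r0 then 1 else 0))"
proof (induction "Suc J - i" arbitrary: i)
  case 0
  then show ?case by simp
next
  case (Suc n)
  then have i: "i \<le> J" by simp
  let ?S = "\<lambda>i x \<omega>. \<Sum>j=i..J. score b F \<tau> j x \<omega>"
  let ?e = "\<lambda>i k. branch_energy b F J k * (if k = i \<or> exp (real (\<tau> + k - 1)) * dist x y < r0 then 1 else 0)"
  have split: "?S i x \<omega> = score b F \<tau> i x \<omega> + ?S (Suc i) x \<omega>" for x \<omega>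
    using i by (rule sum.atLeast_Suc_atMost)
  have splite: "(\<Sum>k=i..J. ?e i k) = branch_energy b F J i + (\<Sum>k=Suc i..J. ?e i k)"
    using sum.atLeast_Suc_atMost[OF i, of "?e i"] by simp
  show ?case
  proof (cases "r0 \<le> exp (real (\<tau> + i)) * dist x y")
    case True
    have "(\<integral>\<^sup>+\<omega>. ?S i x \<omega> * ?S i y \<omega> \<partial>P) = (\<Sum>j=i..J. \<Sum>j'=i..J. \<integral>\<^sup>+\<omega>. score b F \<tau> j x \<omega> * score b F \<tau> j' y \<omega> \<partial>P)"
      by (simp add: sum_product nn_integral_sum)
    also have "\<dots> = (\<Sum>j=i..J. \<Sum>j'=i..J. \<integral>\<^sup>+\<omega>. (ennreal (W b \<tau> i x \<omega>) * barrier_iter b i (j - i) (F j) (R \<tau> i x \<omega>)) *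
       (ennreal (W b \<tau> i y \<omega>) * barrier_iter b i (j' - i) (F j') (R \<tau> i y \<omega>)) \<partial>P)"
      unfolding score_def by (intro sum.cong refl two_point_expectation True) auto
    also have "\<dots> = (\<integral>\<^sup>+\<omega>. (\<Sum>j=i..J. ennreal (W b \<tau> i x \<omega>) * barrier_iter b i (j - i) (F j) (R \<tau> i x \<omega>)) *
       (\<Sum>j'=i..J. ennreal (W b \<tau> i y \<omega>) * barrier_iter b i (j' - i) (F j') (R \<tau> i y \<omega>)) \<partial>P)"
      by (simp add: sum_product nn_integral_sum)
    also have "\<dots> = (\<integral>\<^sup>+\<omega>. (ennreal (W b \<tau> i x \<omega>) * remaining b F J i (R \<tau> i x \<omega>)) *
       (ennreal (W b \<tau> i y \<omega>) * remaining b F J i (R \<tau> i y \<omega>)) \<partial>P)"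
      by (simp add: remaining_def sum_distrib_left)
    also have "\<dots> \<le> branch_energy b F J i" by (rule pair_bound_step[OF i]) auto
    also have "\<dots> \<le> 2 * (\<Sum>k=i..J. ?e i k)"
      unfolding splite by (simp add: mult_2 add_increasing2 add.assoc)
    finally show ?thesis .
  next
    case False
    \<comment> \<open>The induction hypothesis charges scale \<open>Suc i\<close> without condition;
      here that charge is legitimate since the points are not yet separated at scale i.\<close>
    have e: "(\<Sum>k=Suc i..J. ?e (Suc i) k) \<le> (\<Sum>k=Suc i..J. ?e i k)"
      using False by (intro sum_mono) auto
    have mS: "(\<lambda>\<omega>. ?S k z \<omega>) \<in> borel_measurable P" for k z by measurable
    have "(\<integral>\<^sup>+\<omega>. ?S i x \<omega> * ?S i y \<omega> \<partial>P) \<le>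
      (\<integral>\<^sup>+\<omega>. score b F \<tau> i x \<omega> * ?S i y \<omega> + (score b F \<tau> i y \<omega> * ?S i x \<omega> + ?S (Suc i) x \<omega> * ?S (Suc i) y \<omega>) \<partial>P)"
    proof (rule nn_integral_mono)
      fix \<omega>
      have "?S i x \<omega> * ?S i y \<omega> = score b F \<tau> i x \<omega> * ?S i y \<omega> + ?S (Suc i) x \<omega> * ?S i y \<omega>"
        by (subst split) (simp add: distrib_right)
      also have "?S (Suc i) x \<omega> * ?S i y \<omega> = score b F \<tau> i y \<omega> * ?S (Suc i) x \<omega> + ?S (Suc i) x \<omega> * ?S (Suc i) y \<omega>"
        by (subst split) (simp add: distrib_left mult.commute)
      also have "score b F \<tau> i y \<omega> * ?S (Suc i) x \<omega> \<le> score b F \<tau> i y \<omega> * ?S i x \<omega>"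
        by (intro mult_left_mono sum_mono2) auto
      finally show "?S i x \<omega> * ?S i y \<omega> \<le> score b F \<tau> i x \<omega> * ?S i y \<omega> + (score b F \<tau> i y \<omega> * ?S i x \<omega> + ?S (Suc i) x \<omega> * ?S (Suc i) y \<omega>)"
        by (simp add: add_mono)
    qed
    also have "\<dots> = (\<integral>\<^sup>+\<omega>. score b F \<tau> i x \<omega> * ?S i y \<omega> \<partial>P) + ((\<integral>\<^sup>+\<omega>. score b F \<tau> i y \<omega> * ?S i x \<omega> \<partial>P) +
        (\<integral>\<^sup>+\<omega>. ?S (Suc i) x \<omega> * ?S (Suc i) y \<omega> \<partial>P))"
      using mS by (subst nn_integral_add, simp, simp, subst nn_integral_add) auto
    also have "\<dots> \<le> branch_energy b F J i + (branch_energy b F J i + 2 * (\<Sum>k=Suc i..J. ?e i k))"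
    proof (intro add_mono)
      show "(\<integral>\<^sup>+\<omega>. score b F \<tau> i x \<omega> * ?S i y \<omega> \<partial>P) \<le> branch_energy b F J i"
        unfolding score_remaining[OF score_measurable_past] by (rule pair_bound_step[OF i]) auto
      show "(\<integral>\<^sup>+\<omega>. score b F \<tau> i y \<omega> * ?S i x \<omega> \<partial>P) \<le> branch_energy b F J i"
        unfolding score_remaining[OF score_measurable_past] by (rule pair_bound_step[OF i]) auto
      have "(\<integral>\<^sup>+\<omega>. ?S (Suc i) x \<omega> * ?S (Suc i) y \<omega> \<partial>P) \<le> 2 * (\<Sum>k=Suc i..J. ?e (Suc i) k)"
        using Suc.hyps(2) i by (intro Suc.hyps(1)) auto
      also have "\<dots> \<le> 2 * (\<Sum>k=Suc i..J. ?e i k)" using e by (intro mult_left_mono) auto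
      finally show "(\<integral>\<^sup>+\<omega>. ?S (Suc i) x \<omega> * ?S (Suc i) y \<omega> \<partial>P) \<le> 2 * (\<Sum>k=Suc i..J. ?e i k)" .
    qed
    also have "\<dots> = 2 * (\<Sum>k=i..J. ?e i k)" unfolding splite by (simp add: distrib_left mult_2 add_ac)
    finally show ?thesis .
  qed
qed

end

end

section \<open>Second moments and large deviations of weighted volumes\<close>

lemma measurable_pair_lborel: "borel_measurable (N \<Otimes>\<^sub>M lborel) = borel_measurable (N \<Otimes>\<^sub>M borel)"
  by (rule measurable_cong_sets) (auto intro: sets_pair_measure_cong)

lemma mult_swap_real:
  fixes s a b e t w :: real
  assumes "a * b = e * t"
  shows "s * (a * (b * w)) = e * ((s * t) * w)"
proof -
  have "s * (a * (b * w)) = (a * b) * (s * w)" by (simp only: mult_ac)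
  then show ?thesis unfolding assms by (simp only: mult_ac)
qed

lemma ennreal_mult_swap:
  fixes g e a f k e' :: ennreal
  assumes "e * a = k * e'"
  shows "(g * e) * (a * f) = (g * (k * f)) * e'"
proof -
  have "(g * e) * (a * f) = g * (e * a) * f" by (simp only: mult_ac)
  also have "\<dots> = (g * (k * f)) * e'" unfolding assms by (simp only: mult_ac)
  finally show ?thesis .
qed

lemma ennreal_mult_swap2:
  fixes g a b f d e :: ennreal
  assumes "a * b = e * d"
  shows "a * (g * (b * f)) = (e * g) * (d * f)"
proof -
  have "a * (g * (b * f)) = g * (a * b) * f" by (simp only: mult_ac)
  then show ?thesis unfolding assms by (simp only: mult_ac)
qed

section \<open>Second moment of a weighted volume\<close>

context gaussian_noise
begin

lemma measurable_E_pair [measurable]: "(\<lambda>z. E n (snd z) (fst z)) \<in> borel_measurable (P \<Otimes>\<^sub>M lborel)"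
proof -
  have "(\<lambda>(\<omega>, x). E n x \<omega>) \<in> borel_measurable (P \<Otimes>\<^sub>M borel)"
    by (rule measurable_continuous_field) (use E_cont in auto)
  then show ?thesis by (simp add: measurable_pair_lborel case_prod_beta)
qed

lemma measurable_R_pair [measurable]: "(\<lambda>z. R \<tau> j (snd z) (fst z)) \<in> borel_measurable (P \<Otimes>\<^sub>M lborel)"
  unfolding R_def by (rule measurable_path) measurable

lemma measurable_W_pair [measurable]: "(\<lambda>z. W b \<tau> j (snd z) (fst z)) \<in> borel_measurable (P \<Otimes>\<^sub>M lborel)"
  unfolding W_def by (rule measurable_weight) measurable

lemma measurable_score_pair:
  assumes [measurable]: "\<And>j. F j \<in> borel_measurable borel"
  shows "(\<lambda>z. score b F \<tau> j (snd z) (fst z)) \<in> borel_measurable (P \<Otimes>\<^sub>M lborel)"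
  unfolding score_def by measurable

text \<open>Points not separated at scale k - 1 lie in a ball of radius
  \<open>r0 * exp 1 * exp (- (\<tau> + k))\<close>. Its volume times the prefactor
  \<open>exp (\<gamma> + dimn * k)\<close> of the energy is
  \<open>exp (- (dimn * \<tau>)) * branch_const\<close>, for every k.\<close>

definition branch_const :: real where
  "branch_const = unit_ball_vol dimn * (r0 * exp 1) ^ DIM('a) * exp \<gamma>"

lemma branch_const_nonneg: "0 \<le> branch_const"
  unfolding branch_const_def using r0_pos by (intro mult_nonneg_nonneg) (auto simp: dimn_eq)

definition total :: "(nat \<Rightarrow> real) \<Rightarrow> (nat \<Rightarrow> real \<Rightarrow> ennreal) \<Rightarrow> nat \<Rightarrow> nat \<Rightarrow> 'a set \<Rightarrow> 'w \<Rightarrow> ennreal" where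
  "total b F J \<tau> Q \<omega> = (\<integral>\<^sup>+x. indicator Q x * (\<Sum>j=0..J. score b F \<tau> j x \<omega>) \<partial>lborel)"

text \<open>\<open>pair_bound\<close> integrated over pairs of points of Q. For
  \<open>k \<ge> 1\<close> the volume of the partners that are still correlated cancels the growth
  \<open>exp (dimn * k)\<close> of the energy, which is where criticality enters. The term k = 0
  restricts no distances and gives twice the squared mean.\<close>

lemma second_moment:
  assumes F[measurable]: "\<And>j. F j \<in> borel_measurable borel" and Q[measurable]: "Q \<in> sets borel"
  shows "(\<integral>\<^sup>+\<omega>. (total b F J \<tau> Q \<omega>)\<^sup>2 \<partial>P) \<le> 2 * (emeasure lborel Q)\<^sup>2 * (remaining b F J 0 1)\<^sup>2 +
    2 * emeasure lborel Q * ennreal (exp (- (dimn * \<tau>)) * branch_const) *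
      (\<Sum>k=1..J. barrier_iter b 0 k (\<lambda>z. ennreal (exp (- (\<gamma> * z))) * (remaining b F J k z)\<^sup>2) 1)"
proof -
  interpret PL: pair_sigma_finite P "lborel :: 'a measure" ..
  let ?m = "emeasure lborel Q"
  let ?S = "\<lambda>x \<omega>. \<Sum>j=0..J. score b F \<tau> j x \<omega>"
  note measurable_score_pair[of F, OF F, measurable]
  define h where "h \<omega> x = indicator Q x * ?S x \<omega>" for \<omega> x
  have hm[measurable]: "(\<lambda>z. h (fst z) (snd z)) \<in> borel_measurable (P \<Otimes>\<^sub>M lborel)"
    unfolding h_def by measurable
  have hmx[measurable]: "h \<omega> \<in> borel_measurable lborel" if "\<omega> \<in> space P" for \<omega>
    using measurable_compose[OF measurable_Pair1'[OF that] hm] by simp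
  have hmo[measurable]: "(\<lambda>\<omega>. h \<omega> x) \<in> borel_measurable P" for x
    using measurable_compose[OF measurable_Pair2'[of x lborel P] hm] by simp
  let ?\<chi> = "\<lambda>k x y. if k = 0 \<or> exp (real (\<tau> + k - 1)) * dist x y < r0 then 1 else (0::ennreal)"
  have \<chi>m[measurable]: "(\<lambda>x. ?\<chi> k x y) \<in> borel_measurable lborel" "(\<lambda>y. ?\<chi> k x y) \<in> borel_measurable lborel" for k x y
    by measurable
  have \<chi>p[measurable]: "(\<lambda>z. ?\<chi> k (fst z) (snd z)) \<in> borel_measurable (lborel \<Otimes>\<^sub>M lborel)" for k
    by measurable
  have "(\<integral>\<^sup>+\<omega>. (total b F J \<tau> Q \<omega>)\<^sup>2 \<partial>P) = (\<integral>\<^sup>+\<omega>. \<integral>\<^sup>+x. \<integral>\<^sup>+y. h \<omega> x * h \<omega> y \<partial>lborel \<partial>lborel \<partial>P)"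
  proof (rule nn_integral_cong)
    fix \<omega> assume w: "\<omega> \<in> space P"
    note hmx[OF w, measurable]
    show "(total b F J \<tau> Q \<omega>)\<^sup>2 = (\<integral>\<^sup>+x. \<integral>\<^sup>+y. h \<omega> x * h \<omega> y \<partial>lborel \<partial>lborel)"
      unfolding total_def h_def[symmetric] power2_eq_square
      by (simp add: nn_integral_cmult nn_integral_multc)
  qed
  also have "\<dots> = (\<integral>\<^sup>+x. \<integral>\<^sup>+\<omega>. \<integral>\<^sup>+y. h \<omega> x * h \<omega> y \<partial>lborel \<partial>P \<partial>lborel)"
  proof (rule PL.Fubini'[symmetric])
    have "(\<lambda>p. h (fst (fst p)) (snd (fst p)) * h (fst (fst p)) (snd p)) \<in> borel_measurable ((P \<Otimes>\<^sub>M lborel) \<Otimes>\<^sub>M lborel)"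
    proof (rule borel_measurable_times_ennreal)
      show "(\<lambda>p. h (fst (fst p)) (snd (fst p))) \<in> borel_measurable ((P \<Otimes>\<^sub>M lborel) \<Otimes>\<^sub>M lborel)"
        by (rule measurable_compose[OF measurable_fst hm])
      have "(\<lambda>p. (fst (fst p), snd p)) \<in> measurable ((P \<Otimes>\<^sub>M lborel) \<Otimes>\<^sub>M lborel) (P \<Otimes>\<^sub>M lborel)"
        by (rule measurable_Pair) (auto intro: measurable_compose[OF measurable_fst measurable_fst])
      from measurable_compose[OF this hm]
      show "(\<lambda>p. h (fst (fst p)) (snd p)) \<in> borel_measurable ((P \<Otimes>\<^sub>M lborel) \<Otimes>\<^sub>M lborel)" by simp
    qed
    from lborel.borel_measurable_nn_integral_fst[OF this]
    show "(\<lambda>(\<omega>, x). \<integral>\<^sup>+y. h \<omega> x * h \<omega> y \<partial>lborel) \<in> borel_measurable (P \<Otimes>\<^sub>M lborel)"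
      by (simp add: case_prod_beta)
  qed
  also have "\<dots> = (\<integral>\<^sup>+x. \<integral>\<^sup>+y. \<integral>\<^sup>+\<omega>. h \<omega> x * h \<omega> y \<partial>P \<partial>lborel \<partial>lborel)"
    by (intro nn_integral_cong PL.Fubini'[symmetric]) (simp add: case_prod_beta)
  also have "\<dots> \<le> (\<integral>\<^sup>+x. \<integral>\<^sup>+y. (\<Sum>k=0..J. 2 * branch_energy b F J k * (indicator Q x * (indicator Q y * ?\<chi> k x y))) \<partial>lborel \<partial>lborel)"
  proof (intro nn_integral_mono)
    fix x y
    have "(\<integral>\<^sup>+\<omega>. h \<omega> x * h \<omega> y \<partial>P) = indicator Q x * indicator Q y * (\<integral>\<^sup>+\<omega>. ?S x \<omega> * ?S y \<omega> \<partial>P)"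
      unfolding h_def by (subst nn_integral_cmult[symmetric]) (auto simp: mult_ac intro!: measurable_score F borel_measurable_sum borel_measurable_times)
    also have "\<dots> \<le> indicator Q x * indicator Q y * (2 * (\<Sum>k=0..J. branch_energy b F J k * ?\<chi> k x y))"
      by (intro mult_left_mono pair_bound F) auto
    finally show "(\<integral>\<^sup>+\<omega>. h \<omega> x * h \<omega> y \<partial>P) \<le> (\<Sum>k=0..J. 2 * branch_energy b F J k * (indicator Q x * (indicator Q y * ?\<chi> k x y)))"
      by (simp add: sum_distrib_left mult_ac)
  qed
  also have "\<dots> = (\<Sum>k=0..J. 2 * branch_energy b F J k * (\<integral>\<^sup>+x. indicator Q x * (\<integral>\<^sup>+y. indicator Q y * ?\<chi> k x y \<partial>lborel) \<partial>lborel))"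
  proof -
    have [measurable]: "(\<lambda>x. \<integral>\<^sup>+y. indicator Q y * ?\<chi> k x y \<partial>lborel) \<in> borel_measurable lborel" for k
      by measurable
    show ?thesis
      by (simp add: nn_integral_sum nn_integral_cmult)
  qed
  also have "\<dots> \<le> (\<Sum>k=0..J. if k = 0 then 2 * ?m\<^sup>2 * (remaining b F J 0 1)\<^sup>2 else 2 * ?m * ennreal (exp (- (dimn * \<tau>)) * branch_const) *
      barrier_iter b 0 k (\<lambda>z. ennreal (exp (- (\<gamma> * z))) * (remaining b F J k z)\<^sup>2) 1)"
  proof (rule sum_mono)
    fix k
    show "2 * branch_energy b F J k * (\<integral>\<^sup>+x. indicator Q x * (\<integral>\<^sup>+y. indicator Q y * ?\<chi> k x y \<partial>lborel) \<partial>lborel) \<le>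
      (if k = 0 then 2 * ?m\<^sup>2 * (remaining b F J 0 1)\<^sup>2 else 2 * ?m * ennreal (exp (- (dimn * \<tau>)) * branch_const) *
      barrier_iter b 0 k (\<lambda>z. ennreal (exp (- (\<gamma> * z))) * (remaining b F J k z)\<^sup>2) 1)"
    proof (cases "k = 0")
      case True
      have "branch_energy b F J 0 = (remaining b F J 0 1)\<^sup>2"
        unfolding branch_energy_def by (simp add: mult.assoc[symmetric] ennreal_mult[symmetric] exp_add[symmetric])
      then show ?thesis using True by (simp add: nn_integral_multc power2_eq_square mult_ac)
    next
      case False
      define \<rho> where "\<rho> = r0 * exp (- real (\<tau> + k - 1))"
      have \<rho>: "0 < \<rho>" using r0_pos by (simp add: \<rho>_def)
      have "(\<integral>\<^sup>+y. indicator Q y * ?\<chi> k x y \<partial>lborel) \<le> ennreal (unit_ball_vol dimn * \<rho> ^ DIM('a))" for x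
      proof -
        have "(\<integral>\<^sup>+y. indicator Q y * ?\<chi> k x y \<partial>lborel) \<le> (\<integral>\<^sup>+y. indicator (ball x \<rho>) y \<partial>lborel)"
        proof (rule nn_integral_mono)
          fix y
          show "indicator Q y * ?\<chi> k x y \<le> indicator (ball x \<rho>) y"
          proof (cases "exp (real (\<tau> + k - 1)) * dist x y < r0")
            case True
            have "\<rho> = r0 / exp (real (\<tau> + k - 1))" by (simp add: \<rho>_def exp_minus divide_inverse)
            with True have "dist x y < \<rho>"
              using pos_less_divide_eq[of "exp (real (\<tau> + k - 1))" "dist x y" r0] by (simp only: exp_gt_zero mult.commute)
            then show ?thesis by (simp add: indicator_def)
          qed (use \<open>k \<noteq> 0\<close> in \<open>simp only: if_False simp_thms mult_zero_right zero_le\<close>)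
        qed
        also have "\<dots> = ennreal (unit_ball_vol dimn * \<rho> ^ DIM('a))"
          using \<rho> by (simp add: emeasure_ball dimn_eq)
        finally show ?thesis .
      qed
      then have "(\<integral>\<^sup>+x. indicator Q x * (\<integral>\<^sup>+y. indicator Q y * ?\<chi> k x y \<partial>lborel) \<partial>lborel) \<le>
         (\<integral>\<^sup>+x. indicator Q x * ennreal (unit_ball_vol dimn * \<rho> ^ DIM('a)) \<partial>lborel)"
        by (intro nn_integral_mono mult_left_mono) auto
      also have "\<dots> = ?m * ennreal (unit_ball_vol dimn * \<rho> ^ DIM('a))" by (simp add: nn_integral_multc)
      finally have "2 * branch_energy b F J k * (\<integral>\<^sup>+x. indicator Q x * (\<integral>\<^sup>+y. indicator Q y * ?\<chi> k x y \<partial>lborel) \<partial>lborel) \<le>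
        2 * branch_energy b F J k * (?m * ennreal (unit_ball_vol dimn * \<rho> ^ DIM('a)))"
        by (intro mult_left_mono) auto
      also have "\<dots> = 2 * ?m * (ennreal (exp (\<gamma> + dimn * k)) * ennreal (unit_ball_vol dimn * \<rho> ^ DIM('a))) *
        barrier_iter b 0 k (\<lambda>z. ennreal (exp (- (\<gamma> * z))) * (remaining b F J k z)\<^sup>2) 1"
        unfolding branch_energy_def by (simp add: mult_ac)
      also have "ennreal (exp (\<gamma> + dimn * k)) * ennreal (unit_ball_vol dimn * \<rho> ^ DIM('a)) = ennreal (exp (- (dimn * \<tau>)) * branch_const)"
      proof -
        have "\<rho> ^ DIM('a) = r0 ^ DIM('a) * exp (dimn * (- real (\<tau> + k - 1)))"
          by (simp add: \<rho>_def power_mult_distrib exp_of_nat_mult[symmetric] dimn_eq)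
        moreover have "dimn * (- real (\<tau> + k - 1)) = dimn - dimn * \<tau> - dimn * k"
          using False by (simp add: of_nat_diff algebra_simps)
        moreover have "exp dimn = exp 1 ^ DIM('a)" by (simp add: exp_of_nat_mult[symmetric] dimn_eq)
        ultimately have \<rho>d: "\<rho> ^ DIM('a) = r0 ^ DIM('a) * exp (dimn - dimn * \<tau> - dimn * k)"
          and e1: "exp dimn = exp 1 ^ DIM('a)" by simp_all
        have "exp (\<gamma> + dimn * k) * exp (dimn - dimn * \<tau> - dimn * k) = exp \<gamma> * exp dimn * exp (- (dimn * \<tau>))"
          by (simp only: exp_add[symmetric]) simp
        then have "exp (\<gamma> + dimn * k) * (unit_ball_vol dimn * \<rho> ^ DIM('a)) =
            unit_ball_vol dimn * r0 ^ DIM('a) * (exp \<gamma> * exp dimn * exp (- (dimn * \<tau>)))"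
          unfolding \<rho>d by (metis (no_types) mult.assoc mult.left_commute)
        then have "exp (\<gamma> + dimn * k) * (unit_ball_vol dimn * \<rho> ^ DIM('a)) = exp (- (dimn * \<tau>)) * branch_const"
          unfolding branch_const_def power_mult_distrib e1 by (simp only: mult_ac)
        then show ?thesis using \<rho> by (subst ennreal_mult[symmetric]) (auto simp: dimn_eq)
      qed
      finally show ?thesis using False by simp
    qed
  qed
  also have "\<dots> = 2 * ?m\<^sup>2 * (remaining b F J 0 1)\<^sup>2 + (\<Sum>k=1..J. 2 * ?m * ennreal (exp (- (dimn * \<tau>)) * branch_const) *
      barrier_iter b 0 k (\<lambda>z. ennreal (exp (- (\<gamma> * z))) * (remaining b F J k z)\<^sup>2) 1)"
    by (simp add: sum.atLeast_Suc_atMost)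
  finally show ?thesis by (simp add: sum_distrib_left)
qed

section \<open>Displacement of the field inside a cell\<close>

definition displacement :: "nat \<Rightarrow> nat \<Rightarrow> 'a \<Rightarrow> 'a \<Rightarrow> 'w \<Rightarrow> real" where
  "displacement \<tau> j x y \<omega> = (\<Sum>i<j. E (\<tau> + i) y \<omega> - E (\<tau> + i) x \<omega>)"

lemma measurable_displacement [measurable]: "displacement \<tau> j x y \<in> borel_measurable P"
  unfolding displacement_def[abs_def] by measurable

lemma measurable_displacement_past:
  "displacement \<tau> j x y \<in> borel_measurable (generated_sigma P (past (\<tau> + j)))"
  unfolding displacement_def[abs_def]
  by (intro borel_measurable_sum borel_measurable_diff measurable_generated_sigma) (auto simp: past_def)

text \<open>The total drift that weighting by \<open>exp (- displacement)\<close> induces on the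
  path at x: each layer lowers its mean by 1 minus the correlation.\<close>

definition shift :: "nat \<Rightarrow> nat \<Rightarrow> 'a \<Rightarrow> 'a \<Rightarrow> real" where
  "shift \<tau> j x y = (\<Sum>i<j. 1 - c (\<tau> + i) x y)"

lemma shift_nonneg: "0 \<le> shift \<tau> j x y"
  unfolding shift_def using c_le_1 by (intro sum_nonneg) auto

text \<open>Write \<open>E q y = c q x y * E q x + \<epsilon>\<close> with \<open>\<epsilon>\<close>
  independent of A and of \<open>E q x\<close>. Then \<open>exp (- (E q y - E q x))\<close> equals
  \<open>exp (\<mu> * E q x) * exp (- \<epsilon>)\<close>. The second factor has mean at most
  \<open>exp \<mu>\<close>; the first strengthens the tilt from \<open>\<gamma>\<close> to
  \<open>\<gamma> + \<mu>\<close> and thereby lowers the mean of the next position by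
  \<open>\<mu>\<close>. The starting point inside the bridge weight is unaffected. With
  \<open>\<mu> \<le> 1\<close> the costs \<open>\<gamma> * \<mu>\<close>,
  \<open>\<mu>\<^sup>2 / 2\<close> and \<open>\<mu>\<close> fit into
  \<open>(\<gamma> + 2) * \<mu>\<close>.\<close>

lemma one_step_chernoff:
  fixes x y :: 'a
  assumes A: "A \<subseteq> H" and u: "\<And>z. uncorrelated P A {E q z}"
    and G[measurable]: "G \<in> borel_measurable (generated_sigma P A)" and S[measurable]: "S \<in> borel_measurable (generated_sigma P A)"
    and F[measurable]: "F \<in> borel_measurable borel"
  defines "\<mu> \<equiv> 1 - c q x y"
  shows "(\<integral>\<^sup>+\<omega>. (G \<omega> * ennreal (exp (- (E q y \<omega> - E q x \<omega>)))) *
      (ennreal (exp (\<gamma> * E q x \<omega> - \<gamma>\<^sup>2 / 2) * bridge_weight (S \<omega> - b) (S \<omega> + \<gamma> - E q x \<omega> - b)) * F (S \<omega> + \<gamma> - E q x \<omega>)) \<partial>P)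
    \<le> ennreal (exp ((\<gamma> + 2) * \<mu>)) *
      (\<integral>\<^sup>+\<omega>. G \<omega> * (\<integral>\<^sup>+z. ennreal (std_normal_density (z - (S \<omega> - \<mu> - b)) * bridge_weight (S \<omega> - b) z) * F (z + b) \<partial>lborel) \<partial>P)"
proof -
  let ?c = "c q x y"
  have \<mu>: "0 \<le> \<mu>" "\<mu> \<le> 1" using c_nonneg[of q x y] c_le_1[of q x y] by (auto simp: \<mu>_def)
  have AH: "A \<subseteq> borel_measurable P" using A centred_gaussian_spaceD(3)[OF gaussian] by auto
  define \<epsilon> where "\<epsilon> \<omega> = E q y \<omega> - ?c * E q x \<omega>" for \<omega>
  have \<epsilon>H: "\<epsilon> \<in> H" unfolding \<epsilon>_def[abs_def]
    by (intro centred_gaussian_space_diff[OF gaussian] centred_gaussian_spaceD(5)[OF gaussian] E_in)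
  have n\<epsilon>H: "(\<lambda>\<omega>. - \<epsilon> \<omega>) \<in> H" using centred_gaussian_spaceD(5)[OF gaussian \<epsilon>H, of "-1"] by simp
  have int: "integrable P (\<lambda>\<omega>. f \<omega> * g \<omega>)" if "f \<in> H" "g \<in> H" for f g
  proof -
    have fg: "(\<lambda>\<omega>. f \<omega> + g \<omega>) \<in> H" using that centred_gaussian_spaceD(4)[OF gaussian] by auto
    have "integrable P (\<lambda>\<omega>. ((f \<omega> + g \<omega>)\<^sup>2 - (f \<omega>)\<^sup>2 - (g \<omega>)\<^sup>2) / 2)"
      using gaussian_square_integrable[OF centred_gaussian_spaceD(1,2)[OF gaussian]] that fg by auto
    then show ?thesis by (simp add: power2_sum field_simps)
  qed
  have intE: "integrable P (\<lambda>\<omega>. E q a \<omega> * E q a' \<omega>)" for a a' using int E_in by auto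
  have var: "(\<integral>\<omega>. (- \<epsilon> \<omega>)\<^sup>2 \<partial>P) = 1 - ?c\<^sup>2"
  proof -
    have "(\<integral>\<omega>. (- \<epsilon> \<omega>)\<^sup>2 \<partial>P) = (\<integral>\<omega>. E q y \<omega> * E q y \<omega> - 2 * ?c * (E q x \<omega> * E q y \<omega>) + ?c\<^sup>2 * (E q x \<omega> * E q x \<omega>) \<partial>P)"
      by (rule Bochner_Integration.integral_cong) (auto simp: \<epsilon>_def power2_eq_square algebra_simps)
    also have "\<dots> = 1 - 2 * ?c * ?c + ?c\<^sup>2 * 1" using intE cov c_self by simp
    finally show ?thesis by (simp add: power2_eq_square)
  qed
  have Ee: "(\<integral>\<^sup>+\<omega>. ennreal (exp (- \<epsilon> \<omega>)) \<partial>P) \<le> ennreal (exp \<mu>)"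
  proof -
    have "(\<integral>\<^sup>+\<omega>. ennreal (exp (- \<epsilon> \<omega>)) \<partial>P) = ennreal (exp ((1 - ?c\<^sup>2) / 2))"
      using gaussian_exp_moment[OF centred_gaussian_spaceD(1,2)[OF gaussian n\<epsilon>H]] n\<epsilon>H var by simp
    also have "(1 - ?c\<^sup>2) / 2 \<le> \<mu>"
    proof -
      have "\<mu> * (1 + ?c) \<le> \<mu> * 2" using \<mu> c_le_1[of q x y] by (intro mult_left_mono) auto
      moreover have "1 - ?c\<^sup>2 = \<mu> * (1 + ?c)" by (simp add: \<mu>_def power2_eq_square algebra_simps)
      ultimately show ?thesis by simp
    qed
    finally show ?thesis by (simp add: ennreal_leI)
  qed
  define B where "B = insert (E q x) A"
  have B: "B \<subseteq> H" using A E_in by (auto simp: B_def)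
  have uB: "uncorrelated P B {\<epsilon>}"
  proof -
    have "(\<integral>\<omega>. f \<omega> * \<epsilon> \<omega> \<partial>P) = 0" if f: "f \<in> B" for f
    proof -
      have fH: "f \<in> H" using f B by auto
      have "(\<integral>\<omega>. f \<omega> * \<epsilon> \<omega> \<partial>P) = (\<integral>\<omega>. f \<omega> * E q y \<omega> - ?c * (f \<omega> * E q x \<omega>) \<partial>P)"
        by (rule Bochner_Integration.integral_cong) (auto simp: \<epsilon>_def algebra_simps)
      also have "\<dots> = (\<integral>\<omega>. f \<omega> * E q y \<omega> \<partial>P) - ?c * (\<integral>\<omega>. f \<omega> * E q x \<omega> \<partial>P)"
        using int[OF fH E_in] by simp
      also have "\<dots> = 0" using f u[of x] u[of y] cov c_self by (auto simp: B_def uncorrelated_def)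
      finally show ?thesis .
    qed
    then show ?thesis by (auto simp: uncorrelated_def)
  qed
  have [measurable]: "E q x \<in> borel_measurable (generated_sigma P B)"
    by (rule measurable_generated_sigma) (auto simp: B_def)
  have [measurable]: "G \<in> borel_measurable (generated_sigma P B)" "S \<in> borel_measurable (generated_sigma P B)"
    by (rule measurable_generated_sigma_mono[of A], simp add: B_def subset_insertI, measurable)+
  have [measurable]: "\<epsilon> \<in> borel_measurable (generated_sigma P {\<epsilon>})" by (rule measurable_generated_sigma) simp
  define K where "K \<omega> u = ennreal (exp (\<mu> * u) * (exp (\<gamma> * u - \<gamma>\<^sup>2 / 2) * bridge_weight (S \<omega> - b) (S \<omega> + \<gamma> - u - b))) * F (S \<omega> + \<gamma> - u)" for \<omega> u
  have "(\<integral>\<^sup>+\<omega>. (G \<omega> * ennreal (exp (- (E q y \<omega> - E q x \<omega>)))) *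
      (ennreal (exp (\<gamma> * E q x \<omega> - \<gamma>\<^sup>2 / 2) * bridge_weight (S \<omega> - b) (S \<omega> + \<gamma> - E q x \<omega> - b)) * F (S \<omega> + \<gamma> - E q x \<omega>)) \<partial>P)
    = (\<integral>\<^sup>+\<omega>. (G \<omega> * K \<omega> (E q x \<omega>)) * ennreal (exp (- \<epsilon> \<omega>)) \<partial>P)"
  proof (rule nn_integral_cong)
    fix \<omega>
    let ?b = "exp (\<gamma> * E q x \<omega> - \<gamma>\<^sup>2 / 2) * bridge_weight (S \<omega> - b) (S \<omega> + \<gamma> - E q x \<omega> - b)"
    have "exp (- (E q y \<omega> - E q x \<omega>)) = exp (\<mu> * E q x \<omega>) * exp (- \<epsilon> \<omega>)"
      by (simp add: exp_add[symmetric] \<epsilon>_def \<mu>_def algebra_simps)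
    then have "ennreal (exp (- (E q y \<omega> - E q x \<omega>))) * ennreal ?b = ennreal (exp (\<mu> * E q x \<omega>) * ?b) * ennreal (exp (- \<epsilon> \<omega>))"
      by (simp add: ennreal_mult'[symmetric] bridge_weight_nonneg mult_ac)
    then show "(G \<omega> * ennreal (exp (- (E q y \<omega> - E q x \<omega>)))) * (ennreal ?b * F (S \<omega> + \<gamma> - E q x \<omega>)) =
      (G \<omega> * K \<omega> (E q x \<omega>)) * ennreal (exp (- \<epsilon> \<omega>))"
      unfolding K_def by (rule ennreal_mult_swap)
  qed
  also have "\<dots> = (\<integral>\<^sup>+\<omega>. G \<omega> * K \<omega> (E q x \<omega>) \<partial>P) * (\<integral>\<^sup>+\<omega>. ennreal (exp (- \<epsilon> \<omega>)) \<partial>P)"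
    by (rule indep_nn_integral_mult[OF gaussian B _ uB]) (use \<epsilon>H in \<open>auto simp: K_def\<close>)
  also have "\<dots> \<le> (\<integral>\<^sup>+\<omega>. G \<omega> * K \<omega> (E q x \<omega>) \<partial>P) * ennreal (exp \<mu>)" by (intro mult_left_mono Ee) auto
  also have "(\<integral>\<^sup>+\<omega>. G \<omega> * K \<omega> (E q x \<omega>) \<partial>P) = (\<integral>\<^sup>+\<omega>. \<integral>\<^sup>+u. ennreal (std_normal_density u) * (G \<omega> * K \<omega> u) \<partial>lborel \<partial>P)"
    using indep_freeze[OF gaussian A E_in u E_std_normal, of "\<lambda>(\<omega>, u). G \<omega> * K \<omega> u" x]
    by (simp add: K_def)
  also have "\<dots> = (\<integral>\<^sup>+\<omega>. ennreal (exp (\<gamma> * \<mu> + \<mu>\<^sup>2 / 2)) * (G \<omega> * (\<integral>\<^sup>+z. ennreal (std_normal_density (z - (S \<omega> - \<mu> - b)) * bridge_weight (S \<omega> - b) z) * F (z + b) \<partial>lborel)) \<partial>P)"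
  proof (rule nn_integral_cong)
    fix \<omega>
    let ?r = "S \<omega>"
    let ?f = "\<lambda>u. ennreal (std_normal_density (u - (\<gamma> + \<mu>)) * bridge_weight (?r - b) (?r + \<gamma> - u - b)) * F (?r + \<gamma> - u)"
    have "(\<integral>\<^sup>+u. ennreal (std_normal_density u) * (G \<omega> * K \<omega> u) \<partial>lborel) = (\<integral>\<^sup>+u. (ennreal (exp (\<gamma> * \<mu> + \<mu>\<^sup>2 / 2)) * G \<omega>) * ?f u \<partial>lborel)"
    proof (rule nn_integral_cong)
      fix u
      have "\<mu> * u + (\<gamma> * u - \<gamma>\<^sup>2 / 2) = (\<gamma> * \<mu> + \<mu>\<^sup>2 / 2) + ((\<gamma> + \<mu>) * u - (\<gamma> + \<mu>)\<^sup>2 / 2)"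
        by (simp add: power2_eq_square field_simps)
      then have "exp (\<mu> * u) * exp (\<gamma> * u - \<gamma>\<^sup>2 / 2) = exp (\<gamma> * \<mu> + \<mu>\<^sup>2 / 2) * exp ((\<gamma> + \<mu>) * u - (\<gamma> + \<mu>)\<^sup>2 / 2)"
        by (simp only: exp_add[symmetric])
      then have "std_normal_density u * (exp (\<mu> * u) * (exp (\<gamma> * u - \<gamma>\<^sup>2 / 2) * \<beta>)) =
         exp (\<gamma> * \<mu> + \<mu>\<^sup>2 / 2) * (std_normal_density (u - (\<gamma> + \<mu>)) * \<beta>)" for \<beta>
        unfolding std_normal_tilt[symmetric] by (rule mult_swap_real)
      then have "ennreal (std_normal_density u) * ennreal (exp (\<mu> * u) * (exp (\<gamma> * u - \<gamma>\<^sup>2 / 2) * bridge_weight (?r - b) (?r + \<gamma> - u - b)))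
        = ennreal (exp (\<gamma> * \<mu> + \<mu>\<^sup>2 / 2)) * ennreal (std_normal_density (u - (\<gamma> + \<mu>)) * bridge_weight (?r - b) (?r + \<gamma> - u - b))"
        by (subst (1 2) ennreal_mult[symmetric]) (auto simp: bridge_weight_nonneg)
      then show "ennreal (std_normal_density u) * (G \<omega> * K \<omega> u) = (ennreal (exp (\<gamma> * \<mu> + \<mu>\<^sup>2 / 2)) * G \<omega>) * ?f u"
        unfolding K_def by (rule ennreal_mult_swap2)
    qed
    also have "\<dots> = (ennreal (exp (\<gamma> * \<mu> + \<mu>\<^sup>2 / 2)) * G \<omega>) * (\<integral>\<^sup>+u. ?f u \<partial>lborel)" by (rule nn_integral_cmult) measurable
    also have "(\<integral>\<^sup>+u. ?f u \<partial>lborel) = (\<integral>\<^sup>+z. ?f ((?r + \<gamma> - b) + (-1) * z) \<partial>lborel)"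
      by (subst nn_integral_real_affine[where c="-1" and t="?r + \<gamma> - b"]) auto
    also have "\<dots> = (\<integral>\<^sup>+z. ennreal (std_normal_density (z - (?r - \<mu> - b)) * bridge_weight (?r - b) z) * F (z + b) \<partial>lborel)"
    proof -
      have e: "?r + \<gamma> - (?r + \<gamma> - b + - 1 * z) = z + b" for z by simp
      have n: "std_normal_density (?r + \<gamma> - b + - 1 * z - (\<gamma> + \<mu>)) = std_normal_density (z - (?r - \<mu> - b))" for z
      proof -
        have "(?r + \<gamma> - b + - 1 * z - (\<gamma> + \<mu>))\<^sup>2 = (z - (?r - \<mu> - b))\<^sup>2"
          by (simp add: power2_eq_square algebra_simps)
        then show ?thesis by (simp only: std_normal_density_def)
      qed
      show ?thesis unfolding e n by simp
    qed
    finally show "(\<integral>\<^sup>+u. ennreal (std_normal_density u) * (G \<omega> * K \<omega> u) \<partial>lborel) =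
      ennreal (exp (\<gamma> * \<mu> + \<mu>\<^sup>2 / 2)) * (G \<omega> * (\<integral>\<^sup>+z. ennreal (std_normal_density (z - (?r - \<mu> - b)) * bridge_weight (?r - b) z) * F (z + b) \<partial>lborel))"
      by (simp only: mult.assoc)
  qed
  also have "\<dots> = ennreal (exp (\<gamma> * \<mu> + \<mu>\<^sup>2 / 2)) * (\<integral>\<^sup>+\<omega>. G \<omega> * (\<integral>\<^sup>+z. ennreal (std_normal_density (z - (S \<omega> - \<mu> - b)) * bridge_weight (S \<omega> - b) z) * F (z + b) \<partial>lborel) \<partial>P)"
    (is "_ = _ * ?I")
  proof (rule nn_integral_cmult)
    have [measurable]: "G \<in> borel_measurable P" "S \<in> borel_measurable P"
      using measurable_from_generated_sigma[OF AH] G S by blast+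
    show "(\<lambda>\<omega>. G \<omega> * (\<integral>\<^sup>+z. ennreal (std_normal_density (z - (S \<omega> - \<mu> - b)) * bridge_weight (S \<omega> - b) z) * F (z + b) \<partial>lborel)) \<in> borel_measurable P"
      by measurable
  qed
  finally have "(\<integral>\<^sup>+\<omega>. (G \<omega> * ennreal (exp (- (E q y \<omega> - E q x \<omega>)))) *
      (ennreal (exp (\<gamma> * E q x \<omega> - \<gamma>\<^sup>2 / 2) * bridge_weight (S \<omega> - b) (S \<omega> + \<gamma> - E q x \<omega> - b)) * F (S \<omega> + \<gamma> - E q x \<omega>)) \<partial>P)
     \<le> (ennreal (exp (\<gamma> * \<mu> + \<mu>\<^sup>2 / 2)) * ?I) * ennreal (exp \<mu>)" .
  also have "\<dots> = ennreal (exp (\<gamma> * \<mu> + \<mu>\<^sup>2 / 2 + \<mu>)) * ?I"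
    by (simp add: exp_add ennreal_mult mult_ac)
  also have "\<dots> \<le> ennreal (exp ((\<gamma> + 2) * \<mu>)) * ?I"
  proof -
    have "\<mu>\<^sup>2 \<le> \<mu>" using \<mu> by (simp add: power2_eq_square mult_left_le)
    then have "\<gamma> * \<mu> + \<mu>\<^sup>2 / 2 + \<mu> \<le> (\<gamma> + 2) * \<mu>" using \<mu> by (simp add: algebra_simps)
    then show ?thesis by (intro mult_right_mono ennreal_leI) auto
  qed
  finally show ?thesis .
qed

text \<open>The accumulated drift is undone by translating the position upwards by
  \<open>shift\<close>. The translated path is dominated by the killed motion without drift, since
  its bridge weights are evaluated at lower points and bridge weights are monotone. The tilt thus
  costs a factor and moves the argument of F.\<close>

lemma chernoff:
  assumes "F \<in> borel_measurable borel"
  shows "(\<integral>\<^sup>+\<omega>. (ennreal (W b \<tau> j x \<omega>) * F (R \<tau> j x \<omega>)) * ennreal (exp (- displacement \<tau> j x y \<omega>)) \<partial>P) \<le>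
     ennreal (exp ((\<gamma> + 2) * shift \<tau> j x y)) * barrier_iter b 0 j (\<lambda>z. F (z - shift \<tau> j x y)) 1"
  using assms
proof (induction j arbitrary: F)
  case 0
  then show ?case by (simp add: displacement_def shift_def emeasure_space_1)
next
  case (Suc j)
  note [measurable] = Suc.prems
  let ?q = "\<tau> + j"
  let ?m = "shift \<tau> j x y"
  define \<mu> where "\<mu> = 1 - c ?q x y"
  have m': "shift \<tau> (Suc j) x y = ?m + \<mu>" by (simp add: shift_def \<mu>_def)
  define G where "G \<omega> = ennreal (W b \<tau> j x \<omega>) * ennreal (exp (- displacement \<tau> j x y \<omega>))" for \<omega>
  define \<Psi> where "\<Psi> r = (\<integral>\<^sup>+z. ennreal (std_normal_density (z - (r - \<mu> - b j)) * bridge_weight (r - b j) z) * F (z + b j) \<partial>lborel)" for r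
  have [measurable]: "\<Psi> \<in> borel_measurable borel" unfolding \<Psi>_def by measurable
  have inp: "E (\<tau> + k) z \<in> past ?q" if "k < j" for k z using that by (auto simp: past_def)
  have [measurable]: "R \<tau> j x \<in> borel_measurable (generated_sigma P (past ?q))"
      "W b \<tau> j x \<in> borel_measurable (generated_sigma P (past ?q))"
    using inp by (auto intro!: measurable_R_sigma measurable_W_sigma)
  note measurable_displacement_past[measurable]
  have [measurable]: "G \<in> borel_measurable (generated_sigma P (past ?q))" unfolding G_def by measurable
  have "(\<integral>\<^sup>+\<omega>. (ennreal (W b \<tau> (Suc j) x \<omega>) * F (R \<tau> (Suc j) x \<omega>)) * ennreal (exp (- displacement \<tau> (Suc j) x y \<omega>)) \<partial>P) =
    (\<integral>\<^sup>+\<omega>. (G \<omega> * ennreal (exp (- (E ?q y \<omega> - E ?q x \<omega>)))) *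
      (ennreal (exp (\<gamma> * E ?q x \<omega> - \<gamma>\<^sup>2 / 2) * bridge_weight (R \<tau> j x \<omega> - b j) (R \<tau> j x \<omega> + \<gamma> - E ?q x \<omega> - b j)) * F (R \<tau> j x \<omega> + \<gamma> - E ?q x \<omega>)) \<partial>P)"
  proof (rule nn_integral_cong)
    fix \<omega>
    have "exp (- displacement \<tau> (Suc j) x y \<omega>) = exp (- displacement \<tau> j x y \<omega>) * exp (- (E ?q y \<omega> - E ?q x \<omega>))"
      by (simp add: displacement_def exp_add[symmetric])
    then have d: "ennreal (exp (- displacement \<tau> (Suc j) x y \<omega>)) = ennreal (exp (- displacement \<tau> j x y \<omega>)) * ennreal (exp (- (E ?q y \<omega> - E ?q x \<omega>)))"
      by (simp add: ennreal_mult)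
    have w: "ennreal (W b \<tau> (Suc j) x \<omega>) = ennreal (W b \<tau> j x \<omega>) * ennreal (exp (\<gamma> * E ?q x \<omega> - \<gamma>\<^sup>2 / 2) * bridge_weight (R \<tau> j x \<omega> - b j) (R \<tau> j x \<omega> + \<gamma> - E ?q x \<omega> - b j))"
      unfolding W_Suc by (rule ennreal_mult) (auto simp: W_nonneg bridge_weight_nonneg)
    show "(ennreal (W b \<tau> (Suc j) x \<omega>) * F (R \<tau> (Suc j) x \<omega>)) * ennreal (exp (- displacement \<tau> (Suc j) x y \<omega>)) =
     (G \<omega> * ennreal (exp (- (E ?q y \<omega> - E ?q x \<omega>)))) *
      (ennreal (exp (\<gamma> * E ?q x \<omega> - \<gamma>\<^sup>2 / 2) * bridge_weight (R \<tau> j x \<omega> - b j) (R \<tau> j x \<omega> + \<gamma> - E ?q x \<omega> - b j)) * F (R \<tau> j x \<omega> + \<gamma> - E ?q x \<omega>))"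
      unfolding d w G_def R_Suc by (simp only: mult_ac)
  qed
  also have "\<dots> \<le> ennreal (exp ((\<gamma> + 2) * \<mu>)) * (\<integral>\<^sup>+\<omega>. G \<omega> * \<Psi> (R \<tau> j x \<omega>) \<partial>P)"
    unfolding \<Psi>_def \<mu>_def
    by (rule one_step_chernoff[OF past_in[of ?q]]) (auto intro: uncorrelated_past)
  also have "(\<integral>\<^sup>+\<omega>. G \<omega> * \<Psi> (R \<tau> j x \<omega>) \<partial>P) = (\<integral>\<^sup>+\<omega>. (ennreal (W b \<tau> j x \<omega>) * \<Psi> (R \<tau> j x \<omega>)) * ennreal (exp (- displacement \<tau> j x y \<omega>)) \<partial>P)"
    unfolding G_def by (intro nn_integral_cong) (simp only: mult_ac)
  also have "\<dots> \<le> ennreal (exp ((\<gamma> + 2) * ?m)) * barrier_iter b 0 j (\<lambda>z. \<Psi> (z - ?m)) 1"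
    by (rule Suc.IH) measurable
  also have "barrier_iter b 0 j (\<lambda>z. \<Psi> (z - ?m)) 1 \<le> barrier_iter b 0 j (barrier_step (b j) (\<lambda>z. F (z - (?m + \<mu>)))) 1"
  proof (rule barrier_iter_mono)
    fix r
    \<comment> \<open>The substitution aligns the Gaussian with the step without drift, so that
      afterwards the bridge weights are the only difference.\<close>
    have "\<Psi> (r - ?m) = (\<integral>\<^sup>+z. ennreal (std_normal_density ((- (?m + \<mu>) + 1 * z) - (r - ?m - \<mu> - b j)) * bridge_weight (r - ?m - b j) (- (?m + \<mu>) + 1 * z)) * F ((- (?m + \<mu>) + 1 * z) + b j) \<partial>lborel)"
      unfolding \<Psi>_def by (subst nn_integral_real_affine[where c=1 and t="- (?m + \<mu>)"]) auto
    also have "\<dots> \<le> barrier_step (b j) (\<lambda>z. F (z - (?m + \<mu>))) r"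
      unfolding barrier_step_def killed_step_def
    proof (rule nn_integral_mono)
      fix z
      have e: "(- (?m + \<mu>) + 1 * z) - (r - ?m - \<mu> - b j) = z - (r - b j)" "(- (?m + \<mu>) + 1 * z) + b j = z + b j - (?m + \<mu>)" by auto
      have "0 \<le> \<mu>" using c_le_1 by (simp add: \<mu>_def)
      then have "bridge_weight (r - ?m - b j) (- (?m + \<mu>) + 1 * z) \<le> bridge_weight (r - b j) z"
        using shift_nonneg[of \<tau> j x y] by (intro bridge_weight_mono) auto
      then show "ennreal (std_normal_density ((- (?m + \<mu>) + 1 * z) - (r - ?m - \<mu> - b j)) * bridge_weight (r - ?m - b j) (- (?m + \<mu>) + 1 * z)) * F ((- (?m + \<mu>) + 1 * z) + b j)
        \<le> ennreal (std_normal_density (z - (r - b j)) * bridge_weight (r - b j) z) * F (z + b j - (?m + \<mu>))"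
        unfolding e by (intro mult_right_mono ennreal_leI mult_left_mono) auto
    qed
    finally show "\<Psi> (r - ?m) \<le> barrier_step (b j) (\<lambda>z. F (z - (?m + \<mu>))) r" .
  qed
  finally have "(\<integral>\<^sup>+\<omega>. (ennreal (W b \<tau> (Suc j) x \<omega>) * F (R \<tau> (Suc j) x \<omega>)) * ennreal (exp (- displacement \<tau> (Suc j) x y \<omega>)) \<partial>P) \<le>
    ennreal (exp ((\<gamma> + 2) * \<mu>)) * (ennreal (exp ((\<gamma> + 2) * ?m)) * barrier_iter b 0 j (barrier_step (b j) (\<lambda>z. F (z - (?m + \<mu>)))) 1)"
    by (simp add: mult_left_mono)
  also have "\<dots> = ennreal (exp ((\<gamma> + 2) * (?m + \<mu>))) * barrier_iter b 0 j (barrier_step (b j) (\<lambda>z. F (z - (?m + \<mu>)))) 1"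
    by (simp add: ennreal_mult[symmetric] exp_add[symmetric] mult.assoc[symmetric] algebra_simps)
  finally show ?case unfolding m' by simp
qed

end

section \<open>Moments of the mass and of the volume of hits\<close>

context gaussian_noise
begin

text \<open>A score carried by the single time p, so that \<open>second_moment\<close> also covers
  the mass of a set after p layers.\<close>

definition single_score :: "nat \<Rightarrow> nat \<Rightarrow> real \<Rightarrow> ennreal" where
  "single_score p j r = (if j = p then ennreal (sqrt p) else 0)"

lemma measurable_single_score [measurable]: "single_score p j \<in> borel_measurable borel"
  unfolding single_score_def[abs_def] by (cases "j = p") auto

lemma barrier_iter_zero: "barrier_iter b i m (\<lambda>_. 0) r = 0"
proof (induction m arbitrary: r)
  case (Suc m)
  have "barrier_step (b (i + m)) (\<lambda>_. 0) = (\<lambda>_. 0)" by (auto simp: barrier_step_def killed_step_def)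
  then show ?case using Suc by simp
qed simp

lemma remaining_single:
  assumes "i \<le> p"
  shows "remaining (\<lambda>_. 0) (single_score p) p i r = ennreal (sqrt p) * (killed_step ^^ (p - i)) (\<lambda>_. 1) r"
proof -
  have 0: "barrier_iter (\<lambda>_. 0) i (j - i) (single_score p j) r = 0" if "j \<noteq> p" for j
  proof -
    have "single_score p j = (\<lambda>_. 0)" using that by (auto simp: single_score_def)
    then show ?thesis by (simp add: barrier_iter_zero)
  qed
  have "remaining (\<lambda>_. 0) (single_score p) p i r = barrier_iter (\<lambda>_. 0) i (p - i) (single_score p p) r"
    unfolding remaining_def using assms by (subst sum.remove[of _ p]) (auto intro!: sum.neutral simp: 0)
  also have "\<dots> = (killed_step ^^ (p - i)) (\<lambda>z. ennreal (sqrt p) * 1) r"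
    by (simp add: barrier_iter_const single_score_def[abs_def])
  finally show ?thesis by (subst (asm) killed_step_iter_cmult) auto
qed

lemma survival_mass_le: "ennreal (sqrt n) * (killed_step ^^ n) (\<lambda>_. 1) 1 \<le> 1"
proof (cases "n = 0")
  case False
  then have "ennreal (sqrt n) * (killed_step ^^ n) (\<lambda>_. 1) 1 \<le> ennreal (sqrt n) * ennreal (1 / sqrt n)"
    by (intro mult_left_mono killed_survival_le) auto
  also have "\<dots> = 1" using False by (simp flip: ennreal_mult)
  finally show ?thesis .
qed simp

text \<open>The critical measure of V after p layers started at time \<open>\<sigma>\<close>,
  restricted to surviving paths. The factor \<open>sqrt p\<close> offsets their survival
  probability, which is of order \<open>1 / sqrt p\<close>, as in the definition of the
  chaos.\<close>

definition mass :: "nat \<Rightarrow> nat \<Rightarrow> 'a set \<Rightarrow> 'w \<Rightarrow> ennreal" where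
  "mass \<sigma> p V \<omega> = (\<integral>\<^sup>+y. indicator V y * ennreal (sqrt p * W (\<lambda>_. 0) \<sigma> p y \<omega>) \<partial>lborel)"

lemma mass_second_moment:
  assumes V: "V \<in> sets borel"
  shows "(\<integral>\<^sup>+\<omega>. (mass \<sigma> p V \<omega>)\<^sup>2 \<partial>P) \<le> 2 * (emeasure lborel V)\<^sup>2 +
    2 * emeasure lborel V * ennreal (exp (- (dimn * \<sigma>)) * branch_const) * 126"
proof -
  have "mass \<sigma> p V \<omega> = total (\<lambda>_. 0) (single_score p) p \<sigma> V \<omega>" for \<omega>
    unfolding mass_def total_def
  proof (intro nn_integral_cong arg_cong2[where f="(*)"] refl)
    fix y
    have "(\<Sum>j=0..p. score (\<lambda>_. 0) (single_score p) \<sigma> j y \<omega>) = score (\<lambda>_. 0) (single_score p) \<sigma> p y \<omega>"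
      by (subst sum.remove[of _ p]) (auto intro!: sum.neutral simp: score_def single_score_def)
    also have "\<dots> = ennreal (sqrt p * W (\<lambda>_. 0) \<sigma> p y \<omega>)"
      by (simp add: score_def single_score_def ennreal_mult W_nonneg mult.commute)
    finally show "ennreal (sqrt p * W (\<lambda>_. 0) \<sigma> p y \<omega>) = (\<Sum>j=0..p. score (\<lambda>_. 0) (single_score p) \<sigma> j y \<omega>)" by simp
  qed
  then have "(\<integral>\<^sup>+\<omega>. (mass \<sigma> p V \<omega>)\<^sup>2 \<partial>P) = (\<integral>\<^sup>+\<omega>. (total (\<lambda>_. 0) (single_score p) p \<sigma> V \<omega>)\<^sup>2 \<partial>P)" by simp
  also have "\<dots> \<le> 2 * (emeasure lborel V)\<^sup>2 * (remaining (\<lambda>_. 0) (single_score p) p 0 1)\<^sup>2 +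
    2 * emeasure lborel V * ennreal (exp (- (dimn * \<sigma>)) * branch_const) *
      (\<Sum>k=1..p. barrier_iter (\<lambda>_. 0) 0 k (\<lambda>z. ennreal (exp (- (\<gamma> * z))) * (remaining (\<lambda>_. 0) (single_score p) p k z)\<^sup>2) 1)"
    by (rule second_moment) (use V in auto)
  also have "\<dots> \<le> 2 * (emeasure lborel V)\<^sup>2 * 1 + 2 * emeasure lborel V * ennreal (exp (- (dimn * \<sigma>)) * branch_const) * 126"
  proof (intro add_mono mult_left_mono)
    have "(remaining (\<lambda>_. 0) (single_score p) p 0 1)\<^sup>2 \<le> 1\<^sup>2"
      by (intro power_mono) (auto simp: remaining_single survival_mass_le)
    then show "(remaining (\<lambda>_. 0) (single_score p) p 0 1)\<^sup>2 \<le> 1" by simp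
    have "(\<Sum>k=1..p. barrier_iter (\<lambda>_. 0) 0 k (\<lambda>z. ennreal (exp (- (\<gamma> * z))) * (remaining (\<lambda>_. 0) (single_score p) p k z)\<^sup>2) 1) =
      (\<Sum>k=1..p. (killed_step ^^ k) (\<lambda>z. ennreal (exp (- (\<gamma> * z))) * (ennreal (sqrt p) * (killed_step ^^ (p - k)) (\<lambda>_. 1) z)\<^sup>2) 1)"
      by (intro sum.cong refl) (simp add: barrier_iter_const remaining_single)
    also have "\<dots> \<le> 126" by (rule phase1_second_moment[OF gamma_ge_1])
    finally show "(\<Sum>k=1..p. barrier_iter (\<lambda>_. 0) 0 k (\<lambda>z. ennreal (exp (- (\<gamma> * z))) * (remaining (\<lambda>_. 0) (single_score p) p k z)\<^sup>2) 1) \<le> 126" .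
  qed auto
  finally show ?thesis by simp
qed

lemma mass_density_lower:
  assumes "16 \<le> p"
  shows "ennreal (1 / 20) \<le> ennreal (sqrt p) * (killed_step ^^ p) (\<lambda>_. 1) 1"
  using killed_iter_lower[OF assms, of "\<lambda>_. 1" 1] by simp

text \<open>The barrier is raised to the target level at time \<open>n\<close>; this keeps the second moment of the number of hits
  bounded.\<close>

definition level :: "nat \<Rightarrow> real" where "level n = ln n / (2 * \<gamma>)"

definition barrier :: "nat \<Rightarrow> nat \<Rightarrow> real" where "barrier n j = (if j < n then 0 else level n)"

text \<open>The factor \<open>sqrt n\<close> offsets the survival probability up to time n. The
  inequality \<open>n < j\<close> is strict because the step leaving time n is the first with the
  raised barrier, so every scored position has been reached by such a step.\<close>

definition hit_score :: "nat \<Rightarrow> nat \<Rightarrow> nat \<Rightarrow> real \<Rightarrow> ennreal" where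
  "hit_score n L j r = (if n < j \<and> j \<le> n + L then ennreal (sqrt n) * target (r - level n) else 0)"

lemma measurable_hit_score [measurable]: "hit_score n L j \<in> borel_measurable borel"
  unfolding hit_score_def[abs_def] by (cases "n < j \<and> j \<le> n + L") auto

lemma level_nonneg: "0 \<le> level n"
  using gamma_ge_1 unfolding level_def by (cases "n = 0") auto

lemma exp_level: "1 \<le> n \<Longrightarrow> exp (\<gamma> * level n) = sqrt n"
proof -
  assume "1 \<le> n"
  then have "exp (\<gamma> * level n) = exp (ln (sqrt n))"
    using gamma_ge_1 by (simp add: level_def ln_sqrt)
  then show ?thesis using \<open>1 \<le> n\<close> by simp
qed

lemma level_le: "1 \<le> n \<Longrightarrow> level n \<le> sqrt n - 1"
proof -
  assume n: "1 \<le> n"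
  have "level n \<le> ln n / 2"
    unfolding level_def using gamma_ge_1 n by (intro divide_left_mono) auto
  also have "\<dots> = ln (sqrt n)" using n by (simp add: ln_sqrt)
  also have "\<dots> \<le> sqrt n - 1" using n by (intro ln_le_minus_one) auto
  finally show ?thesis .
qed

lemma barrier_iter_late:
  assumes "n \<le> i"
  shows "barrier_iter (barrier n) i m F r = (killed_step ^^ m) (\<lambda>z. F (z + level n)) (r - level n)"
  using assms by (intro barrier_iter_shift) (auto simp: barrier_def)

lemma barrier_iter_early:
  assumes "i + m \<le> n"
  shows "barrier_iter (barrier n) i m F r = (killed_step ^^ m) F r"
  using barrier_iter_shift[of m "barrier n" i 0 F r] assms by (auto simp: barrier_def)

lemma barrier_iter_both:
  assumes "i \<le> n"
  shows "barrier_iter (barrier n) i (n - i + k) F r =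
    (killed_step ^^ (n - i)) (\<lambda>z. (killed_step ^^ k) (\<lambda>z. F (z + level n)) (z - level n)) r"
proof -
  have "barrier_iter (barrier n) n k F = (\<lambda>z. (killed_step ^^ k) (\<lambda>z. F (z + level n)) (z - level n))"
    by (rule ext, rule barrier_iter_late) simp
  then show ?thesis
    unfolding barrier_iter_add using assms by (simp add: barrier_iter_early)
qed

lemma hit_score_iter_late:
  assumes "n \<le> i" "i \<le> j"
  shows "barrier_iter (barrier n) i (j - i) (hit_score n L j) r =
     (if n < j \<and> j \<le> n + L then ennreal (sqrt n) * (killed_step ^^ (j - i)) target (r - level n) else 0)"
proof -
  have "(\<lambda>z. hit_score n L j (z + level n)) = (if n < j \<and> j \<le> n + L then (\<lambda>z. ennreal (sqrt n) * target z) else (\<lambda>_. 0))"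
    by (auto simp: hit_score_def)
  moreover have "(killed_step ^^ m) (\<lambda>_. 0) r = 0" for m r
    using barrier_iter_zero[of "\<lambda>_. 0" 0 m r] by (simp add: barrier_iter_const)
  ultimately show ?thesis
    unfolding barrier_iter_late[OF assms(1)] by (auto simp: killed_step_iter_cmult)
qed

text \<open>Above the raised barrier the later score is a Green sum of \<open>target\<close>:
  bounded however high the path is, and vanishing linearly at the barrier. Both features enter the
  second moment.\<close>

lemma remaining_late:
  assumes "n \<le> i" "i \<le> n + L"
  shows "remaining (barrier n) (hit_score n L) (n + L) i r \<le> ennreal (27 * sqrt n * min 1 (max 0 (r - level n)))"
proof -
  have "remaining (barrier n) (hit_score n L) (n + L) i r \<le> (\<Sum>j=i..n + L. ennreal (sqrt n) * (killed_step ^^ (j - i)) target (r - level n))"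
    unfolding remaining_def using assms by (intro sum_mono) (auto simp: hit_score_iter_late)
  also have "\<dots> = ennreal (sqrt n) * (\<Sum>j=i..n + L. (killed_step ^^ (j - i)) target (r - level n))"
    by (simp add: sum_distrib_left)
  also have "(\<Sum>j=i..n + L. (killed_step ^^ (j - i)) target (r - level n)) = (\<Sum>k=0..n + L - i. (killed_step ^^ k) target (r - level n))"
    using assms by (intro sum.reindex_bij_witness[of _ "\<lambda>k. k + i" "\<lambda>j. j - i"]) auto
  also have "ennreal (sqrt n) * \<dots> \<le> ennreal (sqrt n) * ennreal (27 * min 1 (max 0 (r - level n)))"
    by (intro mult_left_mono killed_green_target_le) auto
  also have "\<dots> = ennreal (27 * sqrt n * min 1 (max 0 (r - level n)))"
    by (subst ennreal_mult[symmetric]) (auto simp: mult_ac)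
  finally show ?thesis .
qed

lemma remaining_early:
  assumes "i \<le> n"
  shows "remaining (barrier n) (hit_score n L) (n + L) i r =
    (killed_step ^^ (n - i)) (\<lambda>z. ennreal (sqrt n) * (\<Sum>k=1..L. (killed_step ^^ k) target (z - level n))) r"
proof -
  have z: "barrier_iter (barrier n) i (j - i) (hit_score n L j) r = 0" if "j \<le> n" for j
  proof -
    have "hit_score n L j = (\<lambda>_. 0)" using that by (auto simp: hit_score_def)
    then show ?thesis by (simp add: barrier_iter_zero)
  qed
  have "remaining (barrier n) (hit_score n L) (n + L) i r = (\<Sum>j\<in>{Suc n..n + L}. barrier_iter (barrier n) i (j - i) (hit_score n L j) r)"
    unfolding remaining_def using assms by (intro sum.mono_neutral_right) (auto simp: z)
  also have "\<dots> = (\<Sum>k=1..L. barrier_iter (barrier n) i (n - i + k) (hit_score n L (n + k)) r)"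
    using assms by (intro sum.reindex_bij_witness[of _ "\<lambda>k. n + k" "\<lambda>j. j - n"]) auto
  also have "\<dots> = (\<Sum>k=1..L. (killed_step ^^ (n - i)) (\<lambda>z. ennreal (sqrt n) * (killed_step ^^ k) target (z - level n)) r)"
  proof (rule sum.cong[OF refl])
    fix k assume k: "k \<in> {1..L}"
    have "(\<lambda>z. hit_score n L (n + k) (z + level n)) = (\<lambda>z. ennreal (sqrt n) * target z)"
      using k by (auto simp: hit_score_def)
    then show "barrier_iter (barrier n) i (n - i + k) (hit_score n L (n + k)) r =
       (killed_step ^^ (n - i)) (\<lambda>z. ennreal (sqrt n) * (killed_step ^^ k) target (z - level n)) r"
      unfolding barrier_iter_both[OF assms] by (simp add: killed_step_iter_cmult)
  qed
  also have "\<dots> = (killed_step ^^ (n - i)) (\<lambda>z. \<Sum>k=1..L. ennreal (sqrt n) * (killed_step ^^ k) target (z - level n)) r"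
    by (rule killed_step_iter_sum[symmetric]) measurable
  finally show ?thesis by (simp add: sum_distrib_left)
qed

text \<open>From any position at time n the Green sum of later hits is at most 27, so before n the
  remaining score is governed by survival up to n alone.\<close>

lemma remaining_early_le:
  assumes "i \<le> n"
  shows "remaining (barrier n) (hit_score n L) (n + L) i r \<le> 27 * (ennreal (sqrt n) * (killed_step ^^ (n - i)) (\<lambda>_. 1) r)"
proof -
  have G: "ennreal (sqrt n) * (\<Sum>k=1..L. (killed_step ^^ k) target (z - level n)) \<le> (27 * ennreal (sqrt n)) * 1" for z
  proof -
    have "(\<Sum>k=1..L. (killed_step ^^ k) target (z - level n)) \<le> (\<Sum>k=0..L. (killed_step ^^ k) target (z - level n))"
      by (intro sum_mono2) auto
    also have "\<dots> \<le> ennreal (27 * min 1 (max 0 (z - level n)))" by (rule killed_green_target_le)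
    also have "\<dots> \<le> ennreal 27" by (intro ennreal_leI) auto
    finally show ?thesis by (simp add: mult.commute mult_left_mono)
  qed
  have "remaining (barrier n) (hit_score n L) (n + L) i r =
      barrier_iter (\<lambda>_. 0) 0 (n - i) (\<lambda>z. ennreal (sqrt n) * (\<Sum>k=1..L. (killed_step ^^ k) target (z - level n))) r"
    using assms by (simp add: remaining_early barrier_iter_const)
  also have "\<dots> \<le> barrier_iter (\<lambda>_. 0) 0 (n - i) (\<lambda>z. (27 * ennreal (sqrt n)) * 1) r"
    by (rule barrier_iter_mono) (rule G)
  also have "\<dots> = (27 * ennreal (sqrt n)) * (killed_step ^^ (n - i)) (\<lambda>_. 1) r"
    unfolding barrier_iter_const by (rule killed_step_iter_cmult) simp
  finally show ?thesis by (simp add: mult.assoc)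
qed

lemma remaining_0_le: "remaining (barrier n) (hit_score n L) (n + L) 0 1 \<le> 27"
proof -
  have "27 * (ennreal (sqrt n) * (killed_step ^^ n) (\<lambda>_. 1) 1) \<le> 27 * 1"
    by (intro mult_left_mono survival_mass_le) auto
  then show ?thesis using remaining_early_le[of 0 n L 1] by (simp add: order_trans)
qed

text \<open>Restrict to paths at height between \<open>sqrt n\<close> and \<open>2 * sqrt n\<close>
  at time n. These are at least 1 above the level by \<open>level_le\<close>, and
  \<open>killed_green_target_ge\<close> needs \<open>8 * (2 * sqrt n)\<^sup>2 = 32 * n\<close>
  further steps. 26000 = 20 * 1300.\<close>

lemma remaining_0_ge:
  assumes n: "16 \<le> n" and L: "32 * n \<le> L"
  shows "ennreal (1 / 26000) \<le> remaining (barrier n) (hit_score n L) (n + L) 0 1"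
proof -
  let ?G = "\<lambda>z. \<Sum>k=1..L. (killed_step ^^ k) target (z - level n)"
  have "ennreal (1 / 20) * ennreal (1 / 1300) \<le> ennreal (sqrt n) * (killed_step ^^ n) ?G 1"
  proof (rule killed_iter_lower[OF n])
    fix z assume z: "sqrt n \<le> z" "z \<le> 2 * sqrt n"
    have 1: "1 \<le> z - level n" using z level_le[of n] n by linarith
    have "(z - level n)\<^sup>2 \<le> (2 * sqrt n)\<^sup>2"
      using 1 z level_nonneg[of n] by (intro power_mono) linarith+
    then have "8 * (z - level n)\<^sup>2 \<le> 32 * n" by (simp add: power_mult_distrib)
    moreover have "real (32 * n) \<le> real L" using L by (simp only: of_nat_le_iff)
    ultimately have "8 * (z - level n)\<^sup>2 \<le> real L" by simp
    then show "ennreal (1 / 1300) \<le> ?G z" by (rule killed_green_target_ge[OF 1])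
  qed measurable
  also have "ennreal (1 / 20) * ennreal (1 / 1300) = ennreal (1 / 26000)"
    by (subst ennreal_mult[symmetric]) auto
  also have "ennreal (sqrt n) * (killed_step ^^ n) ?G 1 = remaining (barrier n) (hit_score n L) (n + L) 0 1"
    by (simp add: remaining_early killed_step_iter_cmult)
  finally show ?thesis .
qed

text \<open>A common majorant: it bounds \<open>exp (- (\<gamma> * w)) * (min 1 w)\<^sup>2\<close>
  in the second moment and, up to a constant, boundedly shifted copies of \<open>target\<close> in
  the Chernoff estimate. Its Green sum is at most 52.\<close>

definition decay :: "real \<Rightarrow> ennreal" where "decay z = ennreal (max 0 z * exp (- z))"

lemma measurable_decay [measurable]: "decay \<in> borel_measurable borel"
  unfolding decay_def by measurable

lemma decay_sum_le:
  "(\<Sum>k=1..L. ennreal (sqrt n) * (killed_step ^^ n) (\<lambda>z. (killed_step ^^ k) decay (z - level n)) 1) \<le> 52"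
proof -
  have "(\<Sum>k=1..L. ennreal (sqrt n) * (killed_step ^^ n) (\<lambda>z. (killed_step ^^ k) decay (z - level n)) 1) =
     ennreal (sqrt n) * (killed_step ^^ n) (\<lambda>z. \<Sum>k=1..L. (killed_step ^^ k) decay (z - level n)) 1"
    by (subst killed_step_iter_sum) (auto simp: sum_distrib_left)
  also have "\<dots> \<le> ennreal (sqrt n) * (killed_step ^^ n) (\<lambda>z. 52 * 1) 1"
  proof (intro mult_left_mono killed_step_iter_mono)
    fix z :: real show "(\<Sum>k=1..L. (killed_step ^^ k) decay (z - level n)) \<le> 52 * 1"
      using killed_green_exp_le[of "z - level n" L] by (simp add: decay_def[abs_def])
  qed auto
  also have "\<dots> = 52 * (ennreal (sqrt n) * (killed_step ^^ n) (\<lambda>z. 1) 1)"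
    by (subst killed_step_iter_cmult) (auto simp: mult_ac)
  also have "\<dots> \<le> 52 * 1" by (intro mult_left_mono survival_mass_le) auto
  finally show ?thesis by simp
qed

text \<open>Up to n this is \<open>phase1_second_moment\<close>. After n the square of the remaining
  score brings two factors \<open>sqrt n\<close>. Survival up to n pays for one; the other is paid
  by \<open>exp (- (\<gamma> * z))\<close>, because paths are above the raised barrier and
  \<open>exp (\<gamma> * level n) = sqrt n\<close>. This second payment fixes the height of the
  level. 729 = 27^2 and 129762 = 729 * (126 + 52).\<close>

lemma hit_branch_sum:
  assumes n: "1 \<le> n"
  shows "(\<Sum>k=1..n + L. barrier_iter (barrier n) 0 k
     (\<lambda>z. ennreal (exp (- (\<gamma> * z))) * (remaining (barrier n) (hit_score n L) (n + L) k z)\<^sup>2) 1) \<le> 129762"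
proof -
  let ?b = "\<lambda>k. barrier_iter (barrier n) 0 k (\<lambda>z. ennreal (exp (- (\<gamma> * z))) * (remaining (barrier n) (hit_score n L) (n + L) k z)\<^sup>2) 1"
  have early: "?b k \<le> 729 * (killed_step ^^ k) (\<lambda>z. ennreal (exp (- (\<gamma> * z))) * (ennreal (sqrt n) * (killed_step ^^ (n - k)) (\<lambda>_. 1) z)\<^sup>2) 1"
    if "k \<in> {1..n}" for k
  proof -
    have k: "k \<le> n" using that by simp
    have "?b k \<le> barrier_iter (barrier n) 0 k (\<lambda>z. 729 * (ennreal (exp (- (\<gamma> * z))) * (ennreal (sqrt n) * (killed_step ^^ (n - k)) (\<lambda>_. 1) z)\<^sup>2)) 1"
    proof (rule barrier_iter_mono)
      fix z
      have "(remaining (barrier n) (hit_score n L) (n + L) k z)\<^sup>2 \<le> (27 * (ennreal (sqrt n) * (killed_step ^^ (n - k)) (\<lambda>_. 1) z))\<^sup>2"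
        by (intro power_mono remaining_early_le k) auto
      also have "\<dots> = 729 * (ennreal (sqrt n) * (killed_step ^^ (n - k)) (\<lambda>_. 1) z)\<^sup>2"
        by (simp add: power_mult_distrib)
      finally show "ennreal (exp (- (\<gamma> * z))) * (remaining (barrier n) (hit_score n L) (n + L) k z)\<^sup>2
        \<le> 729 * (ennreal (exp (- (\<gamma> * z))) * (ennreal (sqrt n) * (killed_step ^^ (n - k)) (\<lambda>_. 1) z)\<^sup>2)"
        by (simp add: mult.left_commute mult_left_mono)
    qed
    also have "\<dots> = 729 * (killed_step ^^ k) (\<lambda>z. ennreal (exp (- (\<gamma> * z))) * (ennreal (sqrt n) * (killed_step ^^ (n - k)) (\<lambda>_. 1) z)\<^sup>2) 1"
      using k by (simp add: barrier_iter_early killed_step_iter_cmult)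
    finally show ?thesis .
  qed
  have late: "?b (n + k) \<le> 729 * (ennreal (sqrt n) * (killed_step ^^ n) (\<lambda>z. (killed_step ^^ k) decay (z - level n)) 1)"
    if "k \<in> {1..L}" for k
  proof -
    have "?b (n + k) \<le> barrier_iter (barrier n) 0 (n + k) (\<lambda>z. (729 * ennreal (sqrt n)) * decay (z - level n)) 1"
    proof (rule barrier_iter_mono)
      fix z
      let ?w = "z - level n"
      have "(remaining (barrier n) (hit_score n L) (n + L) (n + k) z)\<^sup>2 \<le> (ennreal (27 * sqrt n * min 1 (max 0 ?w)))\<^sup>2"
        using that by (intro power_mono remaining_late) auto
      also have "\<dots> = ennreal (729 * n * (min 1 (max 0 ?w))\<^sup>2)"
        by (simp add: ennreal_power power_mult_distrib)
      finally have "ennreal (exp (- (\<gamma> * z))) * (remaining (barrier n) (hit_score n L) (n + L) (n + k) z)\<^sup>2 \<le>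
         ennreal (exp (- (\<gamma> * z))) * ennreal (729 * n * (min 1 (max 0 ?w))\<^sup>2)"
        by (rule mult_left_mono) simp
      also have "\<dots> = ennreal (exp (- (\<gamma> * z)) * (729 * n * (min 1 (max 0 ?w))\<^sup>2))"
        by (rule ennreal_mult[symmetric]) auto
      also have "\<dots> \<le> ennreal ((729 * sqrt n) * (max 0 ?w * exp (- ?w)))"
      proof (rule ennreal_leI)
        have e: "exp (- (\<gamma> * z)) = exp (- (\<gamma> * ?w)) / sqrt n"
        proof -
          have "exp (- (\<gamma> * z)) = exp (- (\<gamma> * ?w) - \<gamma> * level n)" by (simp add: algebra_simps)
          then show ?thesis by (simp only: exp_diff exp_level[OF n])
        qed
        have m: "(min 1 (max 0 ?w))\<^sup>2 \<le> max 0 ?w"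
          by (auto simp: power2_eq_square min_def max_def intro: mult_left_le)
        have "exp (- (\<gamma> * ?w)) * (min 1 (max 0 ?w))\<^sup>2 \<le> max 0 ?w * exp (- ?w)"
        proof (cases "0 < ?w")
          case True
          then have "1 * ?w \<le> \<gamma> * ?w" using gamma_ge_1 by (intro mult_right_mono) auto
          then have "exp (- (\<gamma> * ?w)) \<le> exp (- ?w)" by simp
          then have "exp (- (\<gamma> * ?w)) * (min 1 (max 0 ?w))\<^sup>2 \<le> exp (- ?w) * max 0 ?w"
            using m by (intro mult_mono) auto
          then show ?thesis by (simp add: mult.commute)
        qed (simp add: max_def)
        then have "(729 * sqrt n) * (exp (- (\<gamma> * ?w)) * (min 1 (max 0 ?w))\<^sup>2) \<le> (729 * sqrt n) * (max 0 ?w * exp (- ?w))"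
          by (rule mult_left_mono) simp
        moreover have "exp (- (\<gamma> * z)) * (729 * n * (min 1 (max 0 ?w))\<^sup>2) = (729 * sqrt n) * (exp (- (\<gamma> * ?w)) * (min 1 (max 0 ?w))\<^sup>2)"
          unfolding e using n by (simp add: field_simps)
        ultimately show "exp (- (\<gamma> * z)) * (729 * n * (min 1 (max 0 ?w))\<^sup>2) \<le> (729 * sqrt n) * (max 0 ?w * exp (- ?w))"
          by (simp only:)
      qed
      also have "\<dots> = (729 * ennreal (sqrt n)) * decay ?w"
        by (simp add: decay_def ennreal_mult)
      finally show "ennreal (exp (- (\<gamma> * z))) * (remaining (barrier n) (hit_score n L) (n + L) (n + k) z)\<^sup>2 \<le> (729 * ennreal (sqrt n)) * decay ?w" .
    qed
    also have "\<dots> = (killed_step ^^ n) (\<lambda>z. (killed_step ^^ k) (\<lambda>z. (729 * ennreal (sqrt n)) * decay z) (z - level n)) 1"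
      using barrier_iter_both[of 0 n k "\<lambda>z. (729 * ennreal (sqrt n)) * decay (z - level n)" 1] by simp
    also have "\<dots> = 729 * (ennreal (sqrt n) * (killed_step ^^ n) (\<lambda>z. (killed_step ^^ k) decay (z - level n)) 1)"
      by (simp add: killed_step_iter_cmult mult.assoc)
    finally show ?thesis .
  qed
  have "(\<Sum>k=1..n + L. ?b k) = (\<Sum>k=1..n. ?b k) + (\<Sum>k=Suc n..n + L. ?b k)"
    using sum.ub_add_nat[of 1 n ?b L] by simp
  also have "(\<Sum>k=Suc n..n + L. ?b k) = (\<Sum>k=1..L. ?b (n + k))"
    by (intro sum.reindex_bij_witness[of _ "\<lambda>k. n + k" "\<lambda>j. j - n"]) auto
  also have "(\<Sum>k=1..n. ?b k) + (\<Sum>k=1..L. ?b (n + k)) \<le> 729 * 126 + 729 * 52"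
  proof (rule add_mono)
    have "(\<Sum>k=1..n. ?b k) \<le> (\<Sum>k=1..n. 729 * (killed_step ^^ k) (\<lambda>z. ennreal (exp (- (\<gamma> * z))) * (ennreal (sqrt n) * (killed_step ^^ (n - k)) (\<lambda>_. 1) z)\<^sup>2) 1)"
      by (rule sum_mono) (rule early)
    also have "\<dots> = 729 * (\<Sum>k=1..n. (killed_step ^^ k) (\<lambda>z. ennreal (exp (- (\<gamma> * z))) * (ennreal (sqrt n) * (killed_step ^^ (n - k)) (\<lambda>_. 1) z)\<^sup>2) 1)"
      by (simp add: sum_distrib_left)
    also have "\<dots> \<le> 729 * 126" by (intro mult_left_mono phase1_second_moment gamma_ge_1) auto
    finally show "(\<Sum>k=1..n. ?b k) \<le> 729 * 126" .
    have "(\<Sum>k=1..L. ?b (n + k)) \<le> (\<Sum>k=1..L. 729 * (ennreal (sqrt n) * (killed_step ^^ n) (\<lambda>z. (killed_step ^^ k) decay (z - level n)) 1))"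
      by (rule sum_mono) (rule late)
    also have "\<dots> = 729 * (\<Sum>k=1..L. ennreal (sqrt n) * (killed_step ^^ n) (\<lambda>z. (killed_step ^^ k) decay (z - level n)) 1)"
      by (simp add: sum_distrib_left)
    also have "\<dots> \<le> 729 * 52" by (intro mult_left_mono decay_sum_le) auto
    finally show "(\<Sum>k=1..L. ?b (n + k)) \<le> 729 * 52" .
  qed
  also have "\<dots> = 129762" by simp
  finally show ?thesis .
qed

definition hits :: "nat \<Rightarrow> nat \<Rightarrow> nat \<Rightarrow> 'a set \<Rightarrow> 'w \<Rightarrow> ennreal" where
  "hits n L \<tau> Q = total (barrier n) (hit_score n L) (n + L) \<tau> Q"

text \<open>The lower bound on the volume of Q makes the branching part, which is linear in that
  volume, comparable to its square. 1458 = 2 * 27^2 and 259524 = 2 * 129762.\<close>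

lemma hits_second_moment:
  assumes Q: "Q \<in> sets borel" and n: "1 \<le> n" and big: "ennreal (exp (- (dimn * \<tau>))) \<le> emeasure lborel Q"
  shows "(\<integral>\<^sup>+\<omega>. (hits n L \<tau> Q \<omega>)\<^sup>2 \<partial>P) \<le> ennreal (1458 + 259524 * branch_const) * (emeasure lborel Q)\<^sup>2"
proof -
  let ?m = "emeasure lborel Q"
  have "(\<integral>\<^sup>+\<omega>. (hits n L \<tau> Q \<omega>)\<^sup>2 \<partial>P) \<le> 2 * ?m\<^sup>2 * (remaining (barrier n) (hit_score n L) (n + L) 0 1)\<^sup>2 +
    2 * ?m * ennreal (exp (- (dimn * \<tau>)) * branch_const) *
      (\<Sum>k=1..n + L. barrier_iter (barrier n) 0 k (\<lambda>z. ennreal (exp (- (\<gamma> * z))) * (remaining (barrier n) (hit_score n L) (n + L) k z)\<^sup>2) 1)"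
    unfolding hits_def by (rule second_moment) (use Q in auto)
  also have "\<dots> \<le> 2 * ?m\<^sup>2 * 27\<^sup>2 + 2 * ?m * (?m * ennreal branch_const) * 129762"
  proof (intro add_mono mult_mono power_mono remaining_0_le hit_branch_sum n)
    have "ennreal (exp (- (dimn * \<tau>)) * branch_const) = ennreal (exp (- (dimn * \<tau>))) * ennreal branch_const"
      by (rule ennreal_mult) (auto simp: branch_const_nonneg)
    also have "\<dots> \<le> ?m * ennreal branch_const" by (intro mult_right_mono big) auto
    finally show "ennreal (exp (- (dimn * \<tau>)) * branch_const) \<le> ?m * ennreal branch_const" .
  qed auto
  also have "\<dots> = ((2 * 27\<^sup>2) + (2 * 129762) * ennreal branch_const) * ?m\<^sup>2"
    by (simp only: power2_eq_square distrib_right distrib_left mult_ac)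
  also have "\<dots> = (1458 + 259524 * ennreal branch_const) * ?m\<^sup>2" by simp
  also have "1458 + 259524 * ennreal branch_const = ennreal (1458 + 259524 * branch_const)"
    using branch_const_nonneg by (simp add: ennreal_mult)
  finally show ?thesis .
qed

end

section \<open>Cells with typical future mass\<close>

text \<open>With floors the cells of one scale are half-open cubes that partition the space, and a
  cell depends on x only through its corner. A bounded set therefore meets finitely many of
  them.\<close>

definition cell :: "real \<Rightarrow> 'a::euclidean_space \<Rightarrow> 'a set" where
  "cell s x = {y. \<forall>b\<in>Basis. \<lfloor>exp s * (y \<bullet> b)\<rfloor> = \<lfloor>exp s * (x \<bullet> b)\<rfloor>}"

definition cell_corner :: "real \<Rightarrow> 'a::euclidean_space \<Rightarrow> 'a" where
  "cell_corner s x = (\<Sum>b\<in>Basis. (of_int \<lfloor>exp s * (x \<bullet> b)\<rfloor> * exp (- s)) *\<^sub>R b)"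

lemma cell_iff:
  "y \<in> cell s x \<longleftrightarrow> (\<forall>b\<in>Basis. cell_corner s x \<bullet> b \<le> y \<bullet> b \<and> y \<bullet> b < cell_corner s x \<bullet> b + exp (- s))"
proof -
  have "\<lfloor>exp s * (y \<bullet> b)\<rfloor> = \<lfloor>exp s * (x \<bullet> b)\<rfloor> \<longleftrightarrow>
      cell_corner s x \<bullet> b \<le> y \<bullet> b \<and> y \<bullet> b < cell_corner s x \<bullet> b + exp (- s)" if b: "b \<in> Basis" for b
  proof -
    have c: "cell_corner s x \<bullet> b = of_int \<lfloor>exp s * (x \<bullet> b)\<rfloor> * exp (- s)"
      using b by (simp add: cell_corner_def)
    have "\<lfloor>exp s * (y \<bullet> b)\<rfloor> = \<lfloor>exp s * (x \<bullet> b)\<rfloor> \<longleftrightarrow>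
      of_int \<lfloor>exp s * (x \<bullet> b)\<rfloor> \<le> exp s * (y \<bullet> b) \<and> exp s * (y \<bullet> b) < of_int \<lfloor>exp s * (x \<bullet> b)\<rfloor> + 1"
      by (rule floor_eq_iff)
    also have "\<dots> \<longleftrightarrow> cell_corner s x \<bullet> b \<le> y \<bullet> b \<and> y \<bullet> b < cell_corner s x \<bullet> b + exp (- s)"
      unfolding c exp_minus by (simp add: field_simps)
    finally show ?thesis .
  qed
  then show ?thesis by (auto simp: cell_def)
qed

lemma cell_self: "x \<in> cell s x" by (simp add: cell_def)

lemma sets_cell [measurable]: "cell s x \<in> sets borel"
  unfolding cell_def by measurable

lemma cell_subset_cbox: "cell s x \<subseteq> cbox (cell_corner s x) (cell_corner s x + exp (- s) *\<^sub>R One)"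
  by (auto simp: cell_iff mem_box inner_add_left less_imp_le)

lemma box_subset_cell: "box (cell_corner s x) (cell_corner s x + exp (- s) *\<^sub>R One) \<subseteq> cell s x"
  by (auto simp: cell_iff mem_box inner_add_left less_imp_le)

lemma emeasure_cell: "emeasure lborel (cell s x) = ennreal (exp (- (real DIM('a) * s)))"
  for x :: "'a::euclidean_space"
proof (rule antisym)
  let ?a = "cell_corner s x"
  have e2: "exp (- s) ^ DIM('a) = exp (- (real DIM('a) * s))"
    by (simp only: exp_of_nat_mult[symmetric] mult_minus_right)
  have "emeasure lborel (cell s x) \<le> emeasure lborel (cbox ?a (?a + exp (- s) *\<^sub>R One))"
    by (intro emeasure_mono cell_subset_cbox) auto
  also have "\<dots> = ennreal (exp (- (real DIM('a) * s)))"
    by (subst emeasure_lborel_cbox) (auto simp: inner_add_left e2)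
  finally show "emeasure lborel (cell s x) \<le> ennreal (exp (- (real DIM('a) * s)))" .
  have "ennreal (exp (- (real DIM('a) * s))) = emeasure lborel (box ?a (?a + exp (- s) *\<^sub>R One))"
    by (subst emeasure_lborel_box) (auto simp: inner_add_left e2)
  also have "\<dots> \<le> emeasure lborel (cell s x)"
    by (intro emeasure_mono box_subset_cell) auto
  finally show "ennreal (exp (- (real DIM('a) * s))) \<le> emeasure lborel (cell s x)" .
qed

lemma dist_cell_le:
  fixes x :: "'a::euclidean_space"
  assumes "y \<in> cell s x" shows "dist x y \<le> real DIM('a) * exp (- s)"
proof -
  have "\<bar>(x - y) \<bullet> b\<bar> \<le> exp (- s)" if "b \<in> Basis" for b
    using assms cell_self[of x s] that unfolding cell_iff by (force simp: inner_diff_left)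
  then have "(\<Sum>b\<in>Basis. \<bar>(x - y) \<bullet> b\<bar>) \<le> real DIM('a) * exp (- s)"
    by (rule sum_bounded_above)
  then show ?thesis using norm_le_l1[of "x - y"] by (simp add: dist_norm)
qed

lemma measurable_indicator_cell [measurable]:
  assumes [measurable]: "f \<in> borel_measurable N" "g \<in> borel_measurable N"
  shows "(\<lambda>z. indicator (cell s (f z)) (g z) :: ennreal) \<in> borel_measurable N"
proof -
  have "(\<lambda>z. indicator (cell s (f z)) (g z) :: ennreal) =
      (\<lambda>z. if \<forall>b\<in>Basis. \<lfloor>exp s * (g z \<bullet> b)\<rfloor> = \<lfloor>exp s * (f z \<bullet> b)\<rfloor> then 1 else 0)"
    by (auto simp: cell_def indicator_def)
  also have "\<dots> \<in> borel_measurable N" by measurable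
  finally show ?thesis .
qed

lemma ennreal_le_square: "0 < \<delta> \<Longrightarrow> S \<le> ennreal \<delta> * S\<^sup>2 + ennreal (1 / (4 * \<delta>))"
proof (cases S)
  case (real s)
  assume d: "0 < \<delta>"
  have "0 \<le> (2 * \<delta> * s - 1)\<^sup>2 / (4 * \<delta>)" using d by (intro divide_nonneg_nonneg) auto
  also have "(2 * \<delta> * s - 1)\<^sup>2 / (4 * \<delta>) = \<delta> * s\<^sup>2 + 1 / (4 * \<delta>) - s"
    using d by (simp add: power2_eq_square field_simps)
  finally have "s \<le> \<delta> * s\<^sup>2 + 1 / (4 * \<delta>)" by simp
  then have "ennreal s \<le> ennreal (\<delta> * s\<^sup>2 + 1 / (4 * \<delta>))" by (rule ennreal_leI)
  also have "\<dots> = ennreal \<delta> * ennreal s ^ 2 + ennreal (1 / (4 * \<delta>))"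
    using d real by (subst ennreal_plus) (auto simp: ennreal_mult ennreal_power)
  finally show ?thesis using real by simp
qed (auto simp: power2_eq_square ennreal_mult_top)

text \<open>Integrate \<open>S \<le> \<delta> * S\<^sup>2 + 1 / (4 * \<delta>)\<close> on the event
  that S is positive. The choice \<open>\<delta> = a / (2 * B)\<close> spends half of a on the
  square and yields exactly \<open>a\<^sup>2 / B\<close>.\<close>

lemma (in prob_space) Paley_Zygmund:
  assumes [measurable]: "S \<in> borel_measurable M" and a: "0 < a" "ennreal a \<le> (\<integral>\<^sup>+\<omega>. S \<omega> \<partial>M)"
    and B: "0 < B" "(\<integral>\<^sup>+\<omega>. (S \<omega>)\<^sup>2 \<partial>M) \<le> ennreal B"
  shows "a\<^sup>2 / B \<le> prob {\<omega> \<in> space M. 0 < S \<omega>}"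
proof -
  define \<delta> where "\<delta> = a / (2 * B)"
  have \<delta>: "0 < \<delta>" using a B by (simp add: \<delta>_def)
  let ?p = "prob {\<omega> \<in> space M. 0 < S \<omega>}"
  have "ennreal a \<le> (\<integral>\<^sup>+\<omega>. ennreal \<delta> * (S \<omega>)\<^sup>2 + ennreal (1 / (4 * \<delta>)) * indicator {\<omega> \<in> space M. 0 < S \<omega>} \<omega> \<partial>M)"
    using a(2)
  proof (rule order_trans, intro nn_integral_mono)
    fix \<omega> assume "\<omega> \<in> space M"
    then show "S \<omega> \<le> ennreal \<delta> * (S \<omega>)\<^sup>2 + ennreal (1 / (4 * \<delta>)) * indicator {\<omega> \<in> space M. 0 < S \<omega>} \<omega>"
      using ennreal_le_square[OF \<delta>, of "S \<omega>"] by (cases "S \<omega> = 0") (auto simp: zero_less_iff_neq_zero)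
  qed
  also have "\<dots> = ennreal \<delta> * (\<integral>\<^sup>+\<omega>. (S \<omega>)\<^sup>2 \<partial>M) + ennreal (1 / (4 * \<delta>)) * emeasure M {\<omega> \<in> space M. 0 < S \<omega>}"
    by (subst nn_integral_add) (auto simp: nn_integral_cmult nn_integral_cmult_indicator)
  also have "\<dots> \<le> ennreal \<delta> * ennreal B + ennreal (1 / (4 * \<delta>)) * ennreal ?p"
    by (intro add_mono mult_left_mono B) (auto simp: emeasure_eq_measure)
  also have "\<dots> = ennreal (\<delta> * B + 1 / (4 * \<delta>) * ?p)"
  proof -
    have "ennreal \<delta> * ennreal B = ennreal (\<delta> * B)" "ennreal (1 / (4 * \<delta>)) * ennreal ?p = ennreal (1 / (4 * \<delta>) * ?p)"
      using \<delta> B by (auto intro!: ennreal_mult[symmetric] simp del: times_divide_eq_left)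
    moreover have "ennreal (\<delta> * B) + ennreal (1 / (4 * \<delta>) * ?p) = ennreal (\<delta> * B + 1 / (4 * \<delta>) * ?p)"
      using \<delta> B by (intro ennreal_plus[symmetric]) auto
    ultimately show ?thesis by (simp only:)
  qed
  finally have "a \<le> \<delta> * B + 1 / (4 * \<delta>) * ?p"
    using \<delta> B by (subst (asm) ennreal_le_iff) (auto intro!: add_nonneg_nonneg)
  then show ?thesis using a B by (simp add: \<delta>_def field_simps power2_eq_square)
qed

text \<open>A hit at \<open>x\<close> yields mass only on those points \<open>y\<close> of its cell where the coarse field has not dropped by more than
  \<open>A\<close> below its value at \<open>x\<close>; hence the indicator of the increments.\<close>

definition local_mass :: "real \<Rightarrow> (nat \<Rightarrow> 'a::euclidean_space \<Rightarrow> real) \<Rightarrow> nat \<Rightarrow> nat \<Rightarrow> real \<Rightarrow> nat \<Rightarrow> 'a \<Rightarrow> ennreal" where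
  "local_mass g e \<tau> j A p x = (\<integral>\<^sup>+y. ennreal (exp (real DIM('a) * real (\<tau> + j))) *
     (indicator (cell (real (\<tau> + j)) x) y * (indicator {- A..} (\<Sum>i<j. e (\<tau> + i) y - e (\<tau> + i) x) *
       ennreal (sqrt p * weight g (\<lambda>_. 0) (\<lambda>i. e (\<tau> + j + i) y) p))) \<partial>lborel)"

lemma measurable_local_mass:
  fixes f :: "'w \<Rightarrow> nat \<Rightarrow> 'a::euclidean_space \<Rightarrow> real"
  assumes f: "\<And>q. (\<lambda>z. f (fst z) q (snd z)) \<in> borel_measurable (N \<Otimes>\<^sub>M lborel)"
  shows "(\<lambda>z. local_mass g (f (fst z)) \<tau> j A p (snd z)) \<in> borel_measurable (N \<Otimes>\<^sub>M lborel)"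
proof -
  let ?N = "(N \<Otimes>\<^sub>M lborel) \<Otimes>\<^sub>M (lborel :: 'a measure)"
  have m1[measurable]: "(\<lambda>p. f (fst (fst p)) q (snd (fst p))) \<in> borel_measurable ?N" for q
    by (rule measurable_compose[OF measurable_fst f])
  have m2[measurable]: "(\<lambda>p. f (fst (fst p)) q (snd p)) \<in> borel_measurable ?N" for q
  proof -
    have "(\<lambda>p. (fst (fst p), snd p)) \<in> measurable ?N (N \<Otimes>\<^sub>M lborel)"
      by (rule measurable_Pair) (auto intro: measurable_compose[OF measurable_fst measurable_fst])
    from measurable_compose[OF this f] show ?thesis by simp
  qed
  have m3: "(\<lambda>p. weight g (\<lambda>_. 0) (\<lambda>i. f (fst (fst p)) (\<tau> + j + i) (snd p)) k) \<in> borel_measurable ?N" for k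
    by (rule measurable_weight) (rule m2)
  have m4: "(\<lambda>p. \<Sum>i<j. f (fst (fst p)) (\<tau> + i) (snd p) - f (fst (fst p)) (\<tau> + i) (snd (fst p))) \<in> borel_measurable ?N"
    by (intro borel_measurable_sum borel_measurable_diff m1 m2)
  have m5: "(\<lambda>p. indicator {- A..} (\<Sum>i<j. f (fst (fst p)) (\<tau> + i) (snd p) - f (fst (fst p)) (\<tau> + i) (snd (fst p))) :: ennreal) \<in> borel_measurable ?N"
    by (rule measurable_compose[OF m4]) simp
  have m6: "(\<lambda>p. indicator (cell (real (\<tau> + j)) (snd (fst p))) (snd p) :: ennreal) \<in> borel_measurable ?N"
    by (rule measurable_indicator_cell) (auto intro: measurable_compose[OF measurable_fst measurable_snd])
  have m7: "(\<lambda>p. ennreal (sqrt k * weight g (\<lambda>_. 0) (\<lambda>i. f (fst (fst p)) (\<tau> + j + i) (snd p)) k)) \<in> borel_measurable ?N" for k :: nat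
    using m3[of k] by (intro measurable_compose[OF _ measurable_ennreal] borel_measurable_times borel_measurable_const)
  have "(\<lambda>p. ennreal (exp (real DIM('a) * real (\<tau> + j))) *
     (indicator (cell (real (\<tau> + j)) (snd (fst p))) (snd p) *
      (indicator {- A..} (\<Sum>i<j. f (fst (fst p)) (\<tau> + i) (snd p) - f (fst (fst p)) (\<tau> + i) (snd (fst p))) *
       ennreal (sqrt k * weight g (\<lambda>_. 0) (\<lambda>i. f (fst (fst p)) (\<tau> + j + i) (snd p)) k)))) \<in> borel_measurable ?N" for k :: nat
    by (intro borel_measurable_times_ennreal borel_measurable_const m5 m6 m7)
  from lborel.borel_measurable_nn_integral_fst[OF this[of p]]
  show ?thesis by (simp add: local_mass_def)
qed

section \<open>Good hits and the mass of their cells\<close>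

context gaussian_noise
begin

text \<open>A function of the array e of increments instead of the sample point, so that it can be
  evaluated at a modified field; this is how dependence on a bounded region alone is established.
  The count \<open>N - (\<tau> + j)\<close> of later layers brings hits of all scales to the same
  final time N.\<close>

definition good_hits :: "(nat \<Rightarrow> 'a \<Rightarrow> real) \<Rightarrow> nat \<Rightarrow> nat \<Rightarrow> nat \<Rightarrow> real \<Rightarrow> nat \<Rightarrow> 'a set \<Rightarrow> ennreal" where
  "good_hits e n L \<tau> A N Q = (\<integral>\<^sup>+x. indicator Q x * (\<Sum>j=0..n + L.
     ennreal (weight \<gamma> (barrier n) (\<lambda>i. e (\<tau> + i) x) j) * hit_score n L j (path \<gamma> (\<lambda>i. e (\<tau> + i) x) j) *
     indicator {1 / 80..} (local_mass \<gamma> e \<tau> j A (N - (\<tau> + j)) x)) \<partial>lborel)"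

lemma measurable_good_hits:
  fixes f :: "'v \<Rightarrow> nat \<Rightarrow> 'a \<Rightarrow> real"
  assumes f[measurable]: "\<And>q. (\<lambda>z. f (fst z) q (snd z)) \<in> borel_measurable (M \<Otimes>\<^sub>M lborel)" and Q[measurable]: "Q \<in> sets borel"
  shows "(\<lambda>\<omega>. good_hits (f \<omega>) n L \<tau> A N Q) \<in> borel_measurable M"
proof -
  have [measurable]: "(\<lambda>z. weight \<gamma> (barrier n) (\<lambda>i. f (fst z) (\<tau> + i) (snd z)) j) \<in> borel_measurable (M \<Otimes>\<^sub>M lborel)"
    "(\<lambda>z. path \<gamma> (\<lambda>i. f (fst z) (\<tau> + i) (snd z)) j) \<in> borel_measurable (M \<Otimes>\<^sub>M lborel)" for j
    by (rule measurable_weight measurable_path, rule f)+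
  have [measurable]: "(\<lambda>z. local_mass \<gamma> (f (fst z)) \<tau> j A p (snd z)) \<in> borel_measurable (M \<Otimes>\<^sub>M lborel)" for j p
    by (rule measurable_local_mass) (rule f)
  have "(\<lambda>z. indicator Q (snd z) * (\<Sum>j=0..n + L.
     ennreal (weight \<gamma> (barrier n) (\<lambda>i. f (fst z) (\<tau> + i) (snd z)) j) * hit_score n L j (path \<gamma> (\<lambda>i. f (fst z) (\<tau> + i) (snd z)) j) *
     indicator {1 / 80..} (local_mass \<gamma> (f (fst z)) \<tau> j A (N - (\<tau> + j)) (snd z)))) \<in> borel_measurable (M \<Otimes>\<^sub>M lborel)"
    by measurable
  from lborel.borel_measurable_nn_integral_fst[OF this] show ?thesis by (simp add: good_hits_def)
qed

abbreviation noise :: "'w \<Rightarrow> nat \<Rightarrow> 'a \<Rightarrow> real" where "noise \<omega> \<equiv> \<lambda>q x. E q x \<omega>"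

lemma measurable_E_future:
  assumes "n \<le> q"
  shows "(\<lambda>z. E q (snd z) (fst z)) \<in> borel_measurable (generated_sigma P (future n UNIV) \<Otimes>\<^sub>M lborel)"
proof -
  have "(\<lambda>(\<omega>, x). E q x \<omega>) \<in> borel_measurable (generated_sigma P (future n UNIV) \<Otimes>\<^sub>M borel)"
    by (rule measurable_continuous_field)
      (use assms E_cont in \<open>auto intro!: measurable_generated_sigma simp: future_def\<close>)
  then show ?thesis by (simp add: measurable_pair_lborel case_prod_beta)
qed

lemma measurable_mass_future: 
  assumes [measurable]: "V \<in> sets borel"
  shows "mass \<sigma> p V \<in> borel_measurable (generated_sigma P (future \<sigma> UNIV))"
proof -
  have [measurable]: "(\<lambda>z. W (\<lambda>_. 0) \<sigma> p (snd z) (fst z)) \<in> borel_measurable (generated_sigma P (future \<sigma> UNIV) \<Otimes>\<^sub>M lborel)"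
    unfolding W_def by (rule measurable_weight) (rule measurable_E_future, simp)
  have "(\<lambda>z. indicator V (snd z) * ennreal (sqrt p * W (\<lambda>_. 0) \<sigma> p (snd z) (fst z))) \<in> borel_measurable (generated_sigma P (future \<sigma> UNIV) \<Otimes>\<^sub>M lborel)"
    by measurable
  from lborel.borel_measurable_nn_integral_fst[OF this] show ?thesis by (simp add: mass_def[abs_def])
qed

text \<open>\<open>mass_second_moment\<close> for a cell, rescaled to unit volume: 252 = 2 *
  126.\<close>

definition mass_const :: real where "mass_const = 2 + 252 * branch_const"

lemma mass_const_ge: "2 \<le> mass_const"
  using branch_const_nonneg by (simp add: mass_const_def)

text \<open>G stands for any weight determined by the layers before \<open>\<tau> + j\<close>; the
  score of a hit at x is the case of interest.\<close>

context
  fixes \<tau> j p :: nat and A :: real and x :: 'a and G :: "'w \<Rightarrow> ennreal"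
  assumes G: "G \<in> borel_measurable (generated_sigma P (past (\<tau> + j)))"
begin

lemma measurable_G [measurable]: "G \<in> borel_measurable P"
  by (rule measurable_from_generated_sigma[OF _ G]) (use past_in centred_gaussian_spaceD(3)[OF gaussian] in auto)

lemma measurable_lm [measurable]: "(\<lambda>\<omega>. local_mass \<gamma> (noise \<omega>) \<tau> j A p x) \<in> borel_measurable P"
  using measurable_compose[OF measurable_Pair2'[of x lborel P] measurable_local_mass[of noise P \<gamma> \<tau> j A p]]
  by simp

text \<open>Dropping the indicator of the displacement leaves the rescaled mass of the cell. It
  involves only layers from \<open>\<tau> + j\<close> on and is thus independent of G.\<close>

lemma local_mass_second_moment:
  "(\<integral>\<^sup>+\<omega>. G \<omega> * (local_mass \<gamma> (noise \<omega>) \<tau> j A p x)\<^sup>2 \<partial>P) \<le> (\<integral>\<^sup>+\<omega>. G \<omega> \<partial>P) * ennreal mass_const"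
proof -
  let ?\<sigma> = "\<tau> + j" let ?V = "cell (real (\<tau> + j)) x"
  let ?e = "ennreal (exp (dimn * real ?\<sigma>))"
  have mm[measurable]: "mass ?\<sigma> p ?V \<in> borel_measurable P"
    by (rule measurable_from_generated_sigma[OF _ measurable_mass_future])
      (use future_in centred_gaussian_spaceD(3)[OF gaussian] in auto)
  have le: "local_mass \<gamma> (noise \<omega>) \<tau> j A p x \<le> ?e * mass ?\<sigma> p ?V \<omega>" if w: "\<omega> \<in> space P" for \<omega>
  proof -
    have [measurable]: "(\<lambda>y. W (\<lambda>_. 0) ?\<sigma> p y \<omega>) \<in> borel_measurable borel"
      using measurable_compose[OF measurable_Pair1'[OF w] measurable_W_pair] by simp
    have "local_mass \<gamma> (noise \<omega>) \<tau> j A p x \<le> (\<integral>\<^sup>+y. ?e * (indicator ?V y * ennreal (sqrt p * W (\<lambda>_. 0) ?\<sigma> p y \<omega>)) \<partial>lborel)"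
      unfolding local_mass_def W_def dimn_eq
      by (intro nn_integral_mono mult_left_mono) (auto simp: indicator_def)
    also have "\<dots> = ?e * mass ?\<sigma> p ?V \<omega>" unfolding mass_def by (rule nn_integral_cmult) measurable
    finally show ?thesis .
  qed
  have "(\<integral>\<^sup>+\<omega>. G \<omega> * (local_mass \<gamma> (noise \<omega>) \<tau> j A p x)\<^sup>2 \<partial>P) \<le> (\<integral>\<^sup>+\<omega>. G \<omega> * (?e * mass ?\<sigma> p ?V \<omega>)\<^sup>2 \<partial>P)"
    by (intro nn_integral_mono mult_left_mono power_mono le) auto
  also have "\<dots> = (\<integral>\<^sup>+\<omega>. G \<omega> \<partial>P) * (\<integral>\<^sup>+\<omega>. (?e * mass ?\<sigma> p ?V \<omega>)\<^sup>2 \<partial>P)"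
    using measurable_mass_future[of ?V ?\<sigma> p]
    by (intro indep_nn_integral_mult[OF gaussian past_in future_in[of ?\<sigma> UNIV] uncorrelated_past_future G]) auto
  also have "(\<integral>\<^sup>+\<omega>. (?e * mass ?\<sigma> p ?V \<omega>)\<^sup>2 \<partial>P) = ?e\<^sup>2 * (\<integral>\<^sup>+\<omega>. (mass ?\<sigma> p ?V \<omega>)\<^sup>2 \<partial>P)"
    unfolding power_mult_distrib by (rule nn_integral_cmult) measurable
  also have "\<dots> \<le> ?e\<^sup>2 * (2 * (emeasure lborel ?V)\<^sup>2 +
    2 * emeasure lborel ?V * ennreal (exp (- (dimn * ?\<sigma>)) * branch_const) * 126)"
    by (intro mult_left_mono mass_second_moment) auto
  also have "\<dots> = ennreal mass_const"
  proof -
    have V: "emeasure lborel ?V = ennreal (exp (- (dimn * ?\<sigma>)))" by (simp add: emeasure_cell dimn_eq)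
    have 1: "exp (dimn * ?\<sigma>) * exp (- (dimn * ?\<sigma>)) = 1" by (simp add: exp_add[symmetric])
    have "?e\<^sup>2 * (2 * (emeasure lborel ?V)\<^sup>2 + 2 * emeasure lborel ?V * ennreal (exp (- (dimn * ?\<sigma>)) * branch_const) * 126)
      = (?e * emeasure lborel ?V)\<^sup>2 * 2 + (?e * emeasure lborel ?V) * (?e * ennreal (exp (- (dimn * ?\<sigma>)) * branch_const)) * 252"
      by (simp add: power2_eq_square distrib_left mult_ac)
    also have "?e * emeasure lborel ?V = 1" unfolding V using 1 by (simp flip: ennreal_mult)
    also have "?e * ennreal (exp (- (dimn * ?\<sigma>)) * branch_const) = ennreal branch_const"
      using 1 branch_const_nonneg by (simp add: mult.assoc[symmetric] flip: ennreal_mult)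
    also have "1\<^sup>2 * 2 + 1 * ennreal branch_const * 252 = ennreal mass_const"
      using branch_const_nonneg by (simp add: mass_const_def ennreal_mult mult.commute)
    finally show ?thesis .
  qed
  finally show ?thesis by (simp add: mult_left_mono)
qed

text \<open>The indicator of \<open>- A \<le> displacement\<close> plus
  \<open>exp (- A) * exp (- displacement)\<close> is at least 1, so at most
  \<open>exp (- A) * q\<close> of the weight is lost to points y far below x. On the rest the later
  layers have mean density at least 1/20, whence the factor 20.\<close>

lemma local_mass_first_moment:
  assumes p: "16 \<le> p" and q: "\<And>y. y \<in> cell (real (\<tau> + j)) x \<Longrightarrow>
      (\<integral>\<^sup>+\<omega>. G \<omega> * ennreal (exp (- displacement \<tau> j x y \<omega>)) \<partial>P) \<le> q"
  shows "(\<integral>\<^sup>+\<omega>. G \<omega> \<partial>P) \<le> 20 * (\<integral>\<^sup>+\<omega>. G \<omega> * local_mass \<gamma> (noise \<omega>) \<tau> j A p x \<partial>P) + ennreal (exp (- A)) * q"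
proof -
  interpret PL: pair_sigma_finite P "lborel :: 'a measure" ..
  let ?\<sigma> = "\<tau> + j" let ?V = "cell (real (\<tau> + j)) x"
  let ?e = "ennreal (exp (dimn * real ?\<sigma>))"
  let ?ind = "\<lambda>y \<omega>. indicator {- A..} (displacement \<tau> j x y \<omega>) :: ennreal"
  define w where "w = ennreal (sqrt p) * (killed_step ^^ p) (\<lambda>_. 1) 1"
  have w: "ennreal (1 / 20) \<le> w" unfolding w_def by (rule mass_density_lower[OF p])
  have indm[measurable]: "?ind y \<in> borel_measurable P" for y
    by (rule measurable_compose[OF measurable_displacement]) simp
  have indpast: "?ind y \<in> borel_measurable (generated_sigma P (past ?\<sigma>))" for y
    by (rule measurable_compose[OF measurable_displacement_past]) simp
  have inner: "(\<integral>\<^sup>+\<omega>. G \<omega> * (?ind y \<omega> * ennreal (sqrt p * W (\<lambda>_. 0) ?\<sigma> p y \<omega>)) \<partial>P) = (\<integral>\<^sup>+\<omega>. G \<omega> * ?ind y \<omega> \<partial>P) * w" for y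
  proof -
    have "(\<integral>\<^sup>+\<omega>. (G \<omega> * ?ind y \<omega>) * (ennreal (W (\<lambda>_. 0) ?\<sigma> (0 + p) y \<omega>) * (\<lambda>_. ennreal (sqrt p)) (R ?\<sigma> (0 + p) y \<omega>)) \<partial>P) =
      (\<integral>\<^sup>+\<omega>. (G \<omega> * ?ind y \<omega>) * (ennreal (W (\<lambda>_. 0) ?\<sigma> 0 y \<omega>) * barrier_iter (\<lambda>_. 0) 0 p (\<lambda>_. ennreal (sqrt p)) (R ?\<sigma> 0 y \<omega>)) \<partial>P)"
      by (rule path_expectation[OF past_in[of ?\<sigma>]]) (use G indpast uncorrelated_past in \<open>auto simp: past_def\<close>)
    also have "barrier_iter (\<lambda>_. 0) 0 p (\<lambda>_. ennreal (sqrt p)) = (\<lambda>r. ennreal (sqrt p) * (killed_step ^^ p) (\<lambda>_. 1) r)"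
      using killed_step_iter_cmult[of "\<lambda>_. 1" p "ennreal (sqrt p)"] by (auto simp: barrier_iter_const)
    also have "(\<integral>\<^sup>+\<omega>. (G \<omega> * ?ind y \<omega>) * (ennreal (W (\<lambda>_. 0) ?\<sigma> 0 y \<omega>) * (ennreal (sqrt p) * (killed_step ^^ p) (\<lambda>_. 1) (R ?\<sigma> 0 y \<omega>))) \<partial>P) =
      (\<integral>\<^sup>+\<omega>. G \<omega> * ?ind y \<omega> \<partial>P) * w"
      by (simp add: w_def nn_integral_multc)
    finally show ?thesis by (simp add: ennreal_mult W_nonneg mult_ac)
  qed
  have indpair[measurable]: "(\<lambda>z. ?ind (snd z) (fst z)) \<in> borel_measurable (P \<Otimes>\<^sub>M lborel)"
    unfolding displacement_def by (rule measurable_compose[of _ _ borel], measurable)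
  have lm: "local_mass \<gamma> (noise \<omega>) \<tau> j A p x = (\<integral>\<^sup>+y. ?e * (indicator ?V y * (?ind y \<omega> * ennreal (sqrt p * W (\<lambda>_. 0) ?\<sigma> p y \<omega>))) \<partial>lborel)" for \<omega>
    by (simp add: local_mass_def W_def displacement_def dimn_eq)
  have "(\<integral>\<^sup>+\<omega>. G \<omega> * local_mass \<gamma> (noise \<omega>) \<tau> j A p x \<partial>P) =
    (\<integral>\<^sup>+\<omega>. \<integral>\<^sup>+y. G \<omega> * (?e * (indicator ?V y * (?ind y \<omega> * ennreal (sqrt p * W (\<lambda>_. 0) ?\<sigma> p y \<omega>)))) \<partial>lborel \<partial>P)"
    unfolding lm
  proof (rule nn_integral_cong)
    fix \<omega> assume w: "\<omega> \<in> space P"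
    have "(\<lambda>z. ?e * (indicator ?V (snd z) * (?ind (snd z) (fst z) * ennreal (sqrt p * W (\<lambda>_. 0) ?\<sigma> p (snd z) (fst z))))) \<in> borel_measurable (P \<Otimes>\<^sub>M lborel)"
      by measurable
    from measurable_compose[OF measurable_Pair1'[OF w] this]
    show "G \<omega> * (\<integral>\<^sup>+y. ?e * (indicator ?V y * (?ind y \<omega> * ennreal (sqrt p * W (\<lambda>_. 0) ?\<sigma> p y \<omega>))) \<partial>lborel) =
      (\<integral>\<^sup>+y. G \<omega> * (?e * (indicator ?V y * (?ind y \<omega> * ennreal (sqrt p * W (\<lambda>_. 0) ?\<sigma> p y \<omega>)))) \<partial>lborel)"
      by (intro nn_integral_cmult[symmetric]) simp
  qed
  also have "\<dots> = (\<integral>\<^sup>+y. \<integral>\<^sup>+\<omega>. G \<omega> * (?e * (indicator ?V y * (?ind y \<omega> * ennreal (sqrt p * W (\<lambda>_. 0) ?\<sigma> p y \<omega>)))) \<partial>P \<partial>lborel)"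
  proof (rule PL.Fubini'[symmetric])
    have "(\<lambda>z. G (fst z) * (?e * (indicator ?V (snd z) * (?ind (snd z) (fst z) * ennreal (sqrt p * W (\<lambda>_. 0) ?\<sigma> p (snd z) (fst z)))))) \<in> borel_measurable (P \<Otimes>\<^sub>M lborel)"
      by measurable
    then show "(\<lambda>(\<omega>, y). G \<omega> * (?e * (indicator ?V y * (?ind y \<omega> * ennreal (sqrt p * W (\<lambda>_. 0) ?\<sigma> p y \<omega>))))) \<in> borel_measurable (P \<Otimes>\<^sub>M lborel)"
      by (simp add: case_prod_beta)
  qed
  also have "\<dots> = (\<integral>\<^sup>+y. (?e * w) * (indicator ?V y * (\<integral>\<^sup>+\<omega>. G \<omega> * ?ind y \<omega> \<partial>P)) \<partial>lborel)"
  proof (rule nn_integral_cong)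
    fix y
    have "(\<integral>\<^sup>+\<omega>. G \<omega> * (?e * (indicator ?V y * (?ind y \<omega> * ennreal (sqrt p * W (\<lambda>_. 0) ?\<sigma> p y \<omega>)))) \<partial>P) =
      (\<integral>\<^sup>+\<omega>. (?e * indicator ?V y) * (G \<omega> * (?ind y \<omega> * ennreal (sqrt p * W (\<lambda>_. 0) ?\<sigma> p y \<omega>))) \<partial>P)"
      by (intro nn_integral_cong) (simp only: mult_ac)
    also have "\<dots> = (?e * indicator ?V y) * ((\<integral>\<^sup>+\<omega>. G \<omega> * ?ind y \<omega> \<partial>P) * w)"
      by (subst nn_integral_cmult) (auto simp: inner)
    finally show "(\<integral>\<^sup>+\<omega>. G \<omega> * (?e * (indicator ?V y * (?ind y \<omega> * ennreal (sqrt p * W (\<lambda>_. 0) ?\<sigma> p y \<omega>)))) \<partial>P) =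
       (?e * w) * (indicator ?V y * (\<integral>\<^sup>+\<omega>. G \<omega> * ?ind y \<omega> \<partial>P))" by (simp only: mult_ac)
  qed
  finally have T: "(\<integral>\<^sup>+\<omega>. G \<omega> * local_mass \<gamma> (noise \<omega>) \<tau> j A p x \<partial>P) =
     (\<integral>\<^sup>+y. (?e * w) * (indicator ?V y * (\<integral>\<^sup>+\<omega>. G \<omega> * ?ind y \<omega> \<partial>P)) \<partial>lborel)" .
  have mI: "(\<lambda>y. \<integral>\<^sup>+\<omega>. G \<omega> * ?ind y \<omega> \<partial>P) \<in> borel_measurable lborel"
  proof -
    have "(\<lambda>z. G (snd z) * ?ind (fst z) (snd z)) \<in> borel_measurable (lborel \<Otimes>\<^sub>M P)"
      using measurable_compose[OF measurable_pair_swap' indpair] by (simp add: case_prod_beta)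
    from borel_measurable_nn_integral_fst[OF this] show ?thesis by simp
  qed
  have V: "emeasure lborel ?V = ennreal (exp (- (dimn * ?\<sigma>)))" by (simp add: emeasure_cell dimn_eq)
  have eV: "?e * emeasure lborel ?V = 1"
    unfolding V by (simp add: exp_add[symmetric] flip: ennreal_mult)
  have split: "(\<integral>\<^sup>+\<omega>. G \<omega> \<partial>P) \<le> (\<integral>\<^sup>+\<omega>. G \<omega> * ?ind y \<omega> \<partial>P) + ennreal (exp (- A)) * q" if y: "y \<in> ?V" for y
  proof -
    have "(\<integral>\<^sup>+\<omega>. G \<omega> \<partial>P) \<le> (\<integral>\<^sup>+\<omega>. G \<omega> * ?ind y \<omega> + ennreal (exp (- A)) * (G \<omega> * ennreal (exp (- displacement \<tau> j x y \<omega>))) \<partial>P)"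
    proof (rule nn_integral_mono)
      fix \<omega>
      have "(1::ennreal) \<le> ?ind y \<omega> + ennreal (exp (- A)) * ennreal (exp (- displacement \<tau> j x y \<omega>))"
      proof (cases "- A \<le> displacement \<tau> j x y \<omega>")
        case False
        then have "1 \<le> exp (- A + - displacement \<tau> j x y \<omega>)" by simp
        then have "ennreal 1 \<le> ennreal (exp (- A) * exp (- displacement \<tau> j x y \<omega>))"
          unfolding exp_add by (rule ennreal_leI)
        then show ?thesis using False by (simp add: ennreal_mult)
      qed simp
      then have "G \<omega> * 1 \<le> G \<omega> * (?ind y \<omega> + ennreal (exp (- A)) * ennreal (exp (- displacement \<tau> j x y \<omega>)))"
        by (rule mult_left_mono) simp
      then show "G \<omega> \<le> G \<omega> * ?ind y \<omega> + ennreal (exp (- A)) * (G \<omega> * ennreal (exp (- displacement \<tau> j x y \<omega>)))"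
        by (simp add: distrib_left mult_ac)
    qed
    also have "\<dots> = (\<integral>\<^sup>+\<omega>. G \<omega> * ?ind y \<omega> \<partial>P) + ennreal (exp (- A)) * (\<integral>\<^sup>+\<omega>. G \<omega> * ennreal (exp (- displacement \<tau> j x y \<omega>)) \<partial>P)"
      by (subst nn_integral_add) (auto simp: nn_integral_cmult)
    also have "\<dots> \<le> (\<integral>\<^sup>+\<omega>. G \<omega> * ?ind y \<omega> \<partial>P) + ennreal (exp (- A)) * q"
      by (intro add_left_mono mult_left_mono q y) auto
    finally show ?thesis .
  qed
  have "(\<integral>\<^sup>+\<omega>. G \<omega> \<partial>P) = ?e * (\<integral>\<^sup>+y. indicator ?V y * (\<integral>\<^sup>+\<omega>. G \<omega> \<partial>P) \<partial>lborel)"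
    using eV by (simp add: nn_integral_multc mult.assoc[symmetric])
  also have "\<dots> \<le> ?e * (\<integral>\<^sup>+y. indicator ?V y * (\<integral>\<^sup>+\<omega>. G \<omega> * ?ind y \<omega> \<partial>P) + indicator ?V y * (ennreal (exp (- A)) * q) \<partial>lborel)"
    using split by (intro mult_left_mono nn_integral_mono) (auto simp: indicator_def)
  also have "\<dots> = ?e * (\<integral>\<^sup>+y. indicator ?V y * (\<integral>\<^sup>+\<omega>. G \<omega> * ?ind y \<omega> \<partial>P) \<partial>lborel) + ?e * emeasure lborel ?V * (ennreal (exp (- A)) * q)"
  proof -
    have [measurable]: "(\<lambda>y. \<integral>\<^sup>+\<omega>. G \<omega> * ?ind y \<omega> \<partial>P) \<in> borel_measurable lborel" by (rule mI)
    have "(\<integral>\<^sup>+y. indicator ?V y * (\<integral>\<^sup>+\<omega>. G \<omega> * ?ind y \<omega> \<partial>P) + indicator ?V y * (ennreal (exp (- A)) * q) \<partial>lborel) =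
      (\<integral>\<^sup>+y. indicator ?V y * (\<integral>\<^sup>+\<omega>. G \<omega> * ?ind y \<omega> \<partial>P) \<partial>lborel) + (\<integral>\<^sup>+y. indicator ?V y * (ennreal (exp (- A)) * q) \<partial>lborel)"
      by (rule nn_integral_add) measurable
    also have "(\<integral>\<^sup>+y. indicator ?V y * (ennreal (exp (- A)) * q) \<partial>lborel) = emeasure lborel ?V * (ennreal (exp (- A)) * q)"
      by (simp add: nn_integral_multc)
    finally show ?thesis by (simp only: distrib_left mult.assoc)
  qed
  also have "\<dots> = ?e * (\<integral>\<^sup>+y. indicator ?V y * (\<integral>\<^sup>+\<omega>. G \<omega> * ?ind y \<omega> \<partial>P) \<partial>lborel) + ennreal (exp (- A)) * q"
    unfolding eV by simp
  also have "?e * (\<integral>\<^sup>+y. indicator ?V y * (\<integral>\<^sup>+\<omega>. G \<omega> * ?ind y \<omega> \<partial>P) \<partial>lborel) \<le> 20 * (\<integral>\<^sup>+\<omega>. G \<omega> * local_mass \<gamma> (noise \<omega>) \<tau> j A p x \<partial>P)"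
  proof -
    have "1 = (20::ennreal) * ennreal (1 / 20)" by (simp flip: ennreal_numeral ennreal_mult)
    also have "\<dots> \<le> 20 * w" using w by (intro mult_left_mono) auto
    finally have "1 * (?e * (\<integral>\<^sup>+y. indicator ?V y * (\<integral>\<^sup>+\<omega>. G \<omega> * ?ind y \<omega> \<partial>P) \<partial>lborel)) \<le> (20 * w) * (?e * (\<integral>\<^sup>+y. indicator ?V y * (\<integral>\<^sup>+\<omega>. G \<omega> * ?ind y \<omega> \<partial>P) \<partial>lborel))"
      by (rule mult_right_mono) simp
    also have "\<dots> = 20 * (\<integral>\<^sup>+\<omega>. G \<omega> * local_mass \<gamma> (noise \<omega>) \<tau> j A p x \<partial>P)"
      unfolding T using mI by (subst nn_integral_cmult) (auto simp: mult_ac)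
    finally show ?thesis by simp
  qed
  finally show ?thesis by (simp add: add_mono)
qed

text \<open>The local mass T satisfies \<open>T \<le> 1 / 80 + \<eta> * T\<^sup>2\<close>, up to an
  extra \<open>1 / (4 * \<eta>)\<close> on the event \<open>1 / 80 \<le> T\<close>. With
  \<open>\<eta> = 1 / (80 * mass_const)\<close> and after multiplication by 20, the first two terms
  cost a quarter of the weight each, and the third has the factor
  \<open>400 * mass_const\<close>.\<close>

lemma local_mass_indicator:
  assumes p: "16 \<le> p" and q: "\<And>y. y \<in> cell (real (\<tau> + j)) x \<Longrightarrow>
      (\<integral>\<^sup>+\<omega>. G \<omega> * ennreal (exp (- displacement \<tau> j x y \<omega>)) \<partial>P) \<le> q"
  shows "(\<integral>\<^sup>+\<omega>. G \<omega> \<partial>P) \<le> ennreal (1 / 2) * (\<integral>\<^sup>+\<omega>. G \<omega> \<partial>P) +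
     ennreal (400 * mass_const) * (\<integral>\<^sup>+\<omega>. G \<omega> * indicator {1 / 80..} (local_mass \<gamma> (noise \<omega>) \<tau> j A p x) \<partial>P) +
     ennreal (exp (- A)) * q"
proof -
  let ?T = "\<lambda>\<omega>. local_mass \<gamma> (noise \<omega>) \<tau> j A p x"
  let ?i = "\<lambda>\<omega>. indicator {1 / 80..} (?T \<omega>) :: ennreal"
  have [measurable]: "?i \<in> borel_measurable P" by (rule measurable_compose[OF measurable_lm]) simp
  define \<eta> where "\<eta> = 1 / (80 * mass_const)"
  have \<eta>: "0 < \<eta>" using mass_const_ge by (simp add: \<eta>_def)
  let ?g = "\<integral>\<^sup>+\<omega>. G \<omega> \<partial>P"
  have "(\<integral>\<^sup>+\<omega>. G \<omega> * ?T \<omega> \<partial>P) \<le> (\<integral>\<^sup>+\<omega>. ennreal (1 / 80) * G \<omega> + (ennreal \<eta> * (G \<omega> * (?T \<omega>)\<^sup>2) + ennreal (20 * mass_const) * (G \<omega> * ?i \<omega>)) \<partial>P)"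
  proof (rule nn_integral_mono)
    fix \<omega>
    have "?T \<omega> \<le> ennreal (1 / 80) + (ennreal \<eta> * (?T \<omega>)\<^sup>2 + ennreal (20 * mass_const) * ?i \<omega>)"
    proof (cases "1 / 80 \<le> ?T \<omega>")
      case True
      have "1 / (4 * \<eta>) = 20 * mass_const" by (simp add: \<eta>_def)
      then have "?T \<omega> \<le> ennreal \<eta> * (?T \<omega>)\<^sup>2 + ennreal (20 * mass_const)" using ennreal_le_square[OF \<eta>, of "?T \<omega>"] by simp
      then show ?thesis using True by (simp add: add_increasing)
    next
      case False
      have "1 / 80 = ennreal (1 / 80)"
        by (simp add: ennreal_divide_numeral[symmetric] del: ennreal_divide_numeral flip: ennreal_1)
      then have "?T \<omega> \<le> ennreal (1 / 80)" using False by simp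
      then show ?thesis by (simp add: add_increasing2)
    qed
    then have "G \<omega> * ?T \<omega> \<le> G \<omega> * (ennreal (1 / 80) + (ennreal \<eta> * (?T \<omega>)\<^sup>2 + ennreal (20 * mass_const) * ?i \<omega>))"
      by (rule mult_left_mono) simp
    then show "G \<omega> * ?T \<omega> \<le> ennreal (1 / 80) * G \<omega> + (ennreal \<eta> * (G \<omega> * (?T \<omega>)\<^sup>2) + ennreal (20 * mass_const) * (G \<omega> * ?i \<omega>))"
      by (simp only: distrib_left mult_ac)
  qed
  also have "\<dots> = ennreal (1 / 80) * ?g + (ennreal \<eta> * (\<integral>\<^sup>+\<omega>. G \<omega> * (?T \<omega>)\<^sup>2 \<partial>P) + ennreal (20 * mass_const) * (\<integral>\<^sup>+\<omega>. G \<omega> * ?i \<omega> \<partial>P))"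
    by (subst nn_integral_add, simp, simp, subst nn_integral_add) (auto simp: nn_integral_cmult)
  also have "\<dots> \<le> ennreal (1 / 80) * ?g + (ennreal \<eta> * (?g * ennreal mass_const) + ennreal (20 * mass_const) * (\<integral>\<^sup>+\<omega>. G \<omega> * ?i \<omega> \<partial>P))"
    by (intro add_mono mult_left_mono local_mass_second_moment) auto
  finally have "20 * (\<integral>\<^sup>+\<omega>. G \<omega> * ?T \<omega> \<partial>P) \<le> 20 * (ennreal (1 / 80) * ?g + (ennreal \<eta> * (?g * ennreal mass_const) + ennreal (20 * mass_const) * (\<integral>\<^sup>+\<omega>. G \<omega> * ?i \<omega> \<partial>P)))"
    by (rule mult_left_mono) simp
  also have "\<dots> = (20 * ennreal (1 / 80) + 20 * (ennreal \<eta> * ennreal mass_const)) * ?g + (20 * ennreal (20 * mass_const)) * (\<integral>\<^sup>+\<omega>. G \<omega> * ?i \<omega> \<partial>P)"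
    by (simp only: distrib_left distrib_right mult_ac add_ac)
  also have "20 * ennreal (1 / 80) + 20 * (ennreal \<eta> * ennreal mass_const) = ennreal (1 / 2)"
  proof -
    have "20 * ennreal (1 / 80) = ennreal (20 * (1 / 80))"
      by (subst ennreal_mult) auto
    moreover have "20 * (ennreal \<eta> * ennreal mass_const) = ennreal (20 * (\<eta> * mass_const))"
      proof -
      have "ennreal (20 * (\<eta> * mass_const)) = ennreal 20 * ennreal (\<eta> * mass_const)"
        using \<eta> mass_const_ge by (intro ennreal_mult) auto
      also have "ennreal (\<eta> * mass_const) = ennreal \<eta> * ennreal mass_const"
        using \<eta> mass_const_ge by (intro ennreal_mult) auto
      finally show ?thesis by simp
    qed
    moreover have "ennreal (20 * (1 / 80)) + ennreal (20 * (\<eta> * mass_const)) = ennreal (20 * (1 / 80) + 20 * (\<eta> * mass_const))"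
      using \<eta> mass_const_ge by (intro ennreal_plus[symmetric]) auto
    ultimately have "20 * ennreal (1 / 80) + 20 * (ennreal \<eta> * ennreal mass_const) = ennreal (20 * (1 / 80) + 20 * (\<eta> * mass_const))"
      by (simp only:)
    also have "20 * (1 / 80) + 20 * (\<eta> * mass_const) = 1 / 2" using mass_const_ge by (simp add: \<eta>_def)
    finally show ?thesis .
  qed
  also have "20 * ennreal (20 * mass_const) = ennreal (400 * mass_const)"
    using mass_const_ge by (simp flip: ennreal_numeral ennreal_mult)
  finally have "20 * (\<integral>\<^sup>+\<omega>. G \<omega> * ?T \<omega> \<partial>P) \<le> ennreal (1 / 2) * ?g + ennreal (400 * mass_const) * (\<integral>\<^sup>+\<omega>. G \<omega> * ?i \<omega> \<partial>P)" .
  then show ?thesis using local_mass_first_moment[OF p q] by (meson add_right_mono order_trans)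
qed

end

end

section \<open>Probability of good hits\<close>

context gaussian_noise
begin

text \<open>With \<open>C0 * dimn\<close> as the largest possible shift: the Chernoff cost of that
  shift times the constant that absorbs the shift of \<open>target\<close> into
  \<open>decay\<close>.\<close>

definition chernoff_const :: real where
  "chernoff_const = exp ((\<gamma> + 2) * (C0 * dimn) + 1 + C0 * dimn)"

text \<open>Inside a cell of side \<open>exp (- (\<tau> + j))\<close> layer
  \<open>\<tau> + i\<close> contributes at most \<open>C0 * dimn * exp (- (j - i))\<close>, and the
  geometric series sums to at most \<open>1 / (exp 1 - 1)\<close>, which is below 1. So the shift is
  bounded uniformly in j.\<close>

lemma shift_le:
  assumes "y \<in> cell (real (\<tau> + j)) x"
  shows "shift \<tau> j x y \<le> C0 * dimn"
proof -
  have geo: "(\<Sum>i<k. exp (- real (k - i))) \<le> (1::real)" for k :: nat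
  proof (induction k)
    case (Suc k)
    have "(\<Sum>i<Suc k. exp (- real (Suc k - i))) = exp (-1) * (\<Sum>i<k. exp (- real (k - i))) + exp (-1)"
      by (simp add: sum_distrib_left exp_add[symmetric] Suc_diff_le cong: sum.cong_simp)
    also have "\<dots> \<le> exp (-1) * 1 + exp (-1)" using Suc by (intro add_mono mult_left_mono) auto
    also have "\<dots> \<le> 1"
      using exp_ge_add_one_self[of 1] by (simp add: exp_minus field_simps)
    finally show ?case .
  qed simp
  have dist: "dist x y \<le> dimn * exp (- real (\<tau> + j))" using dist_cell_le[OF assms] by (simp add: dimn_eq)
  have "shift \<tau> j x y \<le> (\<Sum>i<j. C0 * dimn * exp (- real (j - i)))"
    unfolding shift_def
  proof (rule sum_mono)
    fix i assume i: "i \<in> {..<j}"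
    have "1 - c (\<tau> + i) x y \<le> C0 * exp (real (\<tau> + i)) * dist x y" by (rule c_near)
    also have "\<dots> \<le> C0 * exp (real (\<tau> + i)) * (dimn * exp (- real (\<tau> + j)))"
      using dist C0_nonneg by (intro mult_left_mono) auto
    also have "\<dots> = C0 * dimn * exp (real (\<tau> + i) - real (\<tau> + j))"
      by (simp only: exp_diff exp_minus divide_inverse mult_ac)
    also have "real (\<tau> + i) - real (\<tau> + j) = - real (j - i)" using i by (simp add: of_nat_diff)
    finally show "1 - c (\<tau> + i) x y \<le> C0 * dimn * exp (- real (j - i))" .
  qed
  also have "\<dots> = C0 * dimn * (\<Sum>i<j. exp (- real (j - i)))" by (simp add: sum_distrib_left)
  also have "\<dots> \<le> C0 * dimn * 1" using geo[of j] C0_nonneg dimn_eq by (intro mult_left_mono mult_nonneg_nonneg) auto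
  finally show ?thesis by simp
qed

definition decay_level :: "nat \<Rightarrow> nat \<Rightarrow> ennreal" where
  "decay_level n k = ennreal (sqrt n) * (killed_step ^^ n) (\<lambda>z. (killed_step ^^ k) decay (z - level n)) 1"

text \<open>After the tilt a hit is demanded at w minus the shift, where w is the height above the
  level. Then w lies between 0 and \<open>1 + C0 * dimn\<close>, so w is at most
  \<open>exp (1 + C0 * dimn) * (w * exp (- w))\<close>, and the known sum for \<open>decay\<close>
  takes over.\<close>

lemma chernoff_hit:
  assumes k: "k \<in> {1..L}" and y: "y \<in> cell (real (\<tau> + (n + k))) x"
  shows "(\<integral>\<^sup>+\<omega>. score (barrier n) (hit_score n L) \<tau> (n + k) x \<omega> * ennreal (exp (- displacement \<tau> (n + k) x y \<omega>)) \<partial>P)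
    \<le> ennreal chernoff_const * decay_level n k"
proof -
  let ?j = "n + k" let ?m = "shift \<tau> (n + k) x y"
  let ?M = "C0 * dimn"
  have m: "0 \<le> ?m" "?m \<le> ?M" using shift_nonneg shift_le[OF y] by auto
  have "(\<integral>\<^sup>+\<omega>. score (barrier n) (hit_score n L) \<tau> ?j x \<omega> * ennreal (exp (- displacement \<tau> ?j x y \<omega>)) \<partial>P) \<le>
     ennreal (exp ((\<gamma> + 2) * ?m)) * barrier_iter (barrier n) 0 ?j (\<lambda>z. hit_score n L ?j (z - ?m)) 1"
    unfolding score_def by (rule chernoff) simp
  also have "\<dots> \<le> ennreal (exp ((\<gamma> + 2) * ?M)) * barrier_iter (barrier n) 0 ?j (\<lambda>z. (ennreal (exp (1 + ?M)) * ennreal (sqrt n)) * decay (z - level n)) 1"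
  proof (intro mult_mono ennreal_leI barrier_iter_mono)
    show "exp ((\<gamma> + 2) * ?m) \<le> exp ((\<gamma> + 2) * ?M)" using m gamma_ge_1 by (auto intro: mult_left_mono)
    fix z
    let ?w = "z - level n"
    have "target (?w - ?m) \<le> ennreal (exp (1 + ?M)) * decay ?w"
    proof (cases "0 < ?w - ?m \<and> ?w - ?m \<le> 1")
      case True
      have w: "0 < ?w" "?w \<le> 1 + ?M" using True m by auto
      have "?w - ?m \<le> ?w * 1" using m by simp
      also have "\<dots> \<le> ?w * exp (1 + ?M - ?w)" using w by (intro mult_left_mono) auto
      also have "exp (1 + ?M - ?w) = exp (1 + ?M) * exp (- ?w)" by (simp add: exp_add[symmetric])
      also have "?w * (exp (1 + ?M) * exp (- ?w)) = exp (1 + ?M) * (max 0 ?w * exp (- ?w))"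
        using w by (simp add: max_def)
      finally have "?w - ?m \<le> exp (1 + ?M) * (max 0 ?w * exp (- ?w))" .
      then have "ennreal (?w - ?m) \<le> ennreal (exp (1 + ?M) * (max 0 ?w * exp (- ?w)))" by (rule ennreal_leI)
      also have "\<dots> = ennreal (exp (1 + ?M)) * decay ?w" unfolding decay_def by (rule ennreal_mult) auto
      finally show ?thesis using True by (simp add: target_def)
    qed (auto simp: target_def)
    then have "ennreal (sqrt n) * target (?w - ?m) \<le> ennreal (sqrt n) * (ennreal (exp (1 + ?M)) * decay ?w)"
      by (rule mult_left_mono) simp
    then show "hit_score n L ?j (z - ?m) \<le> (ennreal (exp (1 + ?M)) * ennreal (sqrt n)) * decay ?w"
      using k by (simp add: hit_score_def mult_ac diff_diff_eq add.commute)
  qed auto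
  also have "barrier_iter (barrier n) 0 ?j (\<lambda>z. (ennreal (exp (1 + ?M)) * ennreal (sqrt n)) * decay (z - level n)) 1
     = (killed_step ^^ n) (\<lambda>z. (killed_step ^^ k) (\<lambda>z. (ennreal (exp (1 + ?M)) * ennreal (sqrt n)) * decay z) (z - level n)) 1"
    using barrier_iter_both[of 0 n k "\<lambda>z. (ennreal (exp (1 + ?M)) * ennreal (sqrt n)) * decay (z - level n)" 1] by simp
  also have "\<dots> = ennreal (exp (1 + ?M)) * decay_level n k"
    by (simp add: killed_step_iter_cmult mult.assoc decay_level_def)
  also have "ennreal (exp ((\<gamma> + 2) * ?M)) * (ennreal (exp (1 + ?M)) * decay_level n k) = ennreal chernoff_const * decay_level n k"
  proof -
    have "ennreal (exp ((\<gamma> + 2) * ?M)) * ennreal (exp (1 + ?M)) = ennreal chernoff_const"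
      by (simp add: chernoff_const_def exp_add[symmetric] add.assoc flip: ennreal_mult)
    then show ?thesis by (simp only: mult.assoc[symmetric])
  qed
  finally show ?thesis .
qed

text \<open>5408000 = 52 * 104000: the weight lost to large displacements, summed over all scales,
  is at most \<open>exp (- threshold) * (chernoff_const * 52) = 1 / 104000\<close> per unit volume,
  a quarter of the lower bound 1/26000 for the expected hits.\<close>

definition threshold :: real where "threshold = ln (5408000 * chernoff_const)"

abbreviation good :: "nat \<Rightarrow> nat \<Rightarrow> nat \<Rightarrow> nat \<Rightarrow> 'a set \<Rightarrow> 'w \<Rightarrow> ennreal" where
  "good n L \<tau> N Q \<omega> \<equiv> good_hits (noise \<omega>) n L \<tau> threshold N Q"

definition hit_const :: real where "hit_const = 1458 + 259524 * branch_const"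

text \<open>Per unit volume, the squared lower bound for the mean of good hits over the bound for
  their second moment; 41600000 = 400 * 104000. It contains no n, no \<open>\<tau>\<close> and no
  region.\<close>

definition prob_const :: real where
  "prob_const = (1 / (41600000 * mass_const))\<^sup>2 / hit_const"

lemma hit_const_pos: "0 < hit_const" using branch_const_nonneg by (simp add: hit_const_def)

lemma prob_const_pos: "0 < prob_const"
  using hit_const_pos mass_const_ge by (simp add: prob_const_def)

lemma hits_first_moment:
  assumes Q[measurable]: "Q \<in> sets borel"
  shows "(\<integral>\<^sup>+\<omega>. hits n L \<tau> Q \<omega> \<partial>P) = emeasure lborel Q * remaining (barrier n) (hit_score n L) (n + L) 0 1"
    and "(\<integral>\<^sup>+\<omega>. hits n L \<tau> Q \<omega> \<partial>P) = (\<integral>\<^sup>+x. indicator Q x * (\<Sum>j=0..n + L. \<integral>\<^sup>+\<omega>. score (barrier n) (hit_score n L) \<tau> j x \<omega> \<partial>P) \<partial>lborel)"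
proof -
  interpret PL: pair_sigma_finite P "lborel :: 'a measure" ..
  note measurable_score_pair[of "hit_score n L", OF measurable_hit_score, measurable]
  note measurable_score[OF measurable_hit_score, measurable]
  have "(\<integral>\<^sup>+\<omega>. hits n L \<tau> Q \<omega> \<partial>P) = (\<integral>\<^sup>+x. \<integral>\<^sup>+\<omega>. indicator Q x * (\<Sum>j=0..n + L. score (barrier n) (hit_score n L) \<tau> j x \<omega>) \<partial>P \<partial>lborel)"
    unfolding hits_def total_def
  proof (rule PL.Fubini'[symmetric])
    have "(\<lambda>z. indicator Q (snd z) * (\<Sum>j=0..n + L. score (barrier n) (hit_score n L) \<tau> j (snd z) (fst z))) \<in> borel_measurable (P \<Otimes>\<^sub>M lborel)"
      by measurable
    then show "(\<lambda>(\<omega>, x). indicator Q x * (\<Sum>j=0..n + L. score (barrier n) (hit_score n L) \<tau> j x \<omega>)) \<in> borel_measurable (P \<Otimes>\<^sub>M lborel)"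
      by (simp add: case_prod_beta)
  qed
  also have "\<dots> = (\<integral>\<^sup>+x. indicator Q x * (\<Sum>j=0..n + L. \<integral>\<^sup>+\<omega>. score (barrier n) (hit_score n L) \<tau> j x \<omega> \<partial>P) \<partial>lborel)"
    by (simp add: nn_integral_cmult nn_integral_sum)
  finally show 2: "(\<integral>\<^sup>+\<omega>. hits n L \<tau> Q \<omega> \<partial>P) = (\<integral>\<^sup>+x. indicator Q x * (\<Sum>j=0..n + L. \<integral>\<^sup>+\<omega>. score (barrier n) (hit_score n L) \<tau> j x \<omega> \<partial>P) \<partial>lborel)" .
  have "(\<Sum>j=0..n + L. \<integral>\<^sup>+\<omega>. score (barrier n) (hit_score n L) \<tau> j x \<omega> \<partial>P) = remaining (barrier n) (hit_score n L) (n + L) 0 1" for x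
    unfolding remaining_def score_def by (intro sum.cong refl) (simp add: weight_expectation)
  then show "(\<integral>\<^sup>+\<omega>. hits n L \<tau> Q \<omega> \<partial>P) = emeasure lborel Q * remaining (barrier n) (hit_score n L) (n + L) 0 1"
    using 2 by (simp add: nn_integral_multc)
qed

lemma good_le_hits: "good n L \<tau> N Q \<omega> \<le> hits n L \<tau> Q \<omega>"
  unfolding good_hits_def hits_def total_def score_def W_def R_def
  by (intro nn_integral_mono mult_left_mono sum_mono) (auto simp: indicator_def)

lemma measurable_good: "Q \<in> sets borel \<Longrightarrow> good n L \<tau> N Q \<in> borel_measurable P"
  by (rule measurable_good_hits) auto

text \<open>\<open>local_mass_indicator\<close> with the score at x as weight, summed over scales
  and integrated over Q. At least 16 layers remain after the last scale n + L, as the lower bound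
  for the mean mass of a cell requires.\<close>

lemma good_first_moment:
  assumes Q[measurable]: "Q \<in> sets borel" and N: "\<tau> + n + L + 16 \<le> N"
  shows "(\<integral>\<^sup>+\<omega>. hits n L \<tau> Q \<omega> \<partial>P) \<le> ennreal (1 / 2) * (\<integral>\<^sup>+\<omega>. hits n L \<tau> Q \<omega> \<partial>P) +
     ennreal (400 * mass_const) * (\<integral>\<^sup>+\<omega>. good n L \<tau> N Q \<omega> \<partial>P) + ennreal (1 / 104000) * emeasure lborel Q"
proof -
  interpret PL: pair_sigma_finite P "lborel :: 'a measure" ..
  let ?s = "\<lambda>j x \<omega>. score (barrier n) (hit_score n L) \<tau> j x \<omega>"
  let ?T = "\<lambda>j x \<omega>. local_mass \<gamma> (noise \<omega>) \<tau> j threshold (N - (\<tau> + j)) x"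
  let ?i = "\<lambda>j x \<omega>. indicator {1 / 80..} (?T j x \<omega>) :: ennreal"
  note measurable_score_pair[of "hit_score n L", OF measurable_hit_score, measurable]
  have Tm[measurable]: "(\<lambda>z. ?T j (snd z) (fst z)) \<in> borel_measurable (P \<Otimes>\<^sub>M lborel)" for j
    by (rule measurable_local_mass) measurable
  have im: "(\<lambda>z. ?i j (snd z) (fst z)) \<in> borel_measurable (P \<Otimes>\<^sub>M lborel)" for j
    by (rule measurable_compose[OF Tm]) simp
  note [measurable] = this
  have imx[measurable]: "(\<lambda>\<omega>. ?i j x \<omega>) \<in> borel_measurable P" for j x
    using measurable_compose[OF measurable_Pair2'[of x lborel P] im] by (simp only: fst_conv snd_conv space_lborel space_borel UNIV_I simp_thms)
  note measurable_score[OF measurable_hit_score, measurable]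
  have "good n L \<tau> N Q \<omega> = (\<integral>\<^sup>+x. indicator Q x * (\<Sum>j=0..n + L. ?s j x \<omega> * ?i j x \<omega>) \<partial>lborel)" for \<omega>
    unfolding good_hits_def score_def W_def R_def ..
  then have "(\<integral>\<^sup>+\<omega>. good n L \<tau> N Q \<omega> \<partial>P) = (\<integral>\<^sup>+\<omega>. \<integral>\<^sup>+x. indicator Q x * (\<Sum>j=0..n + L. ?s j x \<omega> * ?i j x \<omega>) \<partial>lborel \<partial>P)"
    by simp
  also have "\<dots> = (\<integral>\<^sup>+x. \<integral>\<^sup>+\<omega>. indicator Q x * (\<Sum>j=0..n + L. ?s j x \<omega> * ?i j x \<omega>) \<partial>P \<partial>lborel)"
  proof (rule PL.Fubini'[symmetric])
    have "(\<lambda>z. indicator Q (snd z) * (\<Sum>j=0..n + L. ?s j (snd z) (fst z) * ?i j (snd z) (fst z))) \<in> borel_measurable (P \<Otimes>\<^sub>M lborel)"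
      by measurable
    then show "(\<lambda>(\<omega>, x). indicator Q x * (\<Sum>j=0..n + L. ?s j x \<omega> * ?i j x \<omega>)) \<in> borel_measurable (P \<Otimes>\<^sub>M lborel)"
      by (simp add: case_prod_beta)
  qed
  also have "\<dots> = (\<integral>\<^sup>+x. indicator Q x * (\<Sum>j=0..n + L. \<integral>\<^sup>+\<omega>. ?s j x \<omega> * ?i j x \<omega> \<partial>P) \<partial>lborel)"
  proof (rule nn_integral_cong)
    fix x
    have sm: "(\<lambda>\<omega>. ?s j x \<omega> * ?i j x \<omega>) \<in> borel_measurable P" for j
      by (rule borel_measurable_times_ennreal[OF measurable_score[OF measurable_hit_score] imx])
    have "(\<integral>\<^sup>+\<omega>. indicator Q x * (\<Sum>j=0..n + L. ?s j x \<omega> * ?i j x \<omega>) \<partial>P) =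
      indicator Q x * (\<integral>\<^sup>+\<omega>. (\<Sum>j=0..n + L. ?s j x \<omega> * ?i j x \<omega>) \<partial>P)"
      by (rule nn_integral_cmult) (rule borel_measurable_sum, rule sm)
    also have "(\<integral>\<^sup>+\<omega>. (\<Sum>j=0..n + L. ?s j x \<omega> * ?i j x \<omega>) \<partial>P) = (\<Sum>j=0..n + L. \<integral>\<^sup>+\<omega>. ?s j x \<omega> * ?i j x \<omega> \<partial>P)"
      by (rule nn_integral_sum) (rule sm)
    finally show "(\<integral>\<^sup>+\<omega>. indicator Q x * (\<Sum>j=0..n + L. ?s j x \<omega> * ?i j x \<omega>) \<partial>P) =
      indicator Q x * (\<Sum>j=0..n + L. \<integral>\<^sup>+\<omega>. ?s j x \<omega> * ?i j x \<omega> \<partial>P)" .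
  qed
  finally have gd: "(\<integral>\<^sup>+\<omega>. good n L \<tau> N Q \<omega> \<partial>P) = (\<integral>\<^sup>+x. indicator Q x * (\<Sum>j=0..n + L. \<integral>\<^sup>+\<omega>. ?s j x \<omega> * ?i j x \<omega> \<partial>P) \<partial>lborel)" .
  define q where "q j = (if n < j then ennreal chernoff_const * decay_level n (j - n) else 0)" for j
  have one: "(\<integral>\<^sup>+\<omega>. ?s j x \<omega> \<partial>P) \<le> ennreal (1 / 2) * (\<integral>\<^sup>+\<omega>. ?s j x \<omega> \<partial>P) +
     ennreal (400 * mass_const) * (\<integral>\<^sup>+\<omega>. ?s j x \<omega> * ?i j x \<omega> \<partial>P) + ennreal (exp (- threshold)) * q j"
    if j: "j \<in> {0..n + L}" for j x
  proof (cases "n < j")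
    case False
    then show ?thesis by (simp add: score_def hit_score_def)
  next
    case True
    show ?thesis
    proof (rule local_mass_indicator)
      show "?s j x \<in> borel_measurable (generated_sigma P (past (\<tau> + j)))"
        by (rule score_measurable_past) simp
      show "16 \<le> N - (\<tau> + j)" using N j by auto
      fix y assume y: "y \<in> cell (real (\<tau> + j)) x"
      have "j - n \<in> {1..L}" "n + (j - n) = j" using True j by auto
      then show "(\<integral>\<^sup>+\<omega>. ?s j x \<omega> * ennreal (exp (- displacement \<tau> j x y \<omega>)) \<partial>P) \<le> q j"
        using chernoff_hit[of "j - n" L y \<tau> n x] y True by (simp add: q_def)
    qed
  qed
  have qs: "ennreal (exp (- threshold)) * (\<Sum>j=0..n + L. q j) \<le> ennreal (1 / 104000)"
  proof -
    have "(\<Sum>j=0..n + L. q j) = (\<Sum>j=Suc n..n + L. ennreal chernoff_const * decay_level n (j - n))"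
      by (rule sum.mono_neutral_cong_right) (auto simp: q_def)
    also have "\<dots> = (\<Sum>k=1..L. ennreal chernoff_const * decay_level n k)"
      by (rule sum.reindex_bij_witness[of _ "\<lambda>k. n + k" "\<lambda>j. j - n"]) auto
    also have "\<dots> = ennreal chernoff_const * (\<Sum>k=1..L. decay_level n k)" by (simp add: sum_distrib_left)
    also have "\<dots> \<le> ennreal chernoff_const * 52"
      unfolding decay_level_def by (intro mult_left_mono decay_sum_le) auto
    finally have "ennreal (exp (- threshold)) * (\<Sum>j=0..n + L. q j) \<le> ennreal (exp (- threshold)) * (ennreal chernoff_const * 52)"
      by (rule mult_left_mono) simp
    also have "\<dots> = ennreal (exp (- threshold) * (chernoff_const * 52))"
      by (simp add: ennreal_mult chernoff_const_def)
    also have "exp (- threshold) * (chernoff_const * 52) = 1 / 104000"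
      by (simp add: threshold_def chernoff_const_def exp_minus)
    finally show ?thesis .
  qed
  let ?A = "\<lambda>x. \<Sum>j=0..n + L. \<integral>\<^sup>+\<omega>. ?s j x \<omega> \<partial>P"
  let ?B = "\<lambda>x. \<Sum>j=0..n + L. \<integral>\<^sup>+\<omega>. ?s j x \<omega> * ?i j x \<omega> \<partial>P"
  have mA: "?A \<in> borel_measurable lborel"
  proof -
    have "(\<lambda>z. ?s j (fst z) (snd z)) \<in> borel_measurable (lborel \<Otimes>\<^sub>M P)" for j
      using measurable_compose[OF measurable_pair_swap' measurable_score_pair[of "hit_score n L", OF measurable_hit_score]]
      by (simp add: case_prod_beta)
    from borel_measurable_nn_integral_fst[OF this] show ?thesis by (intro borel_measurable_sum) simp
  qed
  have mB: "?B \<in> borel_measurable lborel"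
  proof -
    have "(\<lambda>z. ?s j (snd z) (fst z) * ?i j (snd z) (fst z)) \<in> borel_measurable (P \<Otimes>\<^sub>M lborel)" for j by measurable
    from measurable_compose[OF measurable_pair_swap' this]
    have "(\<lambda>z. ?s j (fst z) (snd z) * ?i j (fst z) (snd z)) \<in> borel_measurable (lborel \<Otimes>\<^sub>M P)" for j
      by (simp add: case_prod_beta)
    from borel_measurable_nn_integral_fst[OF this] show ?thesis by (intro borel_measurable_sum) simp
  qed
  note [measurable] = mA mB
  have "(\<integral>\<^sup>+\<omega>. hits n L \<tau> Q \<omega> \<partial>P) = (\<integral>\<^sup>+x. indicator Q x * ?A x \<partial>lborel)" by (rule hits_first_moment(2)) measurable
  also have "\<dots> \<le> (\<integral>\<^sup>+x. ennreal (1 / 2) * (indicator Q x * ?A x) + ennreal (400 * mass_const) * (indicator Q x * ?B x) +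
      ennreal (1 / 104000) * indicator Q x \<partial>lborel)"
  proof (rule nn_integral_mono)
    fix x
    have "?A x \<le> (\<Sum>j=0..n + L. ennreal (1 / 2) * (\<integral>\<^sup>+\<omega>. ?s j x \<omega> \<partial>P) +
     ennreal (400 * mass_const) * (\<integral>\<^sup>+\<omega>. ?s j x \<omega> * ?i j x \<omega> \<partial>P) + ennreal (exp (- threshold)) * q j)"
      by (rule sum_mono) (rule one)
    also have "\<dots> = ennreal (1 / 2) * ?A x + ennreal (400 * mass_const) * ?B x + ennreal (exp (- threshold)) * (\<Sum>j=0..n + L. q j)"
      by (simp only: sum.distrib sum_distrib_left)
    also have "\<dots> \<le> ennreal (1 / 2) * ?A x + ennreal (400 * mass_const) * ?B x + ennreal (1 / 104000)"
      by (intro add_left_mono qs)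
    finally show "indicator Q x * ?A x \<le> ennreal (1 / 2) * (indicator Q x * ?A x) + ennreal (400 * mass_const) * (indicator Q x * ?B x) +
      ennreal (1 / 104000) * indicator Q x"
      by (cases "x \<in> Q") simp_all
  qed
  also have "\<dots> = ennreal (1 / 2) * (\<integral>\<^sup>+x. indicator Q x * ?A x \<partial>lborel) + ennreal (400 * mass_const) * (\<integral>\<^sup>+x. indicator Q x * ?B x \<partial>lborel) +
      ennreal (1 / 104000) * emeasure lborel Q"
    by (subst nn_integral_add, measurable, subst nn_integral_add) (auto simp: nn_integral_cmult)
  also have "(\<integral>\<^sup>+x. indicator Q x * ?A x \<partial>lborel) = (\<integral>\<^sup>+\<omega>. hits n L \<tau> Q \<omega> \<partial>P)" by (rule hits_first_moment(2)[symmetric]) measurable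
  finally show ?thesis unfolding gd .
qed

text \<open>The mean h of all hits is at least m / 26000. After giving up h / 2 and m / 104000 there
  remains m / 104000, which bounds the mean of good hits from below. Their second moment is
  dominated by that of all hits, and Paley-Zygmund applies.\<close>

lemma good_probability:
  assumes Q: "Q \<in> sets borel" and n: "16 \<le> n" and L: "32 * n \<le> L" and N: "\<tau> + n + L + 16 \<le> N"
    and big: "exp (- (dimn * \<tau>)) \<le> m" and m: "emeasure lborel Q = ennreal m"
  shows "prob_const \<le> prob {\<omega> \<in> space P. 0 < good n L \<tau> N Q \<omega>}"
proof -
  have m0: "0 < m" using big by (meson exp_gt_zero less_le_trans)
  let ?H = "\<integral>\<^sup>+\<omega>. hits n L \<tau> Q \<omega> \<partial>P"
  have H: "?H = ennreal m * remaining (barrier n) (hit_score n L) (n + L) 0 1"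
    using hits_first_moment(1)[OF Q] m by simp
  have Hle: "?H \<le> ennreal (27 * m)"
  proof -
    have "?H \<le> ennreal m * 27" unfolding H by (intro mult_left_mono remaining_0_le) auto
    then show ?thesis using m0 by (simp add: ennreal_mult mult.commute)
  qed
  have Hge: "ennreal (m / 26000) \<le> ?H"
  proof -
    have "ennreal m * ennreal (1 / 26000) \<le> ?H" unfolding H by (intro mult_left_mono remaining_0_ge n L) auto
    then show ?thesis using m0 by (simp flip: ennreal_mult)
  qed
  define h where "h = enn2real ?H"
  have h: "?H = ennreal h" "m / 26000 \<le> h"
  proof -
    have "?H < \<top>" using Hle by (simp add: le_less_trans)
    then show *: "?H = ennreal h" by (simp add: h_def)
    show "m / 26000 \<le> h" using Hge m0 unfolding * by (subst (asm) ennreal_le_iff) (auto simp: h_def)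
  qed
  have h0: "0 \<le> h" by (simp add: h_def)
  let ?G = "\<integral>\<^sup>+\<omega>. good n L \<tau> N Q \<omega> \<partial>P"
  have "?G \<le> ?H" by (intro nn_integral_mono good_le_hits)
  then have Gfin: "?G < \<top>" using Hle by (simp add: le_less_trans)
  define g where "g = enn2real ?G"
  have g: "?G = ennreal g" "0 \<le> g" using Gfin by (simp_all add: g_def)
  have "ennreal h \<le> ennreal (1 / 2) * ennreal h + ennreal (400 * mass_const) * ennreal g + ennreal (1 / 104000) * ennreal m"
    using good_first_moment[OF Q N] unfolding h(1) g(1) m .
  also have "\<dots> = ennreal (1 / 2 * h + 400 * mass_const * g + 1 / 104000 * m)"
  proof -
    have "ennreal (1 / 2) * ennreal h = ennreal (1 / 2 * h)" "ennreal (400 * mass_const) * ennreal g = ennreal (400 * mass_const * g)"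
      "ennreal (1 / 104000) * ennreal m = ennreal (1 / 104000 * m)"
      using h0 g m0 mass_const_ge by (intro ennreal_mult[symmetric]; simp)+
    then show ?thesis using h0 g m0 mass_const_ge by (simp add: ennreal_plus)
  qed
  finally have "h \<le> 1 / 2 * h + 400 * mass_const * g + 1 / 104000 * m"
    using h0 g m0 mass_const_ge by (subst (asm) ennreal_le_iff) auto
  then have "m / 104000 \<le> 400 * mass_const * g" using h(2) by simp
  then have glow: "1 / (41600000 * mass_const) * m \<le> g" using mass_const_ge by (simp add: field_simps)
  define a where "a = 1 / (41600000 * mass_const) * m"
  have a0: "0 < a" using m0 mass_const_ge by (simp add: a_def)
  have "a\<^sup>2 / (hit_const * m\<^sup>2) \<le> prob {\<omega> \<in> space P. 0 < good n L \<tau> N Q \<omega>}"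
  proof (rule Paley_Zygmund[OF measurable_good[OF Q] a0])
    show "ennreal a \<le> ?G" unfolding g(1) a_def by (rule ennreal_leI) (rule glow)
    show "0 < hit_const * m\<^sup>2" using hit_const_pos m0 by simp
    have "(\<integral>\<^sup>+\<omega>. (good n L \<tau> N Q \<omega>)\<^sup>2 \<partial>P) \<le> (\<integral>\<^sup>+\<omega>. (hits n L \<tau> Q \<omega>)\<^sup>2 \<partial>P)"
      by (intro nn_integral_mono power_mono good_le_hits) auto
    also have "\<dots> \<le> ennreal hit_const * (emeasure lborel Q)\<^sup>2"
      unfolding hit_const_def using n big by (intro hits_second_moment Q) (auto simp: m ennreal_leI)
    also have "\<dots> = ennreal (hit_const * m\<^sup>2)"
      using hit_const_pos m0 by (simp add: m ennreal_power ennreal_mult)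
    finally show "(\<integral>\<^sup>+\<omega>. (good n L \<tau> N Q \<omega>)\<^sup>2 \<partial>P) \<le> ennreal (hit_const * m\<^sup>2)" .
  qed
  moreover have "a\<^sup>2 / (hit_const * m\<^sup>2) = prob_const"
    using m0 by (simp add: a_def prob_const_def power_mult_distrib power_divide)
  ultimately show ?thesis by simp
qed

end

section \<open>Separated regions\<close>

text \<open>The second-moment method for the number of events that occur: with mean m its mean
  square is at most \<open>m + m\<^sup>2\<close>, and
  \<open>m\<^sup>2 / (m + m\<^sup>2) = 1 - 1 / (1 + m)\<close>. Only correlations of pairs of
  regions have to be controlled.\<close>

lemma (in prob_space) pairwise_independent_union:
  fixes A :: "nat \<Rightarrow> 'a set"
  assumes A: "\<And>i. i < J \<Longrightarrow> A i \<in> events" and c: "0 < c" and J: "0 < J"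
    and p: "\<And>i. i < J \<Longrightarrow> c \<le> prob (A i)"
    and ind: "\<And>i k. i < J \<Longrightarrow> k < J \<Longrightarrow> i \<noteq> k \<Longrightarrow> prob (A i \<inter> A k) = prob (A i) * prob (A k)"
  shows "1 - 1 / (c * J) \<le> prob (\<Union>i<J. A i)"
proof -
  define m where "m = (\<Sum>i<J. prob (A i))"
  have m: "c * J \<le> m" using sum_bounded_below[of "{..<J}" c "\<lambda>i. prob (A i)"] p by (simp add: m_def mult.commute)
  then have m0: "0 < m" using c J by (smt (verit) mult_pos_pos of_nat_0_less_iff)
  define S where "S \<omega> = (\<Sum>i<J. indicator (A i) \<omega> :: ennreal)" for \<omega>
  have [measurable]: "A i \<in> events" if "i < J" for i using A that .
  have Sm[measurable]: "S \<in> borel_measurable M" unfolding S_def[abs_def]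
    by (intro borel_measurable_sum borel_measurable_indicator) auto
  have "(\<integral>\<^sup>+\<omega>. S \<omega> \<partial>M) = (\<Sum>i<J. ennreal (prob (A i)))"
    unfolding S_def by (subst nn_integral_sum) (auto simp: emeasure_eq_measure)
  then have ES: "(\<integral>\<^sup>+\<omega>. S \<omega> \<partial>M) = ennreal m" by (simp add: m_def)
  have "(\<integral>\<^sup>+\<omega>. (S \<omega>)\<^sup>2 \<partial>M) = (\<integral>\<^sup>+\<omega>. (\<Sum>i<J. \<Sum>k<J. indicator (A i \<inter> A k) \<omega>) \<partial>M)"
    by (simp add: S_def power2_eq_square sum_product indicator_inter_arith)
  also have "\<dots> = (\<Sum>i<J. \<Sum>k<J. emeasure M (A i \<inter> A k))"
  proof -
    have "(\<integral>\<^sup>+\<omega>. (\<Sum>i<J. \<Sum>k<J. indicator (A i \<inter> A k) \<omega>) \<partial>M) = (\<Sum>i<J. \<integral>\<^sup>+\<omega>. (\<Sum>k<J. indicator (A i \<inter> A k) \<omega>) \<partial>M)"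
      by (rule nn_integral_sum) (intro borel_measurable_sum borel_measurable_indicator, auto)
    also have "\<dots> = (\<Sum>i<J. \<Sum>k<J. \<integral>\<^sup>+\<omega>. indicator (A i \<inter> A k) \<omega> \<partial>M)"
      by (intro sum.cong refl nn_integral_sum) auto
    finally show ?thesis by (simp add: nn_integral_indicator)
  qed
  also have "\<dots> \<le> (\<Sum>i<J. \<Sum>k<J. ennreal ((if i = k then prob (A i) else 0) + prob (A i) * prob (A k)))"
    by (intro sum_mono) (auto simp: emeasure_eq_measure ind intro!: ennreal_leI)
  also have "\<dots> = ennreal (\<Sum>i<J. \<Sum>k<J. (if i = k then prob (A i) else 0) + prob (A i) * prob (A k))"
  proof -
    let ?a = "\<lambda>i k. (if i = k then prob (A i) else 0) + prob (A i) * prob (A k)"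
    have a: "0 \<le> ?a i k" for i k by simp
    have "(\<Sum>i<J. \<Sum>k<J. ennreal (?a i k)) = (\<Sum>i<J. ennreal (\<Sum>k<J. ?a i k))"
      by (intro sum.cong refl sum_ennreal a)
    also have "\<dots> = ennreal (\<Sum>i<J. \<Sum>k<J. ?a i k)"
      by (intro sum_ennreal sum_nonneg a)
    finally show ?thesis .
  qed
  also have "(\<Sum>i<J. \<Sum>k<J. (if i = k then prob (A i) else 0) + prob (A i) * prob (A k)) = m + m\<^sup>2"
    by (simp add: sum.distrib m_def power2_eq_square sum_product)
  finally have ES2: "(\<integral>\<^sup>+\<omega>. (S \<omega>)\<^sup>2 \<partial>M) \<le> ennreal (m + m\<^sup>2)" .
  have "m\<^sup>2 / (m + m\<^sup>2) \<le> prob {\<omega> \<in> space M. 0 < S \<omega>}"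
    by (rule Paley_Zygmund[OF Sm m0]) (use ES ES2 m0 in \<open>auto intro: add_pos_pos\<close>)
  also have "{\<omega> \<in> space M. 0 < S \<omega>} = (\<Union>i<J. A i)"
    using A[THEN sets.sets_into_space] by (auto simp: S_def zero_less_iff_neq_zero indicator_def split: if_splits)
  finally have "m\<^sup>2 / (m + m\<^sup>2) \<le> prob (\<Union>i<J. A i)" .
  moreover have "1 - 1 / (c * J) \<le> m\<^sup>2 / (m + m\<^sup>2)"
  proof -
    have "m + m\<^sup>2 = m * (1 + m)" by (simp add: power2_eq_square distrib_left)
    then have "m\<^sup>2 / (m + m\<^sup>2) = m / (1 + m)" using m0 by (simp add: power2_eq_square)
    also have "\<dots> = 1 - 1 / (1 + m)" using m0 by (simp add: field_simps)
    finally have "m\<^sup>2 / (m + m\<^sup>2) = 1 - 1 / (1 + m)" .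
    moreover have "1 / (1 + m) \<le> 1 / (c * J)" using m m0 c J by (intro divide_left_mono) auto
    ultimately show ?thesis by simp
  qed
  ultimately show ?thesis by simp
qed

lemma nn_integral_pos_exE:
  assumes "0 < (\<integral>\<^sup>+x. indicator Q x * f x \<partial>M)"
  obtains x where "x \<in> Q" "0 < f x"
proof -
  have "\<not> (\<forall>x\<in>Q. f x = 0)"
  proof
    assume "\<forall>x\<in>Q. f x = 0"
    then have "(\<integral>\<^sup>+x. indicator Q x * f x \<partial>M) = (\<integral>\<^sup>+x. 0 \<partial>M)" by (intro nn_integral_cong) (auto simp: indicator_def)
    then show False using assms by simp
  qed
  then show ?thesis using that by (auto simp: zero_less_iff_neq_zero)
qed

context gaussian_noise
begin

text \<open>1/80 is the local mass guaranteed by a good hit,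
  \<open>exp (- (\<gamma> * threshold))\<close> the loss through displacement, and
  \<open>exp (- (dimn * \<tau>))\<close> compensates that \<open>local_mass\<close> is normalised by
  the absolute scale \<open>\<tau> + j\<close> whereas the density is restarted at
  \<open>\<tau>\<close>.\<close>

definition cell_const :: "nat \<Rightarrow> real" where
  "cell_const \<tau> = exp (- (\<gamma> * threshold) - dimn * \<tau>) / 80"

text \<open>A deterministic statement about one array: positivity of the integral yields a point and
  a scale where all factors are nonzero. At the points counted by the local mass the coarse sum is
  almost as large as at x, and the weight of the later layers is at most their normalised
  exponential.\<close>

lemma good_hits_imp_heavy_cell:
  assumes g: "0 < good_hits e n L \<tau> threshold N Q" and n: "1 \<le> n" and N: "\<tau> + n + L \<le> N"
    and em[measurable]: "\<And>q. e q \<in> borel_measurable borel"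
  obtains x j where "x \<in> Q" "n < j" "j \<le> n + L"
    "ennreal (cell_const \<tau> / sqrt n) \<le> (\<integral>\<^sup>+y. indicator (cell (real (\<tau> + j)) x) y *
       ennreal (sqrt N * exp (\<gamma> * (\<Sum>i<N - \<tau>. e (\<tau> + i) y) - dimn * real (N - \<tau>))) \<partial>lborel)"
proof -
  let ?A = threshold
  let ?f = "\<lambda>j x. ennreal (weight \<gamma> (barrier n) (\<lambda>i. e (\<tau> + i) x) j) * hit_score n L j (path \<gamma> (\<lambda>i. e (\<tau> + i) x) j) *
     indicator {1 / 80..} (local_mass \<gamma> e \<tau> j ?A (N - (\<tau> + j)) x)"
  obtain x where x: "x \<in> Q" "0 < (\<Sum>j=0..n + L. ?f j x)"
    using g unfolding good_hits_def by (rule nn_integral_pos_exE)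
  then obtain j where j: "j \<le> n + L" "?f j x \<noteq> 0"
    by (metis (no_types, lifting) atLeastAtMost_iff less_irrefl sum.neutral)
  from j(2) have h0: "hit_score n L j (path \<gamma> (\<lambda>i. e (\<tau> + i) x) j) \<noteq> 0"
    and lm: "1 / 80 \<le> local_mass \<gamma> e \<tau> j ?A (N - (\<tau> + j)) x"
    by (auto simp: indicator_def split: if_splits)
  from h0 have nj: "n < j" and pth: "path \<gamma> (\<lambda>i. e (\<tau> + i) x) j \<le> level n + 1"
    by (auto simp: hit_score_def target_def indicator_def split: if_splits)
  define p where "p = N - (\<tau> + j)"
  have Np: "N - \<tau> = j + p" "p \<le> N" using N j by (auto simp: p_def)
  let ?\<sigma> = "\<tau> + j"
  let ?V = "cell (real ?\<sigma>) x"
  let ?K = "exp (- (\<gamma> * ?A) - dimn * \<tau>) / sqrt n"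
  have K0: "0 \<le> ?K" by simp
  have point: "?K * (exp (dimn * real ?\<sigma>) * (sqrt p * weight \<gamma> (\<lambda>_. 0) (\<lambda>i. e (?\<sigma> + i) y) p)) \<le>
      sqrt N * exp (\<gamma> * (\<Sum>i<N - \<tau>. e (\<tau> + i) y) - dimn * real (N - \<tau>))"
    if d: "- ?A \<le> (\<Sum>i<j. e (\<tau> + i) y - e (\<tau> + i) x)" for y
  proof -
    have sumsplit: "(\<Sum>i<N - \<tau>. e (\<tau> + i) y) = (\<Sum>i<j. e (\<tau> + i) y) + (\<Sum>i<p. e (?\<sigma> + i) y)"
      unfolding Np sum.nat_group[symmetric]
      using sum.atLeastLessThan_concat[of 0 j "j + p" "\<lambda>i. e (\<tau> + i) y"] sum.shift_bounds_nat_ivl[of "\<lambda>i. e (\<tau> + i) y" 0 j p]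
      by (simp add: lessThan_atLeast0 add.commute add.left_commute)
    have "path \<gamma> (\<lambda>i. e (\<tau> + i) x) j = 1 + \<gamma> * real j - (\<Sum>i<j. e (\<tau> + i) x)" by (rule path_eq)
    \<comment> \<open>The start of the path at 1 cancels the width 1 of the target.\<close>
    then have "(\<Sum>i<j. e (\<tau> + i) x) \<ge> \<gamma> * j - level n" using pth by linarith
    then have "(\<Sum>i<j. e (\<tau> + i) y) \<ge> \<gamma> * j - level n - ?A" using d by (simp add: sum_subtractf)
    then have "\<gamma> * (\<Sum>i<j. e (\<tau> + i) y) \<ge> \<gamma> * (\<gamma> * j - level n - ?A)"
      using gamma_ge_1 by (intro mult_left_mono) auto
    moreover have "\<gamma> * (\<gamma> * j - level n - ?A) = 2 * dimn * j - \<gamma> * level n - \<gamma> * ?A"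
      using gamma_sq by (simp add: algebra_simps power2_eq_square)
    ultimately have low: "2 * dimn * j - \<gamma> * level n - \<gamma> * ?A \<le> \<gamma> * (\<Sum>i<j. e (\<tau> + i) y)" by simp
    have wl: "weight \<gamma> (\<lambda>_. 0) (\<lambda>i. e (?\<sigma> + i) y) p \<le> exp (\<gamma> * (\<Sum>i<p. e (?\<sigma> + i) y) - dimn * p)"
      using weight_le[of \<gamma> "\<lambda>_. 0" "\<lambda>i. e (?\<sigma> + i) y" p] gamma_sq by (simp add: mult.commute)
    have "?K * (exp (dimn * real ?\<sigma>) * (sqrt p * weight \<gamma> (\<lambda>_. 0) (\<lambda>i. e (?\<sigma> + i) y) p)) \<le>
       ?K * (exp (dimn * real ?\<sigma>) * (sqrt N * exp (\<gamma> * (\<Sum>i<p. e (?\<sigma> + i) y) - dimn * p)))"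
      using wl Np weight_nonneg by (intro mult_left_mono mult_mono) auto
    also have "\<dots> = sqrt N * (exp (- (\<gamma> * ?A) - dimn * \<tau>) * exp (- (\<gamma> * level n)) * exp (dimn * real ?\<sigma>) * exp (\<gamma> * (\<Sum>i<p. e (?\<sigma> + i) y) - dimn * p))"
      using exp_level[OF n] by (simp add: exp_minus divide_inverse mult_ac)
    also have "exp (- (\<gamma> * ?A) - dimn * \<tau>) * exp (- (\<gamma> * level n)) * exp (dimn * real ?\<sigma>) * exp (\<gamma> * (\<Sum>i<p. e (?\<sigma> + i) y) - dimn * p)
       = exp ((- (\<gamma> * ?A) - dimn * \<tau>) + - (\<gamma> * level n) + dimn * real ?\<sigma> + (\<gamma> * (\<Sum>i<p. e (?\<sigma> + i) y) - dimn * p))"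
      by (simp only: exp_add)
    also have "sqrt N * \<dots> \<le> sqrt N * exp (\<gamma> * (\<Sum>i<N - \<tau>. e (\<tau> + i) y) - dimn * real (N - \<tau>))"
      unfolding sumsplit using low by (intro mult_left_mono) (auto simp: Np algebra_simps)
    finally show ?thesis .
  qed
  have m1[measurable]: "(\<lambda>y. weight \<gamma> (\<lambda>_. 0) (\<lambda>i. e (?\<sigma> + i) y) p) \<in> borel_measurable lborel"
    by (rule measurable_weight) simp
  have "ennreal (cell_const \<tau> / sqrt n) = ennreal ?K * ennreal (1 / 80)"
    using n by (subst ennreal_mult[symmetric]) (auto simp: cell_const_def)
  also have "ennreal (1 / 80) = 1 / 80"
    by (simp add: ennreal_divide_numeral[symmetric] del: ennreal_divide_numeral flip: ennreal_1)
  also have "ennreal ?K * (1 / 80) \<le> ennreal ?K * local_mass \<gamma> e \<tau> j ?A p x"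
    using lm unfolding p_def by (intro mult_left_mono) auto
  also have "\<dots> = (\<integral>\<^sup>+y. ennreal ?K * (ennreal (exp (real DIM('a) * real ?\<sigma>)) *
     (indicator ?V y * (indicator {- ?A..} (\<Sum>i<j. e (\<tau> + i) y - e (\<tau> + i) x) *
       ennreal (sqrt p * weight \<gamma> (\<lambda>_. 0) (\<lambda>i. e (?\<sigma> + i) y) p)))) \<partial>lborel)"
    unfolding local_mass_def by (rule nn_integral_cmult[symmetric]) measurable
  also have "\<dots> \<le> (\<integral>\<^sup>+y. indicator ?V y * ennreal (sqrt N * exp (\<gamma> * (\<Sum>i<N - \<tau>. e (\<tau> + i) y) - dimn * real (N - \<tau>))) \<partial>lborel)"
  proof (rule nn_integral_mono)
    fix y
    show "ennreal ?K * (ennreal (exp (real DIM('a) * real ?\<sigma>)) *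
     (indicator ?V y * (indicator {- ?A..} (\<Sum>i<j. e (\<tau> + i) y - e (\<tau> + i) x) *
       ennreal (sqrt p * weight \<gamma> (\<lambda>_. 0) (\<lambda>i. e (?\<sigma> + i) y) p))))
      \<le> indicator ?V y * ennreal (sqrt N * exp (\<gamma> * (\<Sum>i<N - \<tau>. e (\<tau> + i) y) - dimn * real (N - \<tau>)))"
    proof (cases "y \<in> ?V \<and> - ?A \<le> (\<Sum>i<j. e (\<tau> + i) y - e (\<tau> + i) x)")
      case True
      have "ennreal ?K * (ennreal (exp (dimn * real ?\<sigma>)) * ennreal (sqrt p * weight \<gamma> (\<lambda>_. 0) (\<lambda>i. e (?\<sigma> + i) y) p)) =
        ennreal (?K * (exp (dimn * real ?\<sigma>) * (sqrt p * weight \<gamma> (\<lambda>_. 0) (\<lambda>i. e (?\<sigma> + i) y) p)))"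
        by (subst (1 2) ennreal_mult) (auto simp: weight_nonneg)
      also have "\<dots> \<le> ennreal (sqrt N * exp (\<gamma> * (\<Sum>i<N - \<tau>. e (\<tau> + i) y) - dimn * real (N - \<tau>)))"
        using point[of y] True by (intro ennreal_leI) auto
      finally show ?thesis using True by (simp add: dimn_eq)
    qed (auto simp: indicator_def)
  qed
  finally show ?thesis using that x j nj by blast
qed

definition region :: "'a \<Rightarrow> real \<Rightarrow> 'a set" where
  "region z \<delta> = cbox (z - \<delta> *\<^sub>R One) (z + \<delta> *\<^sub>R One)"

lemma mem_region: "x \<in> region z \<delta> \<longleftrightarrow> (\<forall>b\<in>Basis. \<bar>(x - z) \<bullet> b\<bar> \<le> \<delta>)"
  by (auto simp: region_def mem_box inner_simps abs_le_iff algebra_simps)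

lemma cell_subset_region:
  assumes "x \<in> region z \<delta>" "exp (- s) \<le> \<delta>'"
  shows "cell s x \<subseteq> region z (\<delta> + \<delta>')"
proof
  fix y assume y: "y \<in> cell s x"
  show "y \<in> region z (\<delta> + \<delta>')" unfolding mem_region
  proof
    fix b :: 'a assume b: "b \<in> Basis"
    have "\<bar>(y - x) \<bullet> b\<bar> \<le> exp (- s)"
      using y cell_self[of x s] b unfolding cell_iff by (force simp: inner_diff_left)
    moreover have "\<bar>(x - z) \<bullet> b\<bar> \<le> \<delta>" using assms b by (auto simp: mem_region)
    ultimately show "\<bar>(y - z) \<bullet> b\<bar> \<le> \<delta> + \<delta>'" using assms(2) by (simp add: inner_diff_left)
  qed
qed

lemma emeasure_region: "0 \<le> \<delta> \<Longrightarrow> emeasure lborel (region z \<delta>) = ennreal ((2 * \<delta>) ^ DIM('a))"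
  unfolding region_def by (subst emeasure_lborel_cbox) (auto simp: inner_simps)

text \<open>Good hits in the region read the field on cells that stick out by at most
  \<open>\<delta>\<close>. Clamping the field to the box of half-width \<open>2 * \<delta>\<close>
  does not change them, and the clamped field is measurable with respect to the layers over that
  box.\<close>

lemma good_measurable_region:
  assumes \<delta>: "0 < \<delta>" "exp (- real \<tau>) \<le> \<delta>"
  shows "{\<omega> \<in> space P. 0 < good n L \<tau> N (region z \<delta>) \<omega>} \<in> sets (generated_sigma P (future \<tau> (region z (2 * \<delta>))))"
proof -
  let ?S = "generated_sigma P (future \<tau> (region z (2 * \<delta>)))"
  define \<phi> where "\<phi> = clamp (z - (2 * \<delta>) *\<^sub>R One) (z + (2 * \<delta>) *\<^sub>R One)"
  have le: "(z - (2 * \<delta>) *\<^sub>R One) \<bullet> b \<le> (z + (2 * \<delta>) *\<^sub>R One) \<bullet> b" if "b \<in> Basis" for b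
    using \<delta> that by (simp add: inner_simps)
  have \<phi>in: "\<phi> x \<in> region z (2 * \<delta>)" for x
    unfolding \<phi>_def region_def by (rule clamp_in_interval) (rule le)
  have \<phi>id: "\<phi> x = x" if "x \<in> region z (2 * \<delta>)" for x
    using that unfolding \<phi>_def region_def by (rule clamp_cancel_cbox)
  have \<phi>c: "continuous_on UNIV \<phi>"
    unfolding \<phi>_def using clamp_continuous_on[OF continuous_on_id, of UNIV] by simp
  \<comment> \<open>Layers before \<open>\<tau>\<close> do not enter \<open>good_hits\<close>; the
    default 0 makes each layer of the modified field measurable.\<close>
  define f where "f \<omega> q x = (if \<tau> \<le> q then E q (\<phi> x) \<omega> else 0)" for \<omega> q x
  have fm: "(\<lambda>z. f (fst z) q (snd z)) \<in> borel_measurable (?S \<Otimes>\<^sub>M lborel)" for q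
  proof (cases "\<tau> \<le> q")
    case True
    have "(\<lambda>(\<omega>, x). E q (\<phi> x) \<omega>) \<in> borel_measurable (?S \<Otimes>\<^sub>M borel)"
    proof (rule measurable_continuous_field)
      show "E q (\<phi> x) \<in> borel_measurable ?S" for x
      proof (rule measurable_generated_sigma)
        show "E q (\<phi> x) \<in> future \<tau> (region z (2 * \<delta>))"
          unfolding future_def using True \<phi>in by blast
      qed
      show "continuous_on UNIV (\<lambda>x. E q (\<phi> x) \<omega>)" if "\<omega> \<in> space ?S" for \<omega>
      proof -
        have "continuous_on UNIV (\<lambda>x. E q x \<omega>)"
          by (rule E_cont) (use that in \<open>simp only: space_generated_sigma\<close>)
        then show ?thesis by (rule continuous_on_compose2[OF _ \<phi>c]) simp
      qed
    qed
    then show ?thesis using True by (simp add: f_def measurable_pair_lborel case_prod_beta)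
  qed (simp add: f_def)
  have eq: "good n L \<tau> N (region z \<delta>) \<omega> = good_hits (f \<omega>) n L \<tau> threshold N (region z \<delta>)" for \<omega>
    unfolding good_hits_def
  proof (intro nn_integral_cong)
    fix x
    show "indicator (region z \<delta>) x * (\<Sum>j=0..n + L.
     ennreal (weight \<gamma> (barrier n) (\<lambda>i. noise \<omega> (\<tau> + i) x) j) * hit_score n L j (path \<gamma> (\<lambda>i. noise \<omega> (\<tau> + i) x) j) *
     indicator {1 / 80..} (local_mass \<gamma> (noise \<omega>) \<tau> j threshold (N - (\<tau> + j)) x)) =
     indicator (region z \<delta>) x * (\<Sum>j=0..n + L.
     ennreal (weight \<gamma> (barrier n) (\<lambda>i. f \<omega> (\<tau> + i) x) j) * hit_score n L j (path \<gamma> (\<lambda>i. f \<omega> (\<tau> + i) x) j) *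
     indicator {1 / 80..} (local_mass \<gamma> (f \<omega>) \<tau> j threshold (N - (\<tau> + j)) x))"
    proof (cases "x \<in> region z \<delta>")
      case True
      have "x \<in> cell (real \<tau>) x" by (rule cell_self)
      then have x2: "x \<in> region z (2 * \<delta>)" using cell_subset_region[OF True \<delta>(2)] by auto
      have fx: "f \<omega> (\<tau> + i) x = noise \<omega> (\<tau> + i) x" for i using \<phi>id[OF x2] by (simp add: f_def)
      have "local_mass \<gamma> (noise \<omega>) \<tau> j threshold (N - (\<tau> + j)) x = local_mass \<gamma> (f \<omega>) \<tau> j threshold (N - (\<tau> + j)) x" for j
        unfolding local_mass_def
      proof (intro nn_integral_cong)
        fix y
        show "ennreal (exp (real DIM('a) * real (\<tau> + j))) *
         (indicator (cell (real (\<tau> + j)) x) y * (indicator {- threshold..} (\<Sum>i<j. noise \<omega> (\<tau> + i) y - noise \<omega> (\<tau> + i) x) *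
         ennreal (sqrt (N - (\<tau> + j)) * weight \<gamma> (\<lambda>_. 0) (\<lambda>i. noise \<omega> (\<tau> + j + i) y) (N - (\<tau> + j))))) =
         ennreal (exp (real DIM('a) * real (\<tau> + j))) *
         (indicator (cell (real (\<tau> + j)) x) y * (indicator {- threshold..} (\<Sum>i<j. f \<omega> (\<tau> + i) y - f \<omega> (\<tau> + i) x) *
         ennreal (sqrt (N - (\<tau> + j)) * weight \<gamma> (\<lambda>_. 0) (\<lambda>i. f \<omega> (\<tau> + j + i) y) (N - (\<tau> + j)))))"
        proof (cases "y \<in> cell (real (\<tau> + j)) x")
          case True': True
          have "exp (- real (\<tau> + j)) \<le> exp (- real \<tau>)" by simp
          then have "exp (- real (\<tau> + j)) \<le> \<delta>" using \<delta>(2) by linarith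
          then have "y \<in> region z (2 * \<delta>)" using cell_subset_region[OF True, of "real (\<tau> + j)" \<delta>] True' by auto
          then have fy: "f \<omega> (\<tau> + i) y = noise \<omega> (\<tau> + i) y" "f \<omega> (\<tau> + j + i) y = noise \<omega> (\<tau> + j + i) y" for i
            using \<phi>id by (simp_all add: f_def)
          show ?thesis by (simp only: fx fy)
        qed simp
      qed
      then show ?thesis by (simp only: fx)
    qed simp
  qed
  have m: "(\<lambda>\<omega>. good_hits (f \<omega>) n L \<tau> threshold N (region z \<delta>)) \<in> borel_measurable ?S"
    by (rule measurable_good_hits[OF fm]) (simp add: region_def)
  have "{\<omega> \<in> space P. 0 < good n L \<tau> N (region z \<delta>) \<omega>} =
      (\<lambda>\<omega>. good_hits (f \<omega>) n L \<tau> threshold N (region z \<delta>)) -` {0<..} \<inter> space ?S"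
    unfolding eq space_generated_sigma by blast
  then show ?thesis using measurable_sets[OF m, of "{0<..}"] by (simp only: borel_open open_greaterThan)
qed

text \<open>From time \<open>\<tau>\<close> on, points of different boxes of half-width
  \<open>2 * \<delta>\<close> are beyond the correlation range, so the events are pairwise
  independent. Each region has side \<open>2 * \<delta>\<close>, at least
  \<open>exp (- \<tau>)\<close>, hence the volume that \<open>good_probability\<close>
  requires.\<close>

lemma good_regions_union:
  fixes z :: "nat \<Rightarrow> 'a"
  assumes \<delta>: "0 < \<delta>" "exp (- real \<tau>) \<le> \<delta>" and J: "0 < J"
    and far: "\<And>i k x y. i < J \<Longrightarrow> k < J \<Longrightarrow> i \<noteq> k \<Longrightarrow> x \<in> region (z i) (2 * \<delta>) \<Longrightarrow> y \<in> region (z k) (2 * \<delta>) \<Longrightarrow>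
       r0 \<le> exp (real \<tau>) * dist x y"
    and n: "16 \<le> n" and L: "32 * n \<le> L" and N: "\<tau> + n + L + 16 \<le> N"
  shows "1 - 1 / (prob_const * J) \<le> prob (\<Union>i<J. {\<omega> \<in> space P. 0 < good n L \<tau> N (region (z i) \<delta>) \<omega>})"
proof (rule pairwise_independent_union[OF _ prob_const_pos J])
  let ?A = "\<lambda>i. {\<omega> \<in> space P. 0 < good n L \<tau> N (region (z i) \<delta>) \<omega>}"
  have sA: "?A i \<in> sets (generated_sigma P (future \<tau> (region (z i) (2 * \<delta>))))" for i
    by (rule good_measurable_region[OF \<delta>])
  show "?A i \<in> events" for i
    using sA[of i] sets_generated_sigma_subset[of "future \<tau> (region (z i) (2 * \<delta>))" P] future_in[of \<tau> "region (z i) (2 * \<delta>)"]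
      centred_gaussian_spaceD(3)[OF gaussian] by blast
  show "prob_const \<le> prob (?A i)" for i
  proof (rule good_probability[OF _ n L N])
    show "emeasure lborel (region (z i) \<delta>) = ennreal ((2 * \<delta>) ^ DIM('a))" using \<delta> by (simp add: emeasure_region)
    have "exp (- (dimn * real \<tau>)) = exp (- real \<tau>) ^ DIM('a)"
      by (simp add: exp_of_nat_mult[symmetric] dimn_eq)
    also have "\<dots> \<le> (2 * \<delta>) ^ DIM('a)" using \<delta> by (intro power_mono) auto
    finally show "exp (- (dimn * real \<tau>)) \<le> (2 * \<delta>) ^ DIM('a)" .
  qed (simp add: region_def)
  fix i k assume ik: "i < J" "k < J" "i \<noteq> k"
  have "c q x y = 0" if "\<tau> \<le> q" "x \<in> region (z i) (2 * \<delta>)" "y \<in> region (z k) (2 * \<delta>)" for q x y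
  proof (rule c_far)
    have "r0 \<le> exp (real \<tau>) * dist x y" using far ik that by blast
    also have "\<dots> \<le> exp (real q) * dist x y" using that by (intro mult_right_mono) auto
    finally show "r0 \<le> exp (real q) * dist x y" .
  qed
  then have "uncorrelated P (future \<tau> (region (z i) (2 * \<delta>))) (future \<tau> (region (z k) (2 * \<delta>)))"
    by (auto simp: uncorrelated_def future_def cov)
  from indep_generated_sigma[OF gaussian future_in future_in this]
  show "prob (?A i \<inter> ?A k) = prob (?A i) * prob (?A k)"
    using sA[of i] sA[of k] unfolding indep_sets2_eq by blast
qed

end

section \<open>Passage to the chaos measure\<close>

definition cell_hull :: "real \<Rightarrow> 'a::euclidean_space \<Rightarrow> 'a set" where
  "cell_hull s a = cbox a (a + exp (- s) *\<^sub>R One)"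

text \<open>The hull of a cell enlarged by its own side length in every direction, written as corner
  plus side to match the cubes of \<open>cubes_inside\<close>.\<close>

definition big_cube :: "real \<Rightarrow> 'a::euclidean_space \<Rightarrow> 'a set" where
  "big_cube s a = cbox (a - exp (- s) *\<^sub>R One) (a - exp (- s) *\<^sub>R One + (3 * exp (- s)) *\<^sub>R One)"

text \<open>A Lipschitz function between the indicators of the cell hull and of
  \<open>big_cube\<close>. Its approximate integral dominates the approximate mass of the cell, and
  its integral against \<open>M\<close> is dominated by the mass of the larger cube.\<close>

definition bump :: "real \<Rightarrow> 'a::euclidean_space \<Rightarrow> 'a \<Rightarrow> real" where
  "bump s a y = max 0 (1 - exp s * infdist y (cell_hull s a))"

lemma mem_big_cube:
  "y \<in> big_cube s a \<longleftrightarrow> (\<forall>b\<in>Basis. a \<bullet> b - exp (- s) \<le> y \<bullet> b \<and> y \<bullet> b \<le> a \<bullet> b + 2 * exp (- s))"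
proof -
  have "(a - exp (- s) *\<^sub>R One + (3 * exp (- s)) *\<^sub>R One) \<bullet> b = a \<bullet> b + 2 * exp (- s)"
    "(a - exp (- s) *\<^sub>R One) \<bullet> b = a \<bullet> b - exp (- s)" if "b \<in> Basis" for b
    using that by (simp_all add: inner_simps)
  then show ?thesis unfolding big_cube_def mem_box by simp
qed

lemma mem_cell_hull: "y \<in> cell_hull s a \<longleftrightarrow> (\<forall>b\<in>Basis. a \<bullet> b \<le> y \<bullet> b \<and> y \<bullet> b \<le> a \<bullet> b + exp (- s))"
  by (auto simp: cell_hull_def mem_box inner_simps)

lemma cell_hull_nonempty: "a \<in> cell_hull s a"
  by (simp add: mem_cell_hull)

lemma bump_bounds: "0 \<le> bump s a y" "bump s a y \<le> 1"
  by (auto simp: bump_def infdist_nonneg)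

lemma bump_eq_1: "y \<in> cell_hull s a \<Longrightarrow> bump s a y = 1"
  by (simp add: bump_def)

lemma bump_support:
  assumes "bump s a y \<noteq> 0" shows "y \<in> big_cube s a"
proof -
  have "exp s * infdist y (cell_hull s a) < 1" using assms by (auto simp: bump_def max_def split: if_splits)
  then have i: "infdist y (cell_hull s a) < exp (- s)" by (simp add: exp_minus field_simps)
  have "closed (cell_hull s a)" "cell_hull s a \<noteq> {}" using cell_hull_nonempty by (auto simp: cell_hull_def)
  then obtain w where w: "w \<in> cell_hull s a" "infdist y (cell_hull s a) = dist y w"
    using infdist_attains_inf by metis
  have "\<bar>(y - w) \<bullet> b\<bar> < exp (- s)" if "b \<in> Basis" for b
    using Basis_le_norm[OF that, of "y - w"] i w by (simp add: dist_norm)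
  then show ?thesis using w(1) unfolding mem_big_cube mem_cell_hull
    by (force simp: inner_diff_left)
qed

lemma bump_continuous: "continuous_on UNIV (bump s a)"
  unfolding bump_def[abs_def] by (intro continuous_intros)

lemma bump_test_function: "bump s a \<in> test_functions"
proof -
  have sub: "closed_support (bump s a) \<subseteq> big_cube s a"
    unfolding closed_support_def
    by (rule closure_minimal) (auto dest: bump_support simp: big_cube_def)
  have "bounded (closed_support (bump s a))"
    by (rule bounded_subset[OF bounded_cbox sub[unfolded big_cube_def]])
  moreover have "closed (closed_support (bump s a))" by (simp add: closed_support_def)
  ultimately have "compact (closed_support (bump s a))" by (simp add: compact_eq_bounded_closed)
  then show ?thesis using bump_continuous by (simp add: test_functions_def)
qed

lemma cell_subset_hull: "cell s x \<subseteq> cell_hull s (cell_corner s x)"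
  using cell_subset_cbox by (auto simp: cell_hull_def)

lemma nn_integral_kernel_measurable:
  assumes s: "\<And>\<omega>. \<omega> \<in> space P \<Longrightarrow> sets (M \<omega>) = sets borel"
    and m: "\<And>A. A \<in> sets borel \<Longrightarrow> (\<lambda>\<omega>. emeasure (M \<omega>) A) \<in> borel_measurable P"
    and f: "f \<in> borel_measurable (borel :: 'a::topological_space measure)"
  shows "(\<lambda>\<omega>. \<integral>\<^sup>+x. f x \<partial>M \<omega>) \<in> borel_measurable P"
  using f
proof (induction f rule: borel_measurable_induct)
  case (cong f g)
  then have "f = g" by auto
  then show ?case using cong by simp
next
  case (set A)
  have "(\<lambda>\<omega>. \<integral>\<^sup>+x. indicator A x \<partial>M \<omega>) \<in> borel_measurable P \<longleftrightarrow> (\<lambda>\<omega>. emeasure (M \<omega>) A) \<in> borel_measurable P"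
    using set s by (intro measurable_cong) (simp add: nn_integral_indicator)
  then show ?case using m[OF set] by simp
next
  case (mult u c)
  have "(\<lambda>\<omega>. \<integral>\<^sup>+x. c * u x \<partial>M \<omega>) \<in> borel_measurable P \<longleftrightarrow> (\<lambda>\<omega>. c * (\<integral>\<^sup>+x. u x \<partial>M \<omega>)) \<in> borel_measurable P"
  proof (rule measurable_cong)
    fix \<omega> assume "\<omega> \<in> space P"
    then have "u \<in> borel_measurable (M \<omega>)" using mult(2) measurable_cong_sets[OF s[of \<omega>] refl] by blast
    then show "(\<integral>\<^sup>+x. c * u x \<partial>M \<omega>) = c * (\<integral>\<^sup>+x. u x \<partial>M \<omega>)" by (rule nn_integral_cmult)
  qed
  then show ?case using mult by simp
next
  case (add u v)
  have "(\<lambda>\<omega>. \<integral>\<^sup>+x. v x + u x \<partial>M \<omega>) \<in> borel_measurable P \<longleftrightarrow> (\<lambda>\<omega>. (\<integral>\<^sup>+x. v x \<partial>M \<omega>) + (\<integral>\<^sup>+x. u x \<partial>M \<omega>)) \<in> borel_measurable P"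
  proof (rule measurable_cong)
    fix \<omega> assume "\<omega> \<in> space P"
    then have "u \<in> borel_measurable (M \<omega>)" "v \<in> borel_measurable (M \<omega>)"
      using add measurable_cong_sets[OF s[of \<omega>] refl] by blast+
    then show "(\<integral>\<^sup>+x. v x + u x \<partial>M \<omega>) = (\<integral>\<^sup>+x. v x \<partial>M \<omega>) + (\<integral>\<^sup>+x. u x \<partial>M \<omega>)" by (intro nn_integral_add)
  qed
  then show ?case using add by simp
next
  case (seq U)
  have "(\<lambda>\<omega>. \<integral>\<^sup>+x. (SUP i. U i) x \<partial>M \<omega>) \<in> borel_measurable P \<longleftrightarrow> (\<lambda>\<omega>. SUP i. \<integral>\<^sup>+x. U i x \<partial>M \<omega>) \<in> borel_measurable P"
  proof (rule measurable_cong)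
    fix \<omega> assume "\<omega> \<in> space P"
    then have "U i \<in> borel_measurable (M \<omega>)" for i
      using seq measurable_cong_sets[OF s[of \<omega>] refl] by blast
    then show "(\<integral>\<^sup>+x. (SUP i. U i) x \<partial>M \<omega>) = (SUP i. \<integral>\<^sup>+x. U i x \<partial>M \<omega>)"
      using seq by (simp add: image_comp nn_integral_monotone_convergence_SUP)
  qed
  then show ?case using seq by simp
qed

lemma measurable_cong_eq:
  "g \<in> measurable P N \<Longrightarrow> (\<And>\<omega>. \<omega> \<in> space P \<Longrightarrow> f \<omega> = g \<omega>) \<Longrightarrow> f \<in> measurable P N"
  using measurable_cong[of P f g N] by blast

text \<open>Only the field at integer times enters: the convergence along \<open>at_top\<close> is
  used along the natural numbers.\<close>

locale critical_chaos = gaussian_noise P H E c r0 C0 \<gamma> dimn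
  for P :: "'w measure" and H :: "('w \<Rightarrow> real) set" and E :: "nat \<Rightarrow> 'a::euclidean_space \<Rightarrow> 'w \<Rightarrow> real"
    and c :: "nat \<Rightarrow> 'a \<Rightarrow> 'a \<Rightarrow> real" and r0 C0 \<gamma> dimn :: real +
  fixes X :: "real \<Rightarrow> 'a \<Rightarrow> 'w \<Rightarrow> real" and M :: "'w \<Rightarrow> 'a measure"
  assumes E_eq: "E n x \<omega> = X (real (Suc n)) x \<omega> - X (real n) x \<omega>"
    and X_measurable: "X (real n) x \<in> borel_measurable P"
    and X_cont: "\<omega> \<in> space P \<Longrightarrow> continuous_on UNIV (\<lambda>x. X (real n) x \<omega>)"
    and gmc: "critical_gmc P X M"
begin

lemma sets_M: "\<omega> \<in> space P \<Longrightarrow> sets (M \<omega>) = sets borel"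
  and finite_M: "\<omega> \<in> space P \<Longrightarrow> compact K \<Longrightarrow> emeasure (M \<omega>) K < \<infinity>"
  and measurable_M: "A \<in> sets borel \<Longrightarrow> (\<lambda>\<omega>. emeasure (M \<omega>) A) \<in> borel_measurable P"
  using gmc unfolding critical_gmc_def random_radon_measure_def by blast+

lemma X_telescope: "\<tau> \<le> N \<Longrightarrow> X (real N) y \<omega> = X (real \<tau>) y \<omega> + (\<Sum>i<N - \<tau>. E (\<tau> + i) y \<omega>)"
proof -
  assume "\<tau> \<le> N"
  have "(\<Sum>i<k. E (\<tau> + i) y \<omega>) = X (real (\<tau> + k)) y \<omega> - X (real \<tau>) y \<omega>" for k
  proof (induction k)
    case (Suc k)
    have "E (\<tau> + k) y \<omega> = X (real (\<tau> + Suc k)) y \<omega> - X (real (\<tau> + k)) y \<omega>" unfolding E_eq by simp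
    then show ?case using Suc by simp
  qed simp
  then show ?thesis using \<open>\<tau> \<le> N\<close> by simp
qed

definition approx_density :: "nat \<Rightarrow> 'w \<Rightarrow> 'a \<Rightarrow> real" where
  "approx_density N \<omega> x = sqrt N * exp (\<gamma> * X (real N) x \<omega> - dimn * N)"

lemma approx_eq: "critical_approx X (real N) \<omega> = density lborel (\<lambda>x. ennreal (approx_density N \<omega> x))"
  unfolding critical_approx_def approx_density_def gamma_eq[symmetric] dimn_eq[symmetric] by (rule refl)

lemma approx_density_cont: "\<omega> \<in> space P \<Longrightarrow> continuous_on UNIV (approx_density N \<omega>)"
  unfolding approx_density_def[abs_def] by (intro continuous_intros X_cont)

lemma approx_density_measurable: "\<omega> \<in> space P \<Longrightarrow> approx_density N \<omega> \<in> borel_measurable borel"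
  by (rule borel_measurable_continuous_onI) (rule approx_density_cont)

lemma bump_measurable [measurable]: "bump s a \<in> borel_measurable borel"
  by (rule borel_measurable_continuous_onI) (rule bump_continuous)

lemma nn_integral_approx_bump:
  assumes "\<omega> \<in> space P"
  shows "(\<integral>\<^sup>+x. ennreal (bump s a x) \<partial>critical_approx X (real N) \<omega>) = (\<integral>\<^sup>+x. ennreal (approx_density N \<omega> x) * ennreal (bump s a x) \<partial>lborel)"
    and "(\<integral>\<^sup>+x. ennreal (approx_density N \<omega> x) * ennreal (bump s a x) \<partial>lborel) < \<top>"
proof -
  note [measurable] = approx_density_measurable[OF assms]
  show "(\<integral>\<^sup>+x. ennreal (bump s a x) \<partial>critical_approx X (real N) \<omega>) = (\<integral>\<^sup>+x. ennreal (approx_density N \<omega> x) * ennreal (bump s a x) \<partial>lborel)"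
    unfolding approx_eq by (rule nn_integral_density, measurable)
  have "compact (approx_density N \<omega> ` big_cube s a)"
    unfolding big_cube_def
    by (intro compact_continuous_image continuous_on_subset[OF approx_density_cont[OF assms]]) auto
  then obtain K where K: "\<And>y. y \<in> big_cube s a \<Longrightarrow> norm (approx_density N \<omega> y) \<le> K"
    using compact_imp_bounded bounded_iff by (metis (no_types, lifting) imageI)
  have "(\<integral>\<^sup>+x. ennreal (approx_density N \<omega> x) * ennreal (bump s a x) \<partial>lborel) \<le> (\<integral>\<^sup>+x. ennreal K * indicator (big_cube s a) x \<partial>lborel)"
  proof (rule nn_integral_mono)
    fix x
    show "ennreal (approx_density N \<omega> x) * ennreal (bump s a x) \<le> ennreal K * indicator (big_cube s a) x"
    proof (cases "x \<in> big_cube s a")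
      case True
      have "ennreal (approx_density N \<omega> x) * ennreal (bump s a x) \<le> ennreal K * ennreal 1"
        using K[OF True] bump_bounds[of s a x] by (intro mult_mono ennreal_leI) auto
      then show ?thesis using True by simp
    next
      case False
      then have "bump s a x = 0" using bump_support[of s a x] by blast
      then show ?thesis by simp
    qed
  qed
  also have "\<dots> = ennreal K * emeasure lborel (big_cube s a)"
    by (rule nn_integral_cmult_indicator) (simp add: big_cube_def)
  also have "\<dots> < \<top>" using emeasure_lborel_cbox_finite[of "a - exp (- s) *\<^sub>R One" "a - exp (- s) *\<^sub>R One + (3 * exp (- s)) *\<^sub>R One"]
    by (simp add: ennreal_mult_less_top big_cube_def del: emeasure_lborel_cbox)
  finally show "(\<integral>\<^sup>+x. ennreal (approx_density N \<omega> x) * ennreal (bump s a x) \<partial>lborel) < \<top>" .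
qed

lemma integral_approx_bump:
  assumes "\<omega> \<in> space P"
  shows "ennreal (\<integral>x. bump s a x \<partial>critical_approx X (real N) \<omega>) = (\<integral>\<^sup>+x. ennreal (approx_density N \<omega> x) * ennreal (bump s a x) \<partial>lborel)"
proof -
  have "(\<integral>x. bump s a x \<partial>critical_approx X (real N) \<omega>) = enn2real (\<integral>\<^sup>+x. ennreal (bump s a x) \<partial>critical_approx X (real N) \<omega>)"
    by (rule integral_eq_nn_integral) (auto simp: bump_bounds approx_eq)
  then show ?thesis using nn_integral_approx_bump[OF assms, where s=s and a=a and N=N] by simp
qed

lemma integral_M_bump_le:
  assumes "\<omega> \<in> space P"
  shows "ennreal (\<integral>x. bump s a x \<partial>M \<omega>) \<le> emeasure (M \<omega>) (big_cube s a)"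
proof -
  have m: "bump s a \<in> borel_measurable (M \<omega>)"
    using measurable_cong_sets[OF sets_M[OF assms] refl] bump_measurable by blast
  have "(\<integral>x. bump s a x \<partial>M \<omega>) = enn2real (\<integral>\<^sup>+x. ennreal (bump s a x) \<partial>M \<omega>)"
    by (rule integral_eq_nn_integral[OF m], simp add: bump_bounds)
  then have "ennreal (\<integral>x. bump s a x \<partial>M \<omega>) \<le> (\<integral>\<^sup>+x. ennreal (bump s a x) \<partial>M \<omega>)"
    by (simp add: ennreal_enn2real_if)
  also have "\<dots> \<le> (\<integral>\<^sup>+x. indicator (big_cube s a) x \<partial>M \<omega>)"
  proof (rule nn_integral_mono)
    fix x show "ennreal (bump s a x) \<le> indicator (big_cube s a) x"
      using bump_bounds(2)[of s a x] bump_support[of s a x]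
      by (cases "bump s a x = 0", simp, simp add: ennreal_le_1)
  qed
  also have "\<dots> = emeasure (M \<omega>) (big_cube s a)"
  proof (rule nn_integral_indicator)
    show "big_cube s a \<in> sets (M \<omega>)" unfolding sets_M[OF assms] big_cube_def by (rule borel_closed[OF closed_cbox])
  qed
  finally show ?thesis .
qed

lemma measurable_integral_M_bump: "(\<lambda>\<omega>. \<integral>x. bump s a x \<partial>M \<omega>) \<in> borel_measurable P"
proof -
  have "(\<lambda>\<omega>. \<integral>\<^sup>+x. ennreal (bump s a x) \<partial>M \<omega>) \<in> borel_measurable P"
    by (rule nn_integral_kernel_measurable[OF sets_M measurable_M measurable_compose[OF bump_measurable measurable_ennreal]])
  then have "(\<lambda>\<omega>. enn2real (\<integral>\<^sup>+x. ennreal (bump s a x) \<partial>M \<omega>)) \<in> borel_measurable P" by (rule borel_measurable_enn2real)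
  moreover have "(\<integral>x. bump s a x \<partial>M \<omega>) = enn2real (\<integral>\<^sup>+x. ennreal (bump s a x) \<partial>M \<omega>)" if w: "\<omega> \<in> space P" for \<omega>
  proof (rule integral_eq_nn_integral)
    show "bump s a \<in> borel_measurable (M \<omega>)"
      using measurable_cong_sets[OF sets_M[OF w] refl] bump_measurable by blast
  qed (simp add: bump_bounds)
  ultimately show ?thesis by (rule measurable_cong_eq)
qed

lemma measurable_integral_approx_bump: "(\<lambda>\<omega>. \<integral>x. bump s a x \<partial>critical_approx X (real N) \<omega>) \<in> borel_measurable P"
proof -
  have "(\<lambda>(\<omega>, x). X (real N) x \<omega>) \<in> borel_measurable (P \<Otimes>\<^sub>M borel)"
    by (rule measurable_continuous_field) (use X_measurable X_cont in auto)
  then have Xm: "(\<lambda>z. X (real N) (snd z) (fst z)) \<in> borel_measurable (P \<Otimes>\<^sub>M lborel)"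
    by (simp add: measurable_pair_lborel case_prod_beta)
  have "(\<lambda>z. ennreal (approx_density N (fst z) (snd z)) * ennreal (bump s a (snd z))) \<in> borel_measurable (P \<Otimes>\<^sub>M lborel)"
  proof (rule borel_measurable_times_ennreal)
    have "(\<lambda>z. \<gamma> * X (real N) (snd z) (fst z) - dimn * real N) \<in> borel_measurable (P \<Otimes>\<^sub>M lborel)"
      by (intro borel_measurable_diff borel_measurable_times borel_measurable_const Xm)
    from measurable_compose[OF this borel_measurable_exp]
    have "(\<lambda>z. approx_density N (fst z) (snd z)) \<in> borel_measurable (P \<Otimes>\<^sub>M lborel)"
      unfolding approx_density_def by (intro borel_measurable_times borel_measurable_const)
    then show "(\<lambda>z. ennreal (approx_density N (fst z) (snd z))) \<in> borel_measurable (P \<Otimes>\<^sub>M lborel)"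
      by (rule measurable_compose[OF _ measurable_ennreal])
    have "bump s a \<in> borel_measurable lborel" using bump_measurable[of s a] measurable_cong_sets[OF sets_lborel refl] by blast
    from measurable_compose[OF measurable_compose[OF measurable_snd this] measurable_ennreal]
    show "(\<lambda>z. ennreal (bump s a (snd z))) \<in> borel_measurable (P \<Otimes>\<^sub>M lborel)" .
  qed
  from lborel.borel_measurable_nn_integral_fst[OF this]
  have "(\<lambda>\<omega>. enn2real (\<integral>\<^sup>+x. ennreal (approx_density N \<omega> x) * ennreal (bump s a x) \<partial>lborel)) \<in> borel_measurable P"
    unfolding fst_conv snd_conv by (rule borel_measurable_enn2real)
  moreover have "(\<integral>x. bump s a x \<partial>critical_approx X (real N) \<omega>) = enn2real (\<integral>\<^sup>+x. ennreal (approx_density N \<omega> x) * ennreal (bump s a x) \<partial>lborel)"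
    if w: "\<omega> \<in> space P" for \<omega>
  proof -
    have "0 \<le> (\<integral>x. bump s a x \<partial>critical_approx X (real N) \<omega>)" by (rule integral_nonneg_AE) (simp add: bump_bounds)
    then show ?thesis unfolding integral_approx_bump[OF w, symmetric] by (rule enn2real_ennreal[symmetric])
  qed
  ultimately show ?thesis by (rule measurable_cong_eq)
qed

text \<open>Puts back the field before \<open>\<tau>\<close>, which the restarted walk leaves out.
  Being at least \<open>- k\<close> on the cell, it costs the factor
  \<open>exp (- (\<gamma> * k) - dimn * \<tau>)\<close>.\<close>

lemma heavy_cell_transfer:
  assumes w: "\<omega> \<in> space P" and N: "\<tau> \<le> N" and k: "\<And>y. y \<in> cell s x \<Longrightarrow> - k \<le> X (real \<tau>) y \<omega>"
    and \<kappa>: "0 \<le> \<kappa>" "ennreal \<kappa> \<le> (\<integral>\<^sup>+y. indicator (cell s x) y *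
       ennreal (sqrt N * exp (\<gamma> * (\<Sum>i<N - \<tau>. E (\<tau> + i) y \<omega>) - dimn * real (N - \<tau>))) \<partial>lborel)"
  shows "exp (- (\<gamma> * k) - dimn * \<tau>) * \<kappa> \<le> (\<integral>y. bump s (cell_corner s x) y \<partial>critical_approx X (real N) \<omega>)"
proof -
  let ?e = "exp (- (\<gamma> * k) - dimn * \<tau>)"
  let ?g = "\<lambda>y. sqrt N * exp (\<gamma> * (\<Sum>i<N - \<tau>. E (\<tau> + i) y \<omega>) - dimn * real (N - \<tau>))"
  have [measurable]: "(\<lambda>y. E q y \<omega>) \<in> borel_measurable borel" for q
    by (rule borel_measurable_continuous_onI) (rule E_cont[OF w])
  have "ennreal (?e * \<kappa>) = ennreal ?e * ennreal \<kappa>" using \<kappa> by (simp add: ennreal_mult)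
  also have "\<dots> \<le> ennreal ?e * (\<integral>\<^sup>+y. indicator (cell s x) y * ennreal (?g y) \<partial>lborel)"
    by (intro mult_left_mono \<kappa>) auto
  also have "\<dots> = (\<integral>\<^sup>+y. ennreal ?e * (indicator (cell s x) y * ennreal (?g y)) \<partial>lborel)"
    by (rule nn_integral_cmult[symmetric], measurable)
  also have "\<dots> \<le> (\<integral>\<^sup>+y. ennreal (approx_density N \<omega> y) * ennreal (bump s (cell_corner s x) y) \<partial>lborel)"
  proof (rule nn_integral_mono)
    fix y
    show "ennreal ?e * (indicator (cell s x) y * ennreal (?g y)) \<le> ennreal (approx_density N \<omega> y) * ennreal (bump s (cell_corner s x) y)"
    proof (cases "y \<in> cell s x")
      case True
      have b: "bump s (cell_corner s x) y = 1" using True cell_subset_hull[of s x] by (intro bump_eq_1) auto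
      have "\<gamma> * (- k) \<le> \<gamma> * X (real \<tau>) y \<omega>" using k[OF True] gamma_ge_1 by (intro mult_left_mono) auto
      then have "(- (\<gamma> * k) - dimn * \<tau>) + (\<gamma> * (\<Sum>i<N - \<tau>. E (\<tau> + i) y \<omega>) - dimn * real (N - \<tau>)) \<le> \<gamma> * X (real N) y \<omega> - dimn * N"
        unfolding X_telescope[OF N] using N by (simp add: of_nat_diff algebra_simps)
      then have "?e * exp (\<gamma> * (\<Sum>i<N - \<tau>. E (\<tau> + i) y \<omega>) - dimn * real (N - \<tau>)) \<le> exp (\<gamma> * X (real N) y \<omega> - dimn * N)"
        by (simp add: exp_add[symmetric])
      then have "sqrt N * (?e * exp (\<gamma> * (\<Sum>i<N - \<tau>. E (\<tau> + i) y \<omega>) - dimn * real (N - \<tau>))) \<le> sqrt N * exp (\<gamma> * X (real N) y \<omega> - dimn * N)"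
        by (rule mult_left_mono) simp
      then have "ennreal (?e * ?g y) \<le> ennreal (approx_density N \<omega> y)"
        unfolding approx_density_def by (intro ennreal_leI) (simp add: mult_ac)
      moreover have "ennreal (?e * ?g y) = ennreal ?e * ennreal (?g y)" by (rule ennreal_mult) auto
      ultimately show ?thesis using True b by simp
    qed simp
  qed
  also have "\<dots> = ennreal (\<integral>y. bump s (cell_corner s x) y \<partial>critical_approx X (real N) \<omega>)"
    by (rule integral_approx_bump[OF w, symmetric])
  finally show ?thesis
    by (subst (asm) ennreal_le_iff) (auto simp: integral_nonneg_AE bump_bounds)
qed

lemma deviation_limit:
  assumes F: "finite V" and \<epsilon>: "0 < \<epsilon>"
  defines "dev \<equiv> \<lambda>N::nat. {\<omega> \<in> space P. \<exists>v\<in>V. \<epsilon> \<le> \<bar>(\<integral>x. bump (fst v) (snd v) x \<partial>critical_approx X (real N) \<omega>) - (\<integral>x. bump (fst v) (snd v) x \<partial>M \<omega>)\<bar>}"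
  shows "dev N \<in> sets P" and "(\<lambda>N. prob (dev N)) \<longlonglongrightarrow> 0"
proof -
  have "dev N = (\<Union>v\<in>V. {\<omega> \<in> space P. \<epsilon> \<le> \<bar>(\<integral>x. bump (fst v) (snd v) x \<partial>critical_approx X (real N) \<omega>) - (\<integral>x. bump (fst v) (snd v) x \<partial>M \<omega>)\<bar>})"
    by (auto simp: dev_def)
  also have "\<dots> \<in> sets P" 
  proof (intro sets.finite_UN F)
    fix v
    have "(\<lambda>\<omega>. \<bar>(\<integral>x. bump (fst v) (snd v) x \<partial>critical_approx X (real N) \<omega>) - (\<integral>x. bump (fst v) (snd v) x \<partial>M \<omega>)\<bar>) \<in> borel_measurable P"
      by (intro borel_measurable_abs borel_measurable_diff measurable_integral_approx_bump measurable_integral_M_bump)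
    then show "{\<omega> \<in> space P. \<epsilon> \<le> \<bar>(\<integral>x. bump (fst v) (snd v) x \<partial>critical_approx X (real N) \<omega>) - (\<integral>x. bump (fst v) (snd v) x \<partial>M \<omega>)\<bar>} \<in> sets P"
      unfolding borel_measurable_iff_ge by blast
  qed
  finally show "dev N \<in> sets P" .
  let ?F = "(\<lambda>v. bump (fst v) (snd v)) ` V"
  have "((\<lambda>t. measure P {\<omega>\<in>space P. \<exists>f\<in>?F. \<epsilon> \<le> \<bar>(\<integral>x. f x \<partial>critical_approx X t \<omega>) - (\<integral>x. f x \<partial>M \<omega>)\<bar>}) \<longlongrightarrow> 0) at_top"
  proof -
    have "finite ?F" "?F \<subseteq> test_functions" using F bump_test_function by auto
    then show ?thesis using gmc \<epsilon> unfolding critical_gmc_def converges_in_prob_weak_star_def by blast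
  qed
  then have "((\<lambda>N::nat. measure P {\<omega>\<in>space P. \<exists>f\<in>?F. \<epsilon> \<le> \<bar>(\<integral>x. f x \<partial>critical_approx X (real N) \<omega>) - (\<integral>x. f x \<partial>M \<omega>)\<bar>}) \<longlongrightarrow> 0) sequentially"
    by (rule filterlim_compose[OF _ filterlim_real_sequentially])
  then show "(\<lambda>N. prob (dev N)) \<longlonglongrightarrow> 0" by (simp add: dev_def)
qed

text \<open>All cells that can carry a hit for given \<open>\<tau>\<close> and n, whatever N is.
  Over a bounded set there are finitely many, so convergence in probability applies to all their
  bumps at once.\<close>

definition grid :: "nat \<Rightarrow> nat \<Rightarrow> 'a set \<Rightarrow> (real \<times> 'a) set" where
  "grid \<tau> n Q = {(real (\<tau> + j), cell_corner (real (\<tau> + j)) x) | j x. n < j \<and> j \<le> n + 32 * n \<and> x \<in> Q}"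

lemma finite_grid:
  assumes "bounded Q" shows "finite (grid \<tau> n Q)"
proof -
  obtain B where B: "\<And>x. x \<in> Q \<Longrightarrow> norm x \<le> B" using assms by (auto simp: bounded_iff)
  define h where "h j k = (real (\<tau> + j), (\<Sum>b\<in>(Basis :: 'a set). (of_int (k b) * exp (- real (\<tau> + j))) *\<^sub>R b))" for j and k :: "'a \<Rightarrow> int"
  define K where "K j = (Basis :: 'a set) \<rightarrow>\<^sub>E {\<lfloor>- (exp (real (\<tau> + j)) * B)\<rfloor>..\<lfloor>exp (real (\<tau> + j)) * B\<rfloor>}" for j
  have "grid \<tau> n Q \<subseteq> (\<Union>j\<in>{..n + 32 * n}. h j ` K j)"
  proof
    fix v assume "v \<in> grid \<tau> n Q"
    then obtain j x where v: "v = (real (\<tau> + j), cell_corner (real (\<tau> + j)) x)" "j \<le> n + 32 * n" "x \<in> Q"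
      by (auto simp: grid_def)
    let ?s = "real (\<tau> + j)"
    define k where "k = restrict (\<lambda>b. \<lfloor>exp ?s * (x \<bullet> b)\<rfloor>) Basis"
    have "k \<in> K j"
      unfolding K_def k_def
    proof (rule restrict_PiE_iff[THEN iffD2], rule ballI)
      fix b :: 'a assume b: "b \<in> Basis"
      have "\<bar>x \<bullet> b\<bar> \<le> B" using Basis_le_norm[OF b, of x] B[OF v(3)] by linarith
      then have "exp ?s * (x \<bullet> b) \<le> exp ?s * B" "exp ?s * (- B) \<le> exp ?s * (x \<bullet> b)"
        by (intro mult_left_mono; simp)+
      then show "\<lfloor>exp ?s * (x \<bullet> b)\<rfloor> \<in> {\<lfloor>- (exp ?s * B)\<rfloor>..\<lfloor>exp ?s * B\<rfloor>}"
        by (auto intro: floor_mono)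
    qed
    moreover have "v = h j k" unfolding v h_def k_def cell_corner_def by simp
    ultimately show "v \<in> (\<Union>j\<in>{..n + 32 * n}. h j ` K j)" using v by blast
  qed
  moreover have "finite (\<Union>j\<in>{..n + 32 * n}. h j ` K j)"
    unfolding K_def by (intro finite_UN_I finite_atMost finite_imageI finite_PiE finite_Basis finite_atLeastAtMost_int)
  ultimately show ?thesis by (rule finite_subset)
qed

text \<open>With n fixed, N is taken so large that outside an event of probability below
  \<open>\<eta>\<close> every bump integral over the grid is within \<open>\<epsilon>\<close> of its
  limit. A second \<open>\<eta>\<close> pays for the field before \<open>\<tau>\<close> falling
  below \<open>- k\<close>. The approximate integral is at least \<open>2 * \<epsilon>\<close>; half
  of it survives, which explains the division by 2 in \<open>\<kappa>\<close>.\<close>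

lemma heavy_cubes:
  fixes z :: "nat \<Rightarrow> 'a"
  assumes \<delta>: "0 < \<delta>" "exp (- real \<tau>) \<le> \<delta>" and J: "0 < J"
    and far: "\<And>i k x y. i < J \<Longrightarrow> k < J \<Longrightarrow> i \<noteq> k \<Longrightarrow> x \<in> region (z i) (2 * \<delta>) \<Longrightarrow> y \<in> region (z k) (2 * \<delta>) \<Longrightarrow>
       r0 \<le> exp (real \<tau>) * dist x y"
    and n: "16 \<le> n" and \<eta>: "0 < \<eta>"
    and B: "B \<in> events" "1 - \<eta> \<le> prob B" "\<And>\<omega> i y. \<omega> \<in> B \<Longrightarrow> i < J \<Longrightarrow> y \<in> region (z i) (2 * \<delta>) \<Longrightarrow> - k \<le> X (real \<tau>) y \<omega>"
  defines "\<kappa> \<equiv> exp (- (\<gamma> * k) - dimn * \<tau>) * cell_const \<tau> / 2"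
  defines "C \<equiv> {\<omega> \<in> space P. \<exists>v\<in>grid \<tau> n (\<Union>i<J. region (z i) \<delta>). ennreal (\<kappa> / sqrt n) \<le> emeasure (M \<omega>) (big_cube (fst v) (snd v))}"
  shows "C \<in> events" "1 - 1 / (prob_const * J) - 2 * \<eta> \<le> prob C"
proof -
  let ?V = "grid \<tau> n (\<Union>i<J. region (z i) \<delta>)"
  let ?L = "32 * n"
  have "bounded (\<Union>i<J. region (z i) \<delta>)" by (auto simp: region_def)
  then have fV: "finite ?V" by (rule finite_grid)
  have "C = (\<Union>v\<in>?V. {\<omega> \<in> space P. ennreal (\<kappa> / sqrt n) \<le> emeasure (M \<omega>) (big_cube (fst v) (snd v))})"
    by (auto simp: C_def)
  also have "\<dots> \<in> events"
  proof (intro sets.finite_UN fV)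
    fix v
    have "(\<lambda>\<omega>. emeasure (M \<omega>) (big_cube (fst v) (snd v))) \<in> borel_measurable P"
      by (rule measurable_M) (simp add: big_cube_def)
    then have "(\<lambda>\<omega>. emeasure (M \<omega>) (big_cube (fst v) (snd v))) -` {ennreal (\<kappa> / sqrt n)..} \<inter> space P \<in> events"
      by (rule measurable_sets) simp
    moreover have "(\<lambda>\<omega>. emeasure (M \<omega>) (big_cube (fst v) (snd v))) -` {ennreal (\<kappa> / sqrt n)..} \<inter> space P =
        {\<omega> \<in> space P. ennreal (\<kappa> / sqrt n) \<le> emeasure (M \<omega>) (big_cube (fst v) (snd v))}" by blast
    ultimately show "{\<omega> \<in> space P. ennreal (\<kappa> / sqrt n) \<le> emeasure (M \<omega>) (big_cube (fst v) (snd v))} \<in> events"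
      by (simp only:)
  qed
  finally show C: "C \<in> events" .
  have \<kappa>: "0 < \<kappa>" by (simp add: \<kappa>_def cell_const_def)
  define \<epsilon> where "\<epsilon> = \<kappa> / sqrt n"
  have \<epsilon>: "0 < \<epsilon>" using \<kappa> n by (simp add: \<epsilon>_def)
  define dev where "dev = (\<lambda>N::nat. {\<omega> \<in> space P. \<exists>v\<in>?V. \<epsilon> \<le> \<bar>(\<integral>x. bump (fst v) (snd v) x \<partial>critical_approx X (real N) \<omega>) - (\<integral>x. bump (fst v) (snd v) x \<partial>M \<omega>)\<bar>})"
  have dev: "dev N \<in> events" "(\<lambda>N. prob (dev N)) \<longlonglongrightarrow> 0" for N
    using deviation_limit[OF fV \<epsilon>] by (simp_all add: dev_def)
  have "\<forall>\<^sub>F N in sequentially. prob (dev N) < \<eta>" using dev(2) \<eta> by (rule order_tendstoD)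
  moreover have "\<forall>\<^sub>F N in sequentially. \<tau> + n + ?L + 16 \<le> N" by (rule eventually_ge_at_top)
  ultimately obtain N where N: "prob (dev N) < \<eta>" "\<tau> + n + ?L + 16 \<le> N"
    by (metis (mono_tags, lifting) eventually_conj eventually_happens sequentially_bot)
  define A where "A = (\<Union>i<J. {\<omega> \<in> space P. 0 < good n ?L \<tau> N (region (z i) \<delta>) \<omega>})"
  have A: "1 - 1 / (prob_const * J) \<le> prob A"
    unfolding A_def by (rule good_regions_union[OF \<delta> J far n order_refl N(2)])
  have Aev: "A \<in> events"
  proof -
    have "{\<omega> \<in> space P. 0 < good n ?L \<tau> N (region (z i) \<delta>) \<omega>} \<in> events" for i
    proof -
      have "good n ?L \<tau> N (region (z i) \<delta>) \<in> borel_measurable P"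
        by (rule measurable_good) (simp add: region_def)
      then have "good n ?L \<tau> N (region (z i) \<delta>) -` {0<..} \<inter> space P \<in> events" by (rule measurable_sets) simp
      moreover have "good n ?L \<tau> N (region (z i) \<delta>) -` {0<..} \<inter> space P = {\<omega> \<in> space P. 0 < good n ?L \<tau> N (region (z i) \<delta>) \<omega>}"
        by blast
      ultimately show ?thesis by (simp only:)
    qed
    then show ?thesis unfolding A_def by (rule sets.finite_UN[OF finite_lessThan])
  qed
  have sub: "A \<inter> B - dev N \<subseteq> C"
  proof
    fix \<omega> assume w: "\<omega> \<in> A \<inter> B - dev N"
    then have ws: "\<omega> \<in> space P" using Aev sets.sets_into_space by blast
    from w obtain i where i: "i < J" "0 < good n ?L \<tau> N (region (z i) \<delta>) \<omega>" by (auto simp: A_def)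
    have em: "noise \<omega> q \<in> borel_measurable borel" for q
      by (rule borel_measurable_continuous_onI) (rule E_cont[OF ws])
    obtain x j where xj: "x \<in> region (z i) \<delta>" "n < j" "j \<le> n + ?L"
      "ennreal (cell_const \<tau> / sqrt n) \<le> (\<integral>\<^sup>+y. indicator (cell (real (\<tau> + j)) x) y *
       ennreal (sqrt N * exp (\<gamma> * (\<Sum>i<N - \<tau>. noise \<omega> (\<tau> + i) y) - dimn * real (N - \<tau>))) \<partial>lborel)"
    proof (rule good_hits_imp_heavy_cell[OF i(2) _ _ em])
      show "1 \<le> n" "\<tau> + n + ?L \<le> N" using n N(2) by linarith+
    qed
    let ?s = "real (\<tau> + j)" let ?a = "cell_corner ?s x"
    have v: "(?s, ?a) \<in> ?V" using xj i(1) by (auto simp: grid_def)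
    have s: "exp (- ?s) \<le> \<delta>"
    proof -
      have "exp (- ?s) \<le> exp (- real \<tau>)" by simp
      then show ?thesis using \<delta>(2) by linarith
    qed
    have "exp (- (\<gamma> * k) - dimn * \<tau>) * (cell_const \<tau> / sqrt n) \<le> (\<integral>y. bump ?s ?a y \<partial>critical_approx X (real N) \<omega>)"
    proof (rule heavy_cell_transfer[OF ws])
      show "\<tau> \<le> N" using N(2) by simp
      fix y assume "y \<in> cell ?s x"
      then have "y \<in> region (z i) (\<delta> + \<delta>)" using cell_subset_region[OF xj(1) s] by auto
      then have "y \<in> region (z i) (2 * \<delta>)" unfolding mult_2 .
      then show "- k \<le> X (real \<tau>) y \<omega>" using B(3)[of \<omega> i y] w i(1) by blast
    next
      show "0 \<le> cell_const \<tau> / sqrt n" by (simp add: cell_const_def)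
    next
      show "ennreal (cell_const \<tau> / sqrt n) \<le> (\<integral>\<^sup>+y. indicator (cell ?s x) y *
       ennreal (sqrt N * exp (\<gamma> * (\<Sum>i<N - \<tau>. E (\<tau> + i) y \<omega>) - dimn * real (N - \<tau>))) \<partial>lborel)"
        by (rule xj(4))
    qed
    then have "2 * \<epsilon> \<le> (\<integral>y. bump ?s ?a y \<partial>critical_approx X (real N) \<omega>)" by (simp add: \<epsilon>_def \<kappa>_def)
    moreover have "\<bar>(\<integral>x. bump ?s ?a x \<partial>critical_approx X (real N) \<omega>) - (\<integral>x. bump ?s ?a x \<partial>M \<omega>)\<bar> < \<epsilon>"
    proof (rule ccontr)
      assume "\<not> ?thesis"
      then have "\<omega> \<in> dev N" unfolding dev_def using ws v by (intro CollectI conjI bexI[of _ "(?s, ?a)"], simp_all only: fst_conv snd_conv not_less)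
      then show False using w by blast
    qed
    ultimately have "\<epsilon> \<le> (\<integral>x. bump ?s ?a x \<partial>M \<omega>)" by linarith
    then have "ennreal \<epsilon> \<le> ennreal (\<integral>x. bump ?s ?a x \<partial>M \<omega>)" by (rule ennreal_leI)
    also have "\<dots> \<le> emeasure (M \<omega>) (big_cube ?s ?a)" by (rule integral_M_bump_le[OF ws])
    finally have "ennreal (\<kappa> / sqrt n) \<le> emeasure (M \<omega>) (big_cube (fst (?s, ?a)) (snd (?s, ?a)))" by (simp add: \<epsilon>_def)
    then show "\<omega> \<in> C" unfolding C_def using ws v by blast
  qed
  have "prob A \<le> prob (A \<inter> B - dev N) + prob (space P - B) + prob (dev N)"
  proof -
    have "A \<subseteq> (A \<inter> B - dev N) \<union> (space P - B) \<union> dev N" using Aev sets.sets_into_space by blast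
    then have "prob A \<le> prob ((A \<inter> B - dev N) \<union> (space P - B) \<union> dev N)"
      using Aev B(1) dev(1)[of N] by (intro finite_measure_mono sets.Un sets.Diff sets.Int sets.top)
    also have "\<dots> \<le> prob ((A \<inter> B - dev N) \<union> (space P - B)) + prob (dev N)"
      using Aev B(1) dev(1)[of N] by (intro measure_Un_le sets.Un sets.Diff sets.Int sets.top)
    also have "prob ((A \<inter> B - dev N) \<union> (space P - B)) \<le> prob (A \<inter> B - dev N) + prob (space P - B)"
      using Aev B(1) dev(1)[of N] by (intro measure_Un_le sets.Un sets.Diff sets.Int sets.top)
    finally show ?thesis by simp
  qed
  moreover have "prob (A \<inter> B - dev N) \<le> prob C" using sub C by (rule finite_measure_mono)
  moreover have "prob (space P - B) \<le> \<eta>" using prob_compl[OF B(1)] B(2) by simp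
  ultimately show "1 - 1 / (prob_const * J) - 2 * \<eta> \<le> prob C" using A N(1) by linarith
qed

end

section \<open>Increments of the star-scale invariant field\<close>

text \<open>The Gaussian space to which the independence results are applied:
  \<open>jointly_gaussian\<close> is a statement about exactly these finite combinations.\<close>

definition linear_span :: "'i set \<Rightarrow> ('i \<Rightarrow> 'w \<Rightarrow> real) \<Rightarrow> ('w \<Rightarrow> real) set" where
  "linear_span I Y = {f. \<exists>S a. finite S \<and> S \<subseteq> I \<and> f = (\<lambda>\<omega>. \<Sum>i\<in>S. a i * Y i \<omega>)}"

lemma linear_span_base: "i \<in> I \<Longrightarrow> Y i \<in> linear_span I Y"
  unfolding linear_span_def by (intro CollectI exI[of _ "{i}"] exI[of _ "\<lambda>_. 1"]) simp

lemma linear_span_scale: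
  assumes "f \<in> linear_span I Y" shows "(\<lambda>\<omega>. k * f \<omega>) \<in> linear_span I Y"
proof -
  obtain S a where S: "finite S" "S \<subseteq> I" "f = (\<lambda>\<omega>. \<Sum>i\<in>S. a i * Y i \<omega>)"
    using assms unfolding linear_span_def by blast
  have "(\<lambda>\<omega>. k * f \<omega>) = (\<lambda>\<omega>. \<Sum>i\<in>S. (k * a i) * Y i \<omega>)"
    unfolding S(3) sum_distrib_left by (simp add: mult.assoc)
  then show ?thesis using S(1,2) unfolding linear_span_def
    by (intro CollectI exI[of _ S] exI[of _ "\<lambda>i. k * a i"] conjI)
qed

lemma linear_span_add:
  assumes "f \<in> linear_span I Y" "g \<in> linear_span I Y" shows "(\<lambda>\<omega>. f \<omega> + g \<omega>) \<in> linear_span I Y"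
proof -
  obtain S a where S: "finite S" "S \<subseteq> I" "f = (\<lambda>\<omega>. \<Sum>i\<in>S. a i * Y i \<omega>)"
    using assms(1) unfolding linear_span_def by blast
  obtain T b where T: "finite T" "T \<subseteq> I" "g = (\<lambda>\<omega>. \<Sum>i\<in>T. b i * Y i \<omega>)"
    using assms(2) unfolding linear_span_def by blast
  let ?c = "\<lambda>i. (if i \<in> S then a i else 0) + (if i \<in> T then b i else 0)"
  have "(\<Sum>i\<in>S \<union> T. ?c i * Y i \<omega>) = f \<omega> + g \<omega>" for \<omega>
  proof -
    have "(\<Sum>i\<in>S \<union> T. (if i \<in> S then a i else 0) * Y i \<omega>) = f \<omega>"
      unfolding S(3) using S(1) T(1) by (intro sum.mono_neutral_cong_right) auto
    moreover have "(\<Sum>i\<in>S \<union> T. (if i \<in> T then b i else 0) * Y i \<omega>) = g \<omega>"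
      unfolding T(3) using S(1) T(1) by (intro sum.mono_neutral_cong_right) auto
    ultimately show ?thesis by (simp only: distrib_right sum.distrib)
  qed
  then have "(\<lambda>\<omega>. f \<omega> + g \<omega>) = (\<lambda>\<omega>. \<Sum>i\<in>S \<union> T. ?c i * Y i \<omega>)" by simp
  then show ?thesis using S(1,2) T(1,2) unfolding linear_span_def
    by (intro CollectI exI[of _ "S \<union> T"] exI[of _ ?c] conjI) auto
qed

lemma jointly_gaussian_span:
  assumes P: "prob_space P" and Y: "jointly_gaussian P I Y" and mean: "\<And>i. i \<in> I \<Longrightarrow> (\<integral>\<omega>. Y i \<omega> \<partial>P) = 0"
  shows "centred_gaussian_space P (linear_span I Y)"
proof -
  interpret prob_space P by (rule P)
  have g: "gaussian_rv P f" if "f \<in> linear_span I Y" for f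
    using that Y unfolding linear_span_def jointly_gaussian_def by blast
  have int: "integrable P (Y i)" if "i \<in> I" for i
  proof -
    have "gaussian_rv P (Y i)" by (rule g[OF linear_span_base[OF that]])
    then show ?thesis
      using gaussian_square_integrable[OF _ mean[OF that]] square_integrable_imp_integrable[of "Y i"]
      unfolding gaussian_rv_def by blast
  qed
  have m: "(\<integral>\<omega>. f \<omega> \<partial>P) = 0" if f: "f \<in> linear_span I Y" for f
  proof -
    obtain S a where S: "finite S" "S \<subseteq> I" "f = (\<lambda>\<omega>. \<Sum>i\<in>S. a i * Y i \<omega>)"
      using f unfolding linear_span_def by blast
    have "(\<integral>\<omega>. f \<omega> \<partial>P) = (\<Sum>i\<in>S. \<integral>\<omega>. a i * Y i \<omega> \<partial>P)"
      unfolding S(3) using S(2) int by (intro Bochner_Integration.integral_sum) auto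
    also have "\<dots> = 0" using S(2) mean by (intro sum.neutral) auto
    finally show ?thesis .
  qed
  have "(\<lambda>_. 0) \<in> linear_span I Y"
    unfolding linear_span_def by (intro CollectI exI[of _ "{}"]) simp
  then show ?thesis
    unfolding centred_gaussian_space_def
    by (intro conjI ballI allI g m linear_span_add linear_span_scale)
qed

lemma centred_gaussian_space_integrable_mult:
  assumes P: "prob_space P" and H: "centred_gaussian_space P H" and f: "f \<in> H" and g: "g \<in> H"
  shows "integrable P (\<lambda>\<omega>. f \<omega> * g \<omega>)"
proof -
  note HD = centred_gaussian_spaceD[OF H]
  have sq: "integrable P (\<lambda>\<omega>. (h \<omega>)\<^sup>2)" if "h \<in> H" for h
    by (rule prob_space.gaussian_square_integrable[OF P HD(1)[OF that] HD(2)[OF that]])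
  have "integrable P (\<lambda>\<omega>. ((f \<omega> + g \<omega>)\<^sup>2 - (f \<omega>)\<^sup>2 - (g \<omega>)\<^sup>2) / 2)"
    by (intro integrable_divide Bochner_Integration.integrable_diff sq f g sq[OF HD(4)[OF f g]])
  then show ?thesis by (simp add: power2_sum)
qed

section \<open>The seed covariance and its integrals over unit intervals\<close>

context
  fixes R :: real and rho :: "'a::euclidean_space \<Rightarrow> real"
  assumes R: "0 < R" and seed: "seed_covariance R rho"
begin

lemma seed_nonneg: "0 \<le> rho x" and seed_0: "rho 0 = 1"
  using seed by (auto simp: seed_covariance_def)

text \<open>Positive definiteness on {0, x} with coefficients 1 and -1 gives
  \<open>rho x + rho (- x) \<le> 2 * rho 0\<close>, and the map \<open>uminus\<close> is an
  orthogonal transformation.\<close>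

lemma seed_le_1: "rho x \<le> 1"
proof (cases "x = 0")
  case False
  have "rho (- x) = rho x"
  proof -
    have "orthogonal_transformation (uminus :: 'a \<Rightarrow> 'a)"
      unfolding orthogonal_transformation_def by (auto intro!: linearI)
    then show ?thesis using seed by (auto simp: seed_covariance_def rotationally_symmetric_def)
  qed
  moreover have "\<forall>S c. finite S \<longrightarrow> 0 \<le> (\<Sum>y\<in>S. \<Sum>z\<in>S. c y * c z * rho (y - z))"
    using seed unfolding seed_covariance_def positive_definite_fun_def by (elim conjE)
  from this[rule_format, of "{0, x}" "\<lambda>y. if y = 0 then 1 else - 1"]
  have "0 \<le> (\<Sum>y\<in>{0, x}. \<Sum>z\<in>{0, x}. (if y = 0 then 1 else - 1) * (if z = 0 then 1 else - 1) * rho (y - z))" by simp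
  ultimately show ?thesis using False seed_0 by simp
qed (simp add: seed_0)

lemma seed_outside: "R / 2 \<le> norm x \<Longrightarrow> rho x = 0"
proof (rule ccontr)
  assume x: "R / 2 \<le> norm x" "rho x \<noteq> 0"
  then have "x \<in> closed_support rho" unfolding closed_support_def by (intro subsetD[OF closure_subset]) simp
  then have "x \<in> ball 0 (R / 2)" using seed by (auto simp: seed_covariance_def)
  then show False using x by simp
qed

lemma seed_continuous: "continuous_on UNIV rho"
proof -
  have "k_times_cont_diff 0 rho" using seed unfolding seed_covariance_def smooth_fun_def by blast
  then show ?thesis by simp
qed

text \<open>Differentiability at 0 gives a linear bound on a ball of radius d; outside it
  \<open>1 - rho x \<le> 1 \<le> norm x / d\<close>. A linear bound suffices because the shifts
  inside a cell then form a geometric series.\<close>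

lemma seed_lipschitz_at_0: obtains C where "0 \<le> C" "\<And>x. 1 - rho x \<le> C * norm x"
proof -
  have "k_times_cont_diff (Suc 0) rho" using seed unfolding seed_covariance_def smooth_fun_def by blast
  then have "rho differentiable (at 0)" by (simp add: differentiable_on_def)
  then obtain f' where f': "(rho has_derivative f') (at 0)" unfolding differentiable_def by blast
  then obtain K where K: "\<And>x. norm (f' x) \<le> norm x * K" "0 < K"
    using bounded_linear.pos_bounded[OF has_derivative_bounded_linear[OF f']] by blast
  obtain d where d: "0 < d" "\<And>y. norm (y - 0) < d \<Longrightarrow> norm (rho y - rho 0 - f' (y - 0)) \<le> 1 * norm (y - 0)"
    using f' unfolding has_derivative_at_alt by (meson zero_less_one)
  show thesis
  proof (rule that[of "1 + K + 1 / d"])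
    show "0 \<le> 1 + K + 1 / d" using d K by simp
    fix x
    show "1 - rho x \<le> (1 + K + 1 / d) * norm x"
    proof (cases "norm x < d")
      case True
      then have "\<bar>rho x - 1 - f' x\<bar> \<le> norm x" using d(2)[of x] seed_0 by simp
      moreover have "\<bar>f' x\<bar> \<le> norm x * K" using K(1)[of x] by simp
      ultimately have "1 - rho x \<le> norm x + norm x * K" by linarith
      moreover have "0 \<le> 1 / d * norm x" using d by simp
      ultimately show ?thesis by (simp add: algebra_simps)
    next
      case False
      then have "1 \<le> 1 / d * norm x" using d by (simp add: field_simps)
      moreover have "0 \<le> (1 + K) * norm x" using K by simp
      ultimately show ?thesis using seed_nonneg[of x] by (simp add: distrib_right)
    qed
  qed
qed

definition increment_cov :: "nat \<Rightarrow> 'a \<Rightarrow> 'a \<Rightarrow> real" where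
  "increment_cov n x y = integral {real n..real (Suc n)} (\<lambda>u. rho (exp u *\<^sub>R (x - y)))"

lemma seed_integrable: "(\<lambda>u. rho (exp u *\<^sub>R z)) integrable_on {a..b}"
  by (intro integrable_continuous_interval continuous_on_compose2[OF seed_continuous] continuous_intros) auto

lemma increment_cov_bounds: "0 \<le> increment_cov n x y" "increment_cov n x y \<le> 1"
proof -
  show "0 \<le> increment_cov n x y" unfolding increment_cov_def
    by (rule integral_nonneg[OF seed_integrable]) (rule seed_nonneg)
  have "increment_cov n x y \<le> integral {real n..real (Suc n)} (\<lambda>_. 1)" unfolding increment_cov_def
    by (rule integral_le[OF seed_integrable]) (auto simp: seed_le_1)
  then show "increment_cov n x y \<le> 1" by simp
qed

lemma increment_cov_self: "increment_cov n x x = 1"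
  by (simp add: increment_cov_def seed_0)

lemma increment_cov_far: "R / 2 \<le> exp (real n) * dist x y \<Longrightarrow> increment_cov n x y = 0"
proof -
  assume far: "R / 2 \<le> exp (real n) * dist x y"
  have "rho (exp u *\<^sub>R (x - y)) = 0" if "u \<in> {real n..real (Suc n)}" for u
  proof (rule seed_outside)
    have "exp (real n) * dist x y \<le> exp u * dist x y" using that by (intro mult_right_mono) auto
    then show "R / 2 \<le> norm (exp u *\<^sub>R (x - y))" using far by (simp add: dist_norm)
  qed
  then have "increment_cov n x y = integral {real n..real (Suc n)} (\<lambda>_. 0)"
    unfolding increment_cov_def by (rule Henstock_Kurzweil_Integration.integral_cong)
  then show ?thesis by simp
qed

lemma increment_cov_near:
  assumes C: "0 \<le> C" "\<And>x. 1 - rho x \<le> C * norm x"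
  shows "1 - increment_cov n x y \<le> (C * exp 1) * exp (real n) * dist x y"
proof -
  let ?A = "(C * exp 1) * exp (real n) * dist x y"
  have "1 - ?A \<le> rho (exp u *\<^sub>R (x - y))" if "u \<in> {real n..real (Suc n)}" for u
  proof -
    have "exp u \<le> exp (1 + real n)" using that by simp
    then have "C * (exp u * dist x y) \<le> C * ((exp 1 * exp (real n)) * dist x y)"
      unfolding exp_add using C(1) by (intro mult_left_mono mult_right_mono) auto
    then show ?thesis using C(2)[of "exp u *\<^sub>R (x - y)"] by (simp add: dist_norm mult_ac)
  qed
  then have "integral {real n..real (Suc n)} (\<lambda>_. 1 - ?A) \<le> increment_cov n x y"
    unfolding increment_cov_def by (intro integral_le seed_integrable) auto
  then show ?thesis by simp
qed

end

text \<open>The covariance of two increments is an alternating sum of integrals up to minima of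
  their end points. For different unit intervals it cancels; for equal ones the integral over that
  interval remains. The support radius R / 2 of the seed becomes the correlation range.\<close>

lemma critical_chaos_of_star_scale:
  fixes P :: "'w measure" and rho :: "'a::euclidean_space \<Rightarrow> real"
  assumes P: "prob_space P" and R: "0 < R" and seed: "seed_covariance R rho"
    and X: "star_scale_martingale P rho X" and M: "critical_gmc P X M"
  obtains C0 where "critical_chaos P (linear_span ({0..} \<times> UNIV) (\<lambda>(t, x). X t x))
    (\<lambda>n x \<omega>. X (real (Suc n)) x \<omega> - X (real n) x \<omega>) (increment_cov rho) (R / 2) C0
    (critical_gamma TYPE('a)) (real DIM('a)) X M"
proof -
  interpret prob_space P by (rule P)
  let ?H = "linear_span ({0..} \<times> UNIV) (\<lambda>(t, x). X t x)"
  let ?E = "\<lambda>n x \<omega>. X (real (Suc n)) x \<omega> - X (real n) x \<omega>"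
  let ?F = "\<lambda>t x y. integral {0..t} (\<lambda>u. rho (exp u *\<^sub>R (x - y)))"
  have jg: "jointly_gaussian P ({0..} \<times> UNIV) (\<lambda>(t, x). X t x)"
    and cont: "\<And>t \<omega>. 0 \<le> t \<Longrightarrow> \<omega> \<in> space P \<Longrightarrow> continuous_on UNIV (\<lambda>x. X t x \<omega>)"
    and mean: "\<And>t x. 0 \<le> t \<Longrightarrow> (\<integral>\<omega>. X t x \<omega> \<partial>P) = 0"
    and cv: "\<And>s t x y. 0 \<le> s \<Longrightarrow> 0 \<le> t \<Longrightarrow> (\<integral>\<omega>. X s x \<omega> * X t y \<omega> \<partial>P) = ?F (min s t) x y"
    using X unfolding star_scale_martingale_def by blast+
  have H: "centred_gaussian_space P ?H"
    by (rule jointly_gaussian_span[OF P jg]) (use mean in auto)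
  note HD = centred_gaussian_spaceD[OF H]
  have XH: "X t x \<in> ?H" if "0 \<le> t" for t x
    using linear_span_base[of "(t, x)" "{0..} \<times> UNIV" "\<lambda>(t, x). X t x"] that by simp
  have EH: "?E n x \<in> ?H" for n x by (rule centred_gaussian_space_diff[OF H XH XH]) auto
  have cov: "(\<integral>\<omega>. ?E n x \<omega> * ?E m y \<omega> \<partial>P) = (if n = m then increment_cov rho n x y else 0)" for n m x y
  proof -
    have i: "integrable P (\<lambda>\<omega>. X (real k) x \<omega> * X (real l) y \<omega>)" for k l
      by (rule centred_gaussian_space_integrable_mult[OF P H XH XH]) auto
    have "(\<integral>\<omega>. ?E n x \<omega> * ?E m y \<omega> \<partial>P) = (\<integral>\<omega>. X (real (Suc n)) x \<omega> * X (real (Suc m)) y \<omega> -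
        X (real (Suc n)) x \<omega> * X (real m) y \<omega> - (X (real n) x \<omega> * X (real (Suc m)) y \<omega> - X (real n) x \<omega> * X (real m) y \<omega>) \<partial>P)"
      by (simp only: left_diff_distrib right_diff_distrib)
        (rule Bochner_Integration.integral_cong[OF refl], simp)
    also have "\<dots> = (\<integral>\<omega>. X (real (Suc n)) x \<omega> * X (real (Suc m)) y \<omega> \<partial>P) - (\<integral>\<omega>. X (real (Suc n)) x \<omega> * X (real m) y \<omega> \<partial>P)
        - ((\<integral>\<omega>. X (real n) x \<omega> * X (real (Suc m)) y \<omega> \<partial>P) - (\<integral>\<omega>. X (real n) x \<omega> * X (real m) y \<omega> \<partial>P))"
      by (simp only: Bochner_Integration.integral_diff Bochner_Integration.integrable_diff i)
    also have "\<dots> = ?F (real (min (Suc n) (Suc m))) x y - ?F (real (min (Suc n) m)) x y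
        - (?F (real (min n (Suc m))) x y - ?F (real (min n m)) x y)"
      unfolding cv[OF of_nat_0_le_iff of_nat_0_le_iff] of_nat_min by (rule refl)
    also have "\<dots> = (if n = m then increment_cov rho n x y else 0)"
    proof (cases n m rule: linorder_cases)
      case equal
      have "?F (real n) x y + increment_cov rho n x y = ?F (real (Suc n)) x y"
        unfolding increment_cov_def[OF R seed]
        by (rule Henstock_Kurzweil_Integration.integral_combine[OF _ _ seed_integrable[OF R seed]]) auto
      then show ?thesis using equal by simp
    next
      case less
      then show ?thesis by (simp add: min_def)
    next
      case greater
      then have "min (Suc n) (Suc m) = Suc m" "min (Suc n) m = m" "min n (Suc m) = Suc m" "min n m = m" by auto
      then show ?thesis using greater by simp
    qed
    finally show ?thesis .
  qed
  obtain C where C: "0 \<le> C" "\<And>x. 1 - rho x \<le> C * norm x"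
    using seed_lipschitz_at_0[OF R seed] by blast
  show thesis
  proof (rule that[of "C * exp 1"], unfold_locales)
    show "continuous_on UNIV (\<lambda>x. ?E n x \<omega>)" if "\<omega> \<in> space P" for n \<omega>
      using that by (intro continuous_on_diff cont) auto
    show "X (real n) x \<in> borel_measurable P" for n x by (rule HD(3)[OF XH]) simp
    show "continuous_on UNIV (\<lambda>x. X (real n) x \<omega>)" if "\<omega> \<in> space P" for n \<omega>
      by (rule cont[OF _ that]) simp
  qed (use H EH cov M R C(1) increment_cov_bounds[OF R seed] increment_cov_self[OF R seed]
        increment_cov_far[OF R seed] increment_cov_near[OF R seed C] in \<open>assumption | simp\<close>)+
qed

section \<open>The limit superior over small cubes\<close>

lemma measure_cube:
  fixes a :: "'a::euclidean_space"
  assumes "0 \<le> r" shows "measure lborel (cbox a (a + r *\<^sub>R One)) = r ^ DIM('a)"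
proof -
  have "\<forall>b\<in>Basis. a \<bullet> b \<le> (a + r *\<^sub>R One) \<bullet> b" using assms by (simp add: inner_simps)
  then have "measure lborel (cbox a (a + r *\<^sub>R One)) = (\<Prod>b\<in>(Basis::'a set). (a + r *\<^sub>R One - a) \<bullet> b)"
    by (simp add: measure_lborel_cbox_eq)
  also have "\<dots> = (\<Prod>b\<in>(Basis::'a set). r)" by (rule prod.cong) (auto simp: inner_simps)
  finally show ?thesis by simp
qed

text \<open>Reduces the filter to countably many volume bounds, as the measurability of the event
  requires. Cubes of positive side have positive volume, so \<open>at_right 0\<close> amounts to an
  upper bound on the volume.\<close>

lemma eventually_small_cubes:
  fixes D :: "'a::euclidean_space set"
  shows "eventually Q (small_cubes D) \<longleftrightarrow> (\<exists>m::nat. \<forall>B\<in>cubes_inside D. measure lborel B < 1 / Suc m \<longrightarrow> Q B)"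
    (is "?l \<longleftrightarrow> ?r")
proof
  assume ?l
  then obtain W where W: "eventually W (at_right (0::real))" "\<And>B. W (measure lborel B) \<Longrightarrow> B \<in> cubes_inside D \<Longrightarrow> Q B"
    unfolding small_cubes_def eventually_inf_principal eventually_filtercomap by blast
  obtain e :: real where e: "0 < e" "\<And>y. 0 < y \<Longrightarrow> y < e \<Longrightarrow> W y"
    using W(1) unfolding eventually_at_right_field by blast
  obtain m where m: "1 / Suc m < e" using nat_approx_posE[OF e(1)] by blast
  have "Q B" if "B \<in> cubes_inside D" "measure lborel B < 1 / Suc m" for B
  proof (rule W(2)[OF e(2) that(1)])
    have "\<exists>a r. 0 < r \<and> B = cbox a (a + r *\<^sub>R One)" using that(1) by (simp add: cubes_inside_def)
    then obtain a :: 'a and r where "0 < r" "B = cbox a (a + r *\<^sub>R One)" by (elim exE conjE)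
    then show "0 < measure lborel B" by (simp add: measure_cube)
    show "measure lborel B < e" using that(2) m by linarith
  qed
  then show ?r by blast
next
  assume ?r
  then obtain m :: nat where m: "\<And>B. B \<in> cubes_inside D \<Longrightarrow> measure lborel B < 1 / Suc m \<Longrightarrow> Q B" by blast
  have "eventually (\<lambda>y. y < 1 / Suc m) (at_right (0::real))"
    unfolding eventually_at_right_field by (intro exI[of _ "1 / Suc m"]) simp
  then show ?l
    unfolding small_cubes_def eventually_inf_principal eventually_filtercomap using m by blast
qed

lemma Limsup_pos_iff:
  fixes f :: "'a::euclidean_space set \<Rightarrow> ennreal"
  shows "0 < Limsup (small_cubes D) f \<longleftrightarrow>
     (\<exists>k::nat. \<forall>m::nat. \<exists>B\<in>cubes_inside D. measure lborel B < 1 / Suc m \<and> ennreal (1 / Suc k) < f B)"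
proof
  assume "0 < Limsup (small_cubes D) f"
  then obtain y where y: "0 < y" "\<not> eventually (\<lambda>B. f B < y) (small_cubes D)"
    using Limsup_le_iff[of "small_cubes D" f 0] by (auto simp: not_le[symmetric])
  obtain e where e: "0 < e" "ennreal e < y"
  proof -
    obtain z where z: "0 < z" "z < y" using dense[OF y(1)] by blast
    have "z < \<top>" by (rule less_le_trans[OF z(2) top_greatest])
    then have "z = ennreal (enn2real z)" "0 < enn2real z" using z(1) by (simp_all add: enn2real_positive_iff)
    then show ?thesis using that[of "enn2real z"] z by simp
  qed
  obtain k where k: "1 / Suc k < e" using nat_approx_posE[OF e(1)] by blast
  have "ennreal (1 / Suc k) < y" using e(2) k by (meson ennreal_leI le_less_trans less_imp_le)
  then have "\<exists>B\<in>cubes_inside D. measure lborel B < 1 / Suc m \<and> ennreal (1 / Suc k) < f B" for m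
    using y(2) unfolding eventually_small_cubes by (meson less_le_trans not_less)
  then show "\<exists>k::nat. \<forall>m::nat. \<exists>B\<in>cubes_inside D. measure lborel B < 1 / Suc m \<and> ennreal (1 / Suc k) < f B" by blast
next
  assume "\<exists>k::nat. \<forall>m::nat. \<exists>B\<in>cubes_inside D. measure lborel B < 1 / Suc m \<and> ennreal (1 / Suc k) < f B"
  then obtain k :: nat where k: "\<And>m::nat. \<exists>B\<in>cubes_inside D. measure lborel B < 1 / Suc m \<and> ennreal (1 / Suc k) < f B" by blast
  have "\<not> eventually (\<lambda>B. f B < ennreal (1 / Suc k)) (small_cubes D)"
    unfolding eventually_small_cubes using k by (meson less_asym)
  moreover have "0 < ennreal (1 / Suc k)" by simp
  ultimately have "\<not> Limsup (small_cubes D) f \<le> 0"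
    unfolding Limsup_le_iff[of "small_cubes D" f 0] by blast
  then show "0 < Limsup (small_cubes D) f" by (simp only: not_le)
qed

definition cube_ratio :: "'a::euclidean_space measure \<Rightarrow> 'a set \<Rightarrow> ennreal" where
  "cube_ratio N B = ennreal (sqrt (ln (1 / measure lborel B))) * emeasure N B"

text \<open>Cubes from a countable dense family thus determine whether the limit superior is positive, which makes the event measurable.\<close>

lemma enlarge_cube:
  fixes a :: "'a::euclidean_space"
  assumes T: "\<And>U. open U \<Longrightarrow> U \<noteq> {} \<Longrightarrow> \<exists>v\<in>T. v \<in> U"
    and D: "open D" "cbox a (a + r *\<^sub>R One) \<subseteq> D" and r: "0 < r"
    and N: "sets N = sets borel" "emeasure N (cbox a (a + r *\<^sub>R One)) < \<infinity>"
    and small: "measure lborel (cbox a (a + r *\<^sub>R One)) < \<epsilon>"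
    and large: "ennreal y < cube_ratio N (cbox a (a + r *\<^sub>R One))" and y: "0 \<le> y"
  shows "\<exists>v\<in>T. 0 < snd v \<and> cbox (fst v) (fst v + snd v *\<^sub>R One) \<subseteq> D \<and>
    measure lborel (cbox (fst v) (fst v + snd v *\<^sub>R One)) < \<epsilon> \<and> ennreal y < cube_ratio N (cbox (fst v) (fst v + snd v *\<^sub>R One))"
proof -
  let ?B = "cbox a (a + r *\<^sub>R One)"
  define x where "x = enn2real (emeasure N ?B)"
  have x: "emeasure N ?B = ennreal x" "0 \<le> x" using N(2) by (simp_all add: x_def)
  obtain e where e: "0 < e" "(\<Union>z\<in>?B. ball z e) \<subseteq> D"
    using compact_subset_open_imp_ball_epsilon_subset[OF compact_cbox D] by blast
  let ?s = "\<lambda>h. (r + 2 * h) ^ DIM('a)"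
  have "cube_ratio N ?B = ennreal (sqrt (ln (1 / r ^ DIM('a)))) * ennreal x"
    unfolding cube_ratio_def measure_cube[OF less_imp_le[OF r]] x(1) ..
  then have pos: "y < sqrt (ln (1 / r ^ DIM('a))) * x"
  \<comment> \<open>The real \<open>sqrt\<close> is odd: for cubes of volume above 1 it is negative
    and \<open>ennreal\<close> truncates it to 0, which the strict lower bound on the ratio
    excludes.\<close>
  proof (cases "0 \<le> sqrt (ln (1 / r ^ DIM('a)))")
    case True
    assume "cube_ratio N ?B = ennreal (sqrt (ln (1 / r ^ DIM('a)))) * ennreal x"
    then have "ennreal y < ennreal (sqrt (ln (1 / r ^ DIM('a))) * x)"
      using large True x(2) by (simp add: ennreal_mult)
    then show ?thesis using y by (simp add: ennreal_less_iff)
  next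
    case False
    assume "cube_ratio N ?B = ennreal (sqrt (ln (1 / r ^ DIM('a)))) * ennreal x"
    then show ?thesis using large False by (simp add: ennreal_neg)
  qed
  \<comment> \<open>Volume and logarithmic factor depend continuously on the side, so for small
    positive h the strict inequalities persist. The mass x of the old cube is kept, as it bounds the
    mass of the enlarged cube from below.\<close>
  have "((\<lambda>h. sqrt (ln (1 / ?s h)) * x) \<longlongrightarrow> sqrt (ln (1 / ?s 0)) * x) (at_right 0)"
    using r by (intro tendsto_intros) auto
  then have 1: "\<forall>\<^sub>F h in at_right 0. y < sqrt (ln (1 / ?s h)) * x"
    using pos by (intro order_tendstoD(1)) auto
  have "(?s \<longlongrightarrow> ?s 0) (at_right 0)" by (intro tendsto_intros)
  then have 2: "\<forall>\<^sub>F h in at_right 0. ?s h < \<epsilon>"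
    using small r by (intro order_tendstoD(2)) (auto simp: measure_cube)
  have "((\<lambda>h. 2 * h * norm (One :: 'a)) \<longlongrightarrow> 2 * 0 * norm (One :: 'a)) (at_right 0)" by (intro tendsto_intros)
  then have 3: "\<forall>\<^sub>F h in at_right 0. 2 * h * norm (One :: 'a) < e" using e(1) by (intro order_tendstoD(2)) auto
  have 4: "\<forall>\<^sub>F h in at_right 0. (0::real) < h" by (simp add: eventually_at_right_less)
  obtain h where h: "0 < h" "y < sqrt (ln (1 / ?s h)) * x" "?s h < \<epsilon>" "2 * h * norm (One :: 'a) < e"
    using eventually_happens'[OF _ eventually_conj[OF 4 eventually_conj[OF 1 eventually_conj[OF 2 3]]]] by auto
  \<comment> \<open>Every cube with corner and side in this open set contains the old cube and
    exceeds it by less than \<open>2 * h\<close> in each coordinate direction.\<close>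
  let ?U = "box (a - h *\<^sub>R One) a \<times> {r + h<..<r + 2 * h}"
  have "open ?U" by (intro open_Times open_box open_greaterThanLessThan)
  moreover have "(a - (h / 2) *\<^sub>R One, r + 3 / 2 * h) \<in> ?U" using h(1) by (auto simp: mem_box inner_simps)
  ultimately obtain v where v: "v \<in> T" "v \<in> ?U" using T[of ?U] by blast
  let ?b = "fst v" and ?t = "snd v"
  let ?C = "cbox ?b (?b + ?t *\<^sub>R One)"
  have b: "a \<bullet> i - h < ?b \<bullet> i" "?b \<bullet> i < a \<bullet> i" if "i \<in> Basis" for i
    using v(2) that by (auto simp: mem_box inner_simps mem_Times_iff)
  have t: "r + h < ?t" "?t < r + 2 * h" using v(2) by (auto simp: mem_Times_iff)
  have t0: "0 < ?t" using t h r by simp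
  have BC: "?B \<subseteq> ?C"
  proof
    fix z assume z: "z \<in> ?B"
    have "?b \<bullet> i \<le> z \<bullet> i \<and> z \<bullet> i \<le> ?b \<bullet> i + ?t" if i: "i \<in> Basis" for i
      using z b[OF i] t i by (fastforce simp: mem_box inner_simps)
    then show "z \<in> ?C" by (simp add: mem_box inner_simps)
  qed
  have "?C \<subseteq> D"
  proof
    fix z assume z: "z \<in> ?C"
    have zi: "?b \<bullet> i \<le> z \<bullet> i" "z \<bullet> i \<le> ?b \<bullet> i + ?t" if "i \<in> Basis" for i
      using z that by (auto simp: mem_box inner_simps)
    define w where "w = (\<Sum>i\<in>Basis. max (a \<bullet> i) (min (a \<bullet> i + r) (z \<bullet> i)) *\<^sub>R i)"
    have wi: "w \<bullet> i = max (a \<bullet> i) (min (a \<bullet> i + r) (z \<bullet> i))" if "i \<in> Basis" for i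
      using that by (simp add: w_def)
    have "w \<in> ?B" using r by (simp add: mem_box inner_simps wi)
    moreover have "dist w z < e"
    proof -
      have "norm (w - z) \<le> norm ((2 * h) *\<^sub>R (One :: 'a))"
      proof (rule norm_le_componentwise)
        fix i :: 'a assume i: "i \<in> Basis"
        have "\<bar>(w - z) \<bullet> i\<bar> \<le> 2 * h"
          using zi[OF i] b[OF i] t h(1) r unfolding inner_diff_left wi[OF i] by (simp add: max_def min_def abs_le_iff)
        then show "\<bar>(w - z) \<bullet> i\<bar> \<le> \<bar>((2 * h) *\<^sub>R (One :: 'a)) \<bullet> i\<bar>" using i h(1) by simp
      qed
      then show ?thesis using h(1,4) by (simp add: dist_norm)
    qed
    ultimately have "z \<in> (\<Union>z\<in>?B. ball z e)" by (intro UN_I[of w]) simp_all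
    then show "z \<in> D" using e(2) by blast
  qed
  moreover have mC: "measure lborel ?C = ?t ^ DIM('a)" using t0 by (simp add: measure_cube)
  have st: "?t ^ DIM('a) \<le> ?s h" using t t0 by (intro power_mono) auto
  have "measure lborel ?C < \<epsilon>" using mC st h(3) by linarith
  moreover have "ennreal y < cube_ratio N ?C"
  proof -
    have "1 / ?s h \<le> 1 / ?t ^ DIM('a)" using st t0 r h(1) by (intro divide_left_mono mult_pos_pos zero_less_power) auto
    moreover have "0 < 1 / ?s h" using r h(1) by simp
    ultimately have "sqrt (ln (1 / ?s h)) * x \<le> sqrt (ln (1 / ?t ^ DIM('a))) * x"
      using x(2) by (intro mult_right_mono real_sqrt_le_mono) (auto simp: ln_mono)
    then have lt: "y < sqrt (ln (1 / ?t ^ DIM('a))) * x" using h(2) by linarith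
    have s0: "0 \<le> sqrt (ln (1 / ?t ^ DIM('a)))"
    proof (rule ccontr)
      assume "\<not> ?thesis"
      then have "sqrt (ln (1 / ?t ^ DIM('a))) * x \<le> 0" using x(2) by (intro mult_nonpos_nonneg) auto
      then show False using lt y by linarith
    qed
    have "ennreal y < ennreal (sqrt (ln (1 / ?t ^ DIM('a)))) * ennreal x"
      using lt y s0 x(2) by (simp add: ennreal_mult[symmetric] ennreal_less_iff)
    also have "\<dots> \<le> cube_ratio N ?C"
      unfolding cube_ratio_def mC x(1)[symmetric] using N(1) BC by (intro mult_left_mono emeasure_mono) auto
    finally show ?thesis .
  qed
  ultimately show ?thesis using v(1) t0 by blast
qed

section \<open>The event and its probability\<close>

context critical_chaos
begin

lemma limsup_event:
  assumes D: "open D"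
  shows "{\<omega> \<in> space P. 0 < Limsup (small_cubes D) (cube_ratio (M \<omega>))} \<in> events"
proof -
  obtain T :: "('a \<times> real) set" where T: "countable T" "\<And>U. open U \<Longrightarrow> U \<noteq> {} \<Longrightarrow> \<exists>v\<in>T. v \<in> U"
    by (rule countable_dense_setE) blast
  define C where "C v = cbox (fst v) (fst v + snd v *\<^sub>R One)" for v :: "'a \<times> real"
  define T' where "T' m = {v \<in> T. 0 < snd v \<and> C v \<subseteq> D \<and> measure lborel (C v) < 1 / Suc m}" for m :: nat
  have cT: "countable (T' m)" for m by (rule countable_subset[OF _ T(1)]) (auto simp: T'_def)
  have eq: "0 < Limsup (small_cubes D) (cube_ratio (M \<omega>)) \<longleftrightarrow>
      (\<exists>k::nat. \<forall>m. \<exists>v\<in>T' m. ennreal (1 / Suc k) < cube_ratio (M \<omega>) (C v))" if w: "\<omega> \<in> space P" for \<omega>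
    unfolding Limsup_pos_iff
  proof (intro ex_cong1 all_cong1 iffI)
    fix k m :: nat
    assume "\<exists>B\<in>cubes_inside D. measure lborel B < 1 / Suc m \<and> ennreal (1 / Suc k) < cube_ratio (M \<omega>) B"
    then obtain B where B: "B \<in> cubes_inside D" "measure lborel B < 1 / Suc m" "ennreal (1 / Suc k) < cube_ratio (M \<omega>) B"
      by blast
    from B(1) have "B \<subseteq> D" "\<exists>a r. 0 < r \<and> B = cbox a (a + r *\<^sub>R One)" by (simp_all add: cubes_inside_def)
    then obtain a :: 'a and r where ar: "0 < r" "B = cbox a (a + r *\<^sub>R One)" by (elim exE conjE)
    note B' = \<open>B \<subseteq> D\<close> B(2,3)
    have f: "emeasure (M \<omega>) (cbox a (a + r *\<^sub>R One)) < \<infinity>" by (rule finite_M[OF w compact_cbox])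
    have y: "(0::real) \<le> 1 / Suc k" by simp
    from enlarge_cube[OF T(2) D B'(1)[unfolded ar(2)] ar(1) sets_M[OF w] f B'(2,3)[unfolded ar(2)] y]
    show "\<exists>v\<in>T' m. ennreal (1 / Suc k) < cube_ratio (M \<omega>) (C v)"
      unfolding T'_def C_def by blast
  next
    fix k m :: nat
    assume "\<exists>v\<in>T' m. ennreal (1 / Suc k) < cube_ratio (M \<omega>) (C v)"
    then obtain v where v: "v \<in> T' m" "ennreal (1 / Suc k) < cube_ratio (M \<omega>) (C v)" by blast
    then have "C v \<in> cubes_inside D" unfolding cubes_inside_def T'_def C_def by blast
    then show "\<exists>B\<in>cubes_inside D. measure lborel B < 1 / Suc m \<and> ennreal (1 / Suc k) < cube_ratio (M \<omega>) B"
      using v unfolding T'_def by blast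
  qed
  have "{\<omega> \<in> space P. ennreal y < cube_ratio (M \<omega>) (C v)} \<in> events" for y v
  proof -
    have "(\<lambda>\<omega>. cube_ratio (M \<omega>) (C v)) \<in> borel_measurable P"
      unfolding cube_ratio_def C_def
      by (intro borel_measurable_times_ennreal borel_measurable_const measurable_M borel_closed closed_cbox)
    then have "(\<lambda>\<omega>. cube_ratio (M \<omega>) (C v)) -` {ennreal y<..} \<inter> space P \<in> events" by (rule measurable_sets) simp
    moreover have "(\<lambda>\<omega>. cube_ratio (M \<omega>) (C v)) -` {ennreal y<..} \<inter> space P = {\<omega> \<in> space P. ennreal y < cube_ratio (M \<omega>) (C v)}"
      by blast
    ultimately show ?thesis by (simp only:)
  qed
  then have "{\<omega> \<in> space P. \<exists>k::nat. \<forall>m. \<exists>v\<in>T' m. ennreal (1 / Suc k) < cube_ratio (M \<omega>) (C v)} \<in> events"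
    by (intro sets.sets_Collect_countable_Ex sets.sets_Collect_countable_All sets.sets_Collect_countable_Ex' cT)
  moreover have "{\<omega> \<in> space P. 0 < Limsup (small_cubes D) (cube_ratio (M \<omega>))} =
      {\<omega> \<in> space P. \<exists>k::nat. \<forall>m. \<exists>v\<in>T' m. ennreal (1 / Suc k) < cube_ratio (M \<omega>) (C v)}"
    using eq by blast
  ultimately show ?thesis by (simp only:)
qed

text \<open>Continuous paths are bounded on compact balls, so the events with bound k increase to
  the whole space. They are defined through a countable dense set to be measurable; continuity
  extends the bound to the whole open ball.\<close>

lemma field_bounded_below:
  assumes \<eta>: "0 < \<eta>"
  obtains B and k :: real where "B \<in> events" "1 - \<eta> \<le> prob B"
    "\<And>\<omega> y. \<omega> \<in> B \<Longrightarrow> y \<in> ball x0 \<rho> \<Longrightarrow> - k \<le> X (real \<tau>) y \<omega>"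
proof -
  obtain T :: "'a set" where T: "countable T" "\<And>U. open U \<Longrightarrow> U \<noteq> {} \<Longrightarrow> \<exists>v\<in>T. v \<in> U"
    by (rule countable_dense_setE) blast
  define B where "B k = {\<omega> \<in> space P. \<forall>y\<in>T \<inter> ball x0 \<rho>. - real k \<le> X (real \<tau>) y \<omega>}" for k :: nat
  have Be: "B k \<in> events" for k
  proof -
    have "{\<omega> \<in> space P. - real k \<le> X (real \<tau>) y \<omega>} \<in> events" for y
      using X_measurable[of \<tau> y] unfolding borel_measurable_iff_ge by blast
    then show ?thesis unfolding B_def
      by (intro sets.sets_Collect_countable_All' countable_subset[OF Int_lower1 T(1)])
  qed
  have bound: "- real k \<le> X (real \<tau>) y \<omega>" if w: "\<omega> \<in> B k" and y: "y \<in> ball x0 \<rho>" for \<omega> y k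
  proof (rule ccontr)
    assume neg: "\<not> ?thesis"
    have ws: "\<omega> \<in> space P" using w by (simp add: B_def)
    let ?U = "{y. X (real \<tau>) y \<omega> < - real k} \<inter> ball x0 \<rho>"
    have "open ?U" by (intro open_Int open_ball open_Collect_less X_cont[OF ws] continuous_intros)
    moreover have "?U \<noteq> {}" using neg y by (auto simp: not_le)
    ultimately obtain v where "v \<in> T" "v \<in> ?U" using T(2) by blast
    then show False using w by (force simp: B_def)
  qed
  have "incseq B"
  proof (intro incseq_SucI subsetI)
    fix k \<omega> assume w: "\<omega> \<in> B k"
    have "- real (Suc k) \<le> X (real \<tau>) y \<omega>" if "y \<in> T \<inter> ball x0 \<rho>" for y
    proof -
      have "- real k \<le> X (real \<tau>) y \<omega>" using w that unfolding B_def by blast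
      then show ?thesis by simp
    qed
    then show "\<omega> \<in> B (Suc k)" using w unfolding B_def by blast
  qed
  moreover have "(\<Union>k. B k) = space P"
  proof (intro subset_antisym subsetI)
    fix \<omega> assume ws: "\<omega> \<in> space P"
    have "compact ((\<lambda>y. X (real \<tau>) y \<omega>) ` cball x0 \<rho>)"
      by (intro compact_continuous_image continuous_on_subset[OF X_cont[OF ws]]) auto
    then obtain K where K: "\<And>y. y \<in> cball x0 \<rho> \<Longrightarrow> norm (X (real \<tau>) y \<omega>) \<le> K"
      using compact_imp_bounded bounded_iff by (metis (no_types, lifting) imageI)
    obtain k :: nat where k: "K \<le> real k" using real_arch_simple by blast
    have "\<omega> \<in> B k" unfolding B_def
    proof (intro CollectI conjI ws ballI)
      fix y assume "y \<in> T \<inter> ball x0 \<rho>"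
      then have "y \<in> cball x0 \<rho>" by auto
      then show "- real k \<le> X (real \<tau>) y \<omega>" using K[of y] k by (simp add: abs_le_iff)
    qed
    then show "\<omega> \<in> (\<Union>k. B k)" by blast
  qed (auto simp: B_def)
  ultimately have "(\<lambda>k. prob (B k)) \<longlonglongrightarrow> 1"
    using finite_Lim_measure_incseq[of B] Be prob_space by (simp add: image_subset_iff)
  then have "\<forall>\<^sub>F k in sequentially. 1 - \<eta> < prob (B k)" using \<eta> by (intro order_tendstoD(1)) auto
  then obtain k where "1 - \<eta> < prob (B k)" using eventually_happens by (metis sequentially_bot)
  then show ?thesis using that[of "B k" "real k"] Be bound by simp
qed

text \<open>The cube has volume at most \<open>exp (2 - n)\<close>, so the logarithm of the inverse
  volume is at least n - 2 and hence n / 4. Its root, at least \<open>sqrt n / 2\<close>, cancels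
  the \<open>sqrt n\<close> in the mass bound.\<close>

lemma grid_cube_ratio:
  assumes n: "16 \<le> n" and s: "real n \<le> s" and \<kappa>: "0 \<le> \<kappa>"
    and e: "ennreal (\<kappa> / sqrt n) \<le> emeasure N (big_cube s a)"
  shows "measure lborel (big_cube s a) \<le> 3 * exp (- real n)" and "ennreal (\<kappa> / 2) \<le> cube_ratio N (big_cube s (a :: 'a))"
proof -
  let ?r = "3 * exp (- s)"
  have m: "measure lborel (big_cube s a) = ?r ^ DIM('a)" unfolding big_cube_def by (rule measure_cube) simp
  have e2: "(3::real) \<le> exp 2" using exp_ge_add_one_self[of "2::real"] by simp
  have r: "?r \<le> exp (2 - real n)"
  proof -
    have "?r \<le> exp 2 * exp (- real n)" using e2 s by (intro mult_mono) auto
    then show ?thesis by (simp add: exp_add[symmetric])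
  qed
  have r1: "exp (2 - real n) \<le> 1" using n by simp
  have "?r ^ DIM('a) \<le> ?r ^ 1" using order_trans[OF r r1] by (intro power_decreasing) (simp_all add: Suc_le_eq)
  then have rd: "?r ^ DIM('a) \<le> ?r" by simp
  then show "measure lborel (big_cube s a) \<le> 3 * exp (- real n)" unfolding m using s by (simp add: order_trans)
  have pos: "0 < ?r ^ DIM('a)" by simp
  have "?r ^ DIM('a) \<le> exp (2 - real n)" using rd r by linarith
  then have "ln (?r ^ DIM('a)) \<le> ln (exp (2 - real n))" using pos by (subst ln_le_cancel_iff) auto
  then have "real n - 2 \<le> ln (1 / ?r ^ DIM('a))" using pos by (subst ln_div) auto
  moreover have "real n / 4 \<le> real n - 2" using n by simp
  ultimately have "sqrt (real n / 4) \<le> sqrt (ln (1 / ?r ^ DIM('a)))" by (intro real_sqrt_le_mono) linarith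
  then have sq: "sqrt n / 2 \<le> sqrt (ln (1 / ?r ^ DIM('a)))" by (simp add: real_sqrt_divide)
  have "ennreal (\<kappa> / 2) = ennreal (sqrt n / 2) * ennreal (\<kappa> / sqrt n)"
    using n \<kappa> by (simp add: ennreal_mult[symmetric])
  also have "\<dots> \<le> cube_ratio N (big_cube s a)"
    unfolding cube_ratio_def m by (intro mult_mono ennreal_leI sq e) auto
  finally show "ennreal (\<kappa> / 2) \<le> cube_ratio N (big_cube s a)" .
qed

text \<open>Regions, \<open>\<tau>\<close> and k are fixed before n varies, so
  \<open>\<kappa>\<close> does not depend on n. Every event \<open>C n\<close> has at least the
  stated probability, hence so has the event that infinitely many of them occur, and there
  arbitrarily small cubes with ratio at least \<open>\<kappa> / 2\<close> exist.\<close>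

lemma limsup_prob_ge:
  assumes D: "open D" "D \<noteq> {}" and J: "0 < J" and \<eta>: "0 < \<eta>"
  shows "1 - 1 / (prob_const * real J) - 2 * \<eta> \<le> prob {\<omega> \<in> space P. 0 < Limsup (small_cubes D) (cube_ratio (M \<omega>))}"
proof -
  let ?S = "{\<omega> \<in> space P. 0 < Limsup (small_cubes D) (cube_ratio (M \<omega>))}"
  obtain x0 where "x0 \<in> D" using D(2) by blast
  then obtain \<rho> where \<rho>: "0 < \<rho>" "ball x0 \<rho> \<subseteq> D" using D(1) open_contains_ball by blast
  obtain b0 :: 'a where b0: "b0 \<in> Basis" using nonempty_Basis by blast
  \<comment> \<open>J centres spaced by \<open>8 * \<delta>\<close> along one axis and boxes of
    half-width \<open>4 * \<delta>\<close>, whose points are within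
    \<open>4 * dimn * \<delta>\<close> of the centre, fit into the ball of radius
    \<open>\<rho>\<close>.\<close>
  define \<delta> where "\<delta> = \<rho> / (8 * real J + 4 * dimn)"
  have dn: "1 \<le> dimn" using DIM_positive[where 'a='a] unfolding dimn_eq by linarith
  have \<delta>: "0 < \<delta>" using \<rho>(1) dn by (simp add: \<delta>_def add_nonneg_pos)
  have \<delta>\<rho>: "8 * real J * \<delta> + 4 * dimn * \<delta> = \<rho>"
  proof -
    have "8 * real J + 4 * dimn \<noteq> 0" using dn by linarith
    then have "\<delta> * (8 * real J + 4 * dimn) = \<rho>" unfolding \<delta>_def by simp
    then show ?thesis by (simp add: algebra_simps)
  qed
  define z where "z i = x0 + (8 * \<delta> * real i) *\<^sub>R b0" for i :: nat
  have reg: "region (z i) (4 * \<delta>) \<subseteq> ball x0 \<rho>" if i: "i < J" for i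
  proof
    fix y assume y: "y \<in> region (z i) (4 * \<delta>)"
    have "norm (y - z i) \<le> (\<Sum>b\<in>Basis. \<bar>(y - z i) \<bullet> b\<bar>)" by (rule norm_le_l1)
    also have "\<dots> \<le> (\<Sum>b\<in>(Basis :: 'a set). 4 * \<delta>)" using y by (intro sum_mono) (auto simp: mem_region)
    also have "\<dots> = 4 * dimn * \<delta>" by (simp add: dimn_eq)
    finally have 1: "norm (y - z i) \<le> 4 * dimn * \<delta>" .
    have 2: "norm (z i - x0) = 8 * \<delta> * real i" using \<delta> norm_Basis[OF b0] by (simp add: z_def)
    have "8 * \<delta> * real i < 8 * real J * \<delta>" using i \<delta> by simp
    moreover have "norm (y - x0) \<le> norm (y - z i) + norm (z i - x0)" using norm_triangle_ineq[of "y - z i" "z i - x0"] by simp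
    ultimately have "norm (y - x0) < \<rho>" using 1 2 \<delta>\<rho> by linarith
    then show "y \<in> ball x0 \<rho>" by (simp add: dist_norm norm_minus_commute)
  qed
  \<comment> \<open>Two demands on \<open>\<tau>\<close>: cells must fit into the margin
    \<open>\<delta>\<close> around a region, and the gap \<open>4 * \<delta>\<close> between the
    boxes of half-width \<open>2 * \<delta>\<close> must reach the correlation range
    \<open>r0 * exp (- \<tau>)\<close>.\<close>
  obtain \<tau> :: nat where \<tau>: "exp (- real \<tau>) \<le> \<delta>" "r0 \<le> exp (real \<tau>) * (4 * \<delta>)"
  proof -
    have m: "0 < min \<delta> (4 * \<delta> / r0)" using \<delta> r0_pos by simp
    obtain \<tau> :: nat where "- ln (min \<delta> (4 * \<delta> / r0)) \<le> real \<tau>" using real_arch_simple by blast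
    then have "- real \<tau> \<le> ln (min \<delta> (4 * \<delta> / r0))" by linarith
    then have *: "exp (- real \<tau>) \<le> min \<delta> (4 * \<delta> / r0)" unfolding ln_ge_iff[OF m] .
    then have "exp (- real \<tau>) * r0 \<le> 4 * \<delta>" using r0_pos by (simp add: pos_le_divide_eq)
    then have "exp (real \<tau>) * (exp (- real \<tau>) * r0) \<le> exp (real \<tau>) * (4 * \<delta>)" by (intro mult_left_mono) auto
    moreover have "exp (real \<tau>) * (exp (- real \<tau>) * r0) = r0" by (simp add: exp_minus)
    ultimately have "r0 \<le> exp (real \<tau>) * (4 * \<delta>)" by linarith
    with * show ?thesis by (intro that) simp_all
  qed
  have far: "r0 \<le> exp (real \<tau>) * dist x y"
    if ik: "i < J" "k < J" "i \<noteq> k" "x \<in> region (z i) (2 * \<delta>)" "y \<in> region (z k) (2 * \<delta>)" for i k x y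
  proof -
    have 1: "\<bar>(x - z i) \<bullet> b0\<bar> \<le> 2 * \<delta>" "\<bar>(y - z k) \<bullet> b0\<bar> \<le> 2 * \<delta>" using ik b0 by (auto simp: mem_region)
    have 2: "(z i - z k) \<bullet> b0 = 8 * \<delta> * (real i - real k)" using b0 by (simp add: z_def inner_simps algebra_simps)
    have "1 \<le> \<bar>real i - real k\<bar>" using ik(3) by linarith
    then have "8 * \<delta> * 1 \<le> 8 * \<delta> * \<bar>real i - real k\<bar>" using \<delta> by (intro mult_left_mono) auto
    then have "8 * \<delta> \<le> \<bar>(z i - z k) \<bullet> b0\<bar>" unfolding 2 using \<delta> by (simp add: abs_mult)
    moreover have "(x - y) \<bullet> b0 = (x - z i) \<bullet> b0 + (z i - z k) \<bullet> b0 - (y - z k) \<bullet> b0" by (simp add: inner_simps)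
    ultimately have "4 * \<delta> \<le> \<bar>(x - y) \<bullet> b0\<bar>" using 1 by linarith
    also have "\<dots> \<le> dist x y" using Basis_le_norm[OF b0, of "x - y"] by (simp add: dist_norm)
    finally have "exp (real \<tau>) * (4 * \<delta>) \<le> exp (real \<tau>) * dist x y" by (intro mult_left_mono) auto
    then show ?thesis using \<tau>(2) by linarith
  qed
  obtain B and k :: real where B: "B \<in> events" "1 - \<eta> \<le> prob B"
    "\<And>\<omega> y. \<omega> \<in> B \<Longrightarrow> y \<in> ball x0 \<rho> \<Longrightarrow> - k \<le> X (real \<tau>) y \<omega>"
    using field_bounded_below[OF \<eta>, of x0 \<rho> \<tau>] by metis
  have B3: "- k \<le> X (real \<tau>) y \<omega>" if "\<omega> \<in> B" "i < J" "y \<in> region (z i) (2 * \<delta>)" for \<omega> i y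
  proof (rule B(3)[OF that(1)])
    have "region (z i) (2 * \<delta>) \<subseteq> region (z i) (4 * \<delta>)" using \<delta> by (fastforce simp: mem_region)
    then show "y \<in> ball x0 \<rho>" using reg[OF that(2)] that(3) by blast
  qed
  define \<kappa> where "\<kappa> = exp (- (\<gamma> * k) - dimn * \<tau>) * cell_const \<tau> / 2"
  have \<kappa>: "0 < \<kappa>" by (simp add: \<kappa>_def cell_const_def)
  define C where "C n = {\<omega> \<in> space P. \<exists>v\<in>grid \<tau> n (\<Union>i<J. region (z i) \<delta>).
      ennreal (\<kappa> / sqrt n) \<le> emeasure (M \<omega>) (big_cube (fst v) (snd v))}" for n :: nat
  have C: "C n \<in> events" "1 - 1 / (prob_const * real J) - 2 * \<eta> \<le> prob (C n)" if "16 \<le> n" for n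
    unfolding C_def \<kappa>_def by (rule heavy_cubes[OF \<delta> \<tau>(1) J far that \<eta> B(1,2) B3]; assumption)+
  \<comment> \<open>The intersection of these sets is the limit superior of the events
    \<open>C n\<close>; the offset 16 starts where \<open>heavy_cubes\<close> applies.\<close>
  define U where "U m = (\<Union>n\<in>{m + 16..}. C n)" for m :: nat
  have Ue: "U m \<in> events" for m unfolding U_def by (intro sets.countable_UN'') (auto intro: C(1))
  have Up: "1 - 1 / (prob_const * real J) - 2 * \<eta> \<le> prob (U m)" for m
  proof -
    have "prob (C (m + 16)) \<le> prob (U m)" by (rule finite_measure_mono[OF _ Ue]) (auto simp: U_def)
    then show ?thesis using C(2)[of "m + 16"] by simp
  qed
  have "decseq U" unfolding decseq_def U_def by force
  then have "(\<lambda>m. prob (U m)) \<longlonglongrightarrow> prob (\<Inter>m. U m)"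
    by (intro finite_Lim_measure_decseq) (auto simp: Ue)
  then have lim: "1 - 1 / (prob_const * real J) - 2 * \<eta> \<le> prob (\<Inter>m. U m)"
    by (rule LIMSEQ_le_const) (use Up in blast)
  have "(\<Inter>m. U m) \<subseteq> ?S"
  proof
    fix \<omega> assume w: "\<omega> \<in> (\<Inter>m. U m)"
    then have ws: "\<omega> \<in> space P" unfolding U_def C_def by blast
    obtain l where l: "1 / real (Suc l) < \<kappa> / 2" using nat_approx_posE[of "\<kappa> / 2"] \<kappa> by auto
    have "\<exists>B\<in>cubes_inside D. measure lborel B < 1 / Suc m \<and> ennreal (1 / Suc l) < cube_ratio (M \<omega>) B" for m :: nat
    proof -
      obtain N0 :: nat where N0: "ln (3 * real (Suc m)) < real N0" using reals_Archimedean2 by blast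
      have "\<omega> \<in> U N0" using w by blast
      then obtain n where n: "N0 + 16 \<le> n" "\<omega> \<in> C n" unfolding U_def by auto
      then obtain v where v: "v \<in> grid \<tau> n (\<Union>i<J. region (z i) \<delta>)" "ennreal (\<kappa> / sqrt n) \<le> emeasure (M \<omega>) (big_cube (fst v) (snd v))"
        unfolding C_def by blast
      from v(1) obtain j x i where v': "v = (real (\<tau> + j), cell_corner (real (\<tau> + j)) x)" "n < j" "i < J" "x \<in> region (z i) \<delta>"
        unfolding grid_def by blast
      let ?s = "real (\<tau> + j)" let ?a = "cell_corner ?s x"
      have es: "exp (- ?s) \<le> \<delta>"
      proof -
        have "exp (- ?s) \<le> exp (- real \<tau>)" by simp
        then show ?thesis using \<tau>(1) by linarith
      qed
      have sub: "big_cube ?s ?a \<subseteq> D"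
      proof -
        have "big_cube ?s ?a \<subseteq> region (z i) (4 * \<delta>)"
        proof
          fix y assume y: "y \<in> big_cube ?s ?a"
          have "\<bar>(y - z i) \<bullet> b\<bar> \<le> 4 * \<delta>" if b: "b \<in> Basis" for b
          proof -
            have "x \<in> cell ?s x" by (simp add: cell_def)
            then have "?a \<bullet> b \<le> x \<bullet> b" "x \<bullet> b < ?a \<bullet> b + exp (- ?s)" using b unfolding cell_iff by blast+
            moreover have "?a \<bullet> b - exp (- ?s) \<le> y \<bullet> b" "y \<bullet> b \<le> ?a \<bullet> b + 2 * exp (- ?s)" using y b unfolding mem_big_cube by blast+
            moreover have "\<bar>(x - z i) \<bullet> b\<bar> \<le> \<delta>" using v'(4) b by (simp add: mem_region)
            ultimately show ?thesis using es unfolding inner_diff_left by linarith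
          qed
          then show "y \<in> region (z i) (4 * \<delta>)" by (simp add: mem_region)
        qed
        then show ?thesis using reg[OF v'(3)] \<rho>(2) by blast
      qed
      have cube: "big_cube ?s ?a \<in> cubes_inside D"
        using sub unfolding cubes_inside_def big_cube_def
        by (intro CollectI conjI exI[of _ "?a - exp (- ?s) *\<^sub>R One"] exI[of _ "3 * exp (- ?s)"]) auto
      have nn: "16 \<le> n" "real n \<le> ?s" using n v'(2) by auto
      have ev: "ennreal (\<kappa> / sqrt n) \<le> emeasure (M \<omega>) (big_cube ?s ?a)" using v(2) v'(1) by simp
      note g = grid_cube_ratio[OF nn less_imp_le[OF \<kappa>] ev]
      have "3 * exp (- real n) < 1 / Suc m"
      proof -
        have "ln (3 * real (Suc m)) < real n" using N0 n(1) by linarith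
        then have "exp (ln (3 * real (Suc m))) < exp (real n)" by (simp only: exp_less_cancel_iff)
        then have "3 * real (Suc m) < exp (real n)" by simp
        then show ?thesis by (simp add: exp_minus field_simps)
      qed
      then have "measure lborel (big_cube ?s ?a) < 1 / Suc m" using g(1) by linarith
      moreover have "ennreal (1 / Suc l) < cube_ratio (M \<omega>) (big_cube ?s ?a)"
      proof (rule less_le_trans[OF _ g(2)])
        show "ennreal (1 / Suc l) < ennreal (\<kappa> / 2)" using l by (subst ennreal_less_iff) auto
      qed
      ultimately show ?thesis using cube by blast
    qed
    then show "\<omega> \<in> ?S" unfolding Limsup_pos_iff using ws by blast
  qed
  then have "prob (\<Inter>m. U m) \<le> prob ?S" by (rule finite_measure_mono[OF _ limsup_event[OF D(1)]])
  then show ?thesis using lim by linarith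
qed

text \<open>Both errors are at free disposal: the number of regions is taken as n + 1 and
  \<open>\<eta>\<close> as its inverse.\<close>

lemma limsup_prob:
  assumes D: "open D" "D \<noteq> {}"
  shows "prob {\<omega> \<in> space P. 0 < Limsup (small_cubes D) (cube_ratio (M \<omega>))} = 1"
proof (rule antisym)
  let ?S = "{\<omega> \<in> space P. 0 < Limsup (small_cubes D) (cube_ratio (M \<omega>))}"
  show "1 \<le> prob ?S"
  proof (rule LIMSEQ_le_const2)
    have "(\<lambda>n. 1 - (1 / prob_const) * inverse (real (Suc n)) - 2 * inverse (real (Suc n))) \<longlonglongrightarrow> 1 - (1 / prob_const) * 0 - 2 * 0"
      by (intro tendsto_intros LIMSEQ_inverse_real_of_nat)
    then show "(\<lambda>n. 1 - (1 / prob_const) * inverse (real (Suc n)) - 2 * inverse (real (Suc n))) \<longlonglongrightarrow> 1" by simp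
    have "1 - (1 / prob_const) * inverse (real (Suc n)) - 2 * inverse (real (Suc n)) \<le> prob ?S" for n
    proof -
      have "1 - 1 / (prob_const * real (Suc n)) - 2 * inverse (real (Suc n)) \<le> prob ?S"
        by (rule limsup_prob_ge[OF D]) auto
      then show ?thesis by (simp add: divide_inverse)
    qed
    then show "\<exists>N. \<forall>n\<ge>N. 1 - (1 / prob_const) * inverse (real (Suc n)) - 2 * inverse (real (Suc n)) \<le> prob ?S" by blast
  qed
qed simp

end

theorem theorem1p6:
  fixes P :: "'w measure"
    and R :: real
    and rho :: "'a::euclidean_space \<Rightarrow> real"
    and X :: "real \<Rightarrow> 'a \<Rightarrow> 'w \<Rightarrow> real"
    and M :: "'w \<Rightarrow> 'a measure"
    and D :: "'a set"
  assumes "prob_space P"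
    and "0 < R"
    and "seed_covariance R rho"
    and "star_scale_martingale P rho X"
    and "critical_gmc P X M"
    and "D \<noteq> {}" and "open D" and "bounded D"
  shows "measure P {\<omega> \<in> space P.
           0 < Limsup (small_cubes D)
                 (\<lambda>B. ennreal (sqrt (ln (1 / measure lborel B))) * emeasure (M \<omega>) B)} = 1"
proof -
  obtain C0 where "critical_chaos P (linear_span ({0..} \<times> UNIV) (\<lambda>(t, x). X t x))
    (\<lambda>n x \<omega>. X (real (Suc n)) x \<omega> - X (real n) x \<omega>) (increment_cov rho) (R / 2) C0
    (critical_gamma TYPE('a)) (real DIM('a)) X M"
    using critical_chaos_of_star_scale[OF assms(1-5)] by blast
  from critical_chaos.limsup_prob[OF this assms(7,6)] show ?thesis
    unfolding cube_ratio_def[abs_def] .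
qed

end
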